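(* Let $n>q\ge 1$ and let $F=(f_1,\dots,f_q):\mathbb{C}^n\to\mathbb{C}^q$ be a dominating polynomial map. Then the module of relative exactness $\mathcal{T}^1(F)$ is a torsion $\mathbb{C}[F]$-module. That is, for every TR-exact polynomial 1-form $\omega$ on $\mathbb{C}^n$ there exist a non-zero polynomial $P\in\mathbb{C}[t_1,\dots,t_q]$ and polynomials $R,a_1,\dots,a_q\in\mathbb{C}[x_1,\dots,x_n]$ such that $P(F)\,\omega=dR+a_1df_1+\dots+a_qdf_q$.
   Context: $\mathbb{C}[F]$ denotes the algebra generated by $f_1,\dots,f_q$. A map is dominating if its image is Zariski dense. A fibre $F^{-1}(y)$ is non-critical if $dF$ has rank $q$ at each of its points. A polynomial 1-form $\omega$ on $\mathbb{C}^n$ is TR-exact (topologically relatively exact) if there is a non-empty Zariski open set $U\subset\mathbb{C}^q$ such that for every $y\in U$ the fibre $F^{-1}(y)$ is non-critical and non-empty, and $\omega$ has zero integral along every loop contained in $F^{-1}(y)$. A polynomial 1-form is AR-exact (algebraically relatively exact) if it is a coboundary of the relative de Rham complex $\Omega^k_F=\Omega^k(\mathbb{C}^n)/\sum df_i\wedge\Omega^{k-1}(\mathbb{C}^n)$ of $F$, i.e. if it has the form $dR+\sum_i a_i df_i$ with $R,a_1,\dots,a_q$ polynomials. $\mathcal{T}^1(F)$ is the quotient of the space of TR-exact 1-forms by the space of AR-exact 1-forms, a $\mathbb{C}[F]$-module under $(P(F),\omega)\mapsto P(F)\omega$. *)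

theory Defs
  imports "HOL-Analysis.Analysis" "HOL-Algebra.AbelCoset" "HOL-Algebra.Module"
begin

text \<open>
  Affine space of dimension \<open>n\<close> is \<open>complex ^ 'n\<close> with \<open>n = CARD('n)\<close>. As the field is infinite,
  elements of the polynomial ring are identified with polynomial functions; in particular
  a polynomial is non-zero iff it takes a non-zero value somewhere.
\<close>

inductive polyfun :: "(complex ^ 'n \<Rightarrow> complex) \<Rightarrow> bool" where
  const: "polyfun (\<lambda>x. c)"
| coord: "polyfun (\<lambda>x. x $ i)"
| add: "polyfun p \<Longrightarrow> polyfun r \<Longrightarrow> polyfun (\<lambda>x. p x + r x)"
| mult: "polyfun p \<Longrightarrow> polyfun r \<Longrightarrow> polyfun (\<lambda>x. p x * r x)"

definition polymap :: "(complex ^ 'n \<Rightarrow> complex ^ 'm) \<Rightarrow> bool" where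
  "polymap G \<longleftrightarrow> (\<forall>j. polyfun (\<lambda>x. G x $ j))"

definition zariski_closed :: "(complex ^ 'n) set \<Rightarrow> bool" where
  "zariski_closed Z \<longleftrightarrow> (\<exists>I. (\<forall>p\<in>I. polyfun p) \<and> Z = {x. \<forall>p\<in>I. p x = 0})"

definition zariski_open :: "(complex ^ 'n) set \<Rightarrow> bool" where
  "zariski_open U \<longleftrightarrow> zariski_closed (- U)"

definition zariski_dense :: "(complex ^ 'n) set \<Rightarrow> bool" where
  "zariski_dense S \<longleftrightarrow> (\<forall>Z. zariski_closed Z \<and> S \<subseteq> Z \<longrightarrow> Z = UNIV)"

definition dominating :: "(complex ^ 'n \<Rightarrow> complex ^ 'q) \<Rightarrow> bool" where
  "dominating F \<longleftrightarrow> zariski_dense (range F)"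


text \<open>
  A 1-form \<open>\<Sum>i. w\<^sub>i dx\<^sub>i\<close> is represented by its coefficient field \<open>\<lambda>x. \<chi> i. w\<^sub>i x\<close>;
  a polynomial 1-form is then a \<open>polymap\<close>.
\<close>

type_synonym 'n form = "complex ^ 'n \<Rightarrow> complex ^ 'n"

definition partial :: "'n \<Rightarrow> (complex ^ 'n \<Rightarrow> complex) \<Rightarrow> complex ^ 'n \<Rightarrow> complex" where
  "partial i f x = deriv (\<lambda>z. f (x + axis i z)) 0"

definition ext_d :: "(complex ^ 'n \<Rightarrow> complex) \<Rightarrow> 'n form" where
  "ext_d f x = (\<chi> i. partial i f x)"

definition jac_matrix :: "(complex ^ 'n \<Rightarrow> complex ^ 'q) \<Rightarrow> complex ^ 'n \<Rightarrow> complex ^ 'n ^ 'q" where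
  "jac_matrix F x = (\<chi> j. ext_d (\<lambda>z. F z $ j) x)"

definition noncritical_fibre :: "(complex ^ 'n \<Rightarrow> complex ^ 'q) \<Rightarrow> complex ^ 'q \<Rightarrow> bool" where
  "noncritical_fibre F y \<longleftrightarrow> (\<forall>x \<in> F -` {y}. rank (jac_matrix F x) = CARD('q))"

definition has_form_integral :: "'n form \<Rightarrow> complex \<Rightarrow> (real \<Rightarrow> complex ^ 'n) \<Rightarrow> bool" where
  "has_form_integral \<omega> I \<gamma> \<longleftrightarrow>
     ((\<lambda>t. \<Sum>i\<in>UNIV. \<omega> (\<gamma> t) $ i * vector_derivative \<gamma> (at t within {0..1}) $ i)
        has_integral I) {0..1}"

text \<open>Loops are piecewise \<open>C\<^sup>1\<close> closed paths, as for contour integrals in the library.\<close>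

definition TR_exact :: "(complex ^ 'n \<Rightarrow> complex ^ 'q) \<Rightarrow> 'n form \<Rightarrow> bool" where
  "TR_exact F \<omega> \<longleftrightarrow> polymap \<omega> \<and>
     (\<exists>U. zariski_open U \<and> U \<noteq> {} \<and>
        (\<forall>y\<in>U. noncritical_fibre F y \<and> F -` {y} \<noteq> {} \<and>
           (\<forall>\<gamma>. valid_path \<gamma> \<and> pathfinish \<gamma> = pathstart \<gamma> \<and> path_image \<gamma> \<subseteq> F -` {y}
              \<longrightarrow> has_form_integral \<omega> 0 \<gamma>)))"

definition AR_exact :: "(complex ^ 'n \<Rightarrow> complex ^ 'q) \<Rightarrow> 'n form \<Rightarrow> bool" where
  "AR_exact F \<omega> \<longleftrightarrow>
     (\<exists>R a. polyfun R \<and> (\<forall>j. polyfun (a j)) \<and>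
        \<omega> = (\<lambda>x. ext_d R x + (\<Sum>j\<in>UNIV. a j x *s ext_d (\<lambda>z. F z $ j) x)))"


definition alg_gen :: "(complex ^ 'n \<Rightarrow> complex ^ 'q) \<Rightarrow> (complex ^ 'n \<Rightarrow> complex) ring" where
  "alg_gen F = \<lparr>carrier = {P \<circ> F | P. polyfun P},
     mult = (\<lambda>p r x. p x * r x), one = (\<lambda>x. 1),
     zero = (\<lambda>x. 0), add = (\<lambda>p r x. p x + r x)\<rparr>"

text \<open>
  The \<open>mult\<close> and \<open>one\<close> fields of a module record play no role and are left undefined.
\<close>

definition TR_forms ::
  "(complex ^ 'n \<Rightarrow> complex ^ 'q) \<Rightarrow> (complex ^ 'n \<Rightarrow> complex, 'n form) module" where
  "TR_forms F = \<lparr>carrier = {\<omega>. TR_exact F \<omega>},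
     mult = undefined, one = undefined,
     zero = (\<lambda>x. 0), add = (\<lambda>\<omega> \<eta> x. \<omega> x + \<eta> x),
     smult = (\<lambda>p \<omega> x. p x *s \<omega> x)\<rparr>"

text \<open>
  The quotient of the TR-exact forms by the AR-exact ones, with cosets as elements;
  \<open>p\<close> times the coset of \<open>\<omega>\<close> is the coset of \<open>p \<omega>\<close>, the union below being over all
  representatives \<open>\<omega>\<close>.
\<close>

definition T1 ::
  "(complex ^ 'n \<Rightarrow> complex ^ 'q) \<Rightarrow> (complex ^ 'n \<Rightarrow> complex, 'n form set) module" where
  "T1 F = \<lparr>carrier = a_rcosets\<^bsub>TR_forms F\<^esub> {\<omega>. AR_exact F \<omega>},
     mult = undefined, one = undefined,
     zero = {\<omega>. AR_exact F \<omega>}, add = set_add (TR_forms F),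
     smult = (\<lambda>p X. \<Union>\<omega>\<in>X. {\<omega>. AR_exact F \<omega>} +>\<^bsub>TR_forms F\<^esub> (p \<odot>\<^bsub>TR_forms F\<^esub> \<omega>))\<rparr>"

definition torsion :: "('r, 'a) ring_scheme \<Rightarrow> ('r, 'm, 'b) module_scheme \<Rightarrow> bool" where
  "torsion S M \<longleftrightarrow>
     (\<forall>x\<in>carrier M. \<exists>s\<in>carrier S. s \<noteq> \<zero>\<^bsub>S\<^esub> \<and> s \<odot>\<^bsub>M\<^esub> x = \<zero>\<^bsub>M\<^esub>)"

end

theory Submission
  imports Defs "HOL-Complex_Analysis.Cauchy_Integral_Formula" "HOL-Computational_Algebra.Fundamental_Theorem_Algebra"
begin

text \<open>Fix a TR-exact form \<open>\<omega>\<close> and write \<open>f\<^sub>j\<close> for the components of \<open>F\<close>. Two steps lead to the theorem: on each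
generic fibre \<open>X = F\<inverse>(y)\<close> there is an identity
\<open>\<omega> = dT + \<Sum> a\<^sub>j df\<^sub>j + \<Sum> (f\<^sub>j - y\<^sub>j) \<eta>\<^sub>j\<close> with polynomial data (\<open>fibre_relative_exactness\<close>), and such
identities for many single values of \<open>y\<close> can be replaced by one that depends polynomially on \<open>y\<close>.

The fibre. As \<open>\<omega>\<close> has no periods on \<open>X\<close>, it has a primitive \<open>R\<close> there (\<open>primitive_on_exists\<close>), and the task is
to show that \<open>R\<close> is the restriction of a polynomial. Near a point of the non-critical fibre, \<open>F\<close> and
suitable coordinate functions form a map \<open>G : \<complex>\<^sup>n \<rightarrow> \<complex>\<^sup>n\<close> with invertible derivative, and
\<open>X\<close> is the preimage under \<open>G\<close> of a coordinate slice. Outside a hypersurface \<open>\<Delta> = 0\<close> of the target, \<open>G\<close> is a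
finite covering whose points and inverse Jacobians have moderate growth (\<open>etale_discriminant_exists\<close>).
On a line in the slice, the derivative of \<open>R\<close> along the branches has moderate growth as well, and integration along
segments shows the same for \<open>R\<close> (\<open>primitive_tempered\<close>). Symmetric functions of the values of \<open>R\<close> on the sheets are
single-valued and holomorphic where \<open>\<Delta> \<noteq> 0\<close> and have moderate growth, so they are rational by Liouville's theorem, and
interpolation in a linear form that separates the sheets expresses \<open>R\<close> by them: \<open>Q(G) R = P\<close> on \<open>X\<close> with polynomials
\<open>P\<close> and \<open>Q\<close> (\<open>primitive_rational\<close>). On the other hand \<open>R\<close> is analytic on the manifold \<open>X\<close>, so it has polynomial approximations of every
order at every point (\<open>primitive_taylor\<close>). Hence \<open>P\<close> is congruent to a multiple of \<open>Q(G)\<close> modulo the ideal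
\<open>(f\<^sub>j - y\<^sub>j)\<close> to every order at every point, and then also globally (\<open>local_ideal_membership\<close>). So \<open>R\<close> is a polynomial
wherever \<open>G\<close> is etale, and the Nullstellensatz glues the charts (\<open>primitive_polynomial\<close>). Finally
\<open>\<omega> - dT\<close> vanishes on the tangent vectors of \<open>X\<close>, and Cramer's rule with the same gluing turns this into the
identity above.

The parameter. For a fixed degree bound the identity on the fibre is a system of linear equations for the
coefficients of \<open>T\<close>, \<open>a\<^sub>j\<close> and \<open>\<eta>\<^sub>j\<close>, with coefficients in \<open>\<complex>[y]\<close>. By Baire's theorem one bound suffices for a Zariski dense
set of \<open>y\<close> (\<open>uniform_degree\<close>), and a linear system that is solvable on a dense set of parameters is solvable over the
field of fractions (\<open>parametric_linear_system\<close>). With a common denominator \<open>P(y)\<close>, substituting \<open>y = F(x)\<close> removes the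
terms with \<open>f\<^sub>j - y\<^sub>j\<close> and gives \<open>P(F) \<omega> = dR + \<Sum> a\<^sub>j df\<^sub>j\<close>, since differentiating coefficients that depend on \<open>F(x)\<close> only
contributes multiples of the \<open>df\<^sub>j\<close>.\<close>

section \<open>Polynomial functions\<close>

lemma polyfun_diff: "polyfun p \<Longrightarrow> polyfun r \<Longrightarrow> polyfun (\<lambda>x. p x - r x)"
  using polyfun.add[of p "\<lambda>x. (-1) * r x"] polyfun.mult[OF polyfun.const[of "-1"], of r] by simp

lemma polyfun_minus: "polyfun p \<Longrightarrow> polyfun (\<lambda>x. - p x)"
  using polyfun_diff[OF polyfun.const[of 0]] by simp

lemma polyfun_sum: "(\<And>i. i \<in> S \<Longrightarrow> polyfun (p i)) \<Longrightarrow> polyfun (\<lambda>x. \<Sum>i\<in>S. p i x)"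
  by (induction S rule: infinite_finite_induct) (auto intro: polyfun.intros)

lemma polyfun_prod: "(\<And>i. i \<in> S \<Longrightarrow> polyfun (p i)) \<Longrightarrow> polyfun (\<lambda>x. \<Prod>i\<in>S. p i x)"
  by (induction S rule: infinite_finite_induct) (auto intro: polyfun.intros)

lemma polyfun_power: "polyfun p \<Longrightarrow> polyfun (\<lambda>x. p x ^ k)"
  by (induction k) (auto intro: polyfun.intros)

lemmas polyfun_intros =
  polyfun.intros polyfun_diff polyfun_minus polyfun_sum polyfun_prod polyfun_power

lemma polyfun_compose:
  assumes "polyfun p" "polymap G"
  shows "polyfun (\<lambda>x. p (G x))"
  using assms(1)
proof induction
  case (coord i)
  then show ?case using assms(2) by (auto simp: polymap_def)
qed (auto intro: polyfun.intros)

lemma polyfun_poly: "polyfun p \<Longrightarrow> polyfun (\<lambda>x. poly q (p x))"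
  by (induction q) (auto intro: polyfun_intros)

text \<open>Restriction to lines reduces questions in several variables to univariate polynomials. One degree bound holds for all
lines, which is what interpolation along lines needs.\<close>

lemma polyfun_line:
  assumes "polyfun p"
  shows "\<exists>D. \<forall>a v. \<exists>q::complex poly. degree q \<le> D \<and> (\<forall>z. p (a + z *s v) = poly q z)"
  using assms
proof induction
  case (const c)
  show ?case by (rule exI[of _ 0]) (auto intro: exI[of _ "[:c:]"])
next
  case (coord i)
  show ?case
    by (rule exI[of _ 1], intro allI, rule_tac x = "[:a $ i, v $ i:]" in exI) auto
next
  case (add p r)
  then obtain D E where
    D: "\<forall>a v. \<exists>q::complex poly. degree q \<le> D \<and> (\<forall>z. p (a + z *s v) = poly q z)" and
    E: "\<forall>a v. \<exists>q::complex poly. degree q \<le> E \<and> (\<forall>z. r (a + z *s v) = poly q z)" by blast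
  show ?case
  proof (rule exI[of _ "max D E"], intro allI)
    fix a v
    from D E obtain q q' where "degree q \<le> D" "\<forall>z. p (a + z *s v) = poly q z"
      "degree q' \<le> E" "\<forall>z. r (a + z *s v) = poly q' z" by meson
    then show "\<exists>q. degree q \<le> max D E \<and> (\<forall>z. p (a + z *s v) + r (a + z *s v) = poly q z)"
      by (intro exI[of _ "q + q'"]) (auto intro!: order_trans[OF degree_add_le_max])
  qed
next
  case (mult p r)
  then obtain D E where
    D: "\<forall>a v. \<exists>q::complex poly. degree q \<le> D \<and> (\<forall>z. p (a + z *s v) = poly q z)" and
    E: "\<forall>a v. \<exists>q::complex poly. degree q \<le> E \<and> (\<forall>z. r (a + z *s v) = poly q z)" by blast
  show ?case
  proof (rule exI[of _ "D + E"], intro allI)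
    fix a v
    from D E obtain q q' where "degree q \<le> D" "\<forall>z. p (a + z *s v) = poly q z"
      "degree q' \<le> E" "\<forall>z. r (a + z *s v) = poly q' z" by meson
    then show "\<exists>q. degree q \<le> D + E \<and> (\<forall>z. p (a + z *s v) * r (a + z *s v) = poly q z)"
      by (intro exI[of _ "q * q'"]) (auto intro: order_trans[OF degree_mult_le])
  qed
qed

lemma norm_vector_smult: "norm (c *s v) = norm c * norm (v :: complex ^ 'n)"
  by (simp add: norm_vec_def norm_mult L2_set_right_distrib)

lemma tendsto_vector_smult [tendsto_intros]:
  "(f \<longlongrightarrow> l) F \<Longrightarrow> (g \<longlongrightarrow> m) F \<Longrightarrow> ((\<lambda>x. f x *s g x) \<longlongrightarrow> l *s (m :: complex ^ 'n)) F"
  by (rule vec_tendstoI) (auto intro!: tendsto_mult tendsto_vec_nth)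

lemma continuous_on_vector_smult [continuous_intros]:
  "continuous_on S f \<Longrightarrow> continuous_on S g \<Longrightarrow> continuous_on S (\<lambda>x. f x *s (g x :: complex ^ 'n))"
  by (auto simp: continuous_on_def intro!: tendsto_vector_smult)

lemma line_preimage_open:
  fixes a v :: "complex ^ 'n"
  assumes "open S"
  shows "open {z. a + z *s v \<in> S}"
proof -
  have "continuous_on UNIV (\<lambda>z. a + z *s v)" by (intro continuous_intros)
  then show ?thesis using continuous_open_preimage[of UNIV "\<lambda>z. a + z *s v" S] assms
    by (simp add: vimage_def)
qed

text \<open>On the line through \<open>a\<close> and \<open>x\<close> the function is a univariate polynomial with infinitely many zeros.\<close>

lemma polyfun_eq_0_open:
  assumes "polyfun p" "open S" "a \<in> S" "\<And>x. x \<in> S \<Longrightarrow> p x = 0"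
  shows "p x = 0"
proof -
  obtain q :: "complex poly" where q: "\<And>z. p (a + z *s (x - a)) = poly q z"
    using polyfun_line[OF assms(1)] by blast
  have "q = 0"
  proof (rule ccontr)
    assume "q \<noteq> 0"
    then have "finite {z. poly q z = 0}" by (rule poly_roots_finite)
    moreover have "{z. a + z *s (x - a) \<in> S} \<subseteq> {z. poly q z = 0}"
      using assms(4) q by (metis (mono_tags, lifting) Collect_mono)
    moreover have "open {z. a + z *s (x - a) \<in> S}" using assms(2) by (rule line_preimage_open)
    moreover have "0 \<in> {z. a + z *s (x - a) \<in> S}" using assms(3) by simp
    ultimately show False by (metis finite_subset finite_imp_not_open empty_iff)
  qed
  then show ?thesis using q[of 1] by simp
qed

lemma polyfun_mult_eq_0:
  assumes "polyfun p" "polyfun r" "\<And>x. p x * r x = 0" "p a \<noteq> 0"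
  shows "r x = 0"
proof -
  obtain q :: "complex poly" where q: "\<And>z. p (a + z *s (x - a)) = poly q z"
    using polyfun_line[OF assms(1)] by blast
  obtain q' :: "complex poly" where q': "\<And>z. r (a + z *s (x - a)) = poly q' z"
    using polyfun_line[OF assms(2)] by blast
  have "poly (q * q') z = 0" for z using q[of z] q'[of z] assms(3) by (metis poly_mult)
  then have "q * q' = 0" using poly_all_0_iff_0 by blast
  moreover have "q \<noteq> 0" using q[of 0] assms(4) by auto
  ultimately show ?thesis using q'[of 1] by auto
qed

lemma polyfun_prod_nonzero:
  assumes "finite S" "\<And>i. i \<in> S \<Longrightarrow> polyfun (p i)" "\<And>i. i \<in> S \<Longrightarrow> \<exists>x. p i x \<noteq> 0"
  shows "\<exists>x. (\<Prod>i\<in>S. p i x) \<noteq> 0"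
  using assms
proof (induction S)
  case (insert i S)
  show ?case
  proof (rule ccontr)
    assume "\<not> ?thesis"
    then have "p i x * (\<Prod>i\<in>S. p i x) = 0" for x using insert by simp
    moreover obtain a where "p i a \<noteq> 0" using insert.prems(2)[of i] by auto
    moreover have "polyfun (p i)" "polyfun (\<lambda>x. \<Prod>i\<in>S. p i x)"
      using insert.prems(1) by (auto intro!: polyfun_prod)
    ultimately have "(\<Prod>i\<in>S. p i x) = 0" for x
      using polyfun_mult_eq_0[of "p i" "\<lambda>x. \<Prod>i\<in>S. p i x"] by blast
    then show False using insert.IH insert.prems by (metis insertCI)
  qed
qed auto

text \<open>The function \<open>partial\<close> is defined by a complex derivative in one variable; working with a Frechet derivative whose
coefficients are polynomial gives all differentiation rules at once, and \<open>partial_eqI\<close> identifies the coefficients.\<close>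

lemma polyfun_has_derivative_ex:
  fixes p :: "complex ^ 'n \<Rightarrow> complex"
  assumes "polyfun p"
  shows "\<exists>D. (\<forall>i. polyfun (D i)) \<and> (\<forall>x. (p has_derivative (\<lambda>h. \<Sum>i\<in>UNIV. D i x * h $ i)) (at x))"
  using assms
proof induction
  case (const c)
  show ?case by (rule exI[of _ "\<lambda>i x. 0"]) (auto intro: polyfun_intros)
next
  case (coord i)
  have "((\<lambda>x :: complex ^ 'n. x $ i) has_derivative (\<lambda>h. \<Sum>j\<in>UNIV. (if j = i then 1 else 0) * h $ j)) (at x)" for x
    using bounded_linear_imp_has_derivative[OF bounded_linear_vec_nth[of i]]
    by (simp add: if_distrib[of "\<lambda>c. c * _"] cong: if_cong)
  then show ?case
    by (intro exI[of _ "\<lambda>j x. if j = i then 1 else 0"]) (auto intro: polyfun_intros)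
next
  case (add p r)
  then obtain D E where *: "\<forall>i. polyfun (D i)" "\<forall>i. polyfun (E i)"
    "\<And>x. (p has_derivative (\<lambda>h. \<Sum>i\<in>UNIV. D i x * h $ i)) (at x)"
    "\<And>x. (r has_derivative (\<lambda>h. \<Sum>i\<in>UNIV. E i x * h $ i)) (at x)" by blast
  show ?case
    using * by (intro exI[of _ "\<lambda>i x. D i x + E i x"])
      (auto intro!: polyfun_intros derivative_eq_intros simp: algebra_simps sum.distrib)
next
  case (mult p r)
  then obtain D E where *: "\<forall>i. polyfun (D i)" "\<forall>i. polyfun (E i)"
    "\<And>x. (p has_derivative (\<lambda>h. \<Sum>i\<in>UNIV. D i x * h $ i)) (at x)"
    "\<And>x. (r has_derivative (\<lambda>h. \<Sum>i\<in>UNIV. E i x * h $ i)) (at x)" by blast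
  show ?case
    using * mult.hyps by (intro exI[of _ "\<lambda>i x. p x * E i x + D i x * r x"])
      (auto intro!: polyfun_intros derivative_eq_intros ext
        simp: algebra_simps sum.distrib sum_distrib_left)
qed

lemma partial_eqI:
  fixes p :: "complex ^ 'n \<Rightarrow> complex"
  assumes "(p has_derivative (\<lambda>h. \<Sum>i\<in>UNIV. D i * h $ i)) (at x)"
  shows "partial i p x = D i"
proof -
  have ax: "axis i z = z *s (axis i 1 :: complex ^ 'n)" for z
    by (auto simp: vec_eq_iff axis_def)
  have 1: "((\<lambda>z. x + axis i z) has_derivative (\<lambda>z. axis i z)) (at 0)"
  proof -
    have "bounded_linear (\<lambda>z. axis i z :: complex ^ 'n)"
    proof (rule bounded_linear_intro[of _ 1])
      show "norm (axis i z :: complex ^ 'n) \<le> norm z * 1" for z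
        by (subst ax) (simp add: norm_vector_smult)
    qed (auto simp: vec_eq_iff axis_def)
    then show ?thesis by (auto intro!: derivative_eq_intros bounded_linear_imp_has_derivative)
  qed
  have "((\<lambda>z. p (x + axis i z)) has_derivative (\<lambda>z. \<Sum>j\<in>UNIV. D j * (axis i z :: complex ^ 'n) $ j)) (at 0)"
  proof -
    have e0: "axis i 0 = (0 :: complex ^ 'n)" by (auto simp: vec_eq_iff axis_def)
    show ?thesis
      using has_derivative_compose[OF 1, of p "\<lambda>h. \<Sum>i\<in>UNIV. D i * h $ i"] assms by (simp add: e0)
  qed
  moreover have "(\<Sum>j\<in>UNIV. D j * (axis i z :: complex ^ 'n) $ j) = D i * z" for z
    by (simp add: axis_def if_distrib[of "\<lambda>c. _ * c"] cong: if_cong)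
  ultimately have "((\<lambda>z. p (x + axis i z)) has_field_derivative D i) (at 0)"
    by (simp add: has_field_derivative_def)
  then show ?thesis unfolding partial_def by (rule DERIV_imp_deriv)
qed

lemma polyfun_partial: "polyfun p \<Longrightarrow> polyfun (partial i p)"
  and polyfun_has_derivative:
    "polyfun p \<Longrightarrow> (p has_derivative (\<lambda>h. \<Sum>i\<in>UNIV. partial i p x * h $ i)) (at x)"
proof -
  assume "polyfun p"
  then obtain D where D: "\<And>i. polyfun (D i)"
    "\<And>x. (p has_derivative (\<lambda>h. \<Sum>i\<in>UNIV. D i x * h $ i)) (at x)"
    using polyfun_has_derivative_ex by blast
  have "partial i p = D i" for i using partial_eqI[OF D(2)] by blast
  with D show "polyfun (partial i p)"
    "(p has_derivative (\<lambda>h. \<Sum>i\<in>UNIV. partial i p x * h $ i)) (at x)" by auto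
qed

lemma partial_add:
  assumes "polyfun p" "polyfun r"
  shows "partial i (\<lambda>x. p x + r x) x = partial i p x + partial i r x"
  by (rule partial_eqI[where D = "\<lambda>i. partial i p x + partial i r x"])
    (use assms in \<open>auto intro!: derivative_eq_intros polyfun_has_derivative simp: algebra_simps sum.distrib\<close>)

lemma partial_mult:
  assumes "polyfun p" "polyfun r"
  shows "partial i (\<lambda>x. p x * r x) x = p x * partial i r x + r x * partial i p x"
  by (rule partial_eqI[where D = "\<lambda>i. p x * partial i r x + r x * partial i p x"])
    (use assms in \<open>auto intro!: derivative_eq_intros polyfun_has_derivative ext
       simp: algebra_simps sum.distrib sum_distrib_left\<close>)

lemma partial_const: "partial i (\<lambda>x. c) x = 0"
  by (rule partial_eqI[where D = "\<lambda>i. 0"]) auto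

lemma partial_coord: "partial j (\<lambda>x :: complex ^ 'n. x $ i) x = (if j = i then 1 else 0)"
  by (rule partial_eqI[where D = "\<lambda>j. if j = i then 1 else 0"])
    (use bounded_linear_imp_has_derivative[OF bounded_linear_vec_nth[of i]] in
      \<open>simp add: if_distrib[of "\<lambda>c. c * _"] cong: if_cong\<close>)

lemma partial_sum:
  assumes "\<And>k. k \<in> S \<Longrightarrow> polyfun (p k)"
  shows "partial i (\<lambda>x. \<Sum>k\<in>S. p k x) x = (\<Sum>k\<in>S. partial i (p k) x)"
  using assms
  by (induction S rule: infinite_finite_induct)
    (auto simp: partial_const partial_add polyfun_sum)

lemma polymap_has_derivative:
  assumes "polymap G"
  shows "(G has_derivative (\<lambda>h. jac_matrix G x *v h)) (at x)"
proof (rule has_derivative_componentwise_within[THEN iffD2], intro ballI)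
  fix b :: "complex ^ 'b" assume "b \<in> Basis"
  then obtain j c where b: "b = axis j c" by (auto simp: Basis_vec_def)
  have "((\<lambda>x. G x $ j) has_derivative (\<lambda>h. (jac_matrix G x *v h) $ j)) (at x)"
    using polyfun_has_derivative[of "\<lambda>x. G x $ j"] assms
    by (simp add: polymap_def jac_matrix_def ext_d_def matrix_vector_mult_def)
  then show "((\<lambda>x. G x \<bullet> b) has_derivative (\<lambda>h. (jac_matrix G x *v h) \<bullet> b)) (at x)"
    by (simp add: b inner_axis has_derivative_inner_left)
qed

lemma partial_compose:
  assumes "polyfun p" "polymap G"
  shows "partial i (\<lambda>x. p (G x)) x = (\<Sum>j\<in>UNIV. partial j p (G x) * partial i (\<lambda>x. G x $ j) x)"
proof (rule partial_eqI[where D = "\<lambda>i. \<Sum>j\<in>UNIV. partial j p (G x) * partial i (\<lambda>x. G x $ j) x"])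
  have "((\<lambda>x. p (G x)) has_derivative (\<lambda>h. \<Sum>j\<in>UNIV. partial j p (G x) * (jac_matrix G x *v h) $ j)) (at x)"
    using has_derivative_compose[OF polymap_has_derivative[OF assms(2)] polyfun_has_derivative[OF assms(1)]] .
  moreover have "(\<Sum>j\<in>UNIV. partial j p (G x) * (jac_matrix G x *v h) $ j) =
     (\<Sum>i\<in>UNIV. (\<Sum>j\<in>UNIV. partial j p (G x) * partial i (\<lambda>x. G x $ j) x) * h $ i)" for h
    unfolding jac_matrix_def matrix_vector_mult_def ext_d_def
    by (simp add: sum_distrib_left sum_distrib_right mult.assoc) (rule sum.swap)
  ultimately show "((\<lambda>x. p (G x)) has_derivative (\<lambda>h. \<Sum>i\<in>UNIV. (\<Sum>j\<in>UNIV. partial j p (G x) * partial i (\<lambda>x. G x $ j) x) * h $ i)) (at x)"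
    by simp
qed

lemma polyfun_continuous_on: "polyfun p \<Longrightarrow> continuous_on S p"
  by (meson continuous_at_imp_continuous_on has_derivative_continuous polyfun_has_derivative)

lemma polymap_continuous_on: "polymap p \<Longrightarrow> continuous_on S p"
  by (meson continuous_at_imp_continuous_on has_derivative_continuous polymap_has_derivative)

lemma polyfun_growth:
  assumes "polyfun p"
  shows "\<exists>C k. C \<ge> 0 \<and> (\<forall>x. norm (p x) \<le> C * (1 + norm x) ^ k)"
  using assms
proof induction
  case (const c)
  show ?case by (rule exI[of _ "norm c"], rule exI[of _ 0]) auto
next
  case (coord i)
  show ?case by (rule exI[of _ 1], rule exI[of _ 1]) (auto intro: order_trans[OF Finite_Cartesian_Product.norm_nth_le])
next
  case (add p r)
  then obtain C k D l where *: "C \<ge> 0" "D \<ge> 0" "\<And>x. norm (p x) \<le> C * (1 + norm x) ^ k"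
    "\<And>x. norm (r x) \<le> D * (1 + norm x) ^ l" by blast
  have "norm (p x + r x) \<le> (C + D) * (1 + norm x) ^ (k + l)" for x
  proof -
    have "C * (1 + norm x) ^ k \<le> C * (1 + norm x) ^ (k + l)"
      "D * (1 + norm x) ^ l \<le> D * (1 + norm x) ^ (k + l)"
      using * by (auto intro!: mult_left_mono power_increasing)
    then show ?thesis using *(3,4)[of x] norm_triangle_ineq[of "p x" "r x"] by (simp add: algebra_simps)
  qed
  with * show ?case by (intro exI[of _ "C + D"] exI[of _ "k + l"]) auto
next
  case (mult p r)
  then obtain C k D l where *: "C \<ge> 0" "D \<ge> 0" "\<And>x. norm (p x) \<le> C * (1 + norm x) ^ k"
    "\<And>x. norm (r x) \<le> D * (1 + norm x) ^ l" by blast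
  have "norm (p x * r x) \<le> (C * D) * (1 + norm x) ^ (k + l)" for x
    using mult_mono[OF *(3,4)[of x]] * by (simp add: norm_mult power_add mult_ac)
  with * show ?case by (intro exI[of _ "C * D"] exI[of _ "k + l"]) auto
qed

section \<open>Monomials and algebraic dependence\<close>

text \<open>The exponents are bounded in each variable separately, so that the number of monomials is a power
and the dimension count in \<open>algebraic_dependence\<close> is immediate.\<close>

definition expo_box :: "nat \<Rightarrow> ('n \<Rightarrow> nat) set" where
  "expo_box N = {\<alpha>. \<forall>i. \<alpha> i \<le> N}"

definition monomial :: "('n::finite \<Rightarrow> nat) \<Rightarrow> complex ^ 'n \<Rightarrow> complex" where
  "monomial \<alpha> x = (\<Prod>i\<in>UNIV. x $ i ^ \<alpha> i)"

definition box_degree :: "nat \<Rightarrow> (complex ^ 'n \<Rightarrow> complex) \<Rightarrow> bool" where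
  "box_degree N p \<longleftrightarrow> (\<exists>c. \<forall>x. p x = (\<Sum>\<alpha>\<in>expo_box N. c \<alpha> * monomial \<alpha> x))"

lemma expo_box_PiE: "expo_box N = PiE UNIV (\<lambda>_. {..N})"
  by (auto simp: expo_box_def PiE_def)

lemma finite_expo_box [simp]: "finite (expo_box N :: ('n::finite \<Rightarrow> nat) set)"
  by (simp add: expo_box_PiE finite_PiE)

lemma card_expo_box: "card (expo_box N :: ('n::finite \<Rightarrow> nat) set) = Suc N ^ CARD('n)"
  by (simp add: expo_box_PiE card_PiE)

lemma expo_box_mono: "N \<le> M \<Longrightarrow> expo_box N \<subseteq> expo_box M"
  by (auto simp: expo_box_def intro: order_trans)

lemma monomial_add: "monomial \<alpha> x * monomial \<beta> x = monomial (\<lambda>i. \<alpha> i + \<beta> i) x"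
  by (simp add: monomial_def power_add prod.distrib)

lemma polyfun_monomial: "polyfun (monomial \<alpha>)"
  unfolding monomial_def[abs_def] by (intro polyfun_intros)

lemma monomial_smult: "monomial \<alpha> (z *s x) = z ^ (\<Sum>i\<in>UNIV. \<alpha> i) * monomial \<alpha> x"
  by (simp add: monomial_def power_mult_distrib prod.distrib power_sum)

lemma box_degree_mono:
  fixes p :: "complex ^ 'n \<Rightarrow> complex"
  assumes "box_degree N p" "N \<le> M"
  shows "box_degree M p"
proof -
  obtain c where c: "\<And>x. p x = (\<Sum>\<alpha>\<in>expo_box N. c \<alpha> * monomial \<alpha> x)"
    using assms by (auto simp: box_degree_def)
  have "p x = (\<Sum>\<alpha>\<in>expo_box M. (if \<alpha> \<in> expo_box N then c \<alpha> else 0) * monomial \<alpha> x)" for x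
    unfolding c by (rule sum.mono_neutral_cong_left) (use expo_box_mono[OF assms(2)] in auto)
  then show ?thesis unfolding box_degree_def
    by (intro exI[of _ "\<lambda>\<alpha>. if \<alpha> \<in> expo_box N then c \<alpha> else 0"]) blast
qed

lemma box_degree_monomial: "\<alpha> \<in> expo_box N \<Longrightarrow> box_degree N (\<lambda>x. monomial \<alpha> x)"
  unfolding box_degree_def
  by (rule exI[of _ "\<lambda>\<beta>. if \<beta> = \<alpha> then 1 else 0"])
    (simp add: if_distrib[of "\<lambda>c. c * _"] cong: if_cong)

lemma box_degree_smult: "box_degree N p \<Longrightarrow> box_degree N (\<lambda>x. c * p x)"
  unfolding box_degree_def
  by (elim exE, rule_tac x = "\<lambda>\<alpha>. c * ca \<alpha>" in exI) (simp add: sum_distrib_left mult.assoc)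

lemma box_degree_add: "box_degree N p \<Longrightarrow> box_degree N r \<Longrightarrow> box_degree N (\<lambda>x. p x + r x)"
  unfolding box_degree_def
  by (elim exE, rule_tac x = "\<lambda>\<alpha>. c \<alpha> + ca \<alpha>" in exI) (simp add: sum.distrib algebra_simps)

lemma box_degree_const: "box_degree N (\<lambda>x :: complex ^ 'n. c)"
proof -
  have "monomial (\<lambda>i. 0) x = 1" for x :: "complex ^ 'n" by (simp add: monomial_def)
  then show ?thesis
    using box_degree_smult[OF box_degree_monomial[of "\<lambda>i::'n. 0" N], of c] by (simp add: expo_box_def)
qed

lemma box_degree_sum: "(\<And>i. i \<in> S \<Longrightarrow> box_degree N (p i)) \<Longrightarrow> box_degree N (\<lambda>x. \<Sum>i\<in>S. p i x)"
  by (induction S rule: infinite_finite_induct) (auto intro: box_degree_add box_degree_const)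

lemma box_degree_mult:
  assumes "box_degree N p" "box_degree M r"
  shows "box_degree (N + M) (\<lambda>x. p x * r x)"
proof -
  obtain c d where c: "p = (\<lambda>x. \<Sum>\<alpha>\<in>expo_box N. c \<alpha> * monomial \<alpha> x)"
    and d: "r = (\<lambda>x. \<Sum>\<alpha>\<in>expo_box M. d \<alpha> * monomial \<alpha> x)"
    using assms by (auto simp: box_degree_def fun_eq_iff)
  have eq: "(\<lambda>x. p x * r x) =
      (\<lambda>x. \<Sum>\<alpha>\<in>expo_box N. \<Sum>\<beta>\<in>expo_box M. (c \<alpha> * d \<beta>) * monomial (\<lambda>i. \<alpha> i + \<beta> i) x)"
    unfolding c d by (simp add: sum_product monomial_add[symmetric] mult_ac)
  show ?thesis unfolding eq
    by (intro box_degree_sum box_degree_smult box_degree_monomial)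
      (auto simp: expo_box_def intro: add_mono)
qed

lemma box_degree_prod:
  "(\<And>i. i \<in> S \<Longrightarrow> box_degree (d i) (p i)) \<Longrightarrow> box_degree (\<Sum>i\<in>S. d i) (\<lambda>x. \<Prod>i\<in>S. p i x)"
  by (induction S rule: infinite_finite_induct) (auto intro: box_degree_mult box_degree_const)

lemma box_degree_power: "box_degree N p \<Longrightarrow> box_degree (k * N) (\<lambda>x. p x ^ k)"
  by (induction k) (auto intro: box_degree_mult box_degree_const)

lemma polyfun_box_degree:
  fixes p :: "complex ^ 'n \<Rightarrow> complex"
  assumes "polyfun p"
  shows "\<exists>N. box_degree N p"
  using assms
proof (induction rule: polyfun.induct)
  case (const c)
  then show ?case using box_degree_const by blast
next
  case (coord i)
  have "monomial (\<lambda>j. if j = i then 1 else 0) x = x $ i" for x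
    by (simp add: monomial_def if_distrib[of "\<lambda>k. _ ^ k"] cong: if_cong)
  then have "monomial (\<lambda>j. if j = i then 1 else 0) = (\<lambda>x. x $ i)" by auto
  moreover have "(\<lambda>j. if j = i then 1 else 0) \<in> expo_box 1" by (auto simp: expo_box_def)
  ultimately show ?case using box_degree_monomial[of "\<lambda>j. if j = i then 1 else 0" 1] by auto
next
  case (add p r)
  then obtain N M where "box_degree N p" "box_degree M r" by blast
  then have "box_degree (max N M) p" "box_degree (max N M) r" by (auto intro: box_degree_mono)
  then show ?case using box_degree_add by blast
next
  case (mult p r)
  then show ?case using box_degree_mult by blast
qed

text \<open>Induction on the set of variables: for fixed values of the others, a polynomial in the new variable that vanishes
identically has vanishing coefficients.\<close>

lemma monomials_independent_aux:
  fixes c :: "('n \<Rightarrow> nat) \<Rightarrow> complex"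
  assumes "finite B" "\<And>x :: 'n \<Rightarrow> complex. (\<Sum>\<alpha>\<in>PiE B (\<lambda>_. {..N}). c \<alpha> * (\<Prod>i\<in>B. x i ^ \<alpha> i)) = 0"
    "\<alpha> \<in> PiE B (\<lambda>_. {..N})"
  shows "c \<alpha> = 0"
  using assms
proof (induction B arbitrary: c \<alpha>)
  case empty
  then show ?case by simp
next
  case (insert i B)
  define P where "P = PiE B (\<lambda>_::'n. {..N})"
  have "finite P" using insert.hyps by (auto simp: P_def intro: finite_PiE)
  have eq: "PiE (insert i B) (\<lambda>_. {..N}) = (\<lambda>(k, f). f(i := k)) ` ({..N} \<times> P)"
    unfolding P_def by (rule PiE_insert_eq)
  have inj: "inj_on (\<lambda>(k, f). f(i := k)) ({..N} \<times> P)"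
    unfolding P_def using inj_combinator[OF insert.hyps(2), of "\<lambda>_. {..N}"] by simp
  have step: "(\<Sum>f\<in>P. c (f(i := k)) * (\<Prod>j\<in>B. x j ^ f j)) = 0" if "k \<le> N" for k x
  proof -
    have "(\<Sum>k\<le>N. (\<Sum>f\<in>P. c (f(i := k)) * (\<Prod>j\<in>B. x j ^ f j)) * t ^ k) = 0" for t
    proof -
      have "0 = (\<Sum>\<alpha>\<in>PiE (insert i B) (\<lambda>_. {..N}). c \<alpha> * (\<Prod>j\<in>insert i B. (x(i := t)) j ^ \<alpha> j))"
        using insert.prems(1) by metis
      also have "\<dots> = (\<Sum>(k, f)\<in>{..N} \<times> P. c (f(i := k)) * (\<Prod>j\<in>insert i B. (x(i := t)) j ^ (f(i := k)) j))"
        unfolding eq by (subst sum.reindex[OF inj]) (simp add: case_prod_unfold)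
      also have "\<dots> = (\<Sum>(k, f)\<in>{..N} \<times> P. (c (f(i := k)) * (\<Prod>j\<in>B. x j ^ f j)) * t ^ k)"
      proof (intro sum.cong refl, clarify)
        fix k f
        have "(\<Prod>j\<in>B. (x(i := t)) j ^ (f(i := k)) j) = (\<Prod>j\<in>B. x j ^ f j)"
          using insert.hyps by (intro prod.cong) auto
        then show "c (f(i := k)) * (\<Prod>j\<in>insert i B. (x(i := t)) j ^ (f(i := k)) j) =
            c (f(i := k)) * (\<Prod>j\<in>B. x j ^ f j) * t ^ k"
          using insert.hyps by simp
      qed
      also have "\<dots> = (\<Sum>k\<le>N. (\<Sum>f\<in>P. c (f(i := k)) * (\<Prod>j\<in>B. x j ^ f j)) * t ^ k)"
        by (simp add: sum.cartesian_product[symmetric] sum_distrib_right)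
      finally show ?thesis by simp
    qed
    then have "\<forall>k\<le>N. (\<Sum>f\<in>P. c (f(i := k)) * (\<Prod>j\<in>B. x j ^ f j)) = 0"
      using polyfun_eq_0[of "\<lambda>k. \<Sum>f\<in>P. c (f(i := k)) * (\<Prod>j\<in>B. x j ^ f j)" N] by blast
    then show ?thesis using that by blast
  qed
  obtain k f where kf: "\<alpha> = f(i := k)" "k \<le> N" "f \<in> P" using insert.prems(2) unfolding eq by auto
  show ?case
    using insert.IH[of "\<lambda>f. c (f(i := k))" f] step[OF kf(2)] kf(3) unfolding P_def kf(1) by blast
qed

lemma monomials_independent:
  fixes c :: "('n::finite \<Rightarrow> nat) \<Rightarrow> complex"
  assumes "\<And>x. (\<Sum>\<alpha>\<in>expo_box N. c \<alpha> * monomial \<alpha> x) = 0" "\<alpha> \<in> expo_box N"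
  shows "c \<alpha> = 0"
proof (rule monomials_independent_aux[of UNIV c N])
  show "(\<Sum>\<alpha>\<in>UNIV \<rightarrow>\<^sub>E {..N}. c \<alpha> * (\<Prod>i\<in>UNIV. x i ^ \<alpha> i)) = 0" for x
    using assms(1)[of "\<chi> i. x i"] by (simp add: monomial_def expo_box_PiE)
qed (use assms(2) in \<open>simp_all add: expo_box_PiE\<close>)

text \<open>Gaussian elimination, removing one equation and one unknown at a time.\<close>

lemma homogeneous_system_nontrivial:
  fixes v :: "'a \<Rightarrow> 'b \<Rightarrow> 'f::field"
  assumes "finite B" "finite A" "card B < card A"
  shows "\<exists>c. (\<exists>a\<in>A. c a \<noteq> 0) \<and> (\<forall>b\<in>B. (\<Sum>a\<in>A. c a * v a b) = 0)"
  using assms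
proof (induction B arbitrary: A v)
  case empty
  then obtain a where "a \<in> A" by fastforce
  then show ?case by (intro exI[of _ "\<lambda>_. 1"]) auto
next
  case (insert b B)
  show ?case
  proof (cases "\<forall>a\<in>A. v a b = 0")
    case True
    have "card B < card A" using insert by auto
    from insert.IH[OF insert.prems(1) this, of v] True show ?thesis by auto
  next
    case False
    then obtain a0 where a0: "a0 \<in> A" "v a0 b \<noteq> 0" by blast
    define A' where "A' = A - {a0}"
    have A': "finite A'" "a0 \<notin> A'" "A = insert a0 A'" using insert.prems a0 by (auto simp: A'_def)
    then have "card B < card A'" using insert by auto
    from insert.IH[OF A'(1) this, of "\<lambda>a b'. v a b' - v a b / v a0 b * v a0 b'"]
    obtain c where c: "\<exists>a\<in>A'. c a \<noteq> 0"
      "\<And>b'. b' \<in> B \<Longrightarrow> (\<Sum>a\<in>A'. c a * (v a b' - v a b / v a0 b * v a0 b')) = 0" by blast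
    define s where "s = - (\<Sum>a\<in>A'. c a * v a b) / v a0 b"
    have sum: "(\<Sum>a\<in>A. (c(a0 := s)) a * v a b') = s * v a0 b' + (\<Sum>a\<in>A'. c a * v a b')" for b'
    proof -
      have "(\<Sum>a\<in>A'. (c(a0 := s)) a * v a b') = (\<Sum>a\<in>A'. c a * v a b')"
        using A' by (intro sum.cong) auto
      then show ?thesis using A' by simp
    qed
    have "s * v a0 b' + (\<Sum>a\<in>A'. c a * v a b') = (\<Sum>a\<in>A'. c a * (v a b' - v a b / v a0 b * v a0 b'))" for b'
      by (simp add: s_def algebra_simps sum_subtractf sum_distrib_left sum_divide_distrib)
    moreover have "s * v a0 b + (\<Sum>a\<in>A'. c a * v a b) = 0" using a0 by (simp add: s_def)
    moreover have "\<exists>a\<in>A. (c(a0 := s)) a \<noteq> 0"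
      using c(1) A' by (metis fun_upd_other insertCI)
    ultimately show ?thesis using c(2) sum
      by (intro exI[of _ "c(a0 := s)"]) (auto simp del: fun_upd_apply)
  qed
qed

lemma box_degree_dependent:
  fixes p :: "'a \<Rightarrow> complex ^ 'n \<Rightarrow> complex"
  assumes "finite A" "\<And>a. a \<in> A \<Longrightarrow> box_degree N (p a)" "Suc N ^ CARD('n) < card A"
  shows "\<exists>c. (\<exists>a\<in>A. c a \<noteq> 0) \<and> (\<forall>x. (\<Sum>a\<in>A. c a * p a x) = 0)"
proof -
  have "\<forall>a. \<exists>v. a \<in> A \<longrightarrow> (\<forall>x. p a x = (\<Sum>\<alpha>\<in>expo_box N. v \<alpha> * monomial \<alpha> x))"
    using assms(2) unfolding box_degree_def by blast
  then obtain v where v: "\<And>a x. a \<in> A \<Longrightarrow> p a x = (\<Sum>\<alpha>\<in>expo_box N. v a \<alpha> * monomial \<alpha> x)" by metis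
  obtain c where c: "\<exists>a\<in>A. c a \<noteq> 0" "\<And>\<alpha>. \<alpha> \<in> expo_box N \<Longrightarrow> (\<Sum>a\<in>A. c a * v a \<alpha>) = 0"
    using homogeneous_system_nontrivial[of "expo_box N :: ('n \<Rightarrow> nat) set" A v] assms
    by (auto simp: card_expo_box)
  have "(\<Sum>a\<in>A. c a * p a x) = 0" for x
  proof -
    have "(\<Sum>a\<in>A. c a * p a x) = (\<Sum>a\<in>A. \<Sum>\<alpha>\<in>expo_box N. c a * v a \<alpha> * monomial \<alpha> x)"
      by (intro sum.cong) (auto simp: v sum_distrib_left mult.assoc)
    also have "\<dots> = (\<Sum>\<alpha>\<in>expo_box N. (\<Sum>a\<in>A. c a * v a \<alpha>) * monomial \<alpha> x)"
      by (subst sum.swap) (simp add: sum_distrib_right)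
    finally show ?thesis by (simp add: c(2))
  qed
  with c(1) show ?thesis by blast
qed

text \<open>The products of a monomial in \<open>G\<close> and a power of \<open>g\<close>, with all exponents at most \<open>N\<close>, are \<open>(N + 1) ^ (n + 1)\<close> in number,
while they lie in a space of dimension \<open>(E + 1) ^ n\<close> with \<open>E\<close> linear in \<open>N\<close>. For large \<open>N\<close> they are
dependent, and the independence of the monomials in \<open>s\<close> makes the resulting equation nontrivial.\<close>

lemma algebraic_dependence:
  fixes G :: "complex ^ 'n \<Rightarrow> complex ^ 'n"
  assumes "polymap G" "polyfun g"
  shows "\<exists>K q. (\<forall>k. polyfun (q k)) \<and> (\<exists>k\<le>K. \<exists>s. q k s \<noteq> 0) \<and> (\<forall>x. (\<Sum>k\<le>K. q k (G x) * g x ^ k) = 0)"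
proof -
  have "\<forall>j. \<exists>N. box_degree N (\<lambda>x. G x $ j)" using assms polyfun_box_degree by (auto simp: polymap_def)
  then obtain d where d: "\<And>j. box_degree (d j) (\<lambda>x. G x $ j)" by metis
  obtain d' where d': "box_degree d' g" using assms polyfun_box_degree by blast
  define D where "D = max d' (Max (range d))"
  have D: "box_degree D (\<lambda>x. G x $ j)" "box_degree D g" for j
  proof -
    have "d j \<le> Max (range d)" by (rule Max_ge) auto
    then show "box_degree D (\<lambda>x. G x $ j)" "box_degree D g"
      unfolding D_def by (auto intro: box_degree_mono[OF d[of j] max.coboundedI2] box_degree_mono[OF d'])
  qed
  define n where "n = CARD('n)"
  \<comment> \<open>This choice of \<open>N\<close> gives \<open>(E + 1) ^ n \<le> N * (N + 1) ^ n < (N + 1) ^ (n + 1)\<close>.\<close>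
  define N where "N = ((n + 1) * D + 1) ^ n"
  define E where "E = (n + 1) * N * D"
  define A where "A = (expo_box N :: ('n \<Rightarrow> nat) set) \<times> {..N}"
  have "Suc E \<le> ((n + 1) * D + 1) * Suc N" by (simp add: E_def algebra_simps)
  then have "Suc E ^ n \<le> (((n + 1) * D + 1) * Suc N) ^ n" by (rule power_mono) simp
  also have "\<dots> = N * Suc N ^ n" by (simp only: power_mult_distrib N_def)
  also have "\<dots> < Suc N * Suc N ^ n" by simp
  also have "\<dots> = card A" by (simp add: A_def card_cartesian_product card_expo_box n_def)
  finally have card: "Suc E ^ CARD('n) < card A" by (simp add: n_def)
  have deg: "box_degree E (\<lambda>x. monomial (fst a) (G x) * g x ^ snd a)" if "a \<in> A" for a
  proof -
    have "box_degree ((\<Sum>j\<in>UNIV. fst a j * D) + snd a * D) (\<lambda>x. monomial (fst a) (G x) * g x ^ snd a)"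
      unfolding monomial_def by (intro box_degree_mult box_degree_prod box_degree_power D)
    moreover have "(\<Sum>j\<in>UNIV. fst a j * D) \<le> (\<Sum>j\<in>(UNIV :: 'n set). N * D)"
      using that by (intro sum_mono mult_right_mono) (auto simp: A_def expo_box_def)
    moreover have "snd a * D \<le> N * D" using that by (auto simp: A_def)
    moreover have "E = (\<Sum>j\<in>(UNIV :: 'n set). N * D) + N * D" by (simp add: E_def n_def algebra_simps)
    ultimately show ?thesis by (elim box_degree_mono) linarith
  qed
  have "finite A" by (simp add: A_def)
  then have "\<exists>c. (\<exists>a\<in>A. c a \<noteq> 0) \<and>
      (\<forall>x. (\<Sum>a\<in>A. c a * (monomial (fst a) (G x) * g x ^ snd a)) = 0)"
    by (rule box_degree_dependent[OF _ deg card])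
  then obtain c where
    c: "\<exists>a\<in>A. c a \<noteq> 0" "\<And>x. (\<Sum>a\<in>A. c a * (monomial (fst a) (G x) * g x ^ snd a)) = 0"
    by (elim exE conjE) simp
  define q where "q k s = (\<Sum>\<alpha>\<in>expo_box N. c (\<alpha>, k) * monomial \<alpha> s)" for k s
  have "polyfun (q k)" for k unfolding q_def[abs_def] by (intro polyfun_intros polyfun_monomial)
  moreover have "\<exists>k\<le>N. \<exists>s. q k s \<noteq> 0"
  proof -
    obtain \<alpha> k where *: "c (\<alpha>, k) \<noteq> 0" "\<alpha> \<in> expo_box N" "k \<le> N" using c(1) by (auto simp: A_def)
    then have "\<exists>s. q k s \<noteq> 0"
      using monomials_independent[of "\<lambda>\<alpha>. c (\<alpha>, k)" N \<alpha>] unfolding q_def by blast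
    with * show ?thesis by blast
  qed
  moreover have "(\<Sum>k\<le>N. q k (G x) * g x ^ k) = 0" for x
  proof -
    have "(\<Sum>k\<le>N. q k (G x) * g x ^ k) = (\<Sum>k\<le>N. \<Sum>\<alpha>\<in>expo_box N. c (\<alpha>, k) * (monomial \<alpha> (G x) * g x ^ k))"
      by (simp add: q_def sum_distrib_right mult.assoc)
    also have "\<dots> = (\<Sum>a\<in>A. c a * (monomial (fst a) (G x) * g x ^ snd a))"
      by (subst sum.swap) (simp add: A_def sum.cartesian_product case_prod_unfold)
    finally show ?thesis using c(2) by simp
  qed
  ultimately show ?thesis by blast
qed

lemma polyfun_expand_at:
  assumes "polyfun g"
  shows "\<exists>N c. \<forall>x. g x = (\<Sum>\<alpha>\<in>expo_box N. c \<alpha> * monomial \<alpha> (x - p))"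
proof -
  have "polyfun (\<lambda>x. g (x + p))"
    by (rule polyfun_compose[OF assms]) (auto simp: polymap_def intro!: polyfun_intros)
  then obtain N c where "\<And>x. g (x + p) = (\<Sum>\<alpha>\<in>expo_box N. c \<alpha> * monomial \<alpha> x)"
    using polyfun_box_degree unfolding box_degree_def by blast
  from this[of "_ - p"] show ?thesis by auto
qed

text \<open>The order of vanishing at \<open>p\<close> along \<open>X\<close> as a growth estimate, which makes sense for functions such as primitives
that are not known to be polynomials.\<close>

definition vanishes_to_order :: "nat \<Rightarrow> complex ^ 'n \<Rightarrow> (complex ^ 'n) set \<Rightarrow> (complex ^ 'n \<Rightarrow> complex) \<Rightarrow> bool" where
  "vanishes_to_order k p X g \<longleftrightarrow> (\<exists>C. \<forall>\<^sub>F x in nhds p. x \<in> X \<longrightarrow> norm (g x) \<le> C * norm (x - p) ^ k)"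

lemma poly_low_coeffs_0:
  fixes q :: "complex poly"
  assumes "\<forall>\<^sub>F z in nhds 0. norm (poly q z) \<le> C * norm z ^ k" "d < k"
  shows "coeff q d = 0"
  using assms
proof (induction d arbitrary: q k)
  case 0
  have "norm (poly q 0) \<le> C * norm (0::complex) ^ k" using 0 eventually_nhds_x_imp_x by blast
  then show ?case using 0 by (simp add: poly_0_coeff_0 power_0_left)
next
  case (Suc d)
  obtain k' where k: "k = Suc k'" using Suc.prems by (cases k) auto
  obtain q' where q: "q = pCons (coeff q 0) q'" by (metis coeff_pCons_0 pCons_cases)
  have "norm (poly q 0) \<le> C * norm (0::complex) ^ k" using Suc.prems eventually_nhds_x_imp_x by blast
  then have "coeff q 0 = 0" using k by (simp add: poly_0_coeff_0)
  then have q: "q = pCons 0 q'" using q by simp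
  have "\<forall>\<^sub>F z in at 0. norm (poly q' z) \<le> C * norm z ^ k'"
    using eventually_nhds_conv_at[THEN iffD1, OF Suc.prems(1), THEN conjunct1] eventually_neq_at_within[of 0 0 UNIV]
  proof (eventually_elim)
    case (elim z)
    then show ?case by (simp add: q k norm_mult)
  qed
  moreover have "norm (poly q' 0) \<le> C * norm (0::complex) ^ k'"
  proof (rule tendsto_le[of "at 0"])
    show "((\<lambda>z::complex. C * norm z ^ k') \<longlongrightarrow> C * norm (0::complex) ^ k') (at 0)"
      by (intro tendsto_intros)
    show "((\<lambda>z. norm (poly q' z)) \<longlongrightarrow> norm (poly q' 0)) (at 0)"
      by (intro tendsto_intros)
  qed (use calculation in auto)
  ultimately have "\<forall>\<^sub>F z in nhds 0. norm (poly q' z) \<le> C * norm z ^ k'"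
    by (simp add: eventually_nhds_conv_at)
  then show ?case using Suc.IH Suc.prems(2) k q by simp
qed

text \<open>On the line through \<open>p\<close> and \<open>x\<close>, the coefficient of degree \<open>d\<close> of \<open>g\<close> is its homogeneous part of degree \<open>d\<close> at \<open>x - p\<close>,
and the estimate forces the coefficients of degree less than \<open>k\<close> to vanish.\<close>

lemma vanishing_order_expansion:
  assumes "polyfun g" "vanishes_to_order k p UNIV g"
  shows "\<exists>N c. \<forall>x. g x = (\<Sum>\<alpha> | \<alpha> \<in> expo_box N \<and> k \<le> (\<Sum>i\<in>UNIV. \<alpha> i). c \<alpha> * monomial \<alpha> (x - p))"
proof -
  obtain N c where g: "\<And>x. g x = (\<Sum>\<alpha>\<in>expo_box N. c \<alpha> * monomial \<alpha> (x - p))"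
    using polyfun_expand_at[OF assms(1)] by metis
  obtain C where C: "\<forall>\<^sub>F x in nhds p. norm (g x) \<le> C * norm (x - p) ^ k"
    using assms(2) by (auto simp: vanishes_to_order_def)
  have "g x = (\<Sum>\<alpha> | \<alpha> \<in> expo_box N \<and> k \<le> (\<Sum>i\<in>UNIV. \<alpha> i). c \<alpha> * monomial \<alpha> (x - p))" for x
  proof -
    define v where "v = x - p"
    define q where "q = (\<Sum>\<alpha>\<in>expo_box N. Polynomial.monom (c \<alpha> * monomial \<alpha> v) (\<Sum>i\<in>UNIV. \<alpha> i))"
    have q: "poly q z = g (p + z *s v)" for z
      by (simp add: q_def g poly_sum poly_monom monomial_smult mult_ac)
    have "((\<lambda>z. p + z *s v) \<longlongrightarrow> p + 0 *s v) (nhds 0)"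
      by (intro tendsto_intros tendsto_ident_at filterlim_ident)
    then have "\<forall>\<^sub>F z in nhds 0. norm (g (p + z *s v)) \<le> C * norm (p + z *s v - p) ^ k"
      using C by (auto simp: filterlim_iff)
    then have "\<forall>\<^sub>F z in nhds 0. norm (poly q z) \<le> (C * norm v ^ k) * norm z ^ k"
      by (simp add: q norm_vector_smult power_mult_distrib mult_ac)
    then have low: "coeff q d = 0" if "d < k" for d using poly_low_coeffs_0 that by blast
    have cf: "coeff q d = (\<Sum>\<alpha> | \<alpha> \<in> expo_box N \<and> (\<Sum>i\<in>UNIV. \<alpha> i) = d. c \<alpha> * monomial \<alpha> v)" for d
      by (simp add: q_def coeff_sum sum.inter_filter[symmetric] flip: sum.inter_filter)
    have "(\<Sum>\<alpha> | \<alpha> \<in> expo_box N \<and> (\<Sum>i\<in>UNIV. \<alpha> i) < k. c \<alpha> * monomial \<alpha> v) =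
        (\<Sum>d<k. \<Sum>\<alpha> | \<alpha> \<in> {\<alpha> \<in> expo_box N. (\<Sum>i\<in>UNIV. \<alpha> i) < k} \<and> (\<Sum>i\<in>UNIV. \<alpha> i) = d. c \<alpha> * monomial \<alpha> v)"
      by (rule sum.group[symmetric]) auto
    also have "\<dots> = (\<Sum>d<k. coeff q d)"
      unfolding cf by (intro sum.cong) auto
    also have "\<dots> = 0" using low by simp
    finally have "(\<Sum>\<alpha> | \<alpha> \<in> expo_box N \<and> (\<Sum>i\<in>UNIV. \<alpha> i) < k. c \<alpha> * monomial \<alpha> v) = 0" .
    moreover have "expo_box N = {\<alpha> \<in> expo_box N. k \<le> (\<Sum>i\<in>UNIV. \<alpha> i)} \<union> {\<alpha> \<in> expo_box N. (\<Sum>i\<in>UNIV. \<alpha> i) < k}"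
      by auto
    then have "g x = (\<Sum>\<alpha> | \<alpha> \<in> expo_box N \<and> k \<le> (\<Sum>i\<in>UNIV. \<alpha> i). c \<alpha> * monomial \<alpha> v) +
       (\<Sum>\<alpha> | \<alpha> \<in> expo_box N \<and> (\<Sum>i\<in>UNIV. \<alpha> i) < k. c \<alpha> * monomial \<alpha> v)"
      unfolding g v_def[symmetric] by (subst sum.union_disjoint[symmetric]) (auto intro!: sum.cong)
    ultimately show ?thesis by (simp add: v_def)
  qed
  then show ?thesis by blast
qed

text \<open>Dividing the homogeneous part of degree \<open>d\<close> by \<open>d + 1\<close> integrates \<open>g\<close> along all rays from the origin at once.\<close>

lemma polyfun_radial_primitive:
  fixes g :: "complex ^ 'n \<Rightarrow> complex"
  assumes "polyfun g"
  shows "\<exists>G. polyfun G \<and> (\<forall>s z. ((\<lambda>z. z * G (z *s s)) has_field_derivative g (z *s s)) (at (z :: complex)))"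
proof -
  obtain N c where g: "\<And>x. g x = (\<Sum>\<alpha>\<in>expo_box N. c \<alpha> * monomial \<alpha> x)"
    using polyfun_box_degree[OF assms] by (auto simp: box_degree_def)
  define G where "G x = (\<Sum>\<alpha>\<in>expo_box N. c \<alpha> / (1 + of_nat (\<Sum>i\<in>UNIV. \<alpha> i)) * monomial \<alpha> x)" for x
  have "polyfun G" unfolding G_def[abs_def] by (intro polyfun_intros polyfun_monomial)
  moreover have "((\<lambda>z. z * G (z *s s)) has_field_derivative g (z *s s)) (at z)" for s and z :: complex
  proof -
    have "((\<lambda>z. \<Sum>\<alpha>\<in>expo_box N. c \<alpha> / (1 + of_nat (\<Sum>i\<in>UNIV. \<alpha> i)) * monomial \<alpha> s * z ^ Suc (\<Sum>i\<in>UNIV. \<alpha> i))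
       has_field_derivative
        (\<Sum>\<alpha>\<in>expo_box N. c \<alpha> / (1 + of_nat (\<Sum>i\<in>UNIV. \<alpha> i)) * monomial \<alpha> s * (of_nat (Suc (\<Sum>i\<in>UNIV. \<alpha> i)) * z ^ (\<Sum>i\<in>UNIV. \<alpha> i)))) (at z)"
      by (intro DERIV_sum DERIV_cmult) (auto intro!: derivative_eq_intros simp del: power_Suc)
    moreover have "(\<Sum>\<alpha>\<in>expo_box N. c \<alpha> / (1 + of_nat (\<Sum>i\<in>UNIV. \<alpha> i)) * monomial \<alpha> s * (of_nat (Suc (\<Sum>i\<in>UNIV. \<alpha> i)) * z ^ (\<Sum>i\<in>UNIV. \<alpha> i))) = g (z *s s)"
      unfolding g monomial_smult
    proof (intro sum.cong refl)
      fix \<alpha> :: "'n \<Rightarrow> nat"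
      have "(1 + of_nat (sum \<alpha> UNIV) :: complex) \<noteq> 0" by (metis of_nat_Suc of_nat_neq_0)
      then show "c \<alpha> / (1 + of_nat (sum \<alpha> UNIV)) * monomial \<alpha> s * (of_nat (Suc (sum \<alpha> UNIV)) * z ^ sum \<alpha> UNIV) =
          c \<alpha> * (z ^ sum \<alpha> UNIV * monomial \<alpha> s)" by (simp add: divide_simps del: of_nat_sum)
    qed
    moreover have "(\<lambda>z. \<Sum>\<alpha>\<in>expo_box N. c \<alpha> / (1 + of_nat (\<Sum>i\<in>UNIV. \<alpha> i)) * monomial \<alpha> s * z ^ Suc (\<Sum>i\<in>UNIV. \<alpha> i)) = (\<lambda>z. z * G (z *s s))"
      unfolding G_def monomial_smult by (simp add: sum_distrib_left mult_ac)
    ultimately show ?thesis by simp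
  qed
  ultimately show ?thesis by blast
qed

section \<open>Ideals of polynomial functions\<close>

text \<open>Rings and ideals are plain sets of functions on one type, so that an induction on the number of variables can pass from a
ring to an extension of it.\<close>

definition fun_subring :: "('a \<Rightarrow> complex) set \<Rightarrow> bool" where
  "fun_subring S \<longleftrightarrow> (\<forall>c. (\<lambda>x. c) \<in> S) \<and>
     (\<forall>p\<in>S. \<forall>q\<in>S. (\<lambda>x. p x + q x) \<in> S \<and> (\<lambda>x. p x * q x) \<in> S)"

definition fun_ideal :: "('a \<Rightarrow> complex) set \<Rightarrow> ('a \<Rightarrow> complex) set \<Rightarrow> bool" where
  "fun_ideal S J \<longleftrightarrow> J \<subseteq> S \<and> (\<lambda>x. 0) \<in> J \<and> (\<forall>p\<in>J. \<forall>q\<in>J. (\<lambda>x. p x + q x) \<in> J) \<and>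
     (\<forall>a\<in>S. \<forall>p\<in>J. (\<lambda>x. a x * p x) \<in> J)"

definition noetherian_funs :: "('a \<Rightarrow> complex) set \<Rightarrow> bool" where
  "noetherian_funs S \<longleftrightarrow>
     (\<forall>Q :: nat \<Rightarrow> _. (\<forall>k. fun_ideal S (Q k) \<and> Q k \<subseteq> Q (Suc k)) \<longrightarrow> (\<exists>N. \<forall>k\<ge>N. Q k = Q N))"

lemma fun_idealD:
  assumes "fun_ideal S J"
  shows "(\<lambda>x. 0) \<in> J" "p \<in> J \<Longrightarrow> q \<in> J \<Longrightarrow> (\<lambda>x. p x + q x) \<in> J"
    "a \<in> S \<Longrightarrow> p \<in> J \<Longrightarrow> (\<lambda>x. a x * p x) \<in> J" "p \<in> J \<Longrightarrow> p \<in> S"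
  using assms by (auto simp: fun_ideal_def)

lemma fun_ideal_sum:
  assumes "fun_ideal S J" "\<And>i. i \<in> A \<Longrightarrow> p i \<in> J"
  shows "(\<lambda>x. \<Sum>i\<in>A. p i x) \<in> J"
  using assms(2)
  by (induction A rule: infinite_finite_induct) (auto intro: fun_idealD[OF assms(1)])

lemma fun_ideal_diff:
  assumes "fun_subring S" "fun_ideal S J" "p \<in> J" "q \<in> J"
  shows "(\<lambda>x. p x - q x) \<in> J"
proof -
  have "(\<lambda>x. -1 * q x) \<in> J"
    by (rule fun_idealD(3)[OF assms(2) _ assms(4)]) (use assms(1) in \<open>auto simp: fun_subring_def\<close>)
  from fun_idealD(2)[OF assms(2,3) this] show ?thesis by simp
qed

lemma fun_subringD:
  assumes "fun_subring S"
  shows "(\<lambda>x. c) \<in> S" "p \<in> S \<Longrightarrow> q \<in> S \<Longrightarrow> (\<lambda>x. p x + q x) \<in> S"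
    "p \<in> S \<Longrightarrow> q \<in> S \<Longrightarrow> (\<lambda>x. p x * q x) \<in> S" "p \<in> S \<Longrightarrow> q \<in> S \<Longrightarrow> (\<lambda>x. p x - q x) \<in> S"
proof -
  show *: "(\<lambda>x. c) \<in> S" "p \<in> S \<Longrightarrow> q \<in> S \<Longrightarrow> (\<lambda>x. p x + q x) \<in> S"
    "p \<in> S \<Longrightarrow> q \<in> S \<Longrightarrow> (\<lambda>x. p x * q x) \<in> S" for c p q
    using assms by (auto simp: fun_subring_def)
  assume "p \<in> S" "q \<in> S"
  then show "(\<lambda>x. p x - q x) \<in> S" using *(2)[OF \<open>p \<in> S\<close> *(3)[OF *(1)[of "-1"] \<open>q \<in> S\<close>]] by simp
qed

text \<open>For an increasing chain of ideals \<open>Q k\<close>, let \<open>L k d\<close> be the ideal of the coefficients of \<open>t ^ d\<close> in the elements of \<open>Q k\<close> of degree at most \<open>d\<close> in \<open>t\<close>. It grows in both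
indices. The diagonal becomes stationary at some \<open>N0\<close>, which settles all \<open>d \<ge> N0\<close>, and each of the finitely many smaller
\<open>d\<close> gives a chain of its own; so \<open>L k d\<close> does not depend on \<open>k \<ge> K\<close>. An ideal is determined within a larger one by its
leading coefficients, by induction on the degree.\<close>

theorem hilbert_basis:
  assumes S: "fun_subring S" "noetherian_funs S"
    and T: "S \<subseteq> T" "t \<in> T"
      "\<And>q. q \<in> T \<Longrightarrow> \<exists>d s. (\<forall>j. s j \<in> S) \<and> q = (\<lambda>x. \<Sum>j<d. s j x * t x ^ j)"
  shows "noetherian_funs T"
  unfolding noetherian_funs_def
proof (intro allI impI)
  fix Q :: "nat \<Rightarrow> ('a \<Rightarrow> complex) set"
  assume "\<forall>k. fun_ideal T (Q k) \<and> Q k \<subseteq> Q (Suc k)"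
  then have Q: "\<And>k. fun_ideal T (Q k)" and Qinc: "\<And>i j. i \<le> j \<Longrightarrow> Q i \<subseteq> Q j"
    using lift_Suc_mono_le[of Q] by auto
  define L where "L k d = {c \<in> S. \<exists>s. (\<forall>j. s j \<in> S) \<and>
    (\<lambda>x. (\<Sum>j<d. s j x * t x ^ j) + c x * t x ^ d) \<in> Q k}" for k d :: nat
  have L_ideal: "fun_ideal S (L k d)" for k d
    unfolding fun_ideal_def
  proof (intro conjI ballI)
    show "L k d \<subseteq> S" by (auto simp: L_def)
    show "(\<lambda>x. 0) \<in> L k d"
      using fun_subringD(1)[OF S(1), of 0] fun_idealD(1)[OF Q]
      by (auto simp: L_def intro!: exI[of _ "\<lambda>j x. 0"])
  next
    fix c c' assume "c \<in> L k d" "c' \<in> L k d"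
    then obtain s s' where s: "c \<in> S" "c' \<in> S" "\<And>j. s j \<in> S" "\<And>j. s' j \<in> S"
      "(\<lambda>x. (\<Sum>j<d. s j x * t x ^ j) + c x * t x ^ d) \<in> Q k"
      "(\<lambda>x. (\<Sum>j<d. s' j x * t x ^ j) + c' x * t x ^ d) \<in> Q k" by (auto simp: L_def)
    have "(\<lambda>x. (\<Sum>j<d. (s j x + s' j x) * t x ^ j) + (c x + c' x) * t x ^ d) \<in> Q k"
      using fun_idealD(2)[OF Q s(5,6)] by (simp add: algebra_simps sum.distrib)
    then show "(\<lambda>x. c x + c' x) \<in> L k d" using s fun_subringD(2)[OF S(1)]
      unfolding L_def by (intro CollectI conjI exI[of _ "\<lambda>j x. s j x + s' j x"]) auto
  next
    fix a c assume a: "a \<in> S" and "c \<in> L k d"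
    then obtain s where s: "c \<in> S" "\<And>j. s j \<in> S"
      "(\<lambda>x. (\<Sum>j<d. s j x * t x ^ j) + c x * t x ^ d) \<in> Q k" by (auto simp: L_def)
    have "(\<lambda>x. (\<Sum>j<d. (a x * s j x) * t x ^ j) + (a x * c x) * t x ^ d) \<in> Q k"
      using fun_idealD(3)[OF Q _ s(3), of a] a T(1) by (auto simp: algebra_simps sum_distrib_left)
    then show "(\<lambda>x. a x * c x) \<in> L k d" using s a fun_subringD(3)[OF S(1)]
      unfolding L_def by (intro CollectI conjI exI[of _ "\<lambda>j x. a x * s j x"]) auto
  qed
  have L_Suc: "L k d \<subseteq> L k (Suc d)" for k d
  proof
    fix c assume "c \<in> L k d"
    then obtain s where s: "c \<in> S" "\<And>j. s j \<in> S"
      "(\<lambda>x. (\<Sum>j<d. s j x * t x ^ j) + c x * t x ^ d) \<in> Q k" by (auto simp: L_def)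
    define s' where "s' j = (case j of 0 \<Rightarrow> (\<lambda>x. 0) | Suc i \<Rightarrow> s i)" for j
    have "(\<lambda>x. t x * ((\<Sum>j<d. s j x * t x ^ j) + c x * t x ^ d)) \<in> Q k"
      using fun_idealD(3)[OF Q T(2) s(3)] .
    also have "(\<lambda>x. t x * ((\<Sum>j<d. s j x * t x ^ j) + c x * t x ^ d)) =
      (\<lambda>x. (\<Sum>j<Suc d. s' j x * t x ^ j) + c x * t x ^ Suc d)"
      by (simp add: sum.lessThan_Suc_shift s'_def algebra_simps sum_distrib_left del: sum.lessThan_Suc)
    finally show "c \<in> L k (Suc d)" using s fun_subringD(1)[OF S(1), of 0]
      unfolding L_def by (intro CollectI conjI exI[of _ s']) (auto simp: s'_def split: nat.split)
  qed
  have L_mono: "L k d \<subseteq> L k' d'" if "k \<le> k'" "d \<le> d'" for k d k' d'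
  proof -
    have "L k d \<subseteq> L k' d" using Qinc[OF that(1)] by (auto simp: L_def)
    also have "\<dots> \<subseteq> L k' d'" using lift_Suc_mono_le[of "L k'", OF L_Suc that(2)] .
    finally show ?thesis .
  qed
  have stab: "\<exists>N. \<forall>k\<ge>N. P k = P N" if "\<And>k. fun_ideal S (P k)" "\<And>k. P k \<subseteq> P (Suc k)" for P :: "nat \<Rightarrow> _"
    using S(2) that unfolding noetherian_funs_def by blast
  obtain N0 where N0: "\<And>k. k \<ge> N0 \<Longrightarrow> L k k = L N0 N0"
    using stab[of "\<lambda>k. L k k"] L_ideal L_mono by (metis le_SucI order_refl)
  have "\<exists>N. \<forall>k\<ge>N. L k d = L N d" for d
    using stab[of "\<lambda>k. L k d"] L_ideal L_mono by (metis le_SucI order_refl)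
  then obtain M where M: "\<And>d k. k \<ge> M d \<Longrightarrow> L k d = L (M d) d" by metis
  define K where "K = Max (insert N0 (M ` {..<N0}))"
  have K: "K \<ge> N0" "\<And>d. d < N0 \<Longrightarrow> K \<ge> M d" by (auto simp: K_def)
  have LK: "L k d = L K d" if "k \<ge> K" for k d
  proof (cases "d < N0")
    case True
    with M K that show ?thesis by (metis le_trans)
  next
    case False
    have "L k d \<subseteq> L (max k d) (max k d)" by (rule L_mono) auto
    also have "\<dots> = L N0 N0" using K that by (intro N0) auto
    also have "\<dots> \<subseteq> L K d" using K False by (intro L_mono) auto
    finally show ?thesis using L_mono[OF that order_refl] by blast
  qed
  have "q \<in> Q K" if k: "k \<ge> K" and "\<And>j. s j \<in> S" "q = (\<lambda>x. \<Sum>j<d. s j x * t x ^ j)" "q \<in> Q k" for k d s q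
    using that(2-)
  proof (induction d arbitrary: s q)
    case 0
    then show ?case using fun_idealD(1)[OF Q] by simp
  next
    case (Suc d)
    then have "s d \<in> L k d" unfolding L_def by (intro CollectI conjI exI[of _ s]) auto
    then have "s d \<in> L K d" using LK[OF k] by simp
    then obtain s' where s': "\<And>j. s' j \<in> S" "(\<lambda>x. (\<Sum>j<d. s' j x * t x ^ j) + s d x * t x ^ d) \<in> Q K"
      by (auto simp: L_def)
    let ?q' = "\<lambda>x. (\<Sum>j<d. s' j x * t x ^ j) + s d x * t x ^ d"
    have "?q' \<in> Q k" using s'(2) Qinc[OF k] by blast
    have "(\<lambda>x. -1 * ?q' x) \<in> Q k"
      by (rule fun_idealD(3)[OF Q _ \<open>?q' \<in> Q k\<close>]) (use fun_subringD(1)[OF S(1), of "-1"] T(1) in blast)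
    from fun_idealD(2)[OF Q Suc.prems(3) this]
    have "(\<lambda>x. q x + -1 * ?q' x) \<in> Q K"
      by (intro Suc.IH[of "\<lambda>j x. s j x - s' j x"])
        (use Suc.prems s' fun_subringD(4)[OF S(1)] in \<open>auto simp: algebra_simps sum_subtractf\<close>)
    from fun_idealD(2)[OF Q this s'(2)] show ?case by simp
  qed
  note lower = this
  have "Q k \<subseteq> Q K" if "k \<ge> K" for k
  proof
    fix q assume q: "q \<in> Q k"
    then obtain d s where "\<And>j. s j \<in> S" "q = (\<lambda>x. \<Sum>j<d. s j x * t x ^ j)"
      using T(3) fun_idealD(4)[OF Q] by blast
    then show "q \<in> Q K" using lower[OF that] q by blast
  qed
  then show "\<exists>N. \<forall>k\<ge>N. Q k = Q N" using Qinc by (intro exI[of _ K]) blast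
qed

lemma fun_subring_polyfun: "fun_subring (Collect polyfun)"
  by (auto simp: fun_subring_def intro: polyfun_intros)

definition polyfuns_in :: "'n set \<Rightarrow> (complex ^ 'n \<Rightarrow> complex) set" where
  "polyfuns_in B = {p. polyfun p \<and> (\<forall>x y. (\<forall>i\<in>B. x $ i = y $ i) \<longrightarrow> p x = p y)}"

lemma fun_subring_polyfuns_in: "fun_subring (polyfuns_in B)"
  unfolding fun_subring_def
proof (intro conjI allI ballI)
  fix p q assume "p \<in> polyfuns_in B" "q \<in> polyfuns_in B"
  then have *: "polyfun p" "polyfun q" "\<And>x y. \<forall>i\<in>B. x $ i = y $ i \<Longrightarrow> p x = p y \<and> q x = q y"
    by (auto simp: polyfuns_in_def)
  show "(\<lambda>x. p x + q x) \<in> polyfuns_in B" "(\<lambda>x. p x * q x) \<in> polyfuns_in B"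
    unfolding polyfuns_in_def
    by (intro CollectI conjI allI impI polyfun_intros *(1,2); drule *(3); simp)+
qed (auto simp: polyfuns_in_def intro: polyfun.const)

text \<open>One variable is adjoined at a time; without variables, the ring is the field of constants.\<close>

lemma noetherian_polyfuns_in: "finite B \<Longrightarrow> noetherian_funs (polyfuns_in B :: (complex ^ 'n \<Rightarrow> complex) set)"
proof (induction B rule: finite_induct)
  case empty
  show ?case unfolding noetherian_funs_def
  proof (intro allI impI)
    fix Q :: "nat \<Rightarrow> (complex ^ 'n \<Rightarrow> complex) set"
    assume "\<forall>k. fun_ideal (polyfuns_in {}) (Q k) \<and> Q k \<subseteq> Q (Suc k)"
    then have Q: "\<And>k. fun_ideal (polyfuns_in {}) (Q k)" and Qinc: "\<And>i j. i \<le> j \<Longrightarrow> Q i \<subseteq> Q j"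
      using lift_Suc_mono_le[of Q] by auto
    have const: "\<exists>c. p = (\<lambda>x. c)" if "p \<in> Q k" for p k
      using fun_idealD(4)[OF Q that] by (auto simp: polyfuns_in_def fun_eq_iff intro!: exI[of _ "p 0"])
    show "\<exists>N. \<forall>k\<ge>N. Q k = Q N"
    proof (cases "\<exists>N c. c \<noteq> 0 \<and> (\<lambda>x. c) \<in> Q N")
      case True
      then obtain N c where c: "c \<noteq> 0" "(\<lambda>x. c) \<in> Q N" by blast
      have "(\<lambda>x. a) \<in> Q N" for a
        using fun_idealD(3)[OF Q _ c(2), of "\<lambda>x. a / c"] c(1) by (simp add: polyfuns_in_def polyfun.const)
      then have "Q k \<subseteq> Q N" for k using const by (metis subsetI)
      then show ?thesis using Qinc by blast
    next
      case False
      then have "Q k = {\<lambda>x. 0}" for k using const fun_idealD(1)[OF Q] by blast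
      then show ?thesis by blast
    qed
  qed
next
  case (insert i B)
  show ?case
  proof (rule hilbert_basis[OF fun_subring_polyfuns_in insert.IH, of _ "\<lambda>x. x $ i"])
    show "polyfuns_in B \<subseteq> polyfuns_in (insert i B)" by (auto simp: polyfuns_in_def)
    show "(\<lambda>x. x $ i) \<in> polyfuns_in (insert i B)" by (auto simp: polyfuns_in_def polyfun.coord)
  next
    fix p :: "complex ^ 'n \<Rightarrow> complex" assume p: "p \<in> polyfuns_in (insert i B)"
    then obtain N c where c: "\<And>x. p x = (\<Sum>\<alpha>\<in>expo_box N. c \<alpha> * monomial \<alpha> x)"
      using polyfun_box_degree unfolding polyfuns_in_def box_degree_def by blast
    \<comment> \<open>Setting the other variables to \<open>0\<close> does not change \<open>p\<close>, and makes the variables that occur explicit.\<close>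
    define r where "r x = (\<chi> j. if j \<in> insert i B then x $ j else 0)" for x :: "complex ^ 'n"
    define m where "m \<alpha> x = (\<Prod>j\<in>-{i}. r x $ j ^ \<alpha> j)" for \<alpha> and x :: "complex ^ 'n"
    define s where "s k x = (\<Sum>\<alpha>\<in>{\<alpha>\<in>expo_box N. \<alpha> i = k}. c \<alpha> * m \<alpha> x)" for k x
    have "s k \<in> polyfuns_in B" for k
    proof -
      have "polyfun (\<lambda>x. r x $ j)" for j by (cases "j \<in> insert i B") (auto simp: r_def intro: polyfun_intros)
      then have "polyfun (s k)" unfolding s_def[abs_def] m_def by (intro polyfun_intros)
      moreover have "s k x = s k y" if "\<forall>j\<in>B. x $ j = y $ j" for x y
      proof -
        have "r x $ j = r y $ j" if "j \<noteq> i" for j using that \<open>\<forall>j\<in>B. x $ j = y $ j\<close> by (auto simp: r_def)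
        then have "m \<alpha> x = m \<alpha> y" for \<alpha> unfolding m_def by (intro prod.cong) auto
        then show ?thesis by (simp add: s_def)
      qed
      ultimately show ?thesis by (auto simp: polyfuns_in_def)
    qed
    moreover have "p = (\<lambda>x. \<Sum>k<Suc N. s k x * x $ i ^ k)"
    proof
      fix x
      have "p x = p (r x)" using p by (auto simp: polyfuns_in_def r_def)
      also have "\<dots> = (\<Sum>\<alpha>\<in>expo_box N. c \<alpha> * m \<alpha> x * x $ i ^ \<alpha> i)"
        unfolding c
      proof (intro sum.cong refl)
        fix \<alpha>
        have "monomial \<alpha> (r x) = (\<Prod>j\<in>insert i (-{i}). r x $ j ^ \<alpha> j)"
          unfolding monomial_def by (intro prod.cong) auto
        also have "\<dots> = m \<alpha> x * x $ i ^ \<alpha> i" by (simp add: m_def r_def)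
        finally show "c \<alpha> * monomial \<alpha> (r x) = c \<alpha> * m \<alpha> x * x $ i ^ \<alpha> i" by simp
      qed
      also have "\<dots> = (\<Sum>k<Suc N. \<Sum>\<alpha>\<in>{\<alpha>\<in>expo_box N. \<alpha> i = k}. c \<alpha> * m \<alpha> x * x $ i ^ \<alpha> i)"
        by (rule sum.group[symmetric]) (auto, auto simp: expo_box_def less_Suc_eq_le)
      also have "\<dots> = (\<Sum>k<Suc N. s k x * x $ i ^ k)"
        unfolding s_def sum_distrib_right by (intro sum.cong) auto
      finally show "p x = (\<Sum>k<Suc N. s k x * x $ i ^ k)" .
    qed
    ultimately show "\<exists>d s. (\<forall>j. s j \<in> polyfuns_in B) \<and> p = (\<lambda>x. \<Sum>j<d. s j x * x $ i ^ j)" by blast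
  qed
qed

lemma noetherian_polyfun: "noetherian_funs (Collect polyfun :: (complex ^ 'n \<Rightarrow> complex) set)"
proof -
  have "polyfuns_in UNIV = (Collect polyfun :: (complex ^ 'n \<Rightarrow> complex) set)"
    by (auto simp: polyfuns_in_def vec_eq_iff[symmetric])
  then show ?thesis using noetherian_polyfuns_in[of "UNIV :: 'n set"] by simp
qed

abbreviation polyfun_ideal :: "(complex ^ 'n \<Rightarrow> complex) set \<Rightarrow> bool" where
  "polyfun_ideal \<equiv> fun_ideal (Collect polyfun)"

lemma polyfun_ideal_add_principal:
  fixes J :: "(complex ^ 'n \<Rightarrow> complex) set"
  assumes J: "polyfun_ideal J" and g: "polyfun g"
  shows "polyfun_ideal {\<lambda>x. j x + a x * g x | j a. j \<in> J \<and> polyfun a}" (is "polyfun_ideal ?K")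
    and "J \<subseteq> {\<lambda>x. j x + a x * g x | j a. j \<in> J \<and> polyfun a}"
    and "g \<in> {\<lambda>x. j x + a x * g x | j a. j \<in> J \<and> polyfun a}"
proof -
  show "polyfun_ideal ?K" unfolding fun_ideal_def
  proof (intro conjI ballI)
    show "?K \<subseteq> Collect polyfun" using fun_idealD(4)[OF J] g by (auto intro!: polyfun_intros)
    show "(\<lambda>x. 0) \<in> ?K"
      using fun_idealD(1)[OF J] by (intro CollectI exI[of _ "\<lambda>x. 0"]) (auto intro: polyfun_intros)
  next
    fix p q assume "p \<in> ?K" "q \<in> ?K"
    then obtain j a j' a' where "j \<in> J" "polyfun a" "j' \<in> J" "polyfun a'"
      "p = (\<lambda>x. j x + a x * g x)" "q = (\<lambda>x. j' x + a' x * g x)" by auto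
    then show "(\<lambda>x. p x + q x) \<in> ?K"
      by (intro CollectI exI[of _ "\<lambda>x. j x + j' x"] exI[of _ "\<lambda>x. a x + a' x"])
        (auto simp: algebra_simps intro: polyfun_intros fun_idealD(2)[OF J])
  next
    fix b p :: "complex ^ 'n \<Rightarrow> complex" assume "b \<in> Collect polyfun" "p \<in> ?K"
    then obtain j a where "polyfun b" "j \<in> J" "polyfun a" "p = (\<lambda>x. j x + a x * g x)" by auto
    then show "(\<lambda>x. b x * p x) \<in> ?K"
      by (intro CollectI exI[of _ "\<lambda>x. b x * j x"] exI[of _ "\<lambda>x. b x * a x"])
        (auto simp: algebra_simps intro: polyfun_intros fun_idealD(3)[OF J])
  qed
  show "J \<subseteq> ?K"
  proof
    fix j assume "j \<in> J"
    then show "j \<in> ?K" by (intro CollectI exI[of _ j] exI[of _ "\<lambda>x. 0"]) (auto intro: polyfun_intros)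
  qed
  show "g \<in> ?K" using fun_idealD(1)[OF J]
    by (intro CollectI exI[of _ "\<lambda>x. 0"] exI[of _ "\<lambda>x. 1"]) (auto intro: polyfun_intros)
qed

section \<open>Membership in an ideal tested to finite order\<close>

lemma has_derivative_local_lipschitz:
  assumes "(f has_derivative f') (at x)"
  shows "\<exists>C\<ge>0. \<forall>\<^sub>F y in nhds x. norm (f y - f x) \<le> C * norm (y - x)"
proof -
  have bl: "bounded_linear f'" using assms by (rule has_derivative_bounded_linear)
  obtain d where d: "d > 0" "\<And>y. norm (y - x) < d \<Longrightarrow> norm (f y - f x - f' (y - x)) \<le> 1 * norm (y - x)"
    using assms unfolding has_derivative_at_alt by (metis zero_less_one)
  have "norm (f y - f x) \<le> (1 + onorm f') * norm (y - x)" if "dist y x < d" for y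
  proof -
    have "norm (f y - f x) \<le> norm (f y - f x - f' (y - x)) + norm (f' (y - x))"
      using norm_triangle_ineq[of "f y - f x - f' (y - x)" "f' (y - x)"] by simp
    also have "\<dots> \<le> 1 * norm (y - x) + onorm f' * norm (y - x)"
      using that d by (intro add_mono onorm[OF bl]) (auto simp: dist_norm)
    finally show ?thesis by (simp add: algebra_simps)
  qed
  then show ?thesis using d(1) onorm_pos_le[OF bl] unfolding eventually_nhds_metric
    by (intro exI[of _ "1 + onorm f'"]) auto
qed

lemma vanishes_to_order_add:
  assumes "vanishes_to_order k p X g" "vanishes_to_order k p X h"
  shows "vanishes_to_order k p X (\<lambda>x. g x + h x)"
proof -
  obtain C D where C: "\<forall>\<^sub>F x in nhds p. x \<in> X \<longrightarrow> norm (g x) \<le> C * norm (x - p) ^ k"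
    "\<forall>\<^sub>F x in nhds p. x \<in> X \<longrightarrow> norm (h x) \<le> D * norm (x - p) ^ k"
    using assms by (auto simp: vanishes_to_order_def)
  from C have "\<forall>\<^sub>F x in nhds p. x \<in> X \<longrightarrow> norm (g x + h x) \<le> (C + D) * norm (x - p) ^ k"
    by eventually_elim (auto simp: algebra_simps intro: order_trans[OF norm_triangle_ineq] add_mono)
  then show ?thesis by (auto simp: vanishes_to_order_def)
qed

lemma vanishes_to_order_mult:
  assumes "vanishes_to_order k p X g" "vanishes_to_order l p X h"
  shows "vanishes_to_order (k + l) p X (\<lambda>x. g x * h x)"
proof -
  obtain C D where C: "\<forall>\<^sub>F x in nhds p. x \<in> X \<longrightarrow> norm (g x) \<le> C * norm (x - p) ^ k"
    "\<forall>\<^sub>F x in nhds p. x \<in> X \<longrightarrow> norm (h x) \<le> D * norm (x - p) ^ l"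
    using assms by (auto simp: vanishes_to_order_def)
  from C have "\<forall>\<^sub>F x in nhds p. x \<in> X \<longrightarrow> norm (g x * h x) \<le> (C * D) * norm (x - p) ^ (k + l)"
  proof eventually_elim
    case (elim x)
    show ?case
    proof
      assume "x \<in> X"
      then have "norm (g x) * norm (h x) \<le> (C * norm (x - p) ^ k) * (D * norm (x - p) ^ l)"
        using elim by (intro mult_mono) (auto intro: order_trans[OF norm_ge_zero])
      then show "norm (g x * h x) \<le> (C * D) * norm (x - p) ^ (k + l)"
        by (simp add: norm_mult power_add mult_ac)
    qed
  qed
  then show ?thesis by (auto simp: vanishes_to_order_def)
qed

lemma vanishes_to_order_1:
  assumes "polyfun g" "g p = 0"
  shows "vanishes_to_order 1 p X g"
  using has_derivative_local_lipschitz[OF polyfun_has_derivative[OF assms(1)], of p] assms(2)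
  unfolding vanishes_to_order_def by (auto elim: eventually_mono)

lemma vanishes_to_order_power:
  assumes "vanishes_to_order l p X g"
  shows "vanishes_to_order (k * l) p X (\<lambda>x. g x ^ k)"
proof (induction k)
  case 0
  show ?case by (auto simp: vanishes_to_order_def intro!: exI[of _ 1])
next
  case (Suc k)
  then show ?case using vanishes_to_order_mult[OF assms Suc] by simp
qed

text \<open>By maximality, the ideal \<open>(J : h)\<close> of all \<open>g\<close> with \<open>g h \<in> J\<close> is maximal. Its residue field has countable dimension over
\<open>\<complex>\<close>, so that the coordinate \<open>x\<^sub>i\<close>, as an element of it, is algebraic and hence a constant \<open>c\<close>: otherwise the uncountably many inverses of
\<open>x\<^sub>i - c\<close> would be linearly dependent, which is an algebraic equation for \<open>x\<^sub>i\<close>.\<close>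

lemma maximal_colon_has_point:
  fixes J :: "(complex ^ 'n \<Rightarrow> complex) set"
  assumes J: "polyfun_ideal J" and h: "h \<notin> J"
    and max: "\<And>g. polyfun g \<Longrightarrow> g \<notin> J \<Longrightarrow> \<exists>j a. j \<in> J \<and> polyfun a \<and> h = (\<lambda>x. j x + a x * g x)"
    and "polyfun h"
  shows "\<exists>c. (\<lambda>x. (x $ i - c) * h x) \<in> J"
proof (rule ccontr)
  assume none: "\<not> ?thesis"
  have J2: "(\<lambda>x. a x * p x) \<in> J" if "polyfun a" "p \<in> J" for a p using fun_idealD(3)[OF J] that by auto
  have "\<exists>u. polyfun u \<and> (\<lambda>x. h x - u x * (x $ i - c) * h x) \<in> J" for c
  proof -
    have "polyfun (\<lambda>x. (x $ i - c) * h x)" using \<open>polyfun h\<close> by (intro polyfun_intros)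
    then obtain j a where "j \<in> J" "polyfun a" and eq: "h = (\<lambda>x. j x + a x * ((x $ i - c) * h x))"
      using max none by blast
    have "h x - a x * (x $ i - c) * h x = j x" for x 
      using fun_cong[OF eq, of x] by (simp only: diff_eq_eq mult.assoc)
    then have "(\<lambda>x. h x - a x * (x $ i - c) * h x) = j" by blast
    then show ?thesis using \<open>j \<in> J\<close> \<open>polyfun a\<close> by auto
  qed
  \<comment> \<open>The function \<open>u c\<close> represents the inverse of \<open>x\<^sub>i - c\<close> in the residue field.\<close>
  then obtain u where u: "\<And>c. polyfun (u c)" "\<And>c. (\<lambda>x. h x - u c x * (x $ i - c) * h x) \<in> J" by metis
  \<comment> \<open>No nonzero polynomial in \<open>x\<^sub>i\<close> kills \<open>h\<close>, because it is a product of invertible linear factors.\<close>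
  have no_poly: "(\<lambda>x. poly P (x $ i) * h x) \<notin> J" if "P \<noteq> 0" for P
    using that
  proof (induction "degree P" arbitrary: P)
    case 0
    then obtain c where c: "P = [:c:]" "c \<noteq> 0" by (metis degree_eq_zeroE pCons_0_0)
    show ?case
    proof
      assume "(\<lambda>x. poly P (x $ i) * h x) \<in> J"
      from J2[OF polyfun.const[of "1 / c"] this] c h show False by simp
    qed
  next
    case (Suc d)
    then obtain c where "poly P c = 0"
      using Fundamental_Theorem_Algebra.fundamental_theorem_of_algebra[of P] by (metis constant_degree nat.distinct(1))
    then obtain R where R: "P = [:- c, 1:] * R" using poly_eq_0_iff_dvd by (metis dvdE)
    have "R \<noteq> 0" using Suc.prems R by auto
    moreover have "d = degree R"
      using Suc.hyps(2) degree_mult_eq[of "[:- c, 1:]" R] \<open>R \<noteq> 0\<close> unfolding R by simp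
    ultimately
    have R': "(\<lambda>x. poly R (x $ i) * h x) \<notin> J" using Suc.hyps(1) by blast
    show ?case
    proof
      assume P: "(\<lambda>x. poly P (x $ i) * h x) \<in> J"
      have "(\<lambda>x. poly R (x $ i) * (h x - u c x * (x $ i - c) * h x)) \<in> J"
        by (intro J2 u polyfun_poly polyfun.coord)
      moreover have "(\<lambda>x. u c x * (poly P (x $ i) * h x)) \<in> J" by (intro J2 u P)
      ultimately have "(\<lambda>x. poly R (x $ i) * (h x - u c x * (x $ i - c) * h x) + u c x * (poly P (x $ i) * h x)) \<in> J"
        by (rule fun_idealD(2)[OF J])
      then show False using R' by (simp add: R algebra_simps)
    qed
  qed
  \<comment> \<open>Uncountably many polynomials include infinitely many of a common degree, which are dependent.\<close>
  have "\<exists>N. infinite {c. box_degree N (u c)}"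
  proof (rule ccontr)
    assume "\<not> ?thesis"
    then have "countable (\<Union>N. {c. box_degree N (u c)})" by (auto intro: countable_finite)
    moreover have "(\<Union>N. {c. box_degree N (u c)}) = UNIV" using polyfun_box_degree[OF u(1)] by auto
    ultimately show False using uncountable_UNIV_complex by simp
  qed
  then obtain N where "infinite {c. box_degree N (u c)}" by blast
  then obtain A where A: "A \<subseteq> {c. box_degree N (u c)}" "finite A" "card A = Suc (Suc N ^ CARD('n))"
    by (metis infinite_arbitrarily_large)
  then obtain l where l: "\<exists>a\<in>A. l a \<noteq> 0" "\<And>x. (\<Sum>a\<in>A. l a * u a x) = 0"
    using box_degree_dependent[of A N u] by auto
  define P where "P = (\<Sum>a\<in>A. Polynomial.smult (l a) (\<Prod>b\<in>A - {a}. [:- b, 1:]))"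
  obtain a where a: "a \<in> A" "l a \<noteq> 0" using l by blast
  have "poly P a = (\<Sum>a'\<in>A. l a' * (\<Prod>b\<in>A - {a'}. a - b))" by (simp add: P_def poly_sum poly_prod)
  also have "\<dots> = (\<Sum>a'\<in>{a}. l a' * (\<Prod>b\<in>A - {a'}. a - b))"
    using A a by (intro sum.mono_neutral_right) auto
  also have "\<dots> \<noteq> 0" using A a by simp
  finally have "P \<noteq> 0" by auto
  have "(\<lambda>x. \<Sum>a\<in>A. (l a * (\<Prod>b\<in>A - {a}. x $ i - b)) * (h x - u a x * (x $ i - a) * h x)) \<in> J"
    by (intro fun_ideal_sum[OF J] J2 u polyfun_intros)
  also have "(\<lambda>x. \<Sum>a\<in>A. (l a * (\<Prod>b\<in>A - {a}. x $ i - b)) * (h x - u a x * (x $ i - a) * h x)) = (\<lambda>x. poly P (x $ i) * h x)"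
  proof
    fix x
    have "(\<Sum>a\<in>A. (l a * (\<Prod>b\<in>A - {a}. x $ i - b)) * (u a x * (x $ i - a) * h x)) =
       (\<Sum>a\<in>A. (l a * u a x) * ((\<Prod>b\<in>A. x $ i - b) * h x))"
      using A by (intro sum.cong) (auto simp: prod.remove mult_ac)
    also have "\<dots> = 0" using l(2) by (simp flip: sum_distrib_right)
    finally show "(\<Sum>a\<in>A. (l a * (\<Prod>b\<in>A - {a}. x $ i - b)) * (h x - u a x * (x $ i - a) * h x)) = poly P (x $ i) * h x"
      by (simp add: P_def poly_sum poly_prod right_diff_distrib sum_subtractf sum_distrib_right)
  qed
  finally show False using no_poly[OF \<open>P \<noteq> 0\<close>] by blast
qed

text \<open>Krull's intersection theorem, for all points together. An ideal \<open>M \<supseteq> J\<close> that is maximal among those without \<open>h\<close>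
belongs to a single point \<open>p\<close>: it contains a power of each \<open>x\<^sub>i - p\<^sub>i\<close>, and so every polynomial that vanishes to sufficiently
high order at \<open>p\<close>. The difference of \<open>h\<close> and an element of \<open>J\<close> is such a polynomial, which puts \<open>h\<close> into \<open>M\<close>.\<close>

theorem local_ideal_membership:
  fixes J :: "(complex ^ 'n \<Rightarrow> complex) set"
  assumes J: "polyfun_ideal J" and h: "polyfun h"
    and local: "\<And>p k. \<exists>j\<in>J. vanishes_to_order k p UNIV (\<lambda>x. h x - j x)"
  shows "h \<in> J"
proof (rule ccontr)
  assume "h \<notin> J"
  define \<A> where "\<A> = {I. polyfun_ideal I \<and> J \<subseteq> I \<and> h \<notin> I}"
  have "\<exists>M\<in>\<A>. \<forall>X\<in>\<A>. M \<subseteq> X \<longrightarrow> X = M"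
  proof (rule subset_Zorn_nonempty)
    show "\<A> \<noteq> {}" using J \<open>h \<notin> J\<close> by (auto simp: \<A>_def)
  next
    fix \<C> assume C: "\<C> \<noteq> {}" "subset.chain \<A> \<C>"
    then have *: "\<And>I. I \<in> \<C> \<Longrightarrow> polyfun_ideal I \<and> J \<subseteq> I \<and> h \<notin> I"
      by (auto simp: \<A>_def subset.chain_def)
    have "(\<lambda>x. p x + q x) \<in> \<Union> \<C>" if "p \<in> \<Union> \<C>" "q \<in> \<Union> \<C>" for p q
    proof -
      obtain I I' where I: "I \<in> \<C>" "I' \<in> \<C>" "p \<in> I" "q \<in> I'" using \<open>p \<in> \<Union> \<C>\<close> \<open>q \<in> \<Union> \<C>\<close> by blast
      then consider "I \<subseteq> I'" | "I' \<subseteq> I" using C by (auto simp: subset.chain_def)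
      then obtain I'' where "I'' \<in> \<C>" "p \<in> I''" "q \<in> I''" using I by cases blast+
      then show ?thesis using fun_idealD(2)[of "Collect polyfun" I'' p q] * by blast
    qed
    moreover have "(\<lambda>x. a x * p x) \<in> \<Union> \<C>" if "polyfun a" "p \<in> \<Union> \<C>" for a p
      using that fun_idealD(3)[of "Collect polyfun" _ a p] * by blast
    moreover have "p \<in> Collect polyfun" if "p \<in> \<Union> \<C>" for p
      using that fun_idealD(4)[of "Collect polyfun" _ p] * by blast
    moreover have "(\<lambda>x. 0) \<in> \<Union> \<C>"
      using C(1) fun_idealD(1)[of "Collect polyfun"] * by blast
    ultimately have "polyfun_ideal (\<Union> \<C>)" unfolding fun_ideal_def by blast
    then show "\<Union> \<C> \<in> \<A>" using * C(1) by (auto simp: \<A>_def)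
  qed
  then obtain M where M: "polyfun_ideal M" "J \<subseteq> M" "h \<notin> M"
    and max: "\<And>X. polyfun_ideal X \<Longrightarrow> J \<subseteq> X \<Longrightarrow> h \<notin> X \<Longrightarrow> M \<subseteq> X \<Longrightarrow> X = M"
    by (auto simp: \<A>_def)
  have M2: "(\<lambda>x. a x * p x) \<in> M" if "polyfun a" "p \<in> M" for a p using fun_idealD(3)[OF M(1)] that by auto
  have max': "\<exists>j a. j \<in> M \<and> polyfun a \<and> h = (\<lambda>x. j x + a x * g x)" if "polyfun g" "g \<notin> M" for g
  proof -
    let ?K = "{\<lambda>x. j x + a x * g x | j a. j \<in> M \<and> polyfun a}"
    have "h \<in> ?K"
      using max[of ?K] polyfun_ideal_add_principal[OF M(1) that(1)] M(2) that(2) by blast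
    then show ?thesis by blast
  qed
  have "\<forall>i. \<exists>c. (\<lambda>x. (x $ i - c) * h x) \<in> M"
    using maximal_colon_has_point[OF M(1,3) max' h] by blast
  then obtain p' where p': "\<And>i. (\<lambda>x. (x $ i - p' i) * h x) \<in> M" by metis
  define p :: "complex ^ 'n" where "p = (\<chi> i. p' i)"
  have p: "(\<lambda>x. (x $ i - p $ i) * h x) \<in> M" for i using p' by (simp add: p_def)
  \<comment> \<open>The ideals \<open>Q k = (M : (x\<^sub>i - p\<^sub>i) ^ k)\<close> are stationary from some \<open>N\<close> on. If \<open>(x\<^sub>i - p\<^sub>i) ^ N\<close> were not in \<open>M\<close>, then
    \<open>h = j + a (x\<^sub>i - p\<^sub>i) ^ N\<close> with \<open>j \<in> M\<close>, and \<open>(x\<^sub>i - p\<^sub>i) h \<in> M\<close> would give \<open>a \<in> Q (N + 1) = Q N\<close>, hence \<open>h \<in> M\<close>.\<close>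
  have "\<exists>k. (\<lambda>x. (x $ i - p $ i) ^ k) \<in> M" for i
  proof -
    define Q where "Q k = {g. polyfun g \<and> (\<lambda>x. (x $ i - p $ i) ^ k * g x) \<in> M}" for k
    have "polyfun_ideal (Q k)" for k
      using fun_idealD(1,2)[OF M(1)] M2
      by (auto simp: fun_ideal_def Q_def distrib_left mult.left_commute intro: polyfun_intros)
    moreover have "Q k \<subseteq> Q (Suc k)" for k
    proof
      fix g assume "g \<in> Q k"
      moreover have "polyfun (\<lambda>x. x $ i - p $ i)" by (intro polyfun_intros)
      ultimately show "g \<in> Q (Suc k)" using M2[of "\<lambda>x. x $ i - p $ i" "\<lambda>x. (x $ i - p $ i) ^ k * g x"]
        by (simp add: Q_def mult.assoc)
    qed
    ultimately obtain N where N: "\<And>k. k \<ge> N \<Longrightarrow> Q k = Q N"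
      using noetherian_polyfun unfolding noetherian_funs_def by metis
    show ?thesis
    proof (rule ccontr)
      assume "\<not> ?thesis"
      moreover have "polyfun (\<lambda>x. (x $ i - p $ i) ^ N)" by (intro polyfun_intros)
      ultimately obtain j a where ja: "j \<in> M" "polyfun a" "h = (\<lambda>x. j x + a x * (x $ i - p $ i) ^ N)"
        using max' by meson
      have "(\<lambda>x. (x $ i - p $ i) * h x) \<in> M" using p .
      moreover have "(\<lambda>x. (x $ i - p $ i) * j x) \<in> M" using ja by (intro M2 polyfun_intros)
      ultimately have "(\<lambda>x. (x $ i - p $ i) * h x - (x $ i - p $ i) * j x) \<in> M"
        by (rule fun_ideal_diff[OF fun_subring_polyfun M(1)])
      then have "a \<in> Q (Suc N)" unfolding Q_def using ja(2) by (simp add: ja(3) algebra_simps)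
      then have "a \<in> Q N" using N[of "Suc N"] by simp
      then have "(\<lambda>x. (x $ i - p $ i) ^ N * a x) \<in> M" by (simp add: Q_def)
      from fun_idealD(2)[OF M(1) ja(1) this] have "h \<in> M" by (subst ja(3)) (simp add: mult.commute)
      then show False using M(3) by blast
    qed
  qed
  then obtain k where k: "\<And>i. (\<lambda>x. (x $ i - p $ i) ^ k i) \<in> M" by metis
  define K where "K = (\<Sum>i\<in>UNIV. k i)"
  obtain j where j: "j \<in> J" "vanishes_to_order K p UNIV (\<lambda>x. h x - j x)" using local by blast
  have "polyfun j" using fun_idealD(4)[OF J j(1)] by simp
  then have "polyfun (\<lambda>x. h x - j x)" using h by (intro polyfun_intros)
  from vanishing_order_expansion[OF this j(2)] obtain N c where
    c: "\<And>x. h x - j x = (\<Sum>\<alpha> | \<alpha> \<in> expo_box N \<and> K \<le> (\<Sum>i\<in>UNIV. \<alpha> i). c \<alpha> * monomial \<alpha> (x - p))" by blast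
  have "(\<lambda>x. c \<alpha> * monomial \<alpha> (x - p)) \<in> M" if "K \<le> (\<Sum>i\<in>UNIV. \<alpha> i)" for \<alpha>
  proof -
    have "\<exists>i. k i \<le> \<alpha> i"
    proof (rule ccontr)
      assume "\<not> ?thesis"
      then have "(\<Sum>i\<in>UNIV. \<alpha> i) < K" unfolding K_def by (intro sum_strict_mono) (auto simp: not_le)
      then show False using that by simp
    qed
    then obtain i where i: "k i \<le> \<alpha> i" by blast
    have "(\<lambda>x. c \<alpha> * monomial \<alpha> (x - p)) = (\<lambda>x. (c \<alpha> * (x $ i - p $ i) ^ (\<alpha> i - k i) * (\<Prod>j\<in>-{i}. (x $ j - p $ j) ^ \<alpha> j)) * (x $ i - p $ i) ^ k i)"
    proof
      fix x
      have "monomial \<alpha> (x - p) = (\<Prod>j\<in>insert i (-{i}). (x $ j - p $ j) ^ \<alpha> j)"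
        unfolding monomial_def by (intro prod.cong) auto
      also have "\<dots> = (x $ i - p $ i) ^ \<alpha> i * (\<Prod>j\<in>-{i}. (x $ j - p $ j) ^ \<alpha> j)" by simp
      also have "(x $ i - p $ i) ^ \<alpha> i = (x $ i - p $ i) ^ (\<alpha> i - k i) * (x $ i - p $ i) ^ k i"
        using i by (simp flip: power_add)
      finally show "c \<alpha> * monomial \<alpha> (x - p) = (c \<alpha> * (x $ i - p $ i) ^ (\<alpha> i - k i) * (\<Prod>j\<in>-{i}. (x $ j - p $ j) ^ \<alpha> j)) * (x $ i - p $ i) ^ k i"
        by simp
    qed
    also have "\<dots> \<in> M" by (intro M2 k polyfun_intros)
    finally show ?thesis .
  qed
  then have "(\<lambda>x. h x - j x) \<in> M" unfolding c by (intro fun_ideal_sum[OF M(1)]) auto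
  moreover have "j \<in> M" using j M by blast
  ultimately have "(\<lambda>x. (h x - j x) + j x) \<in> M" by (rule fun_idealD(2)[OF M(1)])
  then show False using M(3) by simp
qed

text \<open>For \<open>g = 1 - j / j p\<close> the function \<open>1 - g ^ k\<close> is a multiple of \<open>j\<close>, and \<open>g ^ k\<close> vanishes to order \<open>k\<close>.\<close>

lemma vanishes_to_order_unit:
  assumes J: "polyfun_ideal J" and j: "j \<in> J" "j p \<noteq> 0"
  shows "\<exists>i\<in>J. vanishes_to_order k p UNIV (\<lambda>x. 1 - i x)"
proof -
  define g where "g x = 1 - j x / j p" for x
  have pj: "polyfun j" using fun_idealD(4)[OF J j(1)] by simp
  have pg: "polyfun g" unfolding g_def[abs_def] divide_inverse by (intro polyfun_intros pj)
  have "(\<lambda>x. 1 - g x ^ k) \<in> J"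
  proof (induction k)
    case 0
    show ?case using fun_idealD(1)[OF J] by simp
  next
    case (Suc k)
    have "(\<lambda>x. (g x ^ k / j p) * j x) \<in> J"
      unfolding divide_inverse by (intro fun_idealD(3)[OF J] j CollectI polyfun_intros pg)
    from fun_idealD(2)[OF J Suc this] have "(\<lambda>x. 1 - g x ^ k + g x ^ k / j p * j x) \<in> J" .
    also have "(\<lambda>x. 1 - g x ^ k + g x ^ k / j p * j x) = (\<lambda>x. 1 - g x ^ Suc k)"
      by (auto simp: g_def field_simps)
    finally show ?case .
  qed
  moreover have "vanishes_to_order (k * 1) p UNIV (\<lambda>x. g x ^ k)"
    by (intro vanishes_to_order_power vanishes_to_order_1 pg) (simp add: g_def j)
  ultimately show ?thesis by (intro bexI[of _ "\<lambda>x. 1 - g x ^ k"]) auto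
qed

text \<open>Where some element of the ideal does not vanish, the ideal approximates \<open>1\<close> to every order.\<close>

corollary weak_nullstellensatz:
  assumes J: "polyfun_ideal J" and "\<And>p. \<exists>j\<in>J. j p \<noteq> 0"
  shows "(\<lambda>x. 1) \<in> J"
proof (rule local_ideal_membership[OF J polyfun.const])
  fix p k
  obtain j where "j \<in> J" "j p \<noteq> 0" using assms(2) by blast
  then show "\<exists>i\<in>J. vanishes_to_order k p UNIV (\<lambda>x. 1 - i x)" by (rule vanishes_to_order_unit[OF J])
qed

section \<open>Local inverses of polynomial maps\<close>

text \<open>The adjugate matrix applied to \<open>b\<close>, by Cramer's rule; its entries are polynomial in those of \<open>A\<close> and \<open>b\<close>.\<close>

definition adj_vec :: "complex ^ 'n ^ 'n \<Rightarrow> complex ^ 'n \<Rightarrow> complex ^ 'n" where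
  "adj_vec A b = (\<chi> k. det (\<chi> i j. if j = k then b $ i else A $ i $ j))"

lemma solve_adj_vec:
  assumes "det A \<noteq> 0"
  shows "A *v x = b \<longleftrightarrow> x = inverse (det A) *s adj_vec A b"
  unfolding cramer[OF assms] by (auto simp: adj_vec_def vec_eq_iff field_simps)

lemma polyfun_det:
  assumes "\<And>i j. polyfun (\<lambda>x. A x $ i $ j)"
  shows "polyfun (\<lambda>x. det (A x))"
  unfolding det_def using assms by (intro polyfun_intros)

lemma polyfun_adj_vec:
  assumes "\<And>i j. polyfun (\<lambda>x. A x $ i $ j)" "\<And>i. polyfun (\<lambda>x. b x $ i)"
  shows "polyfun (\<lambda>x. adj_vec (A x) (b x) $ k)"
proof -
  have "polyfun (\<lambda>x. det (\<chi> i j. if j = k then b x $ i else A x $ i $ j))"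
  proof (rule polyfun_det)
    show "polyfun (\<lambda>x. (\<chi> i j. if j = k then b x $ i else A x $ i $ j) $ i $ j)" for i j
      using assms by (cases "j = k") auto
  qed
  then show ?thesis by (simp add: adj_vec_def)
qed

lemma polyfun_jac: "polymap G \<Longrightarrow> polyfun (\<lambda>x. jac_matrix G x $ i $ j)"
  by (simp add: jac_matrix_def ext_d_def polymap_def polyfun_partial)

lemma polyfun_det_jac: "polymap G \<Longrightarrow> polyfun (\<lambda>x. det (jac_matrix G x))"
  by (intro polyfun_det polyfun_jac)

lemma bounded_linear_matrix_vector: "bounded_linear ((*v) (A :: complex ^ 'n ^ 'm))"
proof (rule bounded_linear_intro)
  show "norm (A *v x) \<le> norm x * (\<Sum>i\<in>UNIV. \<Sum>j\<in>UNIV. norm (A $ i $ j))" for x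
  proof -
    have "norm (A *v x) \<le> (\<Sum>i\<in>UNIV. norm ((A *v x) $ i))" by (simp add: norm_vec_def L2_set_le_sum)
    also have "\<dots> \<le> (\<Sum>i\<in>UNIV. \<Sum>j\<in>UNIV. norm (A $ i $ j) * norm x)"
      unfolding matrix_vector_mult_def
      by (auto intro!: sum_mono order_trans[OF norm_sum] mult_left_mono Finite_Cartesian_Product.norm_nth_le simp: norm_mult)
    finally show ?thesis by (simp add: sum_distrib_left sum_distrib_right mult.commute)
  qed
qed (auto simp: matrix_vector_mult_def vec_eq_iff sum.distrib algebra_simps scaleR_sum_right)

text \<open>The inverse function theorem. Cramer's rule writes the derivative of the inverse as a polynomial expression divided by the
Jacobian determinant, which is the form in which its growth can be estimated.\<close>

lemma polymap_local_inverse: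
  fixes G :: "complex ^ 'n \<Rightarrow> complex ^ 'n"
  assumes G: "polymap G" and p: "det (jac_matrix G p) \<noteq> 0"
  obtains U V g where "open U" "p \<in> U" "open V" "G p \<in> V" "homeomorphism U V G g"
    "\<And>x. x \<in> U \<Longrightarrow> det (jac_matrix G x) \<noteq> 0"
    "\<And>y. y \<in> V \<Longrightarrow> (g has_derivative
        (\<lambda>h. inverse (det (jac_matrix G (g y))) *s adj_vec (jac_matrix G (g y)) h)) (at y)"
proof -
  define U0 where "U0 = {x. det (jac_matrix G x) \<noteq> 0}"
  have "open U0"
    using open_Collect_neq[OF polyfun_continuous_on[OF polyfun_det_jac[OF G]] continuous_on_const[of _ 0]]
    by (simp add: U0_def)
  define f' where "f' x = Blinfun ((*v) (jac_matrix G x))" for x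
  have f': "blinfun_apply (f' x) = (*v) (jac_matrix G x)" for x
    unfolding f'_def by (rule bounded_linear_Blinfun_apply[OF bounded_linear_matrix_vector])
  have cont: "continuous_on U0 f'"
  proof (rule continuous_on_blinfun_componentwise)
    fix b :: "complex ^ 'n"
    have "polyfun (\<lambda>x. (jac_matrix G x *v b) $ i)" for i
      unfolding matrix_vector_mult_def by (simp, intro polyfun_intros polyfun_jac G)
    then have "polymap (\<lambda>x. jac_matrix G x *v b)" by (simp add: polymap_def)
    then show "continuous_on U0 (\<lambda>x. blinfun_apply (f' x) b)"
      unfolding f' by (rule polymap_continuous_on)
  qed
  obtain B where B: "jac_matrix G p ** B = mat 1" "B ** jac_matrix G p = mat 1"
    using p unfolding invertible_det_nz[symmetric] invertible_def by blast
  have inv: "Blinfun ((*v) B) o\<^sub>L f' p = id_blinfun"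
    by (rule blinfun_eqI) (simp add: f' bounded_linear_Blinfun_apply[OF bounded_linear_matrix_vector]
        matrix_vector_mul_assoc B)
  have der: "(G has_derivative blinfun_apply (f' x)) (at x)" for x
    unfolding f' using polymap_has_derivative[OF G] .
  have "p \<in> U0" using p by (simp add: U0_def)
  obtain U V g g' where *: "open U" "U \<subseteq> U0" "p \<in> U" "open V" "G p \<in> V" "homeomorphism U V G g"
    "\<And>y. y \<in> V \<Longrightarrow> (g has_derivative (g' y)) (at y)"
    "\<And>y. y \<in> V \<Longrightarrow> g' y = inv_into UNIV (blinfun_apply (f' (g y)))"
    "\<And>y. y \<in> V \<Longrightarrow> bij (blinfun_apply (f' (g y)))"
    using inverse_function_theorem[OF \<open>open U0\<close> der cont \<open>p \<in> U0\<close> inv] by metis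
  have "g' y = (\<lambda>h. inverse (det (jac_matrix G (g y))) *s adj_vec (jac_matrix G (g y)) h)" if "y \<in> V" for y
  proof
    fix h
    have "g y \<in> U" using *(6) that by (auto simp: homeomorphism_def)
    then have nz: "det (jac_matrix G (g y)) \<noteq> 0" using *(2) by (auto simp: U0_def)
    have "jac_matrix G (g y) *v (g' y h) = h"
      using *(9)[OF that] unfolding *(8)[OF that] f' by (metis bij_inv_eq_iff)
    then show "g' y h = inverse (det (jac_matrix G (g y))) *s adj_vec (jac_matrix G (g y)) h"
      using solve_adj_vec[OF nz] by blast
  qed
  then show ?thesis using * that[of U V g] unfolding U0_def by auto
qed

text \<open>The derivative of \<open>g\<close> minus its linear part at \<open>p\<close> is of size \<open>O(\<rho>)\<close> on the ball of radius \<open>\<rho>\<close>, and the mean value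
inequality applies.\<close>

lemma polyfun_first_order:
  fixes g :: "complex ^ 'n \<Rightarrow> complex"
  assumes "polyfun g"
  shows "\<exists>C\<ge>0. \<exists>r>0. \<forall>\<rho><r. \<forall>x\<in>cball p \<rho>. \<forall>y\<in>cball p \<rho>.
    norm (g y - g x - (\<Sum>i\<in>UNIV. partial i g p * (y - x) $ i)) \<le> C * \<rho> * norm (y - x)"
proof -
  have "\<forall>i. \<exists>C\<ge>0. \<forall>\<^sub>F x in nhds p. norm (partial i g x - partial i g p) \<le> C * norm (x - p)"
    using has_derivative_local_lipschitz[OF polyfun_has_derivative[OF polyfun_partial[OF assms]]] by blast
  then obtain C where C: "\<And>i. C i \<ge> 0"
    "\<And>i. \<forall>\<^sub>F x in nhds p. norm (partial i g x - partial i g p) \<le> C i * norm (x - p)" by metis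
  have "\<forall>\<^sub>F x in nhds p. \<forall>i. norm (partial i g x - partial i g p) \<le> C i * norm (x - p)"
    using C(2) by (simp add: eventually_all_finite)
  then obtain r where r: "r > 0" "\<And>x i. dist x p < r \<Longrightarrow> norm (partial i g x - partial i g p) \<le> C i * norm (x - p)"
    unfolding eventually_nhds_metric by blast
  define D where "D = (\<Sum>i\<in>UNIV. C i)"
  have "norm (g y - g x - (\<Sum>i\<in>UNIV. partial i g p * (y - x) $ i)) \<le> D * \<rho> * norm (y - x)"
    if "\<rho> < r" and xy: "x \<in> cball p \<rho>" "y \<in> cball p \<rho>" for \<rho> x y
  proof -
    define f where "f x = g x - (\<Sum>i\<in>UNIV. partial i g p * x $ i)" for x
    have "norm (f y - f x) \<le> (D * \<rho>) * norm (y - x)"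
    proof (rule differentiable_bound[of "cball p \<rho>" f "\<lambda>x h. \<Sum>i\<in>UNIV. (partial i g x - partial i g p) * h $ i"])
      show "(f has_derivative (\<lambda>h. \<Sum>i\<in>UNIV. (partial i g x - partial i g p) * h $ i)) (at x within cball p \<rho>)" for x
      proof -
        have "((\<lambda>x. \<Sum>i\<in>UNIV. partial i g p * x $ i) has_derivative (\<lambda>h. \<Sum>i\<in>UNIV. partial i g p * h $ i)) (at x)"
          by (intro bounded_linear_imp_has_derivative bounded_linear_sum bounded_linear_mult_right[THEN bounded_linear_compose] bounded_linear_vec_nth)
        from has_derivative_diff[OF polyfun_has_derivative[OF assms, of x] this]
        have "(f has_derivative (\<lambda>h. \<Sum>i\<in>UNIV. (partial i g x - partial i g p) * h $ i)) (at x)"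
          unfolding f_def by (simp add: left_diff_distrib sum_subtractf)
        then show ?thesis by (rule has_derivative_at_withinI)
      qed
      show "onorm (\<lambda>h. \<Sum>i\<in>UNIV. (partial i g x - partial i g p) * h $ i) \<le> D * \<rho>" if "x \<in> cball p \<rho>" for x
      proof (rule onorm_le)
        fix h :: "complex ^ 'n"
        have "norm (\<Sum>i\<in>UNIV. (partial i g x - partial i g p) * h $ i) \<le> (\<Sum>i\<in>UNIV. (C i * \<rho>) * norm h)"
        proof (intro order_trans[OF norm_sum] sum_mono)
          fix i
          have "norm (partial i g x - partial i g p) \<le> C i * norm (x - p)"
            using that \<open>\<rho> < r\<close> by (intro r(2)) (auto simp: dist_commute)
          also have "\<dots> \<le> C i * \<rho>" using that C(1) by (intro mult_left_mono) (auto simp: dist_norm norm_minus_commute)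
          finally show "norm ((partial i g x - partial i g p) * h $ i) \<le> (C i * \<rho>) * norm h"
            unfolding norm_mult by (intro mult_mono Finite_Cartesian_Product.norm_nth_le) (auto intro: order_trans[OF norm_ge_zero])
        qed
        then show "norm (\<Sum>i\<in>UNIV. (partial i g x - partial i g p) * h $ i) \<le> D * \<rho> * norm h"
          by (simp add: D_def sum_distrib_right)
      qed
    qed (use xy in auto)
    then show ?thesis by (simp add: f_def right_diff_distrib sum_subtractf algebra_simps)
  qed
  moreover have "D \<ge> 0" unfolding D_def by (intro sum_nonneg C)
  ultimately show ?thesis using r(1) by blast
qed

lemma polymap_first_order:
  fixes G :: "complex ^ 'n \<Rightarrow> complex ^ 'm"
  assumes "polymap G"
  shows "\<exists>C\<ge>0. \<exists>r>0. \<forall>\<rho><r. \<forall>x\<in>cball p \<rho>. \<forall>y\<in>cball p \<rho>.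
    norm (G y - G x - jac_matrix G p *v (y - x)) \<le> C * \<rho> * norm (y - x)"
proof -
  define Q where "Q j C r \<longleftrightarrow> (\<forall>\<rho><r. \<forall>x\<in>cball p \<rho>. \<forall>y\<in>cball p \<rho>.
    norm (G y $ j - G x $ j - (\<Sum>i\<in>UNIV. partial i (\<lambda>x. G x $ j) p * (y - x) $ i)) \<le> C * \<rho> * norm (y - x))"
    for j and C r :: real
  have "\<forall>j. \<exists>C r. C \<ge> 0 \<and> r > 0 \<and> Q j C r"
    using polyfun_first_order assms unfolding polymap_def Q_def by blast
  then obtain C r where Q: "\<And>j. C j \<ge> 0" "\<And>j. r j > 0" "\<And>j. Q j (C j) (r j)" by metis
  have C: "\<And>j. C j \<ge> 0" "\<And>j. r j > 0"
    "\<And>j \<rho> x y. \<rho> < r j \<Longrightarrow> x \<in> cball p \<rho> \<Longrightarrow> y \<in> cball p \<rho> \<Longrightarrow>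
      norm (G y $ j - G x $ j - (\<Sum>i\<in>UNIV. partial i (\<lambda>x. G x $ j) p * (y - x) $ i)) \<le> C j * \<rho> * norm (y - x)"
    using Q unfolding Q_def by blast+
  have "norm (G y - G x - jac_matrix G p *v (y - x)) \<le> (\<Sum>j\<in>UNIV. C j) * \<rho> * norm (y - x)"
    if "\<rho> < Min (range r)" "x \<in> cball p \<rho>" "y \<in> cball p \<rho>" for \<rho> x y
  proof -
    have "norm (G y - G x - jac_matrix G p *v (y - x)) \<le> (\<Sum>j\<in>UNIV. norm ((G y - G x - jac_matrix G p *v (y - x)) $ j))"
      by (simp add: norm_vec_def L2_set_le_sum)
    also have "\<dots> \<le> (\<Sum>j\<in>UNIV. C j * \<rho> * norm (y - x))"
    proof (rule sum_mono)
      fix j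
      have "\<rho> < r j" using that(1) by (auto simp: less_le_trans)
      from C(3)[OF this that(2,3)]
      show "norm ((G y - G x - jac_matrix G p *v (y - x)) $ j) \<le> C j * \<rho> * norm (y - x)"
        by (simp add: jac_matrix_def ext_d_def matrix_vector_mult_def)
    qed
    finally show ?thesis by (simp add: sum_distrib_right)
  qed
  moreover have "Min (range r) > 0" using C(2) by auto
  moreover have "(\<Sum>j\<in>UNIV. C j) \<ge> 0" by (intro sum_nonneg C)
  ultimately show ?thesis by blast
qed

lemma polymap_compose: "polymap G \<Longrightarrow> polymap H \<Longrightarrow> polymap (\<lambda>x. G (H x))"
  using polyfun_compose[of "\<lambda>x. G x $ _" H] by (simp add: polymap_def)

lemma polymap_matrix_vector: "polymap G \<Longrightarrow> polymap (\<lambda>x. A *v G x)"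
  by (auto simp: polymap_def matrix_vector_mult_def intro!: polyfun_intros)

lemma polymap_diff: "polymap G \<Longrightarrow> polymap H \<Longrightarrow> polymap (\<lambda>x. G x - H x)"
  by (auto simp: polymap_def intro!: polyfun_intros)

lemma polymap_id: "polymap (\<lambda>x. x)"
  by (auto simp: polymap_def intro!: polyfun_intros)

lemma polymap_const: "polymap (\<lambda>x. c)"
  by (auto simp: polymap_def intro!: polyfun_intros)

lemma isCont_tendsto_nhds: "isCont f x \<Longrightarrow> (f \<longlongrightarrow> f x) (nhds x)"
  unfolding isCont_def by (subst (asm) tendsto_at_iff_tendsto_nhds)

lemma polymap_tendsto: "polymap G \<Longrightarrow> (G \<longlongrightarrow> G p) (nhds p)"
  using polymap_has_derivative has_derivative_continuous isCont_tendsto_nhds by blast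

text \<open>Newton's iteration \<open>P' = P - B (G \<circ> P - id)\<close>, with \<open>B\<close> the inverse of the derivative at \<open>p\<close>, gains one order of
accuracy at each step and stays within the polynomial maps.\<close>

lemma approximate_polynomial_inverse:
  fixes G :: "complex ^ 'n \<Rightarrow> complex ^ 'n"
  assumes G: "polymap G" and p: "det (jac_matrix G p) \<noteq> 0"
  shows "\<exists>P C. polymap P \<and> C \<ge> 0 \<and> (\<forall>\<^sub>F x in nhds p. norm (P (G x) - x) \<le> C * norm (x - p) ^ Suc k)"
proof (induction k)
  case 0
  show ?case by (intro exI[of _ "\<lambda>_. p"] exI[of _ 1]) (auto simp: polymap_const norm_minus_commute)
next
  case (Suc k)
  then obtain P C where P: "polymap P" "C \<ge> 0"
    "\<forall>\<^sub>F x in nhds p. norm (P (G x) - x) \<le> C * norm (x - p) ^ Suc k" by blast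
  define A where "A = jac_matrix G p"
  obtain B where B: "B ** A = mat 1"
    using p unfolding A_def invertible_det_nz[symmetric] invertible_def by blast
  define P' where "P' s = P s - B *v (G (P s) - s)" for s
  have "polymap P'" unfolding P'_def[abs_def]
    by (intro polymap_diff polymap_matrix_vector polymap_compose[OF G] P(1) polymap_id)
  obtain D r where D: "D \<ge> 0" "r > 0" "\<And>\<rho> x y. \<rho> < r \<Longrightarrow> x \<in> cball p \<rho> \<Longrightarrow> y \<in> cball p \<rho> \<Longrightarrow>
    norm (G y - G x - A *v (y - x)) \<le> D * \<rho> * norm (y - x)"
    using polymap_first_order[OF G, of p] unfolding A_def by blast
  have K: "norm (B *v v) \<le> norm v * onorm ((*v) B)" for v
    using onorm[OF bounded_linear_matrix_vector, of B v] by (simp add: mult.commute)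
  have "\<forall>\<^sub>F x in nhds p. dist x p < min 1 (r / (2 + 2 * C))"
    unfolding eventually_nhds_metric
    using D(2) P(2) by (intro exI[of _ "min 1 (r / (2 + 2 * C))"]) auto
  from P(3) this
  have "\<forall>\<^sub>F x in nhds p. norm (P' (G x) - x) \<le> (onorm ((*v) B) * D * (1 + C) * C) * norm (x - p) ^ Suc (Suc k)"
  proof eventually_elim
    case (elim x)
    define x' where "x' = P (G x)"
    define t where "t = norm (x - p)"
    have t: "t \<ge> 0" "t \<le> 1" "t * (2 + 2 * C) < r"
      using elim P(2) by (auto simp: t_def dist_norm field_simps)
    have e: "norm (x' - x) \<le> C * t ^ Suc k" using elim by (simp add: x'_def t_def)
    also have "\<dots> \<le> C * t" using t P(2) by (intro mult_left_mono) (auto intro: mult_left_le power_le_one)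
    finally have e': "norm (x' - x) \<le> C * t" .
    define \<rho> where "\<rho> = (1 + C) * t"
    have "t \<le> \<rho>" using t P(2) by (simp add: \<rho>_def algebra_simps)
    then have "x \<in> cball p \<rho>" by (simp add: t_def dist_norm norm_minus_commute)
    moreover have "x' \<in> cball p \<rho>"
    proof -
      have "norm (x' - p) \<le> norm (x' - x) + norm (x - p)" using norm_triangle_ineq[of "x' - x" "x - p"] by simp
      then show ?thesis using e' by (simp add: \<rho>_def dist_norm norm_minus_commute t_def algebra_simps)
    qed
    moreover have "\<rho> < r"
    proof -
      have "0 \<le> t * (1 + C)" using t(1) P(2) by simp
      then show ?thesis using t(3) unfolding \<rho>_def by (simp add: algebra_simps)
    qed
    ultimately have *: "norm (G x' - G x - A *v (x' - x)) \<le> D * \<rho> * norm (x' - x)"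
      by (intro D)
    have "B *v (A *v v) = v" for v by (simp add: matrix_vector_mul_assoc B)
    then have "P' (G x) - x = - (B *v (G x' - G x - A *v (x' - x)))"
      by (simp add: P'_def x'_def matrix_vector_mult_diff_distrib)
    then have "norm (P' (G x) - x) \<le> (D * \<rho> * norm (x' - x)) * onorm ((*v) B)"
      using K[of "G x' - G x - A *v (x' - x)"] mult_right_mono[OF *, of "onorm ((*v) B)"]
        onorm_pos_le[OF bounded_linear_matrix_vector, of B] by simp
    also have "\<dots> \<le> (D * \<rho> * (C * t ^ Suc k)) * onorm ((*v) B)"
      using e D(1) \<open>t \<le> \<rho>\<close> t(1) by (intro mult_right_mono mult_left_mono onorm_pos_le bounded_linear_matrix_vector) auto
    also have "\<dots> = (onorm ((*v) B) * D * (1 + C) * C) * t ^ Suc (Suc k)" by (simp add: \<rho>_def)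
    finally show ?case by (simp add: t_def)
  qed
  moreover have "onorm ((*v) B) * D * (1 + C) * C \<ge> 0"
    using D(1) P(2) onorm_pos_le[OF bounded_linear_matrix_vector, of B] by simp
  ultimately show ?case using \<open>polymap P'\<close> by blast
qed

text \<open>Composing \<open>h\<close> with an approximate inverse of \<open>G\<close> expresses it by the coordinates \<open>G\<close> to any order.\<close>

lemma polyfun_approx_through_chart:
  fixes G :: "complex ^ 'n \<Rightarrow> complex ^ 'n"
  assumes G: "polymap G" and p: "det (jac_matrix G p) \<noteq> 0" and h: "polyfun h"
  shows "\<exists>g. polyfun g \<and> vanishes_to_order k p UNIV (\<lambda>x. h x - g (G x))"
proof -
  obtain P C where P: "polymap P" "C \<ge> 0" "\<forall>\<^sub>F x in nhds p. norm (P (G x) - x) \<le> C * norm (x - p) ^ Suc k"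
    using approximate_polynomial_inverse[OF G p] by blast
  define g where "g s = h (P s)" for s
  have g: "polyfun g" unfolding g_def[abs_def] by (rule polyfun_compose[OF h P(1)])
  obtain D r where D: "D \<ge> 0" "r > 0" "\<And>\<rho> x y. \<rho> < r \<Longrightarrow> x \<in> cball p \<rho> \<Longrightarrow> y \<in> cball p \<rho> \<Longrightarrow>
    norm (h y - h x - (\<Sum>i\<in>UNIV. partial i h p * (y - x) $ i)) \<le> D * \<rho> * norm (y - x)"
    using polyfun_first_order[OF h, of p] by blast
  define \<rho> where "\<rho> = r / 2"
  define L where "L = D * \<rho> + (\<Sum>i\<in>UNIV. norm (partial i h p))"
  have L: "norm (h y - h x) \<le> L * norm (y - x)" if "x \<in> cball p \<rho>" "y \<in> cball p \<rho>" for x y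
  proof -
    have "norm (\<Sum>i\<in>UNIV. partial i h p * (y - x) $ i) \<le> (\<Sum>i\<in>UNIV. norm (partial i h p) * norm (y - x))"
      by (intro order_trans[OF norm_sum] sum_mono) (auto simp only: norm_mult intro!: mult_left_mono Finite_Cartesian_Product.norm_nth_le norm_ge_zero)
    then show ?thesis using D(3)[OF _ that] D(2)
        norm_triangle_sub[of "h y - h x" "\<Sum>i\<in>UNIV. partial i h p * (y - x) $ i"]
      by (simp add: L_def \<rho>_def algebra_simps sum_distrib_left)
  qed
  have "L \<ge> 0" unfolding L_def \<rho>_def using D by (intro add_nonneg_nonneg sum_nonneg) auto
  have "((\<lambda>x. P (G x)) \<longlongrightarrow> P (G p)) (nhds p)"
    by (rule polymap_tendsto[OF polymap_compose[OF P(1) G]])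
  moreover have "P (G p) = p" using eventually_nhds_x_imp_x[OF P(3)] by simp
  ultimately have "\<forall>\<^sub>F x in nhds p. P (G x) \<in> cball p \<rho>"
    using D(2) by (intro topological_tendstoD[of _ p _ "ball p \<rho>", THEN eventually_mono]) (auto simp: \<rho>_def)
  moreover have "\<forall>\<^sub>F x in nhds p. x \<in> cball p \<rho>"
    using D(2) by (intro eventually_nhds_ball[of "\<rho>", THEN eventually_mono]) (auto simp: \<rho>_def dist_commute)
  moreover have "\<forall>\<^sub>F x in nhds p. x \<in> ball p 1" by (rule eventually_nhds_in_open) auto
  ultimately have "\<forall>\<^sub>F x in nhds p. norm (h x - g (G x)) \<le> L * C * norm (x - p) ^ k"
    using P(3)
  proof eventually_elim
    case (elim x)
    have "norm (h x - g (G x)) \<le> L * norm (P (G x) - x)"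
      using L[OF elim(1,2)] by (simp add: g_def norm_minus_commute)
    also have "\<dots> \<le> L * (C * norm (x - p) ^ Suc k)" using elim \<open>L \<ge> 0\<close> by (intro mult_left_mono) auto
    also have "\<dots> \<le> L * (C * norm (x - p) ^ k)"
      using elim \<open>L \<ge> 0\<close> P(2) by (intro mult_left_mono power_decreasing) (auto simp: dist_norm norm_minus_commute)
    finally show ?case by simp
  qed
  then have "vanishes_to_order k p UNIV (\<lambda>x. h x - g (G x))" unfolding vanishes_to_order_def by auto
  with g show ?thesis by blast
qed

definition slice_proj :: "'n set \<Rightarrow> complex ^ 'n \<Rightarrow> complex ^ 'n \<Rightarrow> complex ^ 'n" where
  "slice_proj E c s = (\<chi> i. if i \<in> E then c $ i else s $ i)"

lemma polymap_slice_proj: "polymap (slice_proj E c)"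
  unfolding polymap_def
proof
  show "polyfun (\<lambda>s. slice_proj E c s $ j)" for j
    by (cases "j \<in> E") (auto simp: slice_proj_def intro: polyfun_intros)
qed

text \<open>Hadamard's lemma for polynomials; products are treated by telescoping.\<close>

lemma polyfun_diff_slice:
  fixes g :: "complex ^ 'n \<Rightarrow> complex"
  assumes "polyfun g"
  shows "\<exists>d. (\<forall>i. polyfun (d i)) \<and> (\<forall>s. g s = g (slice_proj E c s) + (\<Sum>i\<in>E. (s $ i - c $ i) * d i s))"
  using assms
proof induction
  case (const a)
  show ?case by (intro exI[of _ "\<lambda>i s. 0"]) (auto intro: polyfun_intros)
next
  case (coord i)
  have "finite E" by simp
  then show ?case
    by (intro exI[of _ "\<lambda>j s. if j = i then 1 else 0"])
      (auto intro: polyfun_intros simp: slice_proj_def if_distrib[of "\<lambda>a. _ * a"] cong: if_cong)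
next
  case (add p r)
  then obtain d d' where d: "\<forall>i. polyfun (d i)" "\<forall>i. polyfun (d' i)"
    "\<And>s. p s = p (slice_proj E c s) + (\<Sum>i\<in>E. (s $ i - c $ i) * d i s)"
    "\<And>s. r s = r (slice_proj E c s) + (\<Sum>i\<in>E. (s $ i - c $ i) * d' i s)" by blast
  show ?case
  proof (intro exI[of _ "\<lambda>i s. d i s + d' i s"] conjI allI)
    show "polyfun (\<lambda>s. d i s + d' i s)" for i using d(1,2) by (auto intro: polyfun_intros)
    show "p s + r s = p (slice_proj E c s) + r (slice_proj E c s) + (\<Sum>i\<in>E. (s $ i - c $ i) * (d i s + d' i s))" for s
      by (subst d(3), subst d(4)) (simp add: distrib_left sum.distrib)
  qed
next
  case (mult p r)
  then obtain d d' where d: "\<forall>i. polyfun (d i)" "\<forall>i. polyfun (d' i)"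
    "\<And>s. p s = p (slice_proj E c s) + (\<Sum>i\<in>E. (s $ i - c $ i) * d i s)"
    "\<And>s. r s = r (slice_proj E c s) + (\<Sum>i\<in>E. (s $ i - c $ i) * d' i s)" by blast
  show ?case
  proof (intro exI[of _ "\<lambda>i s. d i s * r s + p (slice_proj E c s) * d' i s"] conjI allI)
    show "polyfun (\<lambda>s. d i s * r s + p (slice_proj E c s) * d' i s)" for i
      using d(1,2) mult.hyps by (auto intro!: polyfun_intros polyfun_compose[OF _ polymap_slice_proj])
    show "p s * r s = p (slice_proj E c s) * r (slice_proj E c s) +
        (\<Sum>i\<in>E. (s $ i - c $ i) * (d i s * r s + p (slice_proj E c s) * d' i s))" for s
    proof -
      have "(\<Sum>i\<in>E. (s $ i - c $ i) * (d i s * r s + p (slice_proj E c s) * d' i s)) =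
        (\<Sum>i\<in>E. (s $ i - c $ i) * d i s) * r s + p (slice_proj E c s) * (\<Sum>i\<in>E. (s $ i - c $ i) * d' i s)"
        by (simp add: distrib_left sum.distrib sum_distrib_left sum_distrib_right mult_ac)
      also have "\<dots> = (p s - p (slice_proj E c s)) * r s + p (slice_proj E c s) * (r s - r (slice_proj E c s))"
        using d(3)[of s] d(4)[of s] by simp
      finally show ?thesis by (simp add: algebra_simps)
    qed
  qed
qed

lemma norm_slice_proj_le: "norm (slice_proj E c s - c) \<le> norm (s - c)"
  unfolding norm_vec_def by (rule L2_set_mono) (auto simp: slice_proj_def)

text \<open>In the coordinates \<open>G\<close> the set is a coordinate slice. Write \<open>h\<close> as \<open>g \<circ> G\<close> to order \<open>k\<close> and apply Hadamard's lemma to \<open>g\<close>: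
the remaining term is the restriction of \<open>g\<close> to the slice, extended so as to be constant in the coordinates from \<open>E\<close>. It vanishes to order \<open>k\<close> on
the slice, and therefore everywhere, because the projection to the slice does not increase distances.\<close>

theorem vanishing_on_slice_preimage:
  fixes G :: "complex ^ 'n \<Rightarrow> complex ^ 'n"
  assumes G: "polymap G" and p: "det (jac_matrix G p) \<noteq> 0" and h: "polyfun h"
    and van: "vanishes_to_order k p {x. \<forall>i\<in>E. G x $ i = G p $ i} h"
  shows "\<exists>d. (\<forall>i. polyfun (d i)) \<and>
    vanishes_to_order k p UNIV (\<lambda>x. h x - (\<Sum>i\<in>E. (G x $ i - G p $ i) * d i x))"
proof -
  define X where "X = {x. \<forall>i\<in>E. G x $ i = G p $ i}"
  obtain g where g: "polyfun g" and van1: "vanishes_to_order k p UNIV (\<lambda>x. h x - g (G x))"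
    using polyfun_approx_through_chart[OF G p h] by blast
  obtain d where d: "\<And>i. polyfun (d i)"
    "\<And>s. g s = g (slice_proj E (G p) s) + (\<Sum>i\<in>E. (s $ i - G p $ i) * d i s)"
    using polyfun_diff_slice[OF g] by metis
  have van2: "vanishes_to_order k p UNIV (\<lambda>x. g (slice_proj E (G p) (G x)))"
  proof -
    obtain U V q where q: "open U" "p \<in> U" "open V" "G p \<in> V" "homeomorphism U V G q"
      "\<And>x. x \<in> U \<Longrightarrow> det (jac_matrix G x) \<noteq> 0"
      "\<And>y. y \<in> V \<Longrightarrow> (q has_derivative
        (\<lambda>h. inverse (det (jac_matrix G (q y))) *s adj_vec (jac_matrix G (q y)) h)) (at y)"
      using polymap_local_inverse[OF G p] by blast
    have qp: "q (G p) = p" using q by (auto simp: homeomorphism_def)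
    obtain A where A: "\<forall>\<^sub>F x in nhds p. x \<in> X \<longrightarrow> norm (h x) \<le> A * norm (x - p) ^ k"
      using van by (auto simp: vanishes_to_order_def X_def)
    obtain A' where A': "\<forall>\<^sub>F x in nhds p. norm (h x - g (G x)) \<le> A' * norm (x - p) ^ k"
      using van1 by (auto simp: vanishes_to_order_def)
    have gX: "\<forall>\<^sub>F x in nhds p. x \<in> X \<longrightarrow> norm (g (G x)) \<le> (max A 0 + max A' 0) * norm (x - p) ^ k"
      using A A'
    proof eventually_elim
      case (elim x)
      have "A * norm (x - p) ^ k \<le> max A 0 * norm (x - p) ^ k" "A' * norm (x - p) ^ k \<le> max A' 0 * norm (x - p) ^ k"
        by (intro mult_right_mono; simp)+
      then show ?case using elim norm_triangle_sub[of "g (G x)" "h x"] by (auto simp: norm_minus_commute algebra_simps)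
    qed
    obtain K where K: "K \<ge> 0" "\<forall>\<^sub>F y in nhds (G p). norm (q y - q (G p)) \<le> K * norm (y - G p)"
      using has_derivative_local_lipschitz[OF q(7)[OF q(4)]] by blast
    obtain K' where K': "K' \<ge> 0" "\<forall>\<^sub>F x in nhds p. norm (G x - G p) \<le> K' * norm (x - p)"
      using has_derivative_local_lipschitz[OF polymap_has_derivative[OF G]] by blast
    define B where "B = max A 0 + max A' 0"
    have t1: "((\<lambda>s. slice_proj E (G p) s) \<longlongrightarrow> G p) (nhds (G p))"
    proof (rule tendsto_dist_iff[THEN iffD2], rule tendsto_sandwich[of "\<lambda>_. 0" _ _ "\<lambda>s. norm (s - G p)"])
      show "((\<lambda>s. norm (s - G p)) \<longlongrightarrow> 0) (nhds (G p))"
        using tendsto_norm[OF tendsto_diff[OF filterlim_ident tendsto_const], of "G p" "G p"] by simp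
    qed (auto simp: dist_norm norm_slice_proj_le)
    have "(q \<longlongrightarrow> q (G p)) (nhds (G p))"
      by (rule isCont_tendsto_nhds[OF has_derivative_continuous[OF q(7)[OF q(4)]]])
    then have t2: "(q \<longlongrightarrow> p) (nhds (G p))" by (simp add: qp)
    have t3: "(G \<longlongrightarrow> G p) (nhds p)"
      by (rule polymap_tendsto[OF G])
    have E1: "\<forall>\<^sub>F s in nhds (G p). q s \<in> X \<longrightarrow> norm (g (G (q s))) \<le> B * norm (q s - p) ^ k"
      using gX t2 unfolding filterlim_iff B_def by blast
    have E2: "\<forall>\<^sub>F s in nhds (G p). s \<in> V" by (rule eventually_nhds_in_open[OF q(3,4)])
    have "\<forall>\<^sub>F s in nhds (G p). (\<forall>i\<in>E. s $ i = G p $ i) \<longrightarrow> norm (g s) \<le> (B * K ^ k) * norm (s - G p) ^ k"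
      using E1 E2 K(2)
    proof eventually_elim
      case (elim s)
      have Gq: "G (q s) = s" using elim q(5) by (auto simp: homeomorphism_def)
      show ?case
      proof
        assume "\<forall>i\<in>E. s $ i = G p $ i"
        then have "q s \<in> X" by (simp add: X_def Gq)
        then have "norm (g s) \<le> B * norm (q s - p) ^ k" using elim Gq by simp
        also have "\<dots> \<le> B * (K * norm (s - G p)) ^ k"
          using elim by (intro mult_left_mono power_mono) (auto simp: qp B_def)
        finally show "norm (g s) \<le> (B * K ^ k) * norm (s - G p) ^ k" by (simp add: power_mult_distrib)
      qed
    qed
    then have "\<forall>\<^sub>F s in nhds (G p). (\<forall>i\<in>E. slice_proj E (G p) s $ i = G p $ i) \<longrightarrow>
       norm (g (slice_proj E (G p) s)) \<le> (B * K ^ k) * norm (slice_proj E (G p) s - G p) ^ k"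
      using t1 unfolding filterlim_iff by blast
    then have "\<forall>\<^sub>F s in nhds (G p). norm (g (slice_proj E (G p) s)) \<le> (B * K ^ k) * norm (s - G p) ^ k"
    proof eventually_elim
      case (elim s)
      then have "norm (g (slice_proj E (G p) s)) \<le> (B * K ^ k) * norm (slice_proj E (G p) s - G p) ^ k"
        by (simp add: slice_proj_def)
      also have "\<dots> \<le> (B * K ^ k) * norm (s - G p) ^ k"
        using K(1) by (intro mult_left_mono power_mono norm_slice_proj_le) (auto simp: B_def)
      finally show ?case .
    qed
    then have "\<forall>\<^sub>F x in nhds p. norm (g (slice_proj E (G p) (G x))) \<le> (B * K ^ k) * norm (G x - G p) ^ k"
      using t3 unfolding filterlim_iff by blast
    then have "\<forall>\<^sub>F x in nhds p. norm (g (slice_proj E (G p) (G x))) \<le> (B * K ^ k * K' ^ k) * norm (x - p) ^ k"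
      using K'(2)
    proof eventually_elim
      case (elim x)
      have "(B * K ^ k) * norm (G x - G p) ^ k \<le> (B * K ^ k) * (K' * norm (x - p)) ^ k"
        using elim K(1) by (intro mult_left_mono power_mono) (auto simp: B_def)
      then show ?case using elim by (simp add: power_mult_distrib mult_ac)
    qed
    then show ?thesis unfolding vanishes_to_order_def by auto
  qed
  have eq: "(\<lambda>x. h x - (\<Sum>i\<in>E. (G x $ i - G p $ i) * d i (G x))) =
    (\<lambda>x. (h x - g (G x)) + g (slice_proj E (G p) (G x)))"
  proof
    show "h x - (\<Sum>i\<in>E. (G x $ i - G p $ i) * d i (G x)) = (h x - g (G x)) + g (slice_proj E (G p) (G x))" for x
      using d(2)[of "G x"] by simp
  qed
  show ?thesis
  proof (intro exI[of _ "\<lambda>i x. d i (G x)"] conjI allI)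
    show "vanishes_to_order k p UNIV (\<lambda>x. h x - (\<Sum>i\<in>E. (G x $ i - G p $ i) * d i (G x)))"
      unfolding eq by (rule vanishes_to_order_add[OF van1 van2])
  qed (rule polyfun_compose[OF d(1) G])
qed

section \<open>Primitives of 1-forms\<close>

definition form_integrand :: "'n form \<Rightarrow> (real \<Rightarrow> complex ^ 'n) \<Rightarrow> real \<Rightarrow> complex" where
  "form_integrand \<omega> \<gamma> t = (\<Sum>i\<in>UNIV. \<omega> (\<gamma> t) $ i * vector_derivative \<gamma> (at t within {0..1}) $ i)"

lemma has_form_integral_alt: "has_form_integral \<omega> I \<gamma> \<longleftrightarrow> (form_integrand \<omega> \<gamma> has_integral I) {0..1}"
  by (simp add: has_form_integral_def form_integrand_def[abs_def])

text \<open>Substitution in an affine reparametrisation; the sign of the slope accounts for the orientation. Reversed paths and the two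
halves of a joined path are the cases of interest.\<close>

lemma form_integral_affine:
  fixes g \<gamma> :: "real \<Rightarrow> complex ^ 'n"
  assumes g: "valid_path g" and n: "n \<noteq> 0"
    and img: "{a..b} = (\<lambda>x. n * x + d) ` {0..1}" and sub: "{a..b} \<subseteq> {0..1}"
    and eq: "\<And>x. x \<in> {0<..<1} \<Longrightarrow> \<gamma> (n * x + d) = g x"
    and I: "(form_integrand \<omega> \<gamma> has_integral I) {a..b}"
  shows "has_form_integral \<omega> (of_real (sgn n) * I) g"
proof -
  obtain S where S: "finite S" "\<And>x. x \<in> {0..1} - S \<Longrightarrow> g differentiable (at x)"
    using g by (auto simp: valid_path_def piecewise_C1_differentiable_on_def C1_differentiable_on_eq)
  have img': "(\<lambda>x. (1 / n) *\<^sub>R x + - ((1 / n) *\<^sub>R d)) ` cbox a b = {0..1}"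
    unfolding cbox_interval img image_image using n by (simp add: field_simps)
  have "((\<lambda>x. form_integrand \<omega> \<gamma> (n *\<^sub>R x + d)) has_integral (1 / \<bar>n\<bar> ^ DIM(real)) *\<^sub>R I) {0..1}"
    using has_integral_affinity[of "form_integrand \<omega> \<gamma>" I a b n d] I n unfolding img' by simp
  then have "((\<lambda>x. of_real n * form_integrand \<omega> \<gamma> (n * x + d)) has_integral of_real n * ((1 / \<bar>n\<bar>) *\<^sub>R I)) {0..1}"
    by (intro has_integral_mult_right) simp
  moreover have "of_real n * ((1 / \<bar>n\<bar>) *\<^sub>R I) = of_real (sgn n) * I"
    by (simp add: scaleR_conv_of_real sgn_if divide_simps split: if_splits)
  ultimately have *: "((\<lambda>x. of_real n * form_integrand \<omega> \<gamma> (n * x + d)) has_integral of_real (sgn n) * I) {0..1}"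
    by simp
  have "form_integrand \<omega> g x = of_real n * form_integrand \<omega> \<gamma> (n * x + d)" if x: "x \<in> {0..1} - (S \<union> {0, 1})" for x
  proof -
    obtain D where D: "(g has_vector_derivative D) (at x)"
      using S(2)[of x] x by (auto simp: vector_derivative_works)
    have x01: "x \<in> {0<..<1}" using x by auto
    let ?t = "n * x + d"
    have "?t \<in> {a..b}" unfolding img by (rule imageI) (use x in auto)
    then have t: "?t \<in> {0..1}" using sub by blast
    have "((\<lambda>s. (s - d) / n) has_vector_derivative (1 / n)) (at ?t)"
      using n by (auto intro!: derivative_eq_intros simp: has_real_derivative_iff_has_vector_derivative[symmetric])
    moreover have "(g has_vector_derivative D) (at ((?t - d) / n))" using D n by simp
    ultimately have "(g \<circ> (\<lambda>s. (s - d) / n) has_vector_derivative (1 / n) *\<^sub>R D) (at ?t)"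
      by (rule vector_diff_chain_at)
    then have "(\<gamma> has_vector_derivative (1 / n) *\<^sub>R D) (at ?t)"
    proof (rule has_vector_derivative_transform_within_open)
      show "open ((\<lambda>s. (s - d) / n) -` {0<..<1})"
        by (intro open_vimage) (use n in \<open>auto intro!: continuous_intros\<close>)
      show "?t \<in> (\<lambda>s. (s - d) / n) -` {0<..<1}" using n x01 by simp
      show "(g \<circ> (\<lambda>s. (s - d) / n)) s = \<gamma> s" if "s \<in> (\<lambda>s. (s - d) / n) -` {0<..<1}" for s
        using that eq[of "(s - d) / n"] n by simp
    qed
    then have v1: "vector_derivative \<gamma> (at ?t within {0..1}) = (1 / n) *\<^sub>R D"
      using t by (intro vector_derivative_at_within_ivl) auto
    have v2: "vector_derivative g (at x within {0..1}) = D"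
      using x by (intro vector_derivative_at_within_ivl[OF D]) auto
    show ?thesis using n unfolding form_integrand_def v1 v2 eq[OF x01]
      unfolding sum_distrib_left vector_scaleR_component by (intro sum.cong) (simp_all add: scaleR_conv_of_real)
  qed
  then show ?thesis unfolding has_form_integral_alt
    using S(1) by (intro has_integral_spike_finite[OF _ _ *, of "S \<union> {0, 1}"]) simp_all
qed

lemma form_integral_reversepath:
  assumes "valid_path g" "has_form_integral \<omega> I g"
  shows "has_form_integral \<omega> (- I) (reversepath g)"
proof -
  have "{0..1} = (\<lambda>x::real. - 1 * x + 1) ` {0..1}"
    by (auto simp: image_iff intro!: bexI[of _ "1 - _"])
  from form_integral_affine[OF _ _ this, of "reversepath g" g \<omega> I] assms
  show ?thesis
    by (simp add: has_form_integral_alt) (simp add: reversepath_def)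
qed

lemma form_integral_join_split:
  assumes "valid_path g1" "valid_path g2" "pathfinish g1 = pathstart g2" "has_form_integral \<omega> I (g1 +++ g2)"
  shows "\<exists>I1 I2. has_form_integral \<omega> I1 g1 \<and> has_form_integral \<omega> I2 g2 \<and> I = I1 + I2"
proof -
  let ?f = "form_integrand \<omega> (g1 +++ g2)"
  have f: "(?f has_integral I) {0..1}" using assms(4) by (simp add: has_form_integral_alt)
  then have int: "?f integrable_on {0..1}" by blast
  then have "?f integrable_on {0..1/2}" "?f integrable_on {1/2..1}"
    by (auto elim!: integrable_on_subinterval)
  then obtain I1 I2 where I: "(?f has_integral I1) {0..1/2}" "(?f has_integral I2) {1/2..1}" by blast
  have "I = I1 + I2" using has_integral_combine[OF _ _ I] f by (auto dest: has_integral_unique)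
  moreover have "has_form_integral \<omega> I1 g1"
  proof -
    have "{0..1/2} = (\<lambda>x::real. 1/2 * x + 0) ` {0..1}" by (auto simp: image_iff intro!: bexI[of _ "2 * _"])
    from form_integral_affine[OF assms(1) _ this _ _ I(1)] show ?thesis by (simp add: joinpaths_def)
  qed
  moreover have "has_form_integral \<omega> I2 g2"
  proof -
    have "x \<in> (\<lambda>x::real. 1/2 * x + 1/2) ` {0..1}" if "x \<in> {1/2..1}" for x
      using that by (intro image_eqI[of _ _ "2 * x - 1"]) (auto simp: field_simps)
    then have "{1/2..1} = (\<lambda>x::real. 1/2 * x + 1/2) ` {0..1}" by auto
    from form_integral_affine[OF assms(2) _ this _ _ I(2)] show ?thesis by (auto simp: joinpaths_def field_simps)
  qed
  ultimately show ?thesis by blast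
qed

text \<open>Primitives are characterised by path integrals rather than derivatives, which makes sense on sets without interior such as fibres.\<close>

definition primitive_on :: "(complex ^ 'n) set \<Rightarrow> 'n form \<Rightarrow> (complex ^ 'n \<Rightarrow> complex) \<Rightarrow> bool" where
  "primitive_on X \<omega> R \<longleftrightarrow> (\<forall>\<gamma>. valid_path \<gamma> \<and> path_image \<gamma> \<subseteq> X \<longrightarrow>
     has_form_integral \<omega> (R (pathfinish \<gamma>) - R (pathstart \<gamma>)) \<gamma>)"

lemma has_form_integral_unique:
  "has_form_integral \<omega> I \<gamma> \<Longrightarrow> has_form_integral \<omega> I' \<gamma> \<Longrightarrow> I = I'"
  unfolding has_form_integral_alt by (rule has_integral_unique)

text \<open>In each path component choose a base point \<open>rep x\<close>, and for each \<open>x\<close> a path \<open>p x\<close> from it to \<open>x\<close>. The integral along a path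
from \<open>x\<close> to \<open>y\<close> is found from the loop that follows \<open>p x\<close>, the path, and \<open>p y\<close> backwards.\<close>

theorem primitive_on_exists:
  fixes X :: "(complex ^ 'n) set"
  assumes loops: "\<And>\<gamma>. valid_path \<gamma> \<Longrightarrow> pathfinish \<gamma> = pathstart \<gamma> \<Longrightarrow> path_image \<gamma> \<subseteq> X \<Longrightarrow> has_form_integral \<omega> 0 \<gamma>"
  shows "\<exists>R. primitive_on X \<omega> R"
proof -
  define conn where "conn x y \<longleftrightarrow> (\<exists>\<gamma>. valid_path \<gamma> \<and> path_image \<gamma> \<subseteq> X \<and> pathstart \<gamma> = x \<and> pathfinish \<gamma> = y)" for x y
  have refl: "conn x x" if "x \<in> X" for x
    unfolding conn_def by (rule exI[of _ "linepath x x"]) (use that in auto)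
  have sym: "conn y x" if "conn x y" for x y
  proof -
    from that obtain \<gamma> where "valid_path \<gamma>" "path_image \<gamma> \<subseteq> X" "pathstart \<gamma> = x" "pathfinish \<gamma> = y"
      unfolding conn_def by blast
    then show ?thesis unfolding conn_def
      by (intro exI[of _ "reversepath \<gamma>"]) (auto simp: valid_path_imp_reverse)
  qed
  have trans: "conn x z" if "conn x y" "conn y z" for x y z
  proof -
    from that obtain \<gamma> \<gamma>' where "valid_path \<gamma>" "path_image \<gamma> \<subseteq> X" "pathstart \<gamma> = x" "pathfinish \<gamma> = y"
      "valid_path \<gamma>'" "path_image \<gamma>' \<subseteq> X" "pathstart \<gamma>' = y" "pathfinish \<gamma>' = z"
      unfolding conn_def by blast
    then show ?thesis unfolding conn_def
      by (intro exI[of _ "\<gamma> +++ \<gamma>'"]) (auto simp: valid_path_join path_image_join)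
  qed
  \<comment> \<open>The loop \<open>\<gamma>\<close> followed by its reverse shows that the integral along \<open>\<gamma>\<close> exists.\<close>
  have ex: "\<exists>I. has_form_integral \<omega> I \<gamma>" if "valid_path \<gamma>" "path_image \<gamma> \<subseteq> X" for \<gamma>
  proof -
    have "has_form_integral \<omega> 0 (\<gamma> +++ reversepath \<gamma>)"
      using that by (intro loops) (auto simp: valid_path_join valid_path_imp_reverse path_image_join)
    from form_integral_join_split[OF _ _ _ this] that show ?thesis by (auto simp: valid_path_imp_reverse)
  qed
  define rep where "rep x = (SOME p. conn p x)" for x
  define p where "p x = (SOME \<gamma>. valid_path \<gamma> \<and> path_image \<gamma> \<subseteq> X \<and> pathstart \<gamma> = rep x \<and> pathfinish \<gamma> = x)" for x
  define R where "R x = (THE I. has_form_integral \<omega> I (p x))" for x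
  have p: "valid_path (p x) \<and> path_image (p x) \<subseteq> X \<and> pathstart (p x) = rep x \<and> pathfinish (p x) = x" if "x \<in> X" for x
  proof -
    have "conn (rep x) x" unfolding rep_def using refl[OF that] by (rule someI)
    then show ?thesis unfolding conn_def p_def by (rule someI_ex)
  qed
  have R: "has_form_integral \<omega> (R x) (p x)" if x: "x \<in> X" for x
  proof -
    obtain I where "has_form_integral \<omega> I (p x)" using ex[of "p x"] p[OF x] by blast
    then show ?thesis unfolding R_def by (rule theI) (metis \<open>has_form_integral \<omega> I (p x)\<close> has_form_integral_unique)
  qed
  have "has_form_integral \<omega> (R (pathfinish \<gamma>) - R (pathstart \<gamma>)) \<gamma>" if \<gamma>: "valid_path \<gamma>" "path_image \<gamma> \<subseteq> X" for \<gamma>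
  proof -
    define x y where "x = pathstart \<gamma>" and "y = pathfinish \<gamma>"
    have X: "x \<in> X" "y \<in> X" using \<gamma>(2) by (auto simp: x_def y_def)
    have "conn x y" using \<gamma> unfolding conn_def x_def y_def by blast
    then have "conn q x \<longleftrightarrow> conn q y" for q using trans sym by blast
    then have rep: "rep x = rep y" unfolding rep_def by simp
    have px: "valid_path (p x)" "path_image (p x) \<subseteq> X" "pathstart (p x) = rep x" "pathfinish (p x) = x" using p[OF X(1)] by auto
    have py: "valid_path (p y)" "path_image (p y) \<subseteq> X" "pathstart (p y) = rep y" "pathfinish (p y) = y" using p[OF X(2)] by auto
    have v: "valid_path (\<gamma> +++ reversepath (p y))"
      using \<gamma> py by (intro valid_path_join valid_path_imp_reverse) (auto simp: y_def)
    have "has_form_integral \<omega> 0 (p x +++ (\<gamma> +++ reversepath (p y)))"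
    proof (rule loops)
      show "valid_path (p x +++ (\<gamma> +++ reversepath (p y)))" using px(4) by (intro valid_path_join[OF px(1) v]) (simp add: x_def)
      show "path_image (p x +++ (\<gamma> +++ reversepath (p y))) \<subseteq> X"
        using px py \<gamma>(2) by (intro path_image_join_subset[THEN order_trans] Un_least) auto
    qed (use px py rep in \<open>auto simp: x_def y_def\<close>)
    moreover have "pathfinish (p x) = pathstart (\<gamma> +++ reversepath (p y))" using px(4) by (simp add: x_def)
    ultimately obtain I1 I' where
      1: "has_form_integral \<omega> I1 (p x)" "has_form_integral \<omega> I' (\<gamma> +++ reversepath (p y))" "0 = I1 + I'"
      using form_integral_join_split[OF px(1) v] by blast
    have "pathfinish \<gamma> = pathstart (reversepath (p y))" using py(4) by (simp add: y_def)
    then obtain I2 I3 where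
      2: "has_form_integral \<omega> I2 \<gamma>" "has_form_integral \<omega> I3 (reversepath (p y))" "I' = I2 + I3"
      using form_integral_join_split[OF \<gamma>(1) _ _ 1(2)] py(1) valid_path_imp_reverse by blast
    have "I1 = R x" using 1(1) R[OF X(1)] by (rule has_form_integral_unique)
    moreover have "I3 = - R y"
      using 2(2) form_integral_reversepath[OF py(1) R[OF X(2)]] by (rule has_form_integral_unique)
    ultimately have "I2 = R y - R x" using 1(3) 2(3) by (simp add: algebra_simps add_eq_0_iff)
    then show ?thesis using 2(1) by (simp add: x_def y_def)
  qed
  then show ?thesis unfolding primitive_on_def by blast
qed

text \<open>The increments of \<open>R \<circ> c\<close> are contour integrals of the continuous function on the right-hand side along segments.\<close>

lemma primitive_on_curve:
  fixes c :: "complex \<Rightarrow> complex ^ 'n"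
  assumes R: "primitive_on X \<omega> R" and \<omega>: "polymap \<omega>" and S: "open S"
    and c: "\<And>z. z \<in> S \<Longrightarrow> (c has_derivative (\<lambda>h. h *s c' z)) (at z)"
    and c': "continuous_on S c'" and img: "c ` S \<subseteq> X" and z: "z \<in> S"
  shows "((\<lambda>z. R (c z)) has_field_derivative (\<Sum>i\<in>UNIV. \<omega> (c z) $ i * c' z $ i)) (at z)"
proof -
  define f where "f z = (\<Sum>i\<in>UNIV. \<omega> (c z) $ i * c' z $ i)" for z
  have contc: "continuous_on S c"
    using c has_derivative_continuous by (blast intro: continuous_at_imp_continuous_on)
  have contf: "continuous_on S f" unfolding f_def
    using continuous_on_compose2[OF polymap_continuous_on[OF \<omega>, of UNIV] contc]
    by (intro continuous_intros c') auto
  have int: "(f has_contour_integral (R (c w) - R (c z))) (linepath z w)" if seg: "closed_segment z w \<subseteq> S" for w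
  proof -
    define \<gamma> where "\<gamma> = c \<circ> linepath z w"
    have der: "(\<gamma> has_vector_derivative (w - z) *s c' (linepath z w t)) (at t)" if "t \<in> {0..1}" for t
    proof -
      have "linepath z w t \<in> S" using seg that by (auto simp: linepath_in_path)
      then show ?thesis unfolding \<gamma>_def
        using vector_derivative_diff_chain_within[OF has_vector_derivative_linepath_within
            has_derivative_at_withinI[OF c], of z w t UNIV] by simp
    qed
    have "\<gamma> C1_differentiable_on {0..1}"
      unfolding C1_differentiable_on_def
    proof (intro exI[of _ "\<lambda>t. (w - z) *s c' (linepath z w t)"] conjI ballI der)
      show "continuous_on {0..1} (\<lambda>t. (w - z) *s c' (linepath z w t))"
        using seg by (intro continuous_intros continuous_on_compose2[OF c']) (auto simp: linepath_in_path)
    qed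
    then have "valid_path \<gamma>"
      unfolding valid_path_def by (rule C1_differentiable_imp_piecewise)
    moreover have "path_image \<gamma> \<subseteq> X"
      using img seg linepath_in_path[of _ z w] by (fastforce simp: \<gamma>_def path_image_def)
    ultimately have "has_form_integral \<omega> (R (pathfinish \<gamma>) - R (pathstart \<gamma>)) \<gamma>"
      using R unfolding primitive_on_def by blast
    then have "(form_integrand \<omega> \<gamma> has_integral (R (c w) - R (c z))) {0..1}"
      by (simp add: has_form_integral_alt \<gamma>_def pathfinish_def pathstart_def linepath_def)
    then have "((\<lambda>t. f (linepath z w t) * (w - z)) has_integral (R (c w) - R (c z))) {0..1}"
    proof (rule has_integral_eq[rotated])
      fix t :: real assume t: "t \<in> {0..1}"
      then have vd: "vector_derivative \<gamma> (at t within {0..1}) = (w - z) *s c' (linepath z w t)"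
        using der by (intro vector_derivative_at_within_ivl) auto
      show "form_integrand \<omega> \<gamma> t = f (linepath z w t) * (w - z)"
        unfolding form_integrand_def f_def sum_distrib_right vd
        by (intro sum.cong refl) (simp only: \<gamma>_def o_def vector_smult_component mult_ac)
    qed
    then show ?thesis by (simp add: has_contour_integral_linepath)
  qed
  obtain r where r: "r > 0" "ball z r \<subseteq> S" using S z openE by blast
  show ?thesis unfolding has_field_derivative_def has_derivative_at_alt f_def[symmetric]
  proof (intro conjI allI impI)
    show "bounded_linear ((*) (f z))" by (rule bounded_linear_mult_right)
    fix e :: real assume e: "e > 0"
    obtain d where d: "d > 0" "\<And>w. w \<in> S \<Longrightarrow> dist w z < d \<Longrightarrow> dist (f w) (f z) < e"
      using contf z e unfolding continuous_on_iff by metis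
    show "\<exists>d>0. \<forall>y. norm (y - z) < d \<longrightarrow> norm (R (c y) - R (c z) - f z * (y - z)) \<le> e * norm (y - z)"
    proof (intro exI[of _ "min d r"] conjI allI impI)
      fix w assume w: "norm (w - z) < min d r"
      then have "closed_segment z w \<subseteq> ball z (min d r)"
        using r d by (intro closed_segment_subset) (auto simp: dist_norm norm_minus_commute)
      then have seg: "closed_segment z w \<subseteq> S" "\<And>x. x \<in> closed_segment z w \<Longrightarrow> dist x z < d" using r(2)
        by (auto simp: dist_commute subset_iff)
      have "((\<lambda>x. f x - f z) has_contour_integral (R (c w) - R (c z) - f z * (w - z))) (linepath z w)"
        by (intro has_contour_integral_diff int seg has_contour_integral_const_linepath)
      then show "norm (R (c w) - R (c z) - f z * (w - z)) \<le> e * norm (w - z)"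
        using d(2) seg e by (intro has_contour_integral_bound_linepath) (auto simp: dist_norm less_imp_le)
    qed (use d r in auto)
  qed
qed

text \<open>The velocity of a point that lies over a point moving with velocity \<open>v\<close>, that is, the inverse of the derivative of \<open>G\<close> at \<open>x\<close> applied to \<open>v\<close>.\<close>

definition lift_velocity :: "(complex ^ 'n \<Rightarrow> complex ^ 'n) \<Rightarrow> complex ^ 'n \<Rightarrow> complex ^ 'n \<Rightarrow> complex ^ 'n" where
  "lift_velocity G v x = inverse (det (jac_matrix G x)) *s adj_vec (jac_matrix G x) v"

lemma lift_velocity_eq:
  assumes "det (jac_matrix G x) \<noteq> 0"
  shows "jac_matrix G x *v lift_velocity G v x = v" "jac_matrix G x *v w = v \<Longrightarrow> lift_velocity G v x = w"
    "lift_velocity G (h *s v) x = h *s lift_velocity G v x"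
proof -
  show 1: "jac_matrix G x *v lift_velocity G v x = v" for v
    using solve_adj_vec[OF assms] unfolding lift_velocity_def by blast
  show 2: "jac_matrix G x *v w = v \<Longrightarrow> lift_velocity G v x = w" for v w
    using solve_adj_vec[OF assms] unfolding lift_velocity_def by metis
  have "jac_matrix G x *v (h *s lift_velocity G v x) = h *s v"
    using 1 by (simp add: vector_scalar_commute)
  then show "lift_velocity G (h *s v) x = h *s lift_velocity G v x" by (rule 2)
qed

lemma continuous_on_lift_velocity:
  assumes "polymap G" "\<And>x. x \<in> U \<Longrightarrow> det (jac_matrix G x) \<noteq> 0"
  shows "continuous_on U (lift_velocity G v)"
proof -
  have "polymap (\<lambda>x. adj_vec (jac_matrix G x) v)"
    unfolding polymap_def by (intro allI polyfun_adj_vec polyfun_jac assms polyfun.const)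
  then show ?thesis unfolding lift_velocity_def[abs_def]
    using assms by (intro continuous_intros polyfun_continuous_on polyfun_det_jac polymap_continuous_on) auto
qed

lemma local_inverse_line:
  fixes G :: "complex ^ 'n \<Rightarrow> complex ^ 'n"
  assumes G: "polymap G" and V: "open V" and hom: "homeomorphism U V G g"
    and nz: "\<And>x. x \<in> U \<Longrightarrow> det (jac_matrix G x) \<noteq> 0"
    and der: "\<And>y. y \<in> V \<Longrightarrow> (g has_derivative
        (\<lambda>h. inverse (det (jac_matrix G (g y))) *s adj_vec (jac_matrix G (g y)) h)) (at y)"
    and z: "a + z *s v \<in> V"
  shows "((\<lambda>z. g (a + z *s v)) has_derivative (\<lambda>h. h *s lift_velocity G v (g (a + z *s v)))) (at z)"
    and "continuous_on {z. a + z *s v \<in> V} (\<lambda>z. lift_velocity G v (g (a + z *s v)))"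
proof -
  have gU: "g y \<in> U" if "y \<in> V" for y using hom that by (auto simp: homeomorphism_def)
  have "bounded_linear (\<lambda>h. h *s v)"
    by (rule bounded_linear_intro[of _ "norm v"]) (auto simp: norm_vector_smult vec_eq_iff algebra_simps)
  then have 1: "((\<lambda>z. a + z *s v) has_derivative (\<lambda>h. h *s v)) (at z)"
    by (auto intro!: derivative_eq_intros bounded_linear_imp_has_derivative)
  have "((\<lambda>z. g (a + z *s v)) has_derivative (\<lambda>h. lift_velocity G (h *s v) (g (a + z *s v)))) (at z)"
    unfolding lift_velocity_def using has_derivative_compose[OF 1 der[OF z]] .
  then show "((\<lambda>z. g (a + z *s v)) has_derivative (\<lambda>h. h *s lift_velocity G v (g (a + z *s v)))) (at z)"
    by (simp add: lift_velocity_eq(3)[OF nz[OF gU[OF z]]])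
  have "continuous_on V g" using hom by (auto simp: homeomorphism_def)
  then have "continuous_on {z. a + z *s v \<in> V} (\<lambda>z. g (a + z *s v))"
    by (rule continuous_on_compose2) (auto intro!: continuous_intros)
  then show "continuous_on {z. a + z *s v \<in> V} (\<lambda>z. lift_velocity G v (g (a + z *s v)))"
    by (intro continuous_on_compose2[OF continuous_on_lift_velocity[OF G nz]]) (use gU in auto)
qed

section \<open>Functions of moderate growth\<close>

text \<open>The supremum of the points up to which the bound holds is \<open>b\<close>. A sum of absolute values, to which this will be applied, is
locally Lipschitz but need not be differentiable.\<close>

lemma local_lipschitz_interval:
  fixes f :: "real \<Rightarrow> real"
  assumes "a \<le> b" "\<And>t. t \<in> {a..b} \<Longrightarrow> \<exists>e>0. \<forall>s\<in>{a..b}. \<bar>s - t\<bar> < e \<longrightarrow> \<bar>f s - f t\<bar> \<le> B * \<bar>s - t\<bar>"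
  shows "\<bar>f b - f a\<bar> \<le> B * (b - a)"
proof -
  define A where "A = {t \<in> {a..b}. \<bar>f t - f a\<bar> \<le> B * (t - a)}"
  have "a \<in> A" using assms(1) by (simp add: A_def)
  have bdd: "bdd_above A" by (rule bdd_aboveI[of _ b]) (simp add: A_def)
  define c where "c = Sup A"
  have c: "a \<le> c" "c \<le> b" unfolding c_def
    using cSup_upper[OF \<open>a \<in> A\<close> bdd] \<open>a \<in> A\<close> by (auto intro!: cSup_least simp: A_def)
  obtain e where e: "e > 0" "\<And>s. s \<in> {a..b} \<Longrightarrow> \<bar>s - c\<bar> < e \<Longrightarrow> \<bar>f s - f c\<bar> \<le> B * \<bar>s - c\<bar>"
    using assms(2)[of c] c by auto
  obtain t where t: "t \<in> A" "c - e < t" using less_cSup_iff[OF _ bdd, of "c - e"] \<open>a \<in> A\<close> e(1) by (auto simp: c_def)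
  have "t \<le> c" unfolding c_def by (rule cSup_upper[OF t(1) bdd])
  have "\<bar>f t - f c\<bar> \<le> B * \<bar>t - c\<bar>" using t \<open>t \<le> c\<close> e by (intro e(2)) (auto simp: A_def)
  moreover have "\<bar>f t - f a\<bar> \<le> B * (t - a)" using t by (simp add: A_def)
  ultimately have fc: "\<bar>f c - f a\<bar> \<le> B * (c - a)" using \<open>t \<le> c\<close> by (simp add: algebra_simps abs_if split: if_splits)
  have "c = b"
  proof (rule ccontr)
    assume "c \<noteq> b"
    define s where "s = min b (c + e / 2)"
    have s: "s \<in> {a..b}" "c < s" "\<bar>s - c\<bar> < e" using c e(1) \<open>c \<noteq> b\<close> by (auto simp: s_def)
    have "\<bar>f s - f c\<bar> \<le> B * \<bar>s - c\<bar>" by (rule e(2)[OF s(1,3)])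
    then have "s \<in> A" using fc s by (simp add: A_def algebra_simps abs_if split: if_splits)
    then have "s \<le> c" unfolding c_def by (rule cSup_upper[OF _ bdd])
    then show False using s by simp
  qed
  with fc show ?thesis by simp
qed

lemma local_lipschitz_segment:
  fixes m :: "complex \<Rightarrow> real"
  assumes "\<And>x. x \<in> closed_segment a b \<Longrightarrow> \<exists>e>0. \<forall>y. norm (y - x) < e \<longrightarrow> \<bar>m y - m x\<bar> \<le> B * norm (y - x)"
  shows "\<bar>m b - m a\<bar> \<le> B * norm (b - a)"
proof (cases "a = b")
  case False
  then have nz: "norm (b - a) > 0" by simp
  have "\<bar>m (linepath a b 1) - m (linepath a b 0)\<bar> \<le> (B * norm (b - a)) * (1 - 0)"
  proof (rule local_lipschitz_interval)
    fix t :: real assume "t \<in> {0..1}"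
    then obtain e where e: "e > 0" "\<And>y. norm (y - linepath a b t) < e \<Longrightarrow> \<bar>m y - m (linepath a b t)\<bar> \<le> B * norm (y - linepath a b t)"
      using assms[of "linepath a b t"] by (auto simp: linepath_in_path)
    have n: "norm (linepath a b s - linepath a b t) = \<bar>s - t\<bar> * norm (b - a)" for s
    proof -
      have "linepath a b s - linepath a b t = (s - t) *\<^sub>R (b - a)" by (simp add: linepath_def algebra_simps)
      then show ?thesis by simp
    qed
    show "\<exists>e>0. \<forall>s\<in>{0..1}. \<bar>s - t\<bar> < e \<longrightarrow> \<bar>m (linepath a b s) - m (linepath a b t)\<bar> \<le> (B * norm (b - a)) * \<bar>s - t\<bar>"
    proof (intro exI[of _ "e / norm (b - a)"] conjI ballI impI)
      fix s assume "\<bar>s - t\<bar> < e / norm (b - a)"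
      then have "norm (linepath a b s - linepath a b t) < e" using nz by (simp add: n field_simps)
      from e(2)[OF this] show "\<bar>m (linepath a b s) - m (linepath a b t)\<bar> \<le> (B * norm (b - a)) * \<bar>s - t\<bar>"
        by (simp add: n mult_ac)
    qed (use e nz in auto)
  qed simp
  then show ?thesis by (simp add: linepath_def)
qed simp

text \<open>Powers of this function measure moderate growth on the complement of the zeros of \<open>d\<close>, both at the zeros and at infinity.\<close>

definition weight :: "complex poly \<Rightarrow> complex \<Rightarrow> real" where
  "weight d z = (1 + norm z) * (1 + 1 / norm (poly d z))"

lemma weight_ge_1: "1 \<le> weight d z" and weight_ge_norm: "norm z \<le> weight d z"
proof -
  have "1 * 1 \<le> weight d z" unfolding weight_def by (rule mult_mono) auto
  then show "1 \<le> weight d z" by simp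
  have "norm z * 1 \<le> weight d z" unfolding weight_def by (rule mult_mono) auto
  then show "norm z \<le> weight d z" by simp
qed

text \<open>A bound is integrated along segments on which the weight is at most a constant times its value at the
end point \<open>b\<close>. Close to a zero of \<open>d\<close> the segment leads radially inwards from a small circle, and close to infinity radially outwards from
a large one. Compactness takes care of the points in between.\<close>

lemma growth_from_local_lipschitz:
  fixes m :: "complex \<Rightarrow> real"
  assumes d: "d \<noteq> 0" and C: "C \<ge> 0"
    and lip: "\<And>x. poly d x \<noteq> 0 \<Longrightarrow>
      \<exists>e>0. \<forall>y. norm (y - x) < e \<longrightarrow> \<bar>m y - m x\<bar> \<le> (C * weight d x ^ k) * norm (y - x)"
  shows "\<exists>C'. \<forall>x. poly d x \<noteq> 0 \<longrightarrow> \<bar>m x\<bar> \<le> C' * weight d x ^ Suc k"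
proof -
  have cont: "isCont m x" if x: "poly d x \<noteq> 0" for x
  proof -
    obtain e where e: "e > 0" "\<And>y. norm (y - x) < e \<Longrightarrow> \<bar>m y - m x\<bar> \<le> (C * weight d x ^ k) * norm (y - x)"
      using lip[OF x] by blast
    have "((\<lambda>y. (C * weight d x ^ k) * norm (y - x)) \<longlongrightarrow> (C * weight d x ^ k) * norm (x - x)) (at x)"
      by (intro tendsto_intros)
    then have "((\<lambda>y. dist (m y) (m x)) \<longlongrightarrow> 0) (at x)"
      using e by (intro tendsto_sandwich[of "\<lambda>_. 0" "\<lambda>y. dist (m y) (m x)" _ "\<lambda>y. (C * weight d x ^ k) * norm (y - x)"])
        (auto simp: dist_norm eventually_at intro!: exI[of _ e])
    then show ?thesis unfolding isCont_def by (subst tendsto_dist_iff)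
  qed
  have bound: "\<exists>S\<ge>0. \<forall>x\<in>K. \<bar>m x\<bar> \<le> S" if "compact K" "\<And>x. x \<in> K \<Longrightarrow> poly d x \<noteq> 0" for K
  proof -
    have "continuous_on K m" using cont that(2) by (auto intro: continuous_at_imp_continuous_on)
    then have "compact (m ` K)" using that(1) by (rule compact_continuous_image)
    then obtain S where "\<forall>y\<in>m ` K. norm y \<le> S" using compact_imp_bounded bounded_iff by metis
    then show ?thesis by (intro exI[of _ "max S 0"]) (auto simp: max_def intro: order_trans)
  qed
  have seg: "\<bar>m b\<bar> \<le> S + C * (M * weight d b) ^ k * norm (b - a)"
    if "\<bar>m a\<bar> \<le> S" and seg: "\<And>x. x \<in> closed_segment a b \<Longrightarrow> poly d x \<noteq> 0 \<and> weight d x \<le> M * weight d b" for a b M S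
  proof -
    have "\<bar>m b - m a\<bar> \<le> (C * (M * weight d b) ^ k) * norm (b - a)"
    proof (rule local_lipschitz_segment)
      fix x assume x: "x \<in> closed_segment a b"
      obtain e where e: "e > 0" "\<And>y. norm (y - x) < e \<Longrightarrow> \<bar>m y - m x\<bar> \<le> (C * weight d x ^ k) * norm (y - x)"
        using lip seg[OF x] by blast
      have "C * weight d x ^ k \<le> C * (M * weight d b) ^ k"
        using C seg[OF x] weight_ge_1[of d x] by (intro mult_left_mono power_mono) auto
      then have "\<bar>m y - m x\<bar> \<le> (C * (M * weight d b) ^ k) * norm (y - x)" if "norm (y - x) < e" for y
        by (intro order_trans[OF e(2)[OF that]] mult_right_mono) auto
      then show "\<exists>e>0. \<forall>y. norm (y - x) < e \<longrightarrow> \<bar>m y - m x\<bar> \<le> (C * (M * weight d b) ^ k) * norm (y - x)"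
        using e(1) by blast
    qed
    then show ?thesis using that(1) by (simp add: mult.assoc)
  qed
  have local: "\<exists>r>0. \<exists>S\<ge>0. \<forall>x\<in>ball a r. poly d x \<noteq> 0 \<longrightarrow> \<bar>m x\<bar> \<le> S * weight d x ^ Suc k" for a
  proof (cases "poly d a = 0")
    case False
    have "\<forall>\<^sub>F x in nhds a. \<bar>m x\<bar> < \<bar>m a\<bar> + 1"
      by (rule order_tendstoD(2)[OF tendsto_rabs[OF isCont_tendsto_nhds[OF cont[OF False]]]]) simp
    then obtain r where r: "r > 0" "\<And>x. dist x a < r \<Longrightarrow> \<bar>m x\<bar> < \<bar>m a\<bar> + 1"
      unfolding eventually_nhds_metric by blast
    have "\<bar>m x\<bar> \<le> (\<bar>m a\<bar> + 1) * weight d x ^ Suc k" if "x \<in> ball a r" for x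
    proof -
      have "\<bar>m x\<bar> \<le> (\<bar>m a\<bar> + 1) * 1" using r(2)[of x] that by (simp add: dist_commute)
      also have "\<dots> \<le> (\<bar>m a\<bar> + 1) * weight d x ^ Suc k"
        by (intro mult_left_mono one_le_power weight_ge_1) auto
      finally show ?thesis .
    qed
    then show ?thesis using r(1) by (intro exI[of _ r] conjI exI[of _ "\<bar>m a\<bar> + 1"]) auto
  next
    case True
    obtain g where g: "d = [:- a, 1:] ^ Polynomial.order a d * g" "\<not> [:- a, 1:] dvd g" using order_decomp[OF d] by blast
    define \<mu> where "\<mu> = Polynomial.order a d"
    have ga: "poly g a \<noteq> 0" using g(2) poly_eq_0_iff_dvd by blast
    have dg: "norm (poly d x) = norm (x - a) ^ \<mu> * norm (poly g x)" for x
      by (subst g(1)) (simp add: \<mu>_def norm_mult norm_power algebra_simps)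
    define c where "c = norm (poly g a)"
    have "c > 0" using ga by (simp add: c_def)
    have "isCont (\<lambda>x. norm (poly g x)) a" by (intro continuous_intros)
    note lim = isCont_tendsto_nhds[OF this]
    have "\<forall>\<^sub>F x in nhds a. c / 2 < norm (poly g x)" "\<forall>\<^sub>F x in nhds a. norm (poly g x) < 2 * c"
    proof -
      have "c / 2 < norm (poly g a)" "norm (poly g a) < 2 * c" using \<open>c > 0\<close> by (auto simp: c_def)
      then show "\<forall>\<^sub>F x in nhds a. c / 2 < norm (poly g x)" "\<forall>\<^sub>F x in nhds a. norm (poly g x) < 2 * c"
        using order_tendstoD[OF lim] by blast+
    qed
    then have "\<forall>\<^sub>F x in nhds a. c / 2 < norm (poly g x) \<and> norm (poly g x) < 2 * c" by eventually_elim auto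
    then obtain r0 where r0: "r0 > 0" "\<And>x. dist x a < r0 \<Longrightarrow> c / 2 < norm (poly g x) \<and> norm (poly g x) < 2 * c"
      unfolding eventually_nhds_metric by blast
    define r where "r = min 1 (r0 / 2)"
    have r: "r > 0" "r \<le> 1" "r < r0" using r0(1) by (auto simp: r_def)
    have g_bounds: "c / 2 < norm (poly g x)" "norm (poly g x) < 2 * c" if "norm (x - a) \<le> r" for x
      using r0(2)[of x] that r by (auto simp: dist_norm)
    have nz: "poly d x \<noteq> 0" if "norm (x - a) \<le> r" "x \<noteq> a" for x
      using g_bounds[OF that(1)] dg[of x] that \<open>c > 0\<close> by auto
    have "\<exists>S\<ge>0. \<forall>x\<in>sphere a r. \<bar>m x\<bar> \<le> S"
    proof (rule bound)
      fix x assume "x \<in> sphere a r"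
      then show "poly d x \<noteq> 0" using r(1) by (intro nz) (auto simp: dist_norm norm_minus_commute)
    qed simp
    then obtain S where S: "S \<ge> 0" "\<And>x. norm (x - a) = r \<Longrightarrow> \<bar>m x\<bar> \<le> S"
      by (auto simp: dist_norm norm_minus_commute)
    define M where "M = (2 + norm a) * 5"
    have "\<bar>m b\<bar> \<le> (S + C * M ^ k) * weight d b ^ Suc k" if b: "b \<in> ball a r" "poly d b \<noteq> 0" for b
    proof -
      have "b \<noteq> a" using b True by auto
      define t where "t = norm (b - a)"
      have t: "0 < t" "t < r" using b \<open>b \<noteq> a\<close> by (auto simp: t_def dist_norm norm_minus_commute)
      \<comment> \<open>The point of the circle of radius \<open>r\<close> around \<open>a\<close> on the ray through \<open>b\<close>.\<close>
      define e where "e = a + of_real (r / t) * (b - a)"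
      have e: "norm (e - a) = r" using t r by (simp add: e_def norm_mult norm_divide flip: t_def)
      have "\<bar>m b\<bar> \<le> S + C * (M * weight d b) ^ k * norm (b - e)"
      proof (rule seg)
        show "\<bar>m e\<bar> \<le> S" by (rule S(2)[OF e])
      next
        fix x assume "x \<in> closed_segment e b"
        then obtain u where u: "0 \<le> u" "u \<le> 1" "x = (1 - u) *\<^sub>R e + u *\<^sub>R b" by (auto simp: in_segment)
        define l where "l = (1 - u) * (r / t) + u"
        have "x - a = of_real l * (b - a)"
          by (simp add: u(3) e_def l_def scaleR_conv_of_real algebra_simps)
        then have nx: "norm (x - a) = \<bar>l\<bar> * t" by (simp add: norm_mult t_def)
        have "1 \<le> r / t" using t by simp
        then have "1 * (1 - u) \<le> (1 - u) * (r / t)" using u mult_left_mono[of 1 "r / t" "1 - u"] by simp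
        then have l1: "1 \<le> l" by (simp add: l_def)
        have "u * 1 \<le> u * (r / t)" using u \<open>1 \<le> r / t\<close> by (intro mult_left_mono) auto
        then have "l \<le> (1 - u) * (r / t) + u * (r / t)" by (simp add: l_def)
        moreover have "(1 - u) * w + u * w = w" for w :: real by (simp add: algebra_simps)
        ultimately have "l \<le> r / t" by metis
        then have xr: "norm (x - a) \<le> r" "t \<le> norm (x - a)"
          using l1 t by (auto simp: nx field_simps)
        have "x \<noteq> a" using xr(2) t by auto
        have w1: "1 + norm x \<le> (2 + norm a) * (1 + norm b)"
        proof -
          have "norm x \<le> norm (x - a) + norm a" using norm_triangle_ineq[of "x - a" a] by simp
          then have "1 + norm x \<le> (2 + norm a) * 1" using xr r by simp
          also have "\<dots> \<le> (2 + norm a) * (1 + norm b)" by (intro mult_left_mono) auto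
          finally show ?thesis .
        qed
        \<comment> \<open>On the segment \<open>\<bar>x - a\<bar> \<ge> \<bar>b - a\<bar>\<close>, and \<open>g\<close> varies at most by the factor \<open>4\<close> near \<open>a\<close>.\<close>
        have w2: "1 + 1 / norm (poly d x) \<le> 5 * (1 + 1 / norm (poly d b))"
        proof -
          have "norm (poly d b) \<le> 4 * norm (poly d x)"
          proof -
            have "norm (poly d b) = t ^ \<mu> * norm (poly g b)" by (simp add: dg t_def)
            also have "\<dots> \<le> norm (x - a) ^ \<mu> * (4 * norm (poly g x))"
              using xr t g_bounds[of b] g_bounds[OF xr(1)]
              by (intro mult_mono power_mono) (auto simp: t_def)
            finally show ?thesis by (simp add: dg)
          qed
          moreover have "0 < norm (poly d b)" "0 < norm (poly d x)" using b nz[OF xr(1) \<open>x \<noteq> a\<close>] by auto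
          ultimately have "1 / norm (poly d x) \<le> 4 * (1 / norm (poly d b))" by (simp add: field_simps)
          moreover have "0 \<le> 1 / norm (poly d b)" by simp
          ultimately show ?thesis unfolding distrib_left by linarith
        qed
        have "weight d x \<le> ((2 + norm a) * (1 + norm b)) * (5 * (1 + 1 / norm (poly d b)))"
          unfolding weight_def by (intro mult_mono w1 w2) auto
        also have "\<dots> = M * weight d b" unfolding M_def weight_def by (simp only: mult_ac)
        finally show "poly d x \<noteq> 0 \<and> weight d x \<le> M * weight d b"
          using nz[OF xr(1) \<open>x \<noteq> a\<close>] by blast
      qed
      also have "\<dots> \<le> S * weight d b ^ Suc k + C * M ^ k * weight d b ^ Suc k"
      proof (rule add_mono)
        show "S \<le> S * weight d b ^ Suc k"
          using S(1) one_le_power[OF weight_ge_1, of d b "Suc k"] mult_left_mono[of 1 _ S] by simp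
        have "b - e = of_real (1 - r / t) * (b - a)" by (simp add: e_def algebra_simps)
        then have "norm (b - e) = \<bar>1 - r / t\<bar> * t" by (simp add: norm_mult t_def del: of_real_diff of_real_divide)
        also have "\<dots> = r - t" using t by (simp add: abs_if field_simps)
        finally have "norm (b - e) \<le> weight d b" using r t weight_ge_1[of d b] by simp
        moreover have "M \<ge> 0" by (simp add: M_def)
        moreover have "weight d b \<ge> 0" using weight_ge_1[of d b] by simp
        ultimately have "C * (M * weight d b) ^ k * norm (b - e) \<le> C * (M * weight d b) ^ k * weight d b"
          using C by (intro mult_left_mono) auto
        then show "C * (M * weight d b) ^ k * norm (b - e) \<le> C * M ^ k * weight d b ^ Suc k"
          by (simp add: power_mult_distrib mult_ac)
      qed
      finally show ?thesis by (simp add: algebra_simps)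
    qed
    moreover have "M \<ge> 0" by (simp add: M_def)
    ultimately show ?thesis using r(1) S(1) C by (intro exI[of _ r] conjI exI[of _ "S + C * M ^ k"]) auto
  qed
  obtain \<rho> c where \<rho>: "\<rho> > 0" "c > 0" "\<And>x. norm x \<ge> \<rho> \<Longrightarrow> norm (poly d x) \<ge> c"
  proof (cases "degree d = 0")
    case True
    then obtain b where "d = [:b:]" using degree_eq_zeroE by blast
    then show ?thesis using d that[of 1 "norm b"] by auto
  next
    case False
    then obtain b p where "d = pCons b p" "p \<noteq> 0" by (metis degree_pCons_0 pCons_cases)
    then obtain r where "\<And>x. r \<le> norm x \<Longrightarrow> 1 \<le> norm (poly d x)" using poly_infinity[of p 1 b] by blast
    then show ?thesis using that[of "max r 1" 1] by simp
  qed
  have "\<exists>S\<ge>0. \<forall>x\<in>sphere 0 \<rho>. \<bar>m x\<bar> \<le> S"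
  proof (rule bound)
    fix x :: complex assume "x \<in> sphere 0 \<rho>"
    then show "poly d x \<noteq> 0" using \<rho>(2) \<rho>(3)[of x] by auto
  qed simp
  then obtain S1 where S1: "S1 \<ge> 0" "\<And>x. norm x = \<rho> \<Longrightarrow> \<bar>m x\<bar> \<le> S1" by auto
  define M where "M = 1 + 1 / c"
  have far: "\<bar>m b\<bar> \<le> (S1 + C * M ^ k) * weight d b ^ Suc k" if b: "norm b \<ge> \<rho>" for b
  proof -
    define e where "e = of_real (\<rho> / norm b) * b"
    have "norm b > 0" using b \<rho>(1) by linarith
    have e: "norm e = \<rho>" using \<rho>(1) \<open>norm b > 0\<close> by (simp add: e_def norm_mult norm_divide)
    have "\<bar>m b\<bar> \<le> S1 + C * (M * weight d b) ^ k * norm (b - e)"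
    proof (rule seg)
      show "\<bar>m e\<bar> \<le> S1" by (rule S1(2)[OF e])
    next
      fix x assume "x \<in> closed_segment e b"
      then obtain u where u: "0 \<le> u" "u \<le> 1" "x = (1 - u) *\<^sub>R e + u *\<^sub>R b" by (auto simp: in_segment)
      define l where "l = (1 - u) * (\<rho> / norm b) + u"
      have "x = of_real l * b" by (simp add: u(3) e_def l_def scaleR_conv_of_real algebra_simps)
      moreover have "l \<ge> 0" using u \<rho>(1) by (simp add: l_def)
      ultimately have nx: "norm x = l * norm b" by (simp add: norm_mult)
      have "\<rho> / norm b \<le> 1" using b \<open>norm b > 0\<close> by simp
      then have "(1 - u) * (\<rho> / norm b) \<le> (1 - u) * 1" "u * (\<rho> / norm b) \<le> u * 1"
        using u by (intro mult_left_mono; simp)+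
      then have "l \<le> (1 - u) * 1 + u * 1" "(1 - u) * (\<rho> / norm b) + u * (\<rho> / norm b) \<le> l"
        unfolding l_def by linarith+
      moreover have "(1 - u) * w + u * w = w" for w :: real by (simp add: algebra_simps)
      ultimately have "l \<le> 1" "\<rho> / norm b \<le> l" by metis+
      then have x: "\<rho> \<le> norm x" "norm x \<le> norm b"
        using \<open>norm b > 0\<close> by (auto simp: nx field_simps)
      have "poly d x \<noteq> 0" using \<rho>(2,3) x by fastforce
      have "weight d x \<le> (1 + norm b) * M"
        unfolding weight_def M_def using x \<rho> by (intro mult_mono add_mono divide_left_mono) (auto intro!: mult_pos_pos simp: \<open>poly d x \<noteq> 0\<close>)
      also have "\<dots> \<le> (1 + norm b) * M * (1 + 1 / norm (poly d b))"
        using \<rho>(2) mult_left_mono[of 1 "1 + 1 / norm (poly d b)" "(1 + norm b) * M"] by (simp add: M_def)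
      also have "\<dots> = M * weight d b" unfolding weight_def by (simp only: mult_ac)
      finally show "poly d x \<noteq> 0 \<and> weight d x \<le> M * weight d b"
        using \<open>poly d x \<noteq> 0\<close> by blast
    qed
    also have "\<dots> \<le> S1 * weight d b ^ Suc k + C * M ^ k * weight d b ^ Suc k"
    proof (rule add_mono)
      show "S1 \<le> S1 * weight d b ^ Suc k"
        using S1(1) one_le_power[OF weight_ge_1, of d b "Suc k"] mult_left_mono[of 1 _ S1] by simp
      have "b - e = of_real (1 - \<rho> / norm b) * b" by (simp add: e_def algebra_simps)
      then have "norm (b - e) = \<bar>1 - \<rho> / norm b\<bar> * norm b" by (simp add: norm_mult del: of_real_diff of_real_divide)
      also have "\<dots> = norm b - \<rho>" using \<open>norm b > 0\<close> b by (simp add: abs_if field_simps)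
      finally have "norm (b - e) \<le> weight d b" using \<rho>(1) weight_ge_norm[of b d] by simp
      moreover have "M \<ge> 0" using \<rho>(2) by (simp add: M_def)
      moreover have "weight d b \<ge> 0" using weight_ge_1[of d b] by simp
      ultimately have "C * (M * weight d b) ^ k * norm (b - e) \<le> C * (M * weight d b) ^ k * weight d b"
        using C by (intro mult_left_mono) auto
      then show "C * (M * weight d b) ^ k * norm (b - e) \<le> C * M ^ k * weight d b ^ Suc k"
        by (simp add: power_mult_distrib mult_ac)
    qed
    finally show ?thesis by (simp add: algebra_simps)
  qed
  define Q where "Q a r S \<longleftrightarrow> (\<forall>x\<in>ball a r. poly d x \<noteq> 0 \<longrightarrow> \<bar>m x\<bar> \<le> S * weight d x ^ Suc k)" for a r S
  have "\<forall>a. \<exists>r S. r > 0 \<and> S \<ge> 0 \<and> Q a r S" using local unfolding Q_def by blast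
  then obtain r S where rS: "\<And>a. r a > 0" "\<And>a. S a \<ge> 0" "\<And>a. Q a (r a) (S a)" by metis
  have cover: "cball 0 \<rho> \<subseteq> (\<Union>a\<in>UNIV. ball a (r a))" using rS(1) centre_in_ball by blast
  obtain A where A: "finite A" "cball 0 \<rho> \<subseteq> (\<Union>a\<in>A. ball a (r a))"
    by (rule compactE_image[OF compact_cball _ cover]) auto
  define S' where "S' = (S1 + C * M ^ k) + (\<Sum>a\<in>A. S a)"
  have "M \<ge> 0" using \<rho>(2) by (simp add: M_def)
  have "\<bar>m x\<bar> \<le> S' * weight d x ^ Suc k" if x: "poly d x \<noteq> 0" for x
  proof (cases "norm x \<ge> \<rho>")
    case True
    have "S1 + C * M ^ k \<le> S'" unfolding S'_def using rS(2) by (simp add: sum_nonneg)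
    then have "(S1 + C * M ^ k) * weight d x ^ Suc k \<le> S' * weight d x ^ Suc k"
      using weight_ge_1[of d x] by (intro mult_right_mono) auto
    then show ?thesis using far[OF True] by linarith
  next
    case False
    then have "x \<in> cball 0 \<rho>" by simp
    then obtain a where a: "a \<in> A" "x \<in> ball a (r a)" using A(2) by auto
    have "S a \<le> (\<Sum>a\<in>A. S a)" using a A(1) rS(2) by (intro member_le_sum) auto
    moreover have "0 \<le> S1 + C * M ^ k" using S1(1) C \<open>M \<ge> 0\<close> by simp
    ultimately have "S a \<le> S'" unfolding S'_def by linarith
    then have "S a * weight d x ^ Suc k \<le> S' * weight d x ^ Suc k"
      using weight_ge_1[of d x] by (intro mult_right_mono) auto
    then show ?thesis using rS(3)[of a] a(2) x unfolding Q_def by fastforce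
  qed
  then show ?thesis by blast
qed

lemma poly_norm_bound: "\<exists>C\<ge>0. \<forall>z. norm (poly d z) \<le> C * (1 + norm (z :: complex)) ^ degree d"
proof (intro exI[of _ "\<Sum>i\<le>degree d. norm (coeff d i)"] conjI allI)
  fix z :: complex
  have "norm (poly d z) \<le> (\<Sum>i\<le>degree d. norm (coeff d i) * (1 + norm z) ^ degree d)"
    unfolding poly_altdef
  proof (intro order_trans[OF norm_sum] sum_mono)
    fix i assume "i \<in> {..degree d}"
    then have "norm z ^ i \<le> (1 + norm z) ^ degree d"
      by (intro order_trans[OF power_mono[of "norm z" "1 + norm z" i] power_increasing]) auto
    then show "norm (coeff d i * z ^ i) \<le> norm (coeff d i) * (1 + norm z) ^ degree d"
      by (simp add: norm_mult norm_power mult_left_mono)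
  qed
  then show "norm (poly d z) \<le> (\<Sum>i\<le>degree d. norm (coeff d i)) * (1 + norm z) ^ degree d"
    by (simp add: sum_distrib_right)
qed (simp add: sum_nonneg)

text \<open>Multiplied by \<open>d ^ (k + 1)\<close>, the function tends to \<open>0\<close> at the zeros of \<open>d\<close>, so that it extends to an entire function of
polynomial growth; Liouville's theorem applies.\<close>

lemma tempered_holomorphic_is_rational:
  assumes d: "d \<noteq> 0" and h: "h holomorphic_on {z. poly d z \<noteq> 0}"
    and bd: "\<And>z. poly d z \<noteq> 0 \<Longrightarrow> norm (h z) \<le> C * weight d z ^ k"
  shows "\<exists>q. degree q \<le> k + degree d * Suc k \<and> (\<forall>z. poly d z \<noteq> 0 \<longrightarrow> poly d z ^ Suc k * h z = poly q z)"
proof -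
  define H where "H z = (if poly d z = 0 then 0 else poly d z ^ Suc k * h z)" for z
  define C' where "C' = max C 0"
  have H: "norm (H z) \<le> C' * (1 + norm z) ^ k * (1 + norm (poly d z)) ^ k * norm (poly d z)" for z
  proof (cases "poly d z = 0")
    case False
    have "norm (H z) = norm (poly d z) ^ Suc k * norm (h z)" using False by (simp add: H_def norm_mult norm_power)
    also have "\<dots> \<le> norm (poly d z) ^ Suc k * (C' * weight d z ^ k)"
    proof (intro mult_left_mono order_trans[OF bd[OF False]] mult_right_mono)
      show "0 \<le> weight d z ^ k" using weight_ge_1[of d z] by simp
    qed (auto simp: C'_def)
    also have "\<dots> = C' * (norm (poly d z) * weight d z) ^ k * norm (poly d z)"
      by (simp add: power_mult_distrib)
    also have "norm (poly d z) * weight d z = (1 + norm z) * (1 + norm (poly d z))"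
      using False by (simp add: weight_def field_simps)
    finally show ?thesis by (simp add: power_mult_distrib mult_ac)
  qed (simp add: H_def C'_def)
  have fin: "finite {z. poly d z = 0}" by (rule poly_roots_finite[OF d])
  have op: "open {z. poly d z \<noteq> 0}" using fin finite_imp_closed[OF fin] by (simp add: closed_def Collect_neg_eq)
  have holo: "H holomorphic_on {z. poly d z \<noteq> 0}"
  proof (rule holomorphic_transform[of "\<lambda>z. poly d z ^ Suc k * h z"])
    show "(\<lambda>z. poly d z ^ Suc k * h z) holomorphic_on {z. poly d z \<noteq> 0}" by (intro holomorphic_intros h)
  qed (auto simp: H_def)
  have "continuous_on UNIV H"
    unfolding continuous_on_eq_continuous_at[OF open_UNIV]
  proof
    fix z
    show "isCont H z"
    proof (cases "poly d z = 0")
      case False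
      then show ?thesis using holomorphic_on_imp_continuous_on[OF holo] op
        by (simp add: continuous_on_eq_continuous_at)
    next
      case True
      have "((\<lambda>z. C' * (1 + norm z) ^ k * (1 + norm (poly d z)) ^ k * norm (poly d z)) \<longlongrightarrow>
           C' * (1 + norm z) ^ k * (1 + norm (poly d z)) ^ k * norm (poly d z)) (at z)"
        by (intro tendsto_intros)
      then have "(H \<longlongrightarrow> 0) (at z)"
        using True H by (intro Lim_null_comparison[of H "\<lambda>z. C' * (1 + norm z) ^ k * (1 + norm (poly d z)) ^ k * norm (poly d z)"]) auto
      then show ?thesis using True by (simp add: isCont_def H_def)
    qed
  qed
  moreover have "H holomorphic_on UNIV - {z. poly d z = 0}" using holo by (simp add: Diff_eq Collect_neg_eq)
  ultimately have entire: "H holomorphic_on UNIV" by (rule no_isolated_singularity[OF _ _ open_UNIV fin])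
  obtain D where D: "D \<ge> 0" "\<And>z. norm (poly d z) \<le> D * (1 + norm z) ^ degree d" using poly_norm_bound by blast
  define n where "n = k + degree d * Suc k"
  have growth: "norm (H z) \<le> (C' * (1 + D) ^ Suc k * 2 ^ n) * norm z ^ n" if z: "1 \<le> norm z" for z
  proof -
    have "1 + norm (poly d z) \<le> (1 + D) * (1 + norm z) ^ degree d"
    proof -
      have "1 \<le> (1 + norm z) ^ degree d" by (rule one_le_power) simp
      then show ?thesis using D(2)[of z] unfolding distrib_right mult_1 by linarith
    qed
    moreover have "norm (poly d z) \<le> (1 + D) * (1 + norm z) ^ degree d"
    proof -
      have "0 \<le> (1 + norm z) ^ degree d" by simp
      then show ?thesis using D(2)[of z] unfolding distrib_right mult_1 by linarith
    qed
    ultimately have "C' * (1 + norm z) ^ k * (1 + norm (poly d z)) ^ k * norm (poly d z)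
      \<le> C' * (1 + norm z) ^ k * ((1 + D) * (1 + norm z) ^ degree d) ^ k * ((1 + D) * (1 + norm z) ^ degree d)"
      using D(1) by (intro mult_mono power_mono order_refl) (auto simp: C'_def)
    also have "\<dots> = C' * (1 + D) ^ Suc k * (1 + norm z) ^ n"
      by (simp add: n_def power_mult_distrib power_add mult_ac flip: power_mult)
    also have "\<dots> \<le> C' * (1 + D) ^ Suc k * (2 * norm z) ^ n"
      using z D(1) by (intro mult_left_mono power_mono) (auto simp: C'_def)
    finally show ?thesis using H[of z] by (simp add: power_mult_distrib mult_ac)
  qed
  define q where "q = (\<Sum>j\<le>n. Polynomial.monom ((deriv ^^ j) H 0 / fact j) j)"
  have Hq: "H z = poly q z" for z
    using Liouville_polynomial[OF entire growth, where \<xi> = z] by (simp add: q_def poly_sum poly_monom)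
  have "degree q \<le> n" unfolding q_def
    by (intro degree_sum_le) (auto intro: order_trans[OF degree_monom_le])
  moreover have "poly d z ^ Suc k * h z = poly q z" if "poly d z \<noteq> 0" for z
    using that Hq[of z] by (simp add: H_def)
  ultimately show ?thesis unfolding n_def by blast
qed

lemma lagrange_interpolation:
  fixes q :: "complex poly"
  assumes "degree q \<le> K" "inj_on \<nu> {..K}"
  shows "poly q x = (\<Sum>k\<le>K. poly q (\<nu> k) * (\<Prod>j\<in>{..K} - {k}. (x - \<nu> j) / (\<nu> k - \<nu> j)))"
proof -
  define r where "r = (\<Sum>k\<le>K. Polynomial.smult (poly q (\<nu> k)) (\<Prod>j\<in>{..K} - {k}. Polynomial.smult (1 / (\<nu> k - \<nu> j)) [:- \<nu> j, 1:]))"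
  have r: "poly r x = (\<Sum>k\<le>K. poly q (\<nu> k) * (\<Prod>j\<in>{..K} - {k}. (x - \<nu> j) / (\<nu> k - \<nu> j)))" for x
    by (simp add: r_def poly_sum poly_prod diff_divide_distrib)
  have "degree r \<le> K" unfolding r_def
  proof (intro degree_sum_le order_trans[OF degree_smult_le])
    fix k assume "k \<in> {..K}"
    have "degree (\<Prod>j\<in>{..K} - {k}. Polynomial.smult (1 / (\<nu> k - \<nu> j)) [:- \<nu> j, 1:]) \<le> (\<Sum>j\<in>{..K} - {k}. 1)"
      by (intro order_trans[OF degree_prod_sum_le] sum_mono) (auto intro: order_trans[OF degree_smult_le])
    also have "\<dots> = K" using \<open>k \<in> {..K}\<close> by simp
    finally show "degree (\<Prod>j\<in>{..K} - {k}. Polynomial.smult (1 / (\<nu> k - \<nu> j)) [:- \<nu> j, 1:]) \<le> K" .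
  qed simp
  have "q = r"
  proof (rule poly_eqI_degree[of "\<nu> ` {..K}"])
    fix x assume "x \<in> \<nu> ` {..K}"
    then obtain l where l: "l \<le> K" "x = \<nu> l" by auto
    have "poly r (\<nu> l) = (\<Sum>k\<in>{l}. poly q (\<nu> k) * (\<Prod>j\<in>{..K} - {k}. (\<nu> l - \<nu> j) / (\<nu> k - \<nu> j)))"
      unfolding r using l by (intro sum.mono_neutral_right) auto
    also have "\<dots> = poly q (\<nu> l)" using l assms(2) by (auto simp: inj_on_def intro!: prod.neutral split: if_splits)
    finally show "poly q x = poly r x" using l by simp
  qed (use assms \<open>degree r \<le> K\<close> in \<open>auto simp: card_image\<close>)
  then have "poly q x = poly r x" by simp
  also note r
  finally show ?thesis .
qed

text \<open>In a small box without zeros of \<open>\<Delta>\<close>, Lagrange interpolation in one coordinate after another expresses \<open>E\<close> by its values on a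
grid; the degree bound \<open>K\<close> is the same for all lines, so that the same \<open>K + 1\<close> nodes serve for all of them. Outside the box, \<open>E\<close> and the polynomial
agree by comparison along the line from the centre \<open>a\<close>.\<close>

theorem polynomial_on_lines_is_polyfun:
  fixes E :: "complex ^ 'n \<Rightarrow> complex"
  assumes \<Delta>: "polyfun \<Delta>" "\<Delta> a \<noteq> 0"
    and lines: "\<And>a v. \<Delta> a \<noteq> 0 \<Longrightarrow> \<exists>q. degree q \<le> K \<and> (\<forall>z. \<Delta> (a + z *s v) \<noteq> 0 \<longrightarrow> E (a + z *s v) = poly q z)"
  shows "\<exists>P. polyfun P \<and> (\<forall>s. \<Delta> s \<noteq> 0 \<longrightarrow> E s = P s)"
proof -
  have "open {s. \<Delta> s \<noteq> 0}"
    using open_Collect_neq[OF polyfun_continuous_on[OF \<Delta>(1)] continuous_on_const[of _ 0]] by simp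
  then obtain e where e: "e > 0" "ball a e \<subseteq> {s. \<Delta> s \<noteq> 0}" using \<Delta>(2) openE by blast
  define r where "r = e / CARD('n)"
  define Bx where "Bx = {s. \<forall>i. norm (s $ i - a $ i) < r}"
  have "r > 0" using e by (simp add: r_def)
  have Bx: "\<Delta> s \<noteq> 0" if "s \<in> Bx" for s
  proof -
    have "norm (s - a) \<le> (\<Sum>i\<in>UNIV. norm ((s - a) $ i))" by (simp add: norm_vec_def L2_set_le_sum)
    also have "\<dots> < (\<Sum>i\<in>(UNIV :: 'n set). r)" using that by (intro sum_strict_mono) (auto simp: Bx_def)
    also have "\<dots> = e" by (simp add: r_def)
    finally have "s \<in> ball a e" by (simp add: dist_norm norm_minus_commute)
    then show ?thesis using e(2) by blast
  qed
  have aB: "a \<in> Bx" using \<open>r > 0\<close> by (simp add: Bx_def)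
  define ovr where "ovr B s c = (\<chi> i. if i \<in> B then s $ i else c $ i)" for B and s c :: "complex ^ 'n"
  have ovrB: "ovr B s c \<in> Bx" if "s \<in> Bx" "c \<in> Bx" for B s c using that by (auto simp: Bx_def ovr_def)
  have claim: "\<exists>p. polyfun p \<and> (\<forall>s\<in>Bx. E (ovr B s c) = p s)" if "finite B" "c \<in> Bx" for B c
    using that
  proof (induction B arbitrary: c)
    case empty
    have "ovr {} s c = c" for s by (simp add: ovr_def vec_eq_iff)
    then show ?case by (intro exI[of _ "\<lambda>s. E c"]) (auto intro: polyfun_intros)
  next
    case (insert i B)
    \<comment> \<open>Nodes for the coordinate \<open>i\<close>, close enough to \<open>a\<close> to stay in the box.\<close>
    define \<nu> where "\<nu> k = a $ i + of_real (r * real k / real (Suc K))" for k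
    have inj: "inj_on \<nu> {..K}" using \<open>r > 0\<close> by (auto simp: inj_on_def \<nu>_def simp del: of_nat_Suc)
    define ck where "ck k = (\<chi> j. if j = i then \<nu> k else c $ j)" for k
    have ck: "ck k \<in> Bx" if "k \<le> K" for k
    proof -
      have "norm (\<nu> k - a $ i) = r * (real k / real (Suc K))"
        using \<open>r > 0\<close> by (simp add: \<nu>_def norm_divide norm_mult del: of_nat_Suc)
      also have "\<dots> < r * 1" using that \<open>r > 0\<close> by (intro mult_strict_left_mono) auto
      finally show ?thesis using insert.prems by (auto simp: ck_def Bx_def)
    qed
    have "\<forall>k. \<exists>p. k \<le> K \<longrightarrow> polyfun p \<and> (\<forall>s\<in>Bx. E (ovr B s (ck k)) = p s)"
      using insert.IH ck by blast
    then obtain p where p: "\<And>k. k \<le> K \<Longrightarrow> polyfun (p k)" "\<And>k s. k \<le> K \<Longrightarrow> s \<in> Bx \<Longrightarrow> E (ovr B s (ck k)) = p k s"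
      by metis
    define P where "P s = (\<Sum>k\<le>K. p k s * (\<Prod>j\<in>{..K} - {k}. (s $ i - \<nu> j) / (\<nu> k - \<nu> j)))" for s
    have "polyfun P" unfolding P_def[abs_def] divide_inverse by (intro polyfun_intros p(1)) auto
    moreover have "E (ovr (insert i B) s c) = P s" if s: "s \<in> Bx" for s
    proof -
      define b where "b = ovr (insert i B) s c"
      have bB: "b \<in> Bx" unfolding b_def using s insert.prems by (rule ovrB)
      obtain q where q: "degree q \<le> K" "\<And>z. \<Delta> (b + z *s axis i 1) \<noteq> 0 \<Longrightarrow> E (b + z *s axis i 1) = poly q z"
        using lines[OF Bx[OF bB], of "axis i 1"] by blast
      have bk: "b + (\<nu> k - s $ i) *s axis i 1 = ovr B s (ck k)" for k
        using insert.hyps by (auto simp: vec_eq_iff b_def ovr_def ck_def axis_def)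
      have inj': "inj_on (\<lambda>k. \<nu> k - s $ i) {..K}" using inj by (auto simp: inj_on_def)
      have "E b = poly q 0" using q(2)[of 0] Bx[OF bB] by simp
      also have "\<dots> = (\<Sum>k\<le>K. poly q (\<nu> k - s $ i) * (\<Prod>j\<in>{..K} - {k}. (0 - (\<nu> j - s $ i)) / ((\<nu> k - s $ i) - (\<nu> j - s $ i))))"
        by (rule lagrange_interpolation[OF q(1) inj'])
      also have "\<dots> = P s" unfolding P_def
      proof (intro sum.cong refl)
        fix k assume k: "k \<in> {..K}"
        have "poly q (\<nu> k - s $ i) = E (ovr B s (ck k))"
          using q(2)[of "\<nu> k - s $ i"] Bx[OF ovrB[OF s ck]] k unfolding bk by simp
        then show "poly q (\<nu> k - s $ i) * (\<Prod>j\<in>{..K} - {k}. (0 - (\<nu> j - s $ i)) / ((\<nu> k - s $ i) - (\<nu> j - s $ i))) =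
           p k s * (\<Prod>j\<in>{..K} - {k}. (s $ i - \<nu> j) / (\<nu> k - \<nu> j))"
          using p(2)[OF _ s] k by simp
      qed
      finally show ?thesis by (simp add: b_def)
    qed
    ultimately show ?case by blast
  qed
  obtain P where P: "polyfun P" "\<And>s. s \<in> Bx \<Longrightarrow> E (ovr UNIV s a) = P s" using claim[of UNIV a] aB by auto
  have EP: "E s = P s" if "s \<in> Bx" for s using P(2)[OF that] by (simp add: ovr_def)
  have "E s = P s" if s: "\<Delta> s \<noteq> 0" for s
  proof -
    obtain q where q: "\<And>z. \<Delta> (a + z *s (s - a)) \<noteq> 0 \<Longrightarrow> E (a + z *s (s - a)) = poly q z"
      using lines[OF \<Delta>(2), of "s - a"] by blast
    obtain q' :: "complex poly" where q': "\<And>z. P (a + z *s (s - a)) = poly q' z"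
      using polyfun_line[OF P(1)] by blast
    have op: "open {z. a + z *s (s - a) \<in> Bx}"
    proof (rule line_preimage_open)
      have "Bx = (\<Inter>i. {s. norm (s $ i - a $ i) < r})" by (auto simp: Bx_def)
      also have "open \<dots>" by (intro open_INT ballI open_Collect_less continuous_intros) auto
      finally show "open Bx" .
    qed
    have "q - q' = 0"
    proof (rule ccontr)
      assume "q - q' \<noteq> 0"
      then have "finite {z. poly (q - q') z = 0}" by (rule poly_roots_finite)
      moreover have "{z. a + z *s (s - a) \<in> Bx} \<subseteq> {z. poly (q - q') z = 0}"
      proof
        fix z assume "z \<in> {z. a + z *s (s - a) \<in> Bx}"
        then have z: "a + z *s (s - a) \<in> Bx" by simp
        have "poly q z = poly q' z" using q[OF Bx[OF z]] q'[of z] EP[OF z] by metis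
        then show "z \<in> {z. poly (q - q') z = 0}" by simp
      qed
      moreover have "0 \<in> {z. a + z *s (s - a) \<in> Bx}" using aB by simp
      ultimately show False using op by (metis finite_subset finite_imp_not_open empty_iff)
    qed
    then show ?thesis using q[of 1] q'[of 1] s by simp
  qed
  with P(1) show ?thesis by blast
qed

section \<open>Discriminants and local branches\<close>

text \<open>Cauchy's bound for the roots of a polynomial.\<close>

lemma root_bound:
  fixes T :: complex
  assumes "(\<Sum>k\<le>K. q k * T ^ k) = 0" "q K \<noteq> 0"
  shows "norm T \<le> 1 + (\<Sum>k\<le>K. norm (q k)) / norm (q K)"
proof (cases "norm T \<le> 1")
  case True
  moreover have "0 \<le> (\<Sum>k\<le>K. norm (q k)) / norm (q K)" by (simp add: sum_nonneg)
  ultimately show ?thesis by linarith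
next
  case False
  then obtain K' where K: "K = Suc K'" using assms by (cases K) auto
  have "q K * T ^ K = - (\<Sum>k\<le>K'. q k * T ^ k)"
    using assms(1) by (simp add: K add_eq_0_iff add.commute)
  then have "norm (q K) * norm T ^ K = norm (\<Sum>k\<le>K'. q k * T ^ k)"
    by (metis norm_minus_cancel norm_mult norm_power)
  also have "\<dots> \<le> (\<Sum>k\<le>K'. norm (q k) * norm T ^ K')"
    using False by (intro order_trans[OF norm_sum] sum_mono) (auto simp: norm_mult norm_power intro!: mult_left_mono power_increasing)
  also have "\<dots> = (\<Sum>k\<le>K'. norm (q k)) * norm T ^ K'" by (simp add: sum_distrib_right)
  also have "\<dots> \<le> (\<Sum>k\<le>K. norm (q k)) * norm T ^ K'"
    by (intro mult_right_mono) (auto simp: K)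
  finally have "norm T ^ K' * (norm (q K) * norm T) \<le> norm T ^ K' * (\<Sum>k\<le>K. norm (q k))"
    by (simp add: K mult_ac)
  moreover have "norm T ^ K' > 0" using False by (intro zero_less_power) linarith
  ultimately have "norm (q K) * norm T \<le> (\<Sum>k\<le>K. norm (q k))" by simp
  then have "norm T \<le> (\<Sum>k\<le>K. norm (q k)) / norm (q K)" using assms(2) by (simp add: field_simps)
  then show ?thesis by linarith
qed

lemma algebraic_dependence_lead:
  fixes G :: "complex ^ 'n \<Rightarrow> complex ^ 'n"
  assumes "polymap G" "polyfun g"
  shows "\<exists>K q. (\<forall>k. polyfun (q k)) \<and> (\<exists>s. q K s \<noteq> 0) \<and> (\<forall>x. (\<Sum>k\<le>K. q k (G x) * g x ^ k) = 0)"
proof -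
  obtain K q where q: "\<And>k. polyfun (q k)" "\<exists>k\<le>K. \<exists>s. q k s \<noteq> 0" "\<And>x. (\<Sum>k\<le>K. q k (G x) * g x ^ k) = 0"
    using algebraic_dependence[OF assms] by blast
  define L where "L = Max {k. k \<le> K \<and> (\<exists>s. q k s \<noteq> 0)}"
  have fin: "finite {k. k \<le> K \<and> (\<exists>s. q k s \<noteq> 0)}" by simp
  have "L \<in> {k. k \<le> K \<and> (\<exists>s. q k s \<noteq> 0)}" unfolding L_def using q(2) by (intro Max_in fin) auto
  moreover have zero: "q k s = 0" if "k \<le> K" "\<not> k \<le> L" for k s
    using Max_ge[OF fin, of k] that unfolding L_def by blast
  have "(\<Sum>k\<le>L. q k (G x) * g x ^ k) = (\<Sum>k\<le>K. q k (G x) * g x ^ k)" for x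
    using calculation zero by (intro sum.mono_neutral_left) auto
  ultimately show ?thesis using q(1,3) by (intro exI[of _ L] exI[of _ q]) auto
qed

text \<open>A common power of \<open>g\<close> is cancelled from the relation. A nonzero constant term will bound \<open>1 / g\<close>, a root of the reversed
polynomial.\<close>

lemma algebraic_dependence_const:
  fixes G :: "complex ^ 'n \<Rightarrow> complex ^ 'n"
  assumes "polymap G" "polyfun g" "g a \<noteq> 0"
  shows "\<exists>K q. (\<forall>k. polyfun (q k)) \<and> (\<exists>s. q 0 s \<noteq> 0) \<and> (\<forall>x. (\<Sum>k\<le>K. q k (G x) * g x ^ k) = 0)"
proof -
  obtain K q where q: "\<And>k. polyfun (q k)" "\<exists>k\<le>K. \<exists>s. q k s \<noteq> 0" "\<And>x. (\<Sum>k\<le>K. q k (G x) * g x ^ k) = 0"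
    using algebraic_dependence[OF assms(1,2)] by blast
  define l where "l = (LEAST k. k \<le> K \<and> (\<exists>s. q k s \<noteq> 0))"
  have l: "l \<le> K" "\<exists>s. q l s \<noteq> 0" using LeastI_ex[of "\<lambda>k. k \<le> K \<and> (\<exists>s. q k s \<noteq> 0)"] q(2) unfolding l_def by auto
  have zero: "q k s = 0" if "k < l" for k s
    using not_less_Least[of k "\<lambda>k. k \<le> K \<and> (\<exists>s. q k s \<noteq> 0)"] that l unfolding l_def by auto
  have "g x ^ l * (\<Sum>k\<le>K - l. q (k + l) (G x) * g x ^ k) = 0" for x
  proof -
    have "(\<Sum>k\<le>K. q k (G x) * g x ^ k) = (\<Sum>k\<in>{l..K}. q k (G x) * g x ^ k)"
      using zero by (intro sum.mono_neutral_right) auto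
    also have "\<dots> = (\<Sum>k\<in>{0..K - l}. q (k + l) (G x) * g x ^ (k + l))"
      using sum.shift_bounds_cl_nat_ivl[of "\<lambda>k. q k (G x) * g x ^ k" 0 l "K - l"] l by simp
    finally show ?thesis using q(3)[of x] by (simp add: sum_distrib_left power_add mult_ac atMost_atLeast0)
  qed
  then have "(\<Sum>k\<le>K - l. q (k + l) (G x) * g x ^ k) = 0" for x
    by (rule polyfun_mult_eq_0[rotated 2, of "\<lambda>x. g x ^ l" "\<lambda>x. \<Sum>k\<le>K - l. q (k + l) (G x) * g x ^ k" a])
      (use assms q(1) in \<open>auto intro!: polyfun_intros polyfun_compose[OF _ assms(1)]\<close>)
  then show ?thesis using q(1) l(2)
    by (intro exI[of _ "K - l"] exI[of _ "\<lambda>k. q (k + l)"]) auto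
qed

text \<open>The analogue of \<open>weight\<close> in several variables.\<close>

definition vweight :: "(complex ^ 'n \<Rightarrow> complex) \<Rightarrow> complex ^ 'n \<Rightarrow> real" where
  "vweight \<Delta> s = (1 + norm s) * (1 + 1 / norm (\<Delta> s))"

lemma vweight_ge: "1 \<le> vweight \<Delta> s" "1 + norm s \<le> vweight \<Delta> s" "1 / norm (\<Delta> s) \<le> vweight \<Delta> s"
proof -
  have "1 * 1 \<le> vweight \<Delta> s" unfolding vweight_def by (rule mult_mono) auto
  then show "1 \<le> vweight \<Delta> s" by simp
  have "(1 + norm s) * 1 \<le> vweight \<Delta> s" unfolding vweight_def by (rule mult_mono) auto
  then show "1 + norm s \<le> vweight \<Delta> s" by simp
  have "1 * (1 / norm (\<Delta> s)) \<le> vweight \<Delta> s" unfolding vweight_def by (rule mult_mono) auto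
  then show "1 / norm (\<Delta> s) \<le> vweight \<Delta> s" by simp
qed

lemma vweight_power_mono: "k \<le> l \<Longrightarrow> vweight \<Delta> s ^ k \<le> vweight \<Delta> s ^ l"
  by (intro power_increasing vweight_ge)

text \<open>Since \<open>1 / a = b / \<Delta>\<close>, a quotient whose denominator divides \<open>\<Delta>\<close> has moderate growth.\<close>

lemma quotient_growth:
  fixes q :: "nat \<Rightarrow> complex ^ 'n \<Rightarrow> complex"
  assumes q: "\<And>k. polyfun (q k)" and b: "polyfun b" and \<Delta>: "\<And>s. \<Delta> s = a s * b s"
  shows "\<exists>C m. C \<ge> 0 \<and> (\<forall>s. \<Delta> s \<noteq> 0 \<longrightarrow> 1 + (\<Sum>k\<le>K. norm (q k s)) / norm (a s) \<le> C * vweight \<Delta> s ^ m)"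
proof -
  have "\<forall>k. \<exists>C m. C \<ge> 0 \<and> (\<forall>x. norm (q k x * b x) \<le> C * (1 + norm x) ^ m)"
    using polyfun_growth[OF polyfun.mult[OF q b]] by blast
  then obtain C m where C: "\<And>k. C k \<ge> 0" "\<And>k x. norm (q k x * b x) \<le> C k * (1 + norm x) ^ m k" by metis
  define M where "M = (\<Sum>k\<le>K. m k)"
  define D where "D = (\<Sum>k\<le>K. C k)"
  have "1 + (\<Sum>k\<le>K. norm (q k s)) / norm (a s) \<le> (1 + D) * vweight \<Delta> s ^ Suc M" if nz: "\<Delta> s \<noteq> 0" for s
  proof -
    have w: "0 \<le> vweight \<Delta> s" using vweight_ge(1)[of \<Delta> s] by linarith
    have "(\<Sum>k\<le>K. norm (q k s)) / norm (a s) = (\<Sum>k\<le>K. norm (q k s * b s)) * (1 / norm (\<Delta> s))"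
      using nz by (simp add: \<Delta> norm_mult flip: sum_distrib_right)
    also have "\<dots> \<le> (D * vweight \<Delta> s ^ M) * vweight \<Delta> s"
    proof (intro mult_mono vweight_ge)
      show "(\<Sum>k\<le>K. norm (q k s * b s)) \<le> D * vweight \<Delta> s ^ M" unfolding D_def sum_distrib_right
      proof (rule sum_mono)
        fix k assume k: "k \<in> {..K}"
        have "m k \<le> M" unfolding M_def using k by (intro member_le_sum) auto
        have "norm (q k s * b s) \<le> C k * (1 + norm s) ^ m k" by (rule C)
        also have "\<dots> \<le> C k * vweight \<Delta> s ^ m k" using C(1) by (intro mult_left_mono power_mono vweight_ge) auto
        also have "\<dots> \<le> C k * vweight \<Delta> s ^ M" using C(1) \<open>m k \<le> M\<close> by (intro mult_left_mono vweight_power_mono) auto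
        finally show "norm (q k s * b s) \<le> C k * vweight \<Delta> s ^ M" .
      qed
      then show "0 \<le> D * vweight \<Delta> s ^ M" by (rule order_trans[rotated]) (simp add: sum_nonneg)
    qed simp
    also have "\<dots> = D * vweight \<Delta> s ^ Suc M" by simp
    finally have "(\<Sum>k\<le>K. norm (q k s)) / norm (a s) \<le> D * vweight \<Delta> s ^ Suc M" .
    moreover have "1 \<le> vweight \<Delta> s ^ Suc M" by (intro one_le_power vweight_ge)
    ultimately show ?thesis unfolding distrib_right mult_1 by linarith
  qed
  moreover have "0 \<le> 1 + D" unfolding D_def using C(1) by (simp add: sum_nonneg)
  ultimately show ?thesis by blast
qed

text \<open>Over the complement of \<open>\<Delta> = 0\<close> the map \<open>G\<close> is a finite etale covering, as \<open>local_branches\<close> shows; the two estimates say that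
it is tempered along this hypersurface and at infinity.\<close>

definition etale_discriminant ::
  "(complex ^ 'n \<Rightarrow> complex ^ 'n) \<Rightarrow> (complex ^ 'n \<Rightarrow> complex) \<Rightarrow> nat \<Rightarrow> real \<Rightarrow> nat \<Rightarrow> bool" where
  "etale_discriminant G \<Delta> N C m \<longleftrightarrow> polyfun \<Delta> \<and> C \<ge> 0 \<and>
     (\<forall>s. \<Delta> s \<noteq> 0 \<longrightarrow> finite {x. G x = s} \<and> card {x. G x = s} \<le> N) \<and>
     (\<forall>x. \<Delta> (G x) \<noteq> 0 \<longrightarrow> det (jac_matrix G x) \<noteq> 0 \<and> norm x \<le> C * vweight \<Delta> (G x) ^ m \<and>
        inverse (norm (det (jac_matrix G x))) \<le> C * vweight \<Delta> (G x) ^ m)"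

text \<open>The coordinates and the Jacobian determinant satisfy algebraic equations over \<open>\<complex>[G]\<close>. Let \<open>\<Delta>\<close> be the product of the leading
coefficients of the equations for the coordinates and of the constant coefficient of the equation for the determinant. Where it does not vanish, the equations leave finitely
many values for each coordinate, and \<open>root_bound\<close> estimates the coordinates and, by the reversed equation, the inverse of the determinant.\<close>

theorem etale_discriminant_exists:
  fixes G :: "complex ^ 'n \<Rightarrow> complex ^ 'n"
  assumes G: "polymap G" and M: "det (jac_matrix G a) \<noteq> 0"
  shows "\<exists>\<Delta> N C m. (\<exists>s. \<Delta> s \<noteq> 0) \<and> etale_discriminant G \<Delta> N C m"
proof -
  define M where "M x = det (jac_matrix G x)" for x
  have "\<forall>i. \<exists>K q. (\<forall>k. polyfun (q k)) \<and> (\<exists>s. q K s \<noteq> 0) \<and> (\<forall>x. (\<Sum>k\<le>K. q k (G x) * (x $ i) ^ k) = 0)"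
    using algebraic_dependence_lead[OF G polyfun.coord] by blast
  then obtain K q where q: "\<And>i k. polyfun (q i k)" "\<And>i. \<exists>s. q i (K i) s \<noteq> 0"
    "\<And>i x. (\<Sum>k\<le>K i. q i k (G x) * (x $ i) ^ k) = 0" by metis
  obtain L p where p: "\<And>k. polyfun (p k)" "\<exists>s. p 0 s \<noteq> 0" "\<And>x. (\<Sum>k\<le>L. p k (G x) * M x ^ k) = 0"
    using algebraic_dependence_const[OF G polyfun_det_jac[OF G] M] unfolding M_def by blast
  define \<Delta> where "\<Delta> s = p 0 s * (\<Prod>i\<in>UNIV. q i (K i) s)" for s
  have pq: "polyfun (\<lambda>s. \<Prod>i\<in>A. q i (K i) s)" for A by (intro polyfun_intros q)
  have \<Delta>: "polyfun \<Delta>" unfolding \<Delta>_def[abs_def] by (intro polyfun_intros p q)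
  have nz: "\<exists>s. \<Delta> s \<noteq> 0"
  proof (rule ccontr)
    assume "\<not> ?thesis"
    then have "p 0 s * (\<Prod>i\<in>UNIV. q i (K i) s) = 0" for s by (simp add: \<Delta>_def)
    then have "(\<Prod>i\<in>UNIV. q i (K i) s) = 0" for s using polyfun_mult_eq_0[OF p(1) pq] p(2) by blast
    moreover have "\<exists>s. (\<Prod>i\<in>UNIV. q i (K i) s) \<noteq> 0" by (rule polyfun_prod_nonzero) (use q in auto)
    ultimately show False by blast
  qed
  have \<Delta>q: "\<Delta> s = q i (K i) s * (p 0 s * (\<Prod>j\<in>-{i}. q j (K j) s))" for i s
  proof -
    have "(\<Prod>j\<in>UNIV. q j (K j) s) = (\<Prod>j\<in>insert i (-{i}). q j (K j) s)" by (intro prod.cong) auto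
    then show ?thesis by (simp add: \<Delta>_def mult_ac)
  qed
  have "\<forall>i. \<exists>C m. C \<ge> 0 \<and> (\<forall>s. \<Delta> s \<noteq> 0 \<longrightarrow> 1 + (\<Sum>k\<le>K i. norm (q i k s)) / norm (q i (K i) s) \<le> C * vweight \<Delta> s ^ m)"
    by (intro allI quotient_growth[OF q(1) polyfun.mult[OF p(1) pq] \<Delta>q])
  then obtain C m where C: "\<And>i. C i \<ge> 0" "\<And>i s. \<Delta> s \<noteq> 0 \<Longrightarrow>
      1 + (\<Sum>k\<le>K i. norm (q i k s)) / norm (q i (K i) s) \<le> C i * vweight \<Delta> s ^ m i" by metis
  obtain C' m' where C': "C' \<ge> 0" "\<And>s. \<Delta> s \<noteq> 0 \<Longrightarrow>
      1 + (\<Sum>l\<le>L. norm (p (L - l) s)) / norm (p 0 s) \<le> C' * vweight \<Delta> s ^ m'"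
    using quotient_growth[of "\<lambda>l. p (L - l)" _ \<Delta> "p 0" L, OF p(1) pq \<Delta>_def] by blast
  define D where "D = C' + (\<Sum>i\<in>UNIV. C i)"
  define n where "n = m' + (\<Sum>i\<in>UNIV. m i)"
  have mult: "c * vweight \<Delta> s ^ l \<le> d * vweight \<Delta> s ^ n" if "0 \<le> c" "c \<le> d" "l \<le> n" for c d l s
  proof -
    have "0 \<le> vweight \<Delta> s ^ l" using vweight_ge(1)[of \<Delta> s] by simp
    then show ?thesis using that by (intro mult_mono vweight_power_mono) auto
  qed
  have x_bound: "norm (x $ i) \<le> C i * vweight \<Delta> (G x) ^ m i" if "\<Delta> (G x) \<noteq> 0" for x i
  proof -
    have "q i (K i) (G x) \<noteq> 0" using that \<Delta>q[of "G x" i] by auto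
    from root_bound[OF q(3) this] C(2)[OF that, of i] show ?thesis by linarith
  qed
  have "det (jac_matrix G x) \<noteq> 0 \<and> norm x \<le> D * vweight \<Delta> (G x) ^ n \<and>
        inverse (norm (det (jac_matrix G x))) \<le> D * vweight \<Delta> (G x) ^ n" if x: "\<Delta> (G x) \<noteq> 0" for x
  proof (intro conjI)
    have p0: "p 0 (G x) \<noteq> 0" using x by (simp add: \<Delta>_def)
    show M0: "det (jac_matrix G x) \<noteq> 0"
    proof
      assume "det (jac_matrix G x) = 0"
      then have "(\<Sum>k\<le>L. p k (G x) * M x ^ k) = (\<Sum>k\<le>L. if k = 0 then p 0 (G x) else 0)"
        by (intro sum.cong) (auto simp: M_def)
      then show False using p(3) p0 by simp
    qed
    have "norm x \<le> (\<Sum>i\<in>UNIV. norm (x $ i))" by (simp add: norm_vec_def L2_set_le_sum)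
    also have "\<dots> \<le> (\<Sum>i\<in>UNIV. C i * vweight \<Delta> (G x) ^ n)"
    proof (intro sum_mono order_trans[OF x_bound[OF x]] mult C order_refl)
      show "m i \<le> n" for i unfolding n_def by (intro trans_le_add2 member_le_sum) auto
    qed
    also have "\<dots> \<le> D * vweight \<Delta> (G x) ^ n" unfolding sum_distrib_right[symmetric] D_def
      by (intro mult) (auto intro: sum_nonneg C C'(1))
    finally show "norm x \<le> D * vweight \<Delta> (G x) ^ n" .
    have "(\<Sum>l\<le>L. p (L - l) (G x) * (1 / M x) ^ l) = (1 / M x) ^ L * (\<Sum>k\<le>L. p k (G x) * M x ^ k)"
    proof -
      have "(\<Sum>l\<le>L. p (L - l) (G x) * (1 / M x) ^ l) = (\<Sum>k\<le>L. p k (G x) * (1 / M x) ^ (L - k))"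
        by (rule sum.reindex_bij_witness[of _ "\<lambda>k. L - k" "\<lambda>k. L - k"]) auto
      also have "\<dots> = (\<Sum>k\<le>L. (1 / M x) ^ L * (p k (G x) * M x ^ k))"
      proof (intro sum.cong refl)
        fix k assume "k \<in> {..L}"
        then have "(1 / M x) ^ L = (1 / M x) ^ (L - k) * (1 / M x) ^ k" by (simp flip: power_add)
        then show "p k (G x) * (1 / M x) ^ (L - k) = (1 / M x) ^ L * (p k (G x) * M x ^ k)"
          using M0 by (simp add: M_def power_divide)
      qed
      finally show ?thesis by (simp add: sum_distrib_left)
    qed
    then have "(\<Sum>l\<le>L. p (L - l) (G x) * (1 / M x) ^ l) = 0" using p(3) by simp
    from root_bound[of "\<lambda>l. p (L - l) (G x)", OF this] p0
    have "norm (1 / M x) \<le> 1 + (\<Sum>l\<le>L. norm (p (L - l) (G x))) / norm (p 0 (G x))" by simp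
    also have "\<dots> \<le> C' * vweight \<Delta> (G x) ^ m'" by (rule C'(2)[OF x])
    also have "\<dots> \<le> D * vweight \<Delta> (G x) ^ n"
      using C C' by (intro mult) (auto simp: D_def n_def intro!: sum_nonneg)
    finally show "inverse (norm (det (jac_matrix G x))) \<le> D * vweight \<Delta> (G x) ^ n"
      by (simp add: M_def norm_divide inverse_eq_divide)
  qed
  moreover have "finite {x. G x = s} \<and> card {x. G x = s} \<le> (\<Prod>i\<in>UNIV. K i)" if s: "\<Delta> s \<noteq> 0" for s
  proof -
    define P where "P i = (\<Sum>k\<le>K i. Polynomial.monom (q i k s) k)" for i
    have P: "P i \<noteq> 0" "degree (P i) \<le> K i" for i
    proof -
      have "coeff (P i) (K i) = q i (K i) s" by (simp add: P_def coeff_sum)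
      moreover have "q i (K i) s \<noteq> 0" using s \<Delta>q[of s i] by auto
      ultimately show "P i \<noteq> 0" by auto
      show "degree (P i) \<le> K i" unfolding P_def
        by (intro degree_sum_le) (auto intro: order_trans[OF degree_monom_le])
    qed
    define A where "A i = {t. poly (P i) t = 0}" for i
    have finA: "finite (A i)" for i unfolding A_def by (rule poly_roots_finite[OF P(1)])
    have cardA: "card (A i) \<le> K i" for i
      unfolding A_def using card_poly_roots_bound[OF P(1)] P(2) by (rule order_trans)
    have "x \<in> vec_lambda ` (PiE UNIV A)" if "G x = s" for x
    proof (rule image_eqI[of _ _ "vec_nth x"])
      show "vec_nth x \<in> PiE UNIV A" using q(3)[of _ x] that
        by (auto simp: A_def P_def poly_sum poly_monom)
    qed simp
    then have sub: "{x. G x = s} \<subseteq> vec_lambda ` (PiE UNIV A)" by blast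
    have finP: "finite (PiE UNIV A)" by (intro finite_PiE finA) auto
    have "card {x. G x = s} \<le> card (PiE UNIV A)"
      using card_mono[OF finite_imageI[OF finP] sub] card_image_le[OF finP, of vec_lambda] by linarith
    also have "\<dots> \<le> (\<Prod>i\<in>UNIV. K i)" by (simp add: card_PiE) (intro prod_mono, auto simp: cardA)
    finally show ?thesis using finite_subset[OF sub finite_imageI[OF finP]] by blast
  qed
  moreover have "D \<ge> 0" unfolding D_def using C(1) C'(1) by (simp add: sum_nonneg)
  ultimately show ?thesis using \<Delta> nz unfolding etale_discriminant_def by blast
qed

text \<open>The inverse function theorem yields one branch through each point of the fibre over \<open>s0\<close>. These branches exhaust the nearby
fibres: by the estimate on \<open>x\<close>, all points over \<open>s\<close> near \<open>s0\<close> stay in a fixed ball, and the part \<open>K\<close> of that ball away from the branches has a compact image that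
does not contain \<open>s0\<close>.\<close>

theorem local_branches:
  fixes G :: "complex ^ 'n \<Rightarrow> complex ^ 'n"
  assumes G: "polymap G" and E: "etale_discriminant G \<Delta> N C m" and s0: "\<Delta> s0 \<noteq> 0"
  shows "\<exists>e>0. \<exists>br. (\<forall>x. G x = s0 \<longrightarrow> br x s0 = x) \<and> (\<forall>s\<in>ball s0 e. \<Delta> s \<noteq> 0 \<and> bij_betw (\<lambda>x. br x s) {x. G x = s0} {x. G x = s}) \<and>
     (\<forall>x a v. G x = s0 \<longrightarrow> continuous_on {z. a + z *s v \<in> ball s0 e} (\<lambda>z. lift_velocity G v (br x (a + z *s v))) \<and>
        (\<forall>z. a + z *s v \<in> ball s0 e \<longrightarrow>
          ((\<lambda>z. br x (a + z *s v)) has_derivative (\<lambda>h. h *s lift_velocity G v (br x (a + z *s v)))) (at z)))"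
proof -
  define S where "S = {x. G x = s0}"
  have \<Delta>: "polyfun \<Delta>" and C: "C \<ge> 0" and fin: "finite S" using E s0 by (auto simp: etale_discriminant_def S_def)
  have nzM: "det (jac_matrix G x) \<noteq> 0" if "x \<in> S" for x using E s0 that by (auto simp: etale_discriminant_def S_def)
  define chart where "chart x U V g \<longleftrightarrow> open U \<and> x \<in> U \<and> open V \<and> G x \<in> V \<and> homeomorphism U V G g \<and>
    (\<forall>y\<in>U. det (jac_matrix G y) \<noteq> 0) \<and> (\<forall>y\<in>V. (g has_derivative
        (\<lambda>h. inverse (det (jac_matrix G (g y))) *s adj_vec (jac_matrix G (g y)) h)) (at y))" for x U V g
  have "\<exists>U V g. chart x U V g" if x: "x \<in> S" for x
    by (rule polymap_local_inverse[OF G nzM[OF x]]) (unfold chart_def, blast)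
  then obtain U V br where ch: "\<And>x. x \<in> S \<Longrightarrow> chart x (U x) (V x) (br x)" by metis
  \<comment> \<open>Balls of radius \<open>\<delta>\<close> around the points of the fibre are disjoint, which keeps the branches apart.\<close>
  obtain \<delta> where \<delta>: "\<delta> > 0" "\<And>x y. x \<in> S \<Longrightarrow> y \<in> S \<Longrightarrow> x \<noteq> y \<Longrightarrow> 2 * \<delta> \<le> dist x y"
  proof -
    obtain d where d: "\<And>x. d x > 0" "\<And>x y. y \<in> S \<Longrightarrow> y \<noteq> x \<Longrightarrow> d x \<le> dist x y"
      using finite_set_avoid[OF fin] by metis
    define r where "r = Min (insert 1 (d ` S))"
    have "r > 0" using d(1) fin by (simp add: r_def)
    moreover have "r \<le> dist x y" if "x \<in> S" "y \<in> S" "x \<noteq> y" for x y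
    proof -
      have "r \<le> d x" unfolding r_def using fin that by (intro Min_le) auto
      then show ?thesis using d(2)[of y x] that by simp
    qed
    ultimately show ?thesis using that[of "r / 2"] by simp
  qed
  define W where "W x = U x \<inter> ball x \<delta>" for x
  define O' where "O' x = {s \<in> V x. br x s \<in> ball x \<delta>}" for x
  have opO: "open (O' x)" "s0 \<in> O' x" if "x \<in> S" for x
  proof -
    have "continuous_on (V x) (br x)" "open (V x)" using ch[OF that] by (auto simp: chart_def homeomorphism_def)
    then show "open (O' x)" unfolding O'_def
      using continuous_open_preimage[of "V x" "br x" "ball x \<delta>"] by (simp add: vimage_def Int_def)
    have "G x = s0" using that by (simp add: S_def)
    then show "s0 \<in> O' x" using ch[OF that] \<delta>(1) by (auto simp: O'_def chart_def homeomorphism_def)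
  qed
  define B where "B = C * vweight \<Delta> s0 ^ m + 1"
  have "isCont (\<lambda>s. C * vweight \<Delta> s ^ m) s0"
    unfolding vweight_def
    using has_derivative_continuous[OF polyfun_has_derivative[OF \<Delta>]] s0 by (intro continuous_intros) auto
  from order_tendstoD(2)[OF isCont_tendsto_nhds[OF this], of B]
  have ev1: "\<forall>\<^sub>F s in nhds s0. C * vweight \<Delta> s ^ m < B" by (simp add: B_def)
  have "open {s. \<Delta> s \<noteq> 0}"
    using open_Collect_neq[OF polyfun_continuous_on[OF \<Delta>] continuous_on_const[of _ 0]] by simp
  then have ev2: "\<forall>\<^sub>F s in nhds s0. \<Delta> s \<noteq> 0" using s0 eventually_nhds_in_open[of "{s. \<Delta> s \<noteq> 0}" s0] by simp
  have ev3: "\<forall>\<^sub>F s in nhds s0. s \<in> (\<Inter>x\<in>S. O' x)"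
    using opO fin by (intro eventually_nhds_in_open open_INT) auto
  define K where "K = cball 0 B - (\<Union>x\<in>S. W x)"
  have "compact K" unfolding K_def
    using ch by (intro compact_diff compact_cball open_UN) (auto simp: W_def chart_def)
  then have "compact (G ` K)" by (intro compact_continuous_image polymap_continuous_on[OF G])
  then have "open (- (G ` K))" using compact_imp_closed by blast
  moreover have "s0 \<notin> G ` K"
  proof
    assume "s0 \<in> G ` K"
    then obtain x where "x \<in> K" "x \<in> S" by (auto simp: S_def)
    then show False using ch[of x] \<delta>(1) by (auto simp: K_def W_def chart_def)
  qed
  ultimately have ev4: "\<forall>\<^sub>F s in nhds s0. s \<in> - (G ` K)" by (intro eventually_nhds_in_open) auto
  have "\<forall>\<^sub>F s in nhds s0. C * vweight \<Delta> s ^ m < B \<and> \<Delta> s \<noteq> 0 \<and> s \<in> (\<Inter>x\<in>S. O' x) \<and> s \<in> - (G ` K)"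
    using ev1 ev2 ev3 ev4 by eventually_elim blast
  then obtain e where e: "e > 0" "\<And>s. dist s s0 < e \<Longrightarrow> C * vweight \<Delta> s ^ m < B \<and> \<Delta> s \<noteq> 0 \<and> s \<in> (\<Inter>x\<in>S. O' x) \<and> s \<in> - (G ` K)"
    unfolding eventually_nhds_metric by blast
  have bij: "\<Delta> s \<noteq> 0 \<and> bij_betw (\<lambda>x. br x s) S {x. G x = s}" if "s \<in> ball s0 e" for s
  proof -
    have s: "C * vweight \<Delta> s ^ m < B" "\<Delta> s \<noteq> 0" "\<And>x. x \<in> S \<Longrightarrow> s \<in> O' x" "s \<notin> G ` K"
      using e(2)[of s] that by (auto simp: dist_commute)
    have Gs: "G (br x s) = s" "br x s \<in> ball x \<delta>" if "x \<in> S" for x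
      using s(3)[OF that] ch[OF that] by (auto simp: O'_def chart_def homeomorphism_def)
    have "inj_on (\<lambda>x. br x s) S"
    proof (rule inj_onI, rule ccontr)
      fix x y assume xy: "x \<in> S" "y \<in> S" "br x s = br y s" "x \<noteq> y"
      then have "dist x (br x s) < \<delta>" "dist y (br x s) < \<delta>" using Gs(2)[of x] Gs(2)[of y] by auto
      then have "dist x y < 2 * \<delta>" using dist_triangle2[of x y "br x s"] by linarith
      then show False using \<delta>(2)[OF xy(1,2,4)] by simp
    qed
    moreover have "(\<lambda>x. br x s) ` S = {x. G x = s}"
    proof (intro equalityI subsetI)
      fix y assume "y \<in> {x. G x = s}"
      then have y: "G y = s" by simp
      have "norm y \<le> B" using E s(1,2) y unfolding etale_discriminant_def by force
      then obtain x where x: "x \<in> S" "y \<in> W x" using s(4) y by (force simp: K_def)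
      have "br x (G y) = y" using ch[OF x(1)] x(2) by (auto simp: W_def chart_def homeomorphism_def)
      then show "y \<in> (\<lambda>x. br x s) ` S" using x(1) y by (intro image_eqI[of _ _ x]) auto
    qed (use Gs in auto)
    ultimately show ?thesis using s(2) by (simp add: bij_betw_def)
  qed
  show ?thesis unfolding S_def[symmetric]
  proof (intro exI[of _ e] exI[of _ br] conjI e(1) ballI allI impI)
    fix x assume "G x = s0"
    then have "x \<in> S" by (simp add: S_def)
    then show "br x s0 = x" using ch[OF \<open>x \<in> S\<close>] \<open>G x = s0\<close> by (auto simp: chart_def homeomorphism_def)
  next
    fix s assume s: "s \<in> ball s0 e"
    show "\<Delta> s \<noteq> 0" "bij_betw (\<lambda>x. br x s) S {x. G x = s}" using bij[OF s] by blast+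
  next
    fix x a v assume "G x = s0"
    then have x: "x \<in> S" by (simp add: S_def)
    have sub: "ball s0 e \<subseteq> V x" using e(2) x by (auto simp: O'_def dist_commute)
    note c = ch[OF x, unfolded chart_def]
    have line: "((\<lambda>z. br x (a + z *s v)) has_derivative (\<lambda>h. h *s lift_velocity G v (br x (a + z *s v)))) (at z) \<and>
      continuous_on {z. a + z *s v \<in> V x} (\<lambda>z. lift_velocity G v (br x (a + z *s v)))" if "a + z *s v \<in> V x" for z
      using local_inverse_line[OF G, of "V x" "U x" "br x" a z v] c that by blast
    show "continuous_on {z. a + z *s v \<in> ball s0 e} (\<lambda>z. lift_velocity G v (br x (a + z *s v)))"
    proof (cases "\<exists>z. a + z *s v \<in> V x")
      case True
      then have "continuous_on {z. a + z *s v \<in> V x} (\<lambda>z. lift_velocity G v (br x (a + z *s v)))" using line by blast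
      then show ?thesis by (rule continuous_on_subset) (use sub in blast)
    next
      case False
      then have "{z. a + z *s v \<in> ball s0 e} = {}" using sub by blast
      then show ?thesis by simp
    qed
    fix z assume "a + z *s v \<in> ball s0 e"
    then show "((\<lambda>z. br x (a + z *s v)) has_derivative (\<lambda>h. h *s lift_velocity G v (br x (a + z *s v)))) (at z)"
      using line sub by blast
  qed
qed

section \<open>Moderate growth of primitives\<close>

lemma lift_velocity_linear:
  assumes "det (jac_matrix G x) \<noteq> 0"
  shows "lift_velocity G v x = (\<Sum>j\<in>UNIV. v $ j *s lift_velocity G (axis j 1) x)"
proof (rule lift_velocity_eq(2)[OF assms])
  have "jac_matrix G x *v (\<Sum>j\<in>UNIV. v $ j *s lift_velocity G (axis j 1) x) =
     (\<Sum>j\<in>UNIV. v $ j *s (jac_matrix G x *v lift_velocity G (axis j 1) x))"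
    by (simp add: matrix_vector_mult_def vec_eq_iff sum_distrib_left sum_distrib_right mult_ac)
      (auto intro: sum.swap)
  also have "\<dots> = (\<Sum>j\<in>UNIV. v $ j *s axis j 1)" by (simp add: lift_velocity_eq(1)[OF assms])
  also have "\<dots> = v" by (rule basis_expansion)
  finally show "jac_matrix G x *v (\<Sum>j\<in>UNIV. v $ j *s lift_velocity G (axis j 1) x) = v" .
qed

lemma etale_discriminantD:
  assumes "etale_discriminant G \<Delta> N C m"
  shows "polyfun \<Delta>" "C \<ge> 0" "\<Delta> s \<noteq> 0 \<Longrightarrow> finite {x. G x = s}" "\<Delta> s \<noteq> 0 \<Longrightarrow> card {x. G x = s} \<le> N"
    "\<Delta> (G x) \<noteq> 0 \<Longrightarrow> det (jac_matrix G x) \<noteq> 0" "\<Delta> (G x) \<noteq> 0 \<Longrightarrow> norm x \<le> C * vweight \<Delta> (G x) ^ m"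
    "\<Delta> (G x) \<noteq> 0 \<Longrightarrow> inverse (norm (det (jac_matrix G x))) \<le> C * vweight \<Delta> (G x) ^ m"
  using assms unfolding etale_discriminant_def by blast+

lemma polyfun_fibre_growth:
  assumes E: "etale_discriminant G \<Delta> N C m" and f: "polyfun f"
  shows "\<exists>B k. B \<ge> 0 \<and> (\<forall>x. \<Delta> (G x) \<noteq> 0 \<longrightarrow> norm (f x) \<le> B * vweight \<Delta> (G x) ^ k)"
proof -
  obtain A k where A: "A \<ge> 0" "\<And>x. norm (f x) \<le> A * (1 + norm x) ^ k" using polyfun_growth[OF f] by blast
  have "norm (f x) \<le> (A * (1 + C) ^ k) * vweight \<Delta> (G x) ^ (m * k)" if "\<Delta> (G x) \<noteq> 0" for x
  proof -
    have "1 \<le> vweight \<Delta> (G x) ^ m" by (intro one_le_power vweight_ge)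
    then have "1 + norm x \<le> (1 + C) * vweight \<Delta> (G x) ^ m"
      using etale_discriminantD(6)[OF E that] unfolding distrib_right mult_1 by linarith
    then have "A * (1 + norm x) ^ k \<le> A * ((1 + C) * vweight \<Delta> (G x) ^ m) ^ k"
      using A(1) by (intro mult_left_mono power_mono) auto
    then show ?thesis using A(2)[of x] by (simp add: power_mult_distrib power_mult)
  qed
  moreover have "A * (1 + C) ^ k \<ge> 0" using A(1) etale_discriminantD(2)[OF E] by simp
  ultimately show ?thesis by blast
qed

text \<open>By Cramer's rule the lifted velocity is a polynomial expression divided by the Jacobian determinant.\<close>

lemma velocity_growth:
  fixes G :: "complex ^ 'n \<Rightarrow> complex ^ 'n"
  assumes G: "polymap G" and E: "etale_discriminant G \<Delta> N C m" and \<omega>: "polymap \<omega>"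
  shows "\<exists>B k. B \<ge> 0 \<and> (\<forall>x v. \<Delta> (G x) \<noteq> 0 \<longrightarrow>
    norm (\<Sum>i\<in>UNIV. \<omega> x $ i * lift_velocity G v x $ i) \<le> (B * norm v) * vweight \<Delta> (G x) ^ k)"
proof -
  define f where "f j x = (\<Sum>i\<in>UNIV. \<omega> x $ i * adj_vec (jac_matrix G x) (axis j 1) $ i)" for j x
  have "polyfun (f j)" for j unfolding f_def[abs_def]
    using \<omega> by (intro polyfun_intros polyfun_adj_vec polyfun_jac G) (auto simp: polymap_def intro: polyfun_intros)
  then have "\<forall>j. \<exists>B k. B \<ge> 0 \<and> (\<forall>x. \<Delta> (G x) \<noteq> 0 \<longrightarrow> norm (f j x) \<le> B * vweight \<Delta> (G x) ^ k)"
    using polyfun_fibre_growth[OF E] by blast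
  then obtain B k where B: "\<And>j. B j \<ge> 0" "\<And>j x. \<Delta> (G x) \<noteq> 0 \<Longrightarrow> norm (f j x) \<le> B j * vweight \<Delta> (G x) ^ k j" by metis
  define K where "K = (\<Sum>j\<in>UNIV. k j)"
  have C: "C \<ge> 0" using etale_discriminantD(2)[OF E] .
  have "norm (\<Sum>i\<in>UNIV. \<omega> x $ i * lift_velocity G v x $ i) \<le>
      ((\<Sum>j\<in>UNIV. B j) * C * norm v) * vweight \<Delta> (G x) ^ (K + m)" if nz: "\<Delta> (G x) \<noteq> 0" for x v
  proof -
    have det: "det (jac_matrix G x) \<noteq> 0" by (rule etale_discriminantD(5)[OF E nz])
    have w: "0 \<le> vweight \<Delta> (G x)" using vweight_ge(1)[of \<Delta> "G x"] by linarith
    have "(\<Sum>i\<in>UNIV. \<omega> x $ i * lift_velocity G v x $ i) = (\<Sum>i\<in>UNIV. \<Sum>j\<in>UNIV. v $ j * (\<omega> x $ i * lift_velocity G (axis j 1) x $ i))"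
      by (subst lift_velocity_linear[OF det]) (simp add: sum_distrib_left mult_ac)
    also have "\<dots> = (\<Sum>j\<in>UNIV. v $ j * (inverse (det (jac_matrix G x)) * f j x))"
      by (subst sum.swap) (simp add: f_def lift_velocity_def sum_distrib_left mult_ac)
    also have "norm \<dots> \<le> (\<Sum>j\<in>UNIV. norm v * ((C * vweight \<Delta> (G x) ^ m) * (B j * vweight \<Delta> (G x) ^ K)))"
    proof (intro order_trans[OF norm_sum] sum_mono)
      fix j
      have "k j \<le> K" unfolding K_def by (intro member_le_sum) auto
      have "norm (f j x) \<le> B j * vweight \<Delta> (G x) ^ k j" by (rule B(2)[OF nz])
      also have "\<dots> \<le> B j * vweight \<Delta> (G x) ^ K" using B(1) \<open>k j \<le> K\<close> by (intro mult_left_mono vweight_power_mono) auto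
      finally show "norm (v $ j * (inverse (det (jac_matrix G x)) * f j x)) \<le> norm v * ((C * vweight \<Delta> (G x) ^ m) * (B j * vweight \<Delta> (G x) ^ K))"
        unfolding norm_mult norm_inverse using etale_discriminantD(7)[OF E nz] C w
        by (intro mult_mono Finite_Cartesian_Product.norm_nth_le) auto
    qed
    also have "\<dots> = ((\<Sum>j\<in>UNIV. B j) * C * norm v) * vweight \<Delta> (G x) ^ (K + m)"
      by (simp add: sum_distrib_left sum_distrib_right power_add mult_ac)
    finally show ?thesis .
  qed
  moreover have "(\<Sum>j\<in>UNIV. B j) * C \<ge> 0" using B(1) C by (simp add: sum_nonneg)
  ultimately show ?thesis by blast
qed

lemma line_branches:
  fixes G :: "complex ^ 'n \<Rightarrow> complex ^ 'n"
  assumes G: "polymap G" and E: "etale_discriminant G \<Delta> N C m" and z0: "\<Delta> (a + z0 *s v) \<noteq> 0"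
  obtains r \<beta> where "r > 0" "\<And>x. G x = a + z0 *s v \<Longrightarrow> \<beta> x z0 = x"
    "\<And>z. z \<in> ball z0 r \<Longrightarrow> \<Delta> (a + z *s v) \<noteq> 0"
    "\<And>z. z \<in> ball z0 r \<Longrightarrow> bij_betw (\<lambda>x. \<beta> x z) {x. G x = a + z0 *s v} {x. G x = a + z *s v}"
    "\<And>x. G x = a + z0 *s v \<Longrightarrow> continuous_on (ball z0 r) (\<lambda>z. lift_velocity G v (\<beta> x z))"
    "\<And>x z. G x = a + z0 *s v \<Longrightarrow> z \<in> ball z0 r \<Longrightarrow> (\<beta> x has_derivative (\<lambda>h. h *s lift_velocity G v (\<beta> x z))) (at z)"
proof -
  obtain e br where e: "e > 0" and br: "\<And>x. G x = a + z0 *s v \<Longrightarrow> br x (a + z0 *s v) = x"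
    "\<And>s. s \<in> ball (a + z0 *s v) e \<Longrightarrow> \<Delta> s \<noteq> 0 \<and> bij_betw (\<lambda>x. br x s) {x. G x = a + z0 *s v} {x. G x = s}"
    "\<And>x. G x = a + z0 *s v \<Longrightarrow> continuous_on {z. a + z *s v \<in> ball (a + z0 *s v) e} (\<lambda>z. lift_velocity G v (br x (a + z *s v)))"
    "\<And>x z. G x = a + z0 *s v \<Longrightarrow> a + z *s v \<in> ball (a + z0 *s v) e \<Longrightarrow>
          ((\<lambda>z. br x (a + z *s v)) has_derivative (\<lambda>h. h *s lift_velocity G v (br x (a + z *s v)))) (at z)"
    using local_branches[OF G E z0] by blast
  have "open {z. a + z *s v \<in> ball (a + z0 *s v) e}" by (rule line_preimage_open) simp
  then obtain r where r: "r > 0" "ball z0 r \<subseteq> {z. a + z *s v \<in> ball (a + z0 *s v) e}"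
    using openE[of "{z. a + z *s v \<in> ball (a + z0 *s v) e}" z0] e by auto
  show ?thesis
  proof (rule that[of r "\<lambda>x z. br x (a + z *s v)"])
    show "r > 0" by (rule r(1))
  next
    fix x assume x: "G x = a + z0 *s v"
    show "br x (a + z0 *s v) = x" by (rule br(1)[OF x])
    show "continuous_on (ball z0 r) (\<lambda>z. lift_velocity G v (br x (a + z *s v)))"
      by (rule continuous_on_subset[OF br(3)[OF x] r(2)])
    fix z assume "z \<in> ball z0 r"
    then show "((\<lambda>z. br x (a + z *s v)) has_derivative (\<lambda>h. h *s lift_velocity G v (br x (a + z *s v)))) (at z)"
      using br(4)[OF x] r(2) by blast
  next
    fix z assume "z \<in> ball z0 r"
    then have "a + z *s v \<in> ball (a + z0 *s v) e" using r(2) by blast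
    from br(2)[OF this] show "\<Delta> (a + z *s v) \<noteq> 0"
      "bij_betw (\<lambda>x. br x (a + z *s v)) {x. G x = a + z0 *s v} {x. G x = a + z *s v}" by blast+
  qed
qed

lemma polyfun_curve_derivative:
  assumes "polyfun f" "(\<beta> has_derivative (\<lambda>h. h *s w)) (at z)"
  shows "((\<lambda>z. f (\<beta> z)) has_field_derivative (\<Sum>i\<in>UNIV. partial i f (\<beta> z) * w $ i)) (at z)"
proof -
  have "((\<lambda>z. f (\<beta> z)) has_derivative (\<lambda>h. \<Sum>i\<in>UNIV. partial i f (\<beta> z) * (h *s w) $ i)) (at z)"
    using has_derivative_compose[OF assms(2) polyfun_has_derivative[OF assms(1)]] .
  moreover have "(\<lambda>h. \<Sum>i\<in>UNIV. partial i f (\<beta> z) * (h *s w) $ i) = (*) (\<Sum>i\<in>UNIV. partial i f (\<beta> z) * w $ i)"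
    by (rule ext) (simp add: sum_distrib_left mult_ac)
  ultimately show ?thesis by (simp add: has_field_derivative_def)
qed

definition slice :: "'n set \<Rightarrow> complex ^ 'n \<Rightarrow> (complex ^ 'n) set" where
  "slice E c = {s. \<forall>i\<in>E. s $ i = c $ i}"

text \<open>The lines on which the discriminant does not vanish identically; \<open>d\<close> is its restriction.\<close>

definition line_in_slice where
  "line_in_slice E c \<Delta> a v d \<longleftrightarrow> a \<in> slice E c \<and> v \<in> slice E 0 \<and> d \<noteq> 0 \<and> (\<forall>z. \<Delta> (a + z *s v) = poly d z)"

lemma line_in_sliceD:
  assumes "line_in_slice E c \<Delta> a v d"
  shows "a + z *s v \<in> slice E c" "d \<noteq> 0" "\<Delta> (a + z *s v) = poly d z"
  using assms by (auto simp: line_in_slice_def slice_def)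

lemma vweight_line:
  assumes "line_in_slice E c \<Delta> a v d"
  shows "\<exists>A\<ge>1. \<forall>z. vweight \<Delta> (a + z *s v) \<le> A * weight d z"
proof (intro exI[of _ "1 + norm a + norm v"] conjI allI)
  fix z
  have "norm (a + z *s v) \<le> norm a + norm z * norm v"
    using norm_triangle_ineq[of a "z *s v"] by (simp add: norm_vector_smult)
  moreover have "0 \<le> norm a * norm z" by simp
  moreover have "(1 + norm a + norm v) * (1 + norm z) = 1 + norm a + norm v + norm z + norm a * norm z + norm z * norm v"
    by (simp add: algebra_simps)
  ultimately have "1 + norm (a + z *s v) \<le> (1 + norm a + norm v) * (1 + norm z)"
    using norm_ge_zero[of v] norm_ge_zero[of z] by linarith
  then have "vweight \<Delta> (a + z *s v) \<le> ((1 + norm a + norm v) * (1 + norm z)) * (1 + 1 / norm (poly d z))"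
    unfolding vweight_def line_in_sliceD(3)[OF assms] by (intro mult_right_mono) auto
  then show "vweight \<Delta> (a + z *s v) \<le> (1 + norm a + norm v) * weight d z" by (simp add: weight_def mult.assoc)
qed simp

text \<open>The exponent \<open>k\<close> is the same for all lines, whereas the constant may depend on the line: only the exponent enters the degree bound in
\<open>polynomial_on_lines_is_polyfun\<close>.\<close>

definition tempered where
  "tempered G E c \<Delta> k f \<longleftrightarrow> (\<forall>a v d. line_in_slice E c \<Delta> a v d \<longrightarrow>
     (\<exists>C\<ge>0. \<forall>z x. poly d z \<noteq> 0 \<longrightarrow> G x = a + z *s v \<longrightarrow> norm (f x) \<le> C * weight d z ^ k))"

lemma polyfun_tempered:
  fixes f :: "complex ^ 'n \<Rightarrow> complex"
  assumes D: "etale_discriminant G \<Delta> N C m" and f: "polyfun f"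
  shows "\<exists>k. tempered G E c \<Delta> k f"
proof -
  obtain B k where B: "B \<ge> 0" "\<And>x. \<Delta> (G x) \<noteq> 0 \<Longrightarrow> norm (f x) \<le> B * vweight \<Delta> (G x) ^ k"
    using polyfun_fibre_growth[OF D f] by blast
  have "tempered G E c \<Delta> k f" unfolding tempered_def
  proof (intro allI impI)
    fix a v :: "complex ^ 'n" and d assume line: "line_in_slice E c \<Delta> a v d"
    obtain A where A: "A \<ge> 1" "\<And>z. vweight \<Delta> (a + z *s v) \<le> A * weight d z" using vweight_line[OF line] by blast
    have "norm (f x) \<le> (B * A ^ k) * weight d z ^ k" if "poly d z \<noteq> 0" "G x = a + z *s v" for z x
    proof -
      have "norm (f x) \<le> B * vweight \<Delta> (G x) ^ k" using that line_in_sliceD(3)[OF line] by (intro B) simp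
      also have "\<dots> \<le> B * (A * weight d z) ^ k"
        unfolding that(2) using B(1) vweight_ge(1)[of \<Delta> "a + z *s v"] by (intro mult_left_mono power_mono A) auto
      finally show ?thesis by (simp add: power_mult_distrib)
    qed
    moreover have "B * A ^ k \<ge> 0" using B(1) A(1) by simp
    ultimately show "\<exists>C\<ge>0. \<forall>z x. poly d z \<noteq> 0 \<longrightarrow> G x = a + z *s v \<longrightarrow> norm (f x) \<le> C * weight d z ^ k" by blast
  qed
  then show ?thesis by blast
qed

lemma tempered_mono:
  assumes "tempered G E c \<Delta> k f" "k \<le> l"
  shows "tempered G E c \<Delta> l f"
  unfolding tempered_def
proof (intro allI impI)
  fix a v d assume line: "line_in_slice E c \<Delta> a v d"
  then obtain C where C: "C \<ge> 0" "\<And>z x. poly d z \<noteq> 0 \<Longrightarrow> G x = a + z *s v \<Longrightarrow> norm (f x) \<le> C * weight d z ^ k"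
    using assms(1) unfolding tempered_def by blast
  have "C * weight d z ^ k \<le> C * weight d z ^ l" for z
    using C(1) assms(2) by (intro mult_left_mono power_increasing weight_ge_1) auto
  then show "\<exists>C\<ge>0. \<forall>z x. poly d z \<noteq> 0 \<longrightarrow> G x = a + z *s v \<longrightarrow> norm (f x) \<le> C * weight d z ^ l"
    using C by (meson order_trans)
qed

lemma primitive_branch_derivative:
  fixes G :: "complex ^ 'n \<Rightarrow> complex ^ 'n"
  assumes R: "primitive_on (G -` slice E c) \<omega> R" and \<omega>: "polymap \<omega>"
    and line: "a \<in> slice E c" "v \<in> slice E 0"
    and \<beta>: "\<And>z. z \<in> ball z0 r \<Longrightarrow> (\<beta> has_derivative (\<lambda>h. h *s lift_velocity G v (\<beta> z))) (at z)"
    and cont: "continuous_on (ball z0 r) (\<lambda>z. lift_velocity G v (\<beta> z))"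
    and img: "\<And>z. z \<in> ball z0 r \<Longrightarrow> G (\<beta> z) = a + z *s v" and z: "z \<in> ball z0 r"
  shows "((\<lambda>z. R (\<beta> z)) has_field_derivative (\<Sum>i\<in>UNIV. \<omega> (\<beta> z) $ i * lift_velocity G v (\<beta> z) $ i)) (at z)"
proof (rule primitive_on_curve[OF R \<omega> open_ball \<beta> cont _ z])
  show "\<beta> ` ball z0 r \<subseteq> G -` slice E c" using img line by (auto simp: slice_def)
qed

text \<open>Along a line \<open>R\<close> has several branches, but the sum \<open>M\<close> of \<open>\<bar>R\<bar>\<close> over the sheets is a function on the line. Its local
Lipschitz constant is controlled by the derivatives of the branches, which have moderate growth by \<open>velocity_growth\<close>, and \<open>M\<close> dominates \<open>\<bar>R\<bar>\<close>.\<close>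

lemma primitive_tempered:
  fixes G :: "complex ^ 'n \<Rightarrow> complex ^ 'n"
  assumes G: "polymap G" and D: "etale_discriminant G \<Delta> N C m" and \<omega>: "polymap \<omega>"
    and R: "primitive_on (G -` slice E c) \<omega> R"
  shows "\<exists>k. tempered G E c \<Delta> k R"
proof -
  obtain B k where B: "B \<ge> 0" "\<And>x v. \<Delta> (G x) \<noteq> 0 \<Longrightarrow>
    norm (\<Sum>i\<in>UNIV. \<omega> x $ i * lift_velocity G v x $ i) \<le> (B * norm v) * vweight \<Delta> (G x) ^ k"
    using velocity_growth[OF G D \<omega>] by blast
  have "tempered G E c \<Delta> (Suc k) R" unfolding tempered_def
  proof (intro allI impI)
    fix a v :: "complex ^ 'n" and d assume line: "line_in_slice E c \<Delta> a v d"
    then have av: "a \<in> slice E c" "v \<in> slice E 0" by (auto simp: line_in_slice_def)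
    note \<Delta>d = line_in_sliceD(3)[OF line]
    obtain A where A: "A \<ge> 1" "\<And>z. vweight \<Delta> (a + z *s v) \<le> A * weight d z" using vweight_line[OF line] by blast
    define M where "M z = (\<Sum>x\<in>{x. G x = a + z *s v}. norm (R x))" for z
    \<comment> \<open>The summand \<open>1\<close> absorbs the error term in the first-order expansion of \<open>R\<close> along a branch.\<close>
    define Q where "Q = B * norm v * A ^ k + 1"
    have "Q \<ge> 0" using B A by (simp add: Q_def)
    have "\<exists>C'. \<forall>z. poly d z \<noteq> 0 \<longrightarrow> \<bar>M z\<bar> \<le> C' * weight d z ^ Suc k"
    proof (rule growth_from_local_lipschitz[of d "N * Q"])
      fix z0 assume "poly d z0 \<noteq> 0"
      then have nz: "\<Delta> (a + z0 *s v) \<noteq> 0" by (simp add: \<Delta>d)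
      define S where "S = {x. G x = a + z0 *s v}"
      have S: "finite S" "card S \<le> N" using etale_discriminantD(3,4)[OF D nz] by (auto simp: S_def)
      obtain r \<beta> where r: "r > 0" and br: "\<And>x. G x = a + z0 *s v \<Longrightarrow> \<beta> x z0 = x"
        "\<And>z. z \<in> ball z0 r \<Longrightarrow> \<Delta> (a + z *s v) \<noteq> 0"
        "\<And>z. z \<in> ball z0 r \<Longrightarrow> bij_betw (\<lambda>x. \<beta> x z) {x. G x = a + z0 *s v} {x. G x = a + z *s v}"
        "\<And>x. G x = a + z0 *s v \<Longrightarrow> continuous_on (ball z0 r) (\<lambda>z. lift_velocity G v (\<beta> x z))"
        "\<And>x z. G x = a + z0 *s v \<Longrightarrow> z \<in> ball z0 r \<Longrightarrow> (\<beta> x has_derivative (\<lambda>h. h *s lift_velocity G v (\<beta> x z))) (at z)"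
        by (rule line_branches[OF G D nz]; rule that; assumption)
      have \<beta>: "\<And>x. x \<in> S \<Longrightarrow> \<beta> x z0 = x"
        "\<And>z. z \<in> ball z0 r \<Longrightarrow> bij_betw (\<lambda>x. \<beta> x z) S {x. G x = a + z *s v}"
        "\<And>x. x \<in> S \<Longrightarrow> continuous_on (ball z0 r) (\<lambda>z. lift_velocity G v (\<beta> x z))"
        "\<And>x z. x \<in> S \<Longrightarrow> z \<in> ball z0 r \<Longrightarrow> (\<beta> x has_derivative (\<lambda>h. h *s lift_velocity G v (\<beta> x z))) (at z)"
        using br by (simp_all add: S_def)
      have M: "M z = (\<Sum>x\<in>S. norm (R (\<beta> x z)))" if "z \<in> ball z0 r" for z
        unfolding M_def using sum.reindex_bij_betw[OF \<beta>(2)[OF that], of "\<lambda>x. norm (R x)"] by simp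
      have ev: "\<forall>\<^sub>F z in nhds z0. norm (R (\<beta> x z) - R x) \<le> (Q * weight d z0 ^ k) * norm (z - z0)" if x: "x \<in> S" for x
      proof -
        have "G (\<beta> x z) = a + z *s v" if "z \<in> ball z0 r" for z
          using \<beta>(2)[OF that] x by (auto simp: bij_betw_def)
        then have "((\<lambda>z. R (\<beta> x z)) has_field_derivative (\<Sum>i\<in>UNIV. \<omega> (\<beta> x z0) $ i * lift_velocity G v (\<beta> x z0) $ i)) (at z0)"
          using primitive_branch_derivative[OF R \<omega> av \<beta>(4)[OF x] \<beta>(3)[OF x]] r by simp
        then obtain D where D: "((\<lambda>z. R (\<beta> x z)) has_field_derivative D) (at z0)" "norm D \<le> B * norm v * vweight \<Delta> (a + z0 *s v) ^ k"
          using B(2)[of x v] nz x \<beta>(1)[OF x] by (auto simp: S_def)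
        have "norm D \<le> B * norm v * (A * weight d z0) ^ k"
          using D(2) B(1) vweight_ge(1)[of \<Delta> "a + z0 *s v"] by (elim order_trans) (intro mult_left_mono power_mono A, auto)
        moreover have "1 \<le> weight d z0 ^ k" by (intro one_le_power weight_ge_1)
        ultimately have "norm D + 1 \<le> Q * weight d z0 ^ k"
          unfolding Q_def distrib_right mult_1 power_mult_distrib by (simp add: mult_ac)
        obtain \<delta> where \<delta>: "\<delta> > 0" "\<And>z. norm (z - z0) < \<delta> \<Longrightarrow> norm (R (\<beta> x z) - R (\<beta> x z0) - D * (z - z0)) \<le> 1 * norm (z - z0)"
          using D(1) unfolding has_field_derivative_def has_derivative_at_alt by (metis zero_less_one)
        have "norm (R (\<beta> x z) - R x) \<le> (Q * weight d z0 ^ k) * norm (z - z0)" if "dist z z0 < \<delta>" for z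
        proof -
          have "norm (R (\<beta> x z) - R x) \<le> norm (R (\<beta> x z) - R (\<beta> x z0) - D * (z - z0)) + norm (D * (z - z0))"
            using norm_triangle_ineq[of "R (\<beta> x z) - R (\<beta> x z0) - D * (z - z0)" "D * (z - z0)"] \<beta>(1)[OF x] by simp
          also have "\<dots> \<le> 1 * norm (z - z0) + norm D * norm (z - z0)"
            using \<delta>(2)[of z] that by (intro add_mono) (auto simp: dist_norm norm_mult)
          also have "\<dots> = (norm D + 1) * norm (z - z0)" by (simp add: algebra_simps)
          also have "\<dots> \<le> (Q * weight d z0 ^ k) * norm (z - z0)"
            using \<open>norm D + 1 \<le> _\<close> by (intro mult_right_mono) auto
          finally show ?thesis .
        qed
        then show ?thesis unfolding eventually_nhds_metric using \<delta>(1) by blast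
      qed
      have "\<forall>\<^sub>F z in nhds z0. \<forall>x\<in>S. norm (R (\<beta> x z) - R x) \<le> (Q * weight d z0 ^ k) * norm (z - z0)"
        using ev S(1) by (simp add: eventually_ball_finite_distrib)
      moreover have "\<forall>\<^sub>F z in nhds z0. z \<in> ball z0 r" using r by (intro eventually_nhds_in_open) auto
      ultimately have "\<forall>\<^sub>F z in nhds z0. \<bar>M z - M z0\<bar> \<le> (N * Q * weight d z0 ^ k) * norm (z - z0)"
      proof eventually_elim
        case (elim z)
        have "M z - M z0 = (\<Sum>x\<in>S. norm (R (\<beta> x z)) - norm (R x))"
          using M[OF elim(2)] M[of z0] r \<beta>(1) by (simp add: sum_subtractf)
        also have "\<bar>\<dots>\<bar> \<le> (\<Sum>x\<in>S. (Q * weight d z0 ^ k) * norm (z - z0))"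
        proof (intro order_trans[OF sum_abs] sum_mono)
          fix x assume "x \<in> S"
          then show "\<bar>norm (R (\<beta> x z)) - norm (R x)\<bar> \<le> (Q * weight d z0 ^ k) * norm (z - z0)"
            using elim(1) norm_triangle_ineq3[of "R (\<beta> x z)" "R x"] by force
        qed
        also have "\<dots> = real (card S) * ((Q * weight d z0 ^ k) * norm (z - z0))" by simp
        also have "\<dots> \<le> real N * ((Q * weight d z0 ^ k) * norm (z - z0))"
          using S(2) \<open>Q \<ge> 0\<close> weight_ge_1[of d z0] by (intro mult_right_mono) auto
        finally show ?case by (simp add: mult_ac)
      qed
      then show "\<exists>e>0. \<forall>y. norm (y - z0) < e \<longrightarrow> \<bar>M y - M z0\<bar> \<le> (N * Q * weight d z0 ^ k) * norm (y - z0)"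
        unfolding eventually_nhds_metric by (simp add: dist_norm)
    qed (use line_in_sliceD(2)[OF line] \<open>Q \<ge> 0\<close> in auto)
    then obtain C' where C': "\<And>z. poly d z \<noteq> 0 \<Longrightarrow> \<bar>M z\<bar> \<le> C' * weight d z ^ Suc k" by blast
    have "norm (R x) \<le> max C' 0 * weight d z ^ Suc k" if "poly d z \<noteq> 0" "G x = a + z *s v" for z x
    proof -
      have "\<Delta> (a + z *s v) \<noteq> 0" using that \<Delta>d by simp
      then have "norm (R x) \<le> M z" unfolding M_def
        using that(2) by (intro member_le_sum etale_discriminantD(3)[OF D]) auto
      also have "\<dots> \<le> C' * weight d z ^ Suc k" using C'[OF that(1)] by simp
      also have "\<dots> \<le> max C' 0 * weight d z ^ Suc k"
        using weight_ge_1[of d z] by (intro mult_right_mono) auto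
      finally show ?thesis .
    qed
    then show "\<exists>C\<ge>0. \<forall>z x. poly d z \<noteq> 0 \<longrightarrow> G x = a + z *s v \<longrightarrow> norm (R x) \<le> C * weight d z ^ Suc k"
      by (intro exI[of _ "max C' 0"]) auto
  qed
  then show ?thesis by blast
qed

lemma slice_proj_line: "slice_proj E c (a + z *s v) = slice_proj E c a + z *s slice_proj E 0 v"
  by (auto simp: slice_proj_def vec_eq_iff)

lemma slice_proj_slice: "slice_proj E c s \<in> slice E c" "s \<in> slice E c \<Longrightarrow> slice_proj E c s = s"
  by (auto simp: slice_proj_def slice_def vec_eq_iff)

text \<open>Extended to the whole space by the projection to the slice, \<open>\<Delta> ^ (k + 1) h\<close> is a polynomial of bounded degree on every line, by \<open>tempered_holomorphic_is_rational\<close>.\<close>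

theorem tempered_slice_function_rational:
  fixes h :: "complex ^ 'n \<Rightarrow> complex"
  assumes \<Delta>: "polyfun \<Delta>" and s1: "s1 \<in> slice E c" "\<Delta> s1 \<noteq> 0"
    and holo: "\<And>a v d z0. line_in_slice E c \<Delta> a v d \<Longrightarrow> poly d z0 \<noteq> 0 \<Longrightarrow>
       \<exists>r>0. \<exists>H. H holomorphic_on ball z0 r \<and> (\<forall>z\<in>ball z0 r. h (a + z *s v) = H z)"
    and temp: "\<And>a v d. line_in_slice E c \<Delta> a v d \<Longrightarrow>
       \<exists>C. \<forall>z. poly d z \<noteq> 0 \<longrightarrow> norm (h (a + z *s v)) \<le> C * weight d z ^ k"
  shows "\<exists>B P. polyfun P \<and> (\<forall>s\<in>slice E c. \<Delta> s \<noteq> 0 \<longrightarrow> \<Delta> s ^ B * h s = P s)"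
proof -
  define \<pi> where "\<pi> = slice_proj E c"
  define \<Delta>' where "\<Delta>' s = \<Delta> (\<pi> s)" for s
  have \<Delta>': "polyfun \<Delta>'" unfolding \<Delta>'_def[abs_def] \<pi>_def by (rule polyfun_compose[OF \<Delta> polymap_slice_proj])
  have "\<Delta>' s1 \<noteq> 0" using s1 by (simp add: \<Delta>'_def \<pi>_def slice_proj_slice)
  obtain D where D: "\<And>a v. \<exists>q::complex poly. degree q \<le> D \<and> (\<forall>z. \<Delta>' (a + z *s v) = poly q z)"
    using polyfun_line[OF \<Delta>'] by blast
  define h' where "h' s = \<Delta>' s ^ Suc k * h (\<pi> s)" for s
  have "\<exists>P. polyfun P \<and> (\<forall>s. \<Delta>' s \<noteq> 0 \<longrightarrow> h' s = P s)"
  proof (rule polynomial_on_lines_is_polyfun[OF \<Delta>' \<open>\<Delta>' s1 \<noteq> 0\<close>])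
    fix a v assume a: "\<Delta>' a \<noteq> 0"
    obtain d where d: "degree d \<le> D" "\<And>z. \<Delta>' (a + z *s v) = poly d z" using D by blast
    have "d \<noteq> 0" using d(2)[of 0] a by auto
    define a' v' where "a' = \<pi> a" and "v' = slice_proj E 0 v"
    have \<pi>: "\<pi> (a + z *s v) = a' + z *s v'" for z by (simp add: \<pi>_def a'_def v'_def slice_proj_line)
    have line: "line_in_slice E c \<Delta> a' v' d"
      using d(2) \<open>d \<noteq> 0\<close> unfolding line_in_slice_def \<Delta>'_def \<pi>
      by (auto simp: a'_def v'_def \<pi>_def slice_proj_slice)
    obtain C where C: "\<And>z. poly d z \<noteq> 0 \<Longrightarrow> norm (h (a' + z *s v')) \<le> C * weight d z ^ k"
      using temp[OF line] by blast
    have "(\<lambda>z. h (a' + z *s v')) holomorphic_on {z. poly d z \<noteq> 0}"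
      unfolding holomorphic_on_def
    proof
      fix z0 assume "z0 \<in> {z. poly d z \<noteq> 0}"
      then obtain r H where r: "r > 0" "H holomorphic_on ball z0 r" "\<And>z. z \<in> ball z0 r \<Longrightarrow> h (a' + z *s v') = H z"
        using holo[OF line] by blast
      then have "H field_differentiable at z0"
        using holomorphic_on_imp_differentiable_at[of H "ball z0 r" z0] by simp
      then obtain H' where "(H has_field_derivative H') (at z0)" by (auto simp: field_differentiable_def)
      then have "((\<lambda>z. h (a' + z *s v')) has_field_derivative H') (at z0)"
        by (rule has_field_derivative_transform_within_open[of _ _ _ "ball z0 r"]) (use r in auto)
      then show "(\<lambda>z. h (a' + z *s v')) field_differentiable at z0 within {z. poly d z \<noteq> 0}"
        using field_differentiable_at_within field_differentiable_def by blast
    qed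
    from tempered_holomorphic_is_rational[OF \<open>d \<noteq> 0\<close> this C] obtain q where
      q: "degree q \<le> k + degree d * Suc k" "\<And>z. poly d z \<noteq> 0 \<Longrightarrow> poly d z ^ Suc k * h (a' + z *s v') = poly q z" by blast
    have "degree q \<le> k + D * Suc k" using q(1) d(1) by (meson add_left_mono mult_le_mono1 order_trans)
    moreover have "h' (a + z *s v) = poly q z" if "\<Delta>' (a + z *s v) \<noteq> 0" for z
      using q(2)[of z] that unfolding d(2) h'_def \<pi> by simp
    ultimately show "\<exists>q. degree q \<le> k + D * Suc k \<and> (\<forall>z. \<Delta>' (a + z *s v) \<noteq> 0 \<longrightarrow> h' (a + z *s v) = poly q z)" by blast
  qed
  then obtain P where "polyfun P" "\<And>s. \<Delta>' s \<noteq> 0 \<Longrightarrow> h' s = P s" by blast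
  then show ?thesis
    by (intro exI[of _ "Suc k"] exI[of _ P])
      (metis h'_def \<Delta>'_def \<pi>_def slice_proj_slice(2))
qed

section \<open>Symmetric functions of the sheets\<close>

text \<open>The discriminant of the values of \<open>\<theta>\<close> up to sign. Factors \<open>1\<close> on the diagonal keep all products indexed by the same set, so that
reindexing along a bijection is immediate.\<close>

definition fibre_disc :: "('a \<Rightarrow> complex) \<Rightarrow> 'a set \<Rightarrow> complex" where
  "fibre_disc \<theta> S = (\<Prod>u\<in>S. \<Prod>v\<in>S. if v = u then 1 else \<theta> u - \<theta> v)"

text \<open>The polynomial in \<open>t\<close> that takes the value \<open>f x\<close> at \<open>\<theta> x\<close>, multiplied by \<open>fibre_disc \<theta> S\<close> to clear denominators.\<close>

definition fibre_lagrange :: "('a \<Rightarrow> complex) \<Rightarrow> ('a \<Rightarrow> complex) \<Rightarrow> 'a set \<Rightarrow> complex \<Rightarrow> complex" where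
  "fibre_lagrange f \<theta> S t = (\<Sum>x\<in>S. f x * (\<Prod>w\<in>S. if w = x then 1 else t - \<theta> w) *
     (\<Prod>u\<in>S. if u = x then 1 else \<Prod>v\<in>S. if v = u then 1 else \<theta> u - \<theta> v))"

lemma fibre_lagrange_eval:
  assumes "finite S" "x \<in> S"
  shows "fibre_lagrange f \<theta> S (\<theta> x) = f x * fibre_disc \<theta> S"
proof -
  define g where "g u = (\<Prod>v\<in>S. if v = u then 1 else \<theta> u - \<theta> v)" for u
  have "fibre_lagrange f \<theta> S (\<theta> x) = (\<Sum>y\<in>{x}. f y * (\<Prod>w\<in>S. if w = y then 1 else \<theta> x - \<theta> w) * (\<Prod>u\<in>S. if u = y then 1 else g u))"
    unfolding fibre_lagrange_def g_def[symmetric]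
  proof (intro sum.mono_neutral_right assms ballI)
    fix y assume y: "y \<in> S - {x}"
    have "(\<Prod>w\<in>S. if w = y then 1 else \<theta> x - \<theta> w) = 0"
      by (rule prod_zero) (use assms y in \<open>auto intro!: bexI[of _ x]\<close>)
    then show "f y * (\<Prod>w\<in>S. if w = y then 1 else \<theta> x - \<theta> w) * (\<Prod>u\<in>S. if u = y then 1 else g u) = 0" by simp
  qed (use assms in auto)
  also have "\<dots> = f x * (g x * (\<Prod>u\<in>S. if u = x then 1 else g u))" by (simp add: g_def)
  also have "(\<Prod>u\<in>S. if u = x then 1 else g u) = (\<Prod>u\<in>S - {x}. g u)"
    using assms by (simp add: prod.remove)
  also have "g x * (\<Prod>u\<in>S - {x}. g u) = fibre_disc \<theta> S"
    unfolding fibre_disc_def g_def[symmetric] using assms by (simp add: prod.remove)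
  finally show ?thesis .
qed

lemma fibre_disc_reindex:
  assumes "bij_betw b S' S"
  shows "fibre_disc \<theta> S = fibre_disc (\<lambda>x. \<theta> (b x)) S'"
proof -
  have inj: "b v = b u \<longleftrightarrow> v = u" if "u \<in> S'" "v \<in> S'" for u v
    using assms that by (auto simp: bij_betw_def inj_on_def)
  have "fibre_disc \<theta> S = (\<Prod>u\<in>S'. \<Prod>v\<in>S'. if b v = b u then 1 else \<theta> (b u) - \<theta> (b v))"
    unfolding fibre_disc_def by (simp add: prod.reindex_bij_betw[OF assms, symmetric])
  also have "\<dots> = fibre_disc (\<lambda>x. \<theta> (b x)) S'"
    unfolding fibre_disc_def using inj by (intro prod.cong) auto
  finally show ?thesis .
qed

lemma fibre_lagrange_reindex:
  assumes "bij_betw b S' S"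
  shows "fibre_lagrange f \<theta> S t = fibre_lagrange (\<lambda>x. f (b x)) (\<lambda>x. \<theta> (b x)) S' t"
proof -
  have inj: "b v = b u \<longleftrightarrow> v = u" if "u \<in> S'" "v \<in> S'" for u v
    using assms that by (auto simp: bij_betw_def inj_on_def)
  have "fibre_lagrange f \<theta> S t = (\<Sum>x\<in>S'. f (b x) * (\<Prod>w\<in>S'. if b w = b x then 1 else t - \<theta> (b w)) *
     (\<Prod>u\<in>S'. if b u = b x then 1 else \<Prod>v\<in>S'. if b v = b u then 1 else \<theta> (b u) - \<theta> (b v)))"
    unfolding fibre_lagrange_def
    by (simp add: prod.reindex_bij_betw[OF assms, symmetric] sum.reindex_bij_betw[OF assms, symmetric] cong: if_cong)
  also have "\<dots> = fibre_lagrange (\<lambda>x. f (b x)) (\<lambda>x. \<theta> (b x)) S' t"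
    unfolding fibre_lagrange_def using inj by (intro sum.cong prod.cong arg_cong2[of _ _ _ _ "(*)"]) auto
  finally show ?thesis .
qed

lemma fibre_disc_holomorphic:
  assumes "\<And>x. x \<in> S \<Longrightarrow> (\<lambda>z. \<theta> x z) holomorphic_on A"
  shows "(\<lambda>z. fibre_disc (\<lambda>x. \<theta> x z) S) holomorphic_on A"
  unfolding fibre_disc_def
proof (intro holomorphic_on_prod)
  show "(\<lambda>z. if v = u then 1 else \<theta> u z - \<theta> v z) holomorphic_on A" if "u \<in> S" "v \<in> S" for u v
    using assms that by (cases "v = u") (auto intro!: holomorphic_intros)
qed

lemma fibre_lagrange_holomorphic:
  assumes "\<And>x. x \<in> S \<Longrightarrow> (\<lambda>z. \<theta> x z) holomorphic_on A" "\<And>x. x \<in> S \<Longrightarrow> (\<lambda>z. f x z) holomorphic_on A"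
  shows "(\<lambda>z. fibre_lagrange (\<lambda>x. f x z) (\<lambda>x. \<theta> x z) S t) holomorphic_on A"
  unfolding fibre_lagrange_def
proof (intro holomorphic_on_sum holomorphic_on_mult holomorphic_on_prod assms(2))
  have *: "(\<lambda>z. if v = u then 1 else \<theta> u z - \<theta> v z) holomorphic_on A" if "u \<in> S" "v \<in> S" for u v
    using assms that by (cases "v = u") (auto intro!: holomorphic_intros)
  show "(\<lambda>z. if w = x then 1 else t - \<theta> w z) holomorphic_on A" if "x \<in> S" "w \<in> S" for x w
    using assms that by (cases "w = x") (auto intro!: holomorphic_intros)
  show "(\<lambda>z. if u = x then 1 else \<Prod>v\<in>S. if v = u then 1 else \<theta> u z - \<theta> v z) holomorphic_on A"
    if "x \<in> S" "u \<in> S" for x u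
    using that * by (cases "u = x") (auto intro!: holomorphic_on_prod)
qed

lemma norm_prod_le_power:
  fixes f :: "'a \<Rightarrow> complex"
  assumes "\<And>i. i \<in> S \<Longrightarrow> norm (f i) \<le> U" "1 \<le> U" "card S \<le> N"
  shows "norm (\<Prod>i\<in>S. f i) \<le> U ^ N"
proof -
  have "norm (\<Prod>i\<in>S. f i) \<le> (\<Prod>i\<in>S. U)" unfolding prod_norm[symmetric] by (rule prod_mono) (use assms(1) in auto)
  also have "\<dots> \<le> U ^ N" using assms by (simp add: power_increasing)
  finally show ?thesis .
qed

lemma fibre_disc_bound:
  assumes "\<And>u v. u \<in> S \<Longrightarrow> v \<in> S \<Longrightarrow> norm (\<theta> u - \<theta> v) \<le> U" "1 \<le> U" "card S \<le> N"
  shows "norm (fibre_disc \<theta> S) \<le> (U ^ N) ^ N"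
  unfolding fibre_disc_def using assms by (intro norm_prod_le_power) (auto simp: one_le_power)

lemma fibre_lagrange_bound:
  assumes "\<And>u v. u \<in> S \<Longrightarrow> v \<in> S \<Longrightarrow> norm (\<theta> u - \<theta> v) \<le> U" "\<And>u. u \<in> S \<Longrightarrow> norm (t - \<theta> u) \<le> U"
    "\<And>u. u \<in> S \<Longrightarrow> norm (f u) \<le> U" "1 \<le> U" "card S \<le> N"
  shows "norm (fibre_lagrange f \<theta> S t) \<le> N * (U * U ^ N * (U ^ N) ^ N)"
proof -
  have "norm (fibre_lagrange f \<theta> S t) \<le> (\<Sum>x\<in>S. U * U ^ N * (U ^ N) ^ N)"
    unfolding fibre_lagrange_def
  proof (intro order_trans[OF norm_sum] sum_mono)
    fix x assume "x \<in> S"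
    then show "norm (f x * (\<Prod>w\<in>S. if w = x then 1 else t - \<theta> w) *
       (\<Prod>u\<in>S. if u = x then 1 else \<Prod>v\<in>S. if v = u then 1 else \<theta> u - \<theta> v)) \<le> U * U ^ N * (U ^ N) ^ N"
      unfolding norm_mult using assms
      by (intro mult_mono norm_prod_le_power) (auto simp: one_le_power intro: norm_prod_le_power)
  qed
  also have "\<dots> = card S * (U * U ^ N * (U ^ N) ^ N)" by simp
  also have "\<dots> \<le> N * (U * U ^ N * (U ^ N) ^ N)" using assms by (intro mult_right_mono) auto
  finally show ?thesis .
qed

lemma fibre_lagrange_poly:
  assumes "finite S"
  shows "\<exists>q. degree q \<le> card S \<and> (\<forall>t. fibre_lagrange f \<theta> S t = poly q t)"
proof -
  define q where "q = (\<Sum>x\<in>S. Polynomial.smult (f x * (\<Prod>u\<in>S. if u = x then 1 else \<Prod>v\<in>S. if v = u then 1 else \<theta> u - \<theta> v))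
     (\<Prod>w\<in>S. if w = x then 1 else [:- \<theta> w, 1:]))"
  have "degree q \<le> card S" unfolding q_def
  proof (intro degree_sum_le assms order_trans[OF degree_smult_le])
    fix x
    have "degree (\<Prod>w\<in>S. if w = x then 1 else [:- \<theta> w, 1:]) \<le> (\<Sum>w\<in>S. 1)"
      by (intro order_trans[OF degree_prod_sum_le[OF assms]] sum_mono) auto
    then show "degree (\<Prod>w\<in>S. if w = x then 1 else [:- \<theta> w, 1:]) \<le> card S" by simp
  qed
  moreover have "fibre_lagrange f \<theta> S t = poly q t" for t
    unfolding q_def fibre_lagrange_def poly_sum
    by (intro sum.cong refl) (simp add: poly_prod if_distrib[of "\<lambda>p. poly p t"] mult_ac cong: if_cong)
  ultimately show ?thesis by blast
qed

text \<open>The condition on \<open>l\<close> is the nonvanishing of finitely many nonzero linear functions.\<close>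

lemma separating_linear_form:
  fixes S :: "(complex ^ 'n) set"
  assumes "finite S"
  shows "\<exists>l :: complex ^ 'n. inj_on (\<lambda>x. \<Sum>i\<in>UNIV. l $ i * x $ i) S"
proof -
  define A where "A = {(x, y). x \<in> S \<and> y \<in> S \<and> x \<noteq> y}"
  have "A \<subseteq> S \<times> S" by (auto simp: A_def)
  then have finA: "finite A" using assms finite_subset by blast
  have "\<exists>l. (\<Prod>a\<in>A. \<Sum>i\<in>UNIV. l $ i * (fst a - snd a) $ i) \<noteq> 0"
  proof (rule polyfun_prod_nonzero[OF finA])
    show "polyfun (\<lambda>l. \<Sum>i\<in>UNIV. l $ i * (fst a - snd a) $ i)" for a by (intro polyfun_intros)
    fix a assume "a \<in> A"
    then obtain j where j: "(fst a - snd a) $ j \<noteq> 0" by (auto simp: A_def vec_eq_iff)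
    have "(\<Sum>i\<in>UNIV. (axis j 1 :: complex ^ 'n) $ i * (fst a - snd a) $ i) = (fst a - snd a) $ j"
      by (simp add: axis_def if_distrib[of "\<lambda>c. c * _"] cong: if_cong)
    then show "\<exists>l. (\<Sum>i\<in>UNIV. l $ i * (fst a - snd a) $ i) \<noteq> 0" using j by (intro exI[of _ "axis j 1"]) simp
  qed
  then obtain l where l: "(\<Prod>a\<in>A. \<Sum>i\<in>UNIV. l $ i * (fst a - snd a) $ i) \<noteq> 0" by blast
  have "inj_on (\<lambda>x. \<Sum>i\<in>UNIV. l $ i * x $ i) S"
  proof (rule inj_onI, rule ccontr)
    fix x y assume xy: "x \<in> S" "y \<in> S" "(\<Sum>i\<in>UNIV. l $ i * x $ i) = (\<Sum>i\<in>UNIV. l $ i * y $ i)" "x \<noteq> y"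
    then have "(x, y) \<in> A" by (simp add: A_def)
    moreover have "(\<Sum>i\<in>UNIV. l $ i * (fst (x, y) - snd (x, y)) $ i) = 0"
      using xy(3) by (simp add: right_diff_distrib sum_subtractf)
    ultimately have "(\<Prod>a\<in>A. \<Sum>i\<in>UNIV. l $ i * (fst a - snd a) $ i) = 0" using finA by (intro prod_zero bexI[of _ "(x, y)"])
    then show False using l by simp
  qed
  then show ?thesis by blast
qed

text \<open>Let \<open>\<theta>\<close> be a linear form that separates the points of one fibre off the discriminant. The discriminant of \<open>\<theta>\<close> on the
fibres and, for each \<open>t\<close>, the value at \<open>t\<close> of the Lagrange polynomial of \<open>R\<close> are symmetric in the sheets: they are functions on the slice, locally
holomorphic along lines and tempered, and so they are rational. The product of \<open>R\<close> and the discriminant is the Lagrange polynomial at \<open>t = \<theta> x\<close>, and its values at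
\<open>t = 0, \<dots>, N\<close> determine it.\<close>

theorem primitive_rational:
  fixes G :: "complex ^ 'n \<Rightarrow> complex ^ 'n"
  assumes G: "polymap G" and D: "etale_discriminant G \<Delta> N C m" and \<omega>: "polymap \<omega>"
    and R: "primitive_on (G -` slice E c) \<omega> R" and s1: "s1 \<in> slice E c" "\<Delta> s1 \<noteq> 0"
  shows "\<exists>Q P. polyfun Q \<and> polyfun P \<and> (\<exists>s\<in>slice E c. Q s \<noteq> 0) \<and> (\<forall>x. G x \<in> slice E c \<longrightarrow> Q (G x) * R x = P x)"
proof -
  have \<Delta>: "polyfun \<Delta>" by (rule etale_discriminantD(1)[OF D])
  define F where "F s = {x. G x = s}" for s
  have F: "finite (F s)" "card (F s) \<le> N" if "\<Delta> s \<noteq> 0" for s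
    using etale_discriminantD(3,4)[OF D that] by (auto simp: F_def)
  obtain l where l: "inj_on (\<lambda>x. \<Sum>i\<in>UNIV. l $ i * x $ i) (F s1)"
    using separating_linear_form[OF F(1)[OF s1(2)]] by blast
  define \<theta> where "\<theta> x = (\<Sum>i\<in>UNIV. l $ i * x $ i)" for x
  have \<theta>: "polyfun \<theta>" unfolding \<theta>_def[abs_def] by (intro polyfun_intros)
  obtain k1 k2 where k: "tempered G E c \<Delta> k1 \<theta>" "tempered G E c \<Delta> k2 R"
    using polyfun_tempered[OF D \<theta>] primitive_tempered[OF G D \<omega> R] by blast
  define k where "k = max k1 k2"
  have temp: "tempered G E c \<Delta> k \<theta>" "tempered G E c \<Delta> k R"
    using k by (auto simp: k_def elim: tempered_mono)
  have bounds: "\<exists>A\<ge>1. \<forall>z. poly d z \<noteq> 0 \<longrightarrow> 1 \<le> A * weight d z ^ k \<and>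
      (\<forall>x\<in>F (a + z *s v). norm (R x) \<le> A * weight d z ^ k \<and> norm (t - \<theta> x) \<le> A * weight d z ^ k \<and>
        (\<forall>y\<in>F (a + z *s v). norm (\<theta> x - \<theta> y) \<le> A * weight d z ^ k))"
    if line: "line_in_slice E c \<Delta> a v d" for a v d t
  proof -
    obtain A1 A2 where A: "A1 \<ge> 0" "\<And>z x. poly d z \<noteq> 0 \<Longrightarrow> G x = a + z *s v \<Longrightarrow> norm (\<theta> x) \<le> A1 * weight d z ^ k"
      "A2 \<ge> 0" "\<And>z x. poly d z \<noteq> 0 \<Longrightarrow> G x = a + z *s v \<Longrightarrow> norm (R x) \<le> A2 * weight d z ^ k"
      using temp line unfolding tempered_def by blast
    define A where "A = 1 + 2 * A1 + A2 + norm t"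
    have A': "A \<ge> 1" using A by (simp add: A_def)
    show ?thesis
    proof (intro exI[of _ A] conjI A' allI impI ballI)
      fix z assume z: "poly d z \<noteq> 0"
      have w: "1 \<le> weight d z ^ k" by (intro one_le_power weight_ge_1)
      have le: "b * weight d z ^ k \<le> A * weight d z ^ k" if "b \<le> A" for b
        using that w by (intro mult_right_mono) auto
      show "1 \<le> A * weight d z ^ k" using w le[OF A'] unfolding mult_1 by (rule order_trans)
      fix x assume "x \<in> F (a + z *s v)"
      then have x: "G x = a + z *s v" by (simp add: F_def)
      show "norm (R x) \<le> A * weight d z ^ k"
        using A(4)[OF z x] le[of A2] A by (simp add: A_def)
      have tw: "norm t \<le> norm t * weight d z ^ k" using w mult_left_mono[of 1 _ "norm t"] by simp
      have "norm (t - \<theta> x) \<le> norm t + norm (\<theta> x)" by (rule norm_triangle_ineq4)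
      also have "\<dots> \<le> (norm t + A1) * weight d z ^ k" using A(2)[OF z x] tw by (simp add: distrib_right)
      also have "\<dots> \<le> A * weight d z ^ k" by (rule le) (use A in \<open>simp add: A_def\<close>)
      finally show "norm (t - \<theta> x) \<le> A * weight d z ^ k" .
      fix y assume "y \<in> F (a + z *s v)"
      then have y: "G y = a + z *s v" by (simp add: F_def)
      have "norm (\<theta> x - \<theta> y) \<le> norm (\<theta> x) + norm (\<theta> y)" by (rule norm_triangle_ineq4)
      also have "\<dots> \<le> (2 * A1) * weight d z ^ k" using A(2)[OF z x] A(2)[OF z y] by simp
      also have "\<dots> \<le> A * weight d z ^ k" by (rule le) (use A in \<open>simp add: A_def\<close>)
      finally show "norm (\<theta> x - \<theta> y) \<le> A * weight d z ^ k" .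
    qed
  qed
  have local: "\<exists>r>0. \<exists>(S :: (complex ^ 'n) set) \<beta>. (\<forall>z\<in>ball z0 r. bij_betw (\<lambda>x. \<beta> x z) S (F (a + z *s v))) \<and>
      (\<forall>x\<in>S. (\<lambda>z. \<theta> (\<beta> x z)) holomorphic_on ball z0 r \<and> (\<lambda>z. R (\<beta> x z)) holomorphic_on ball z0 r)"
    if line: "line_in_slice E c \<Delta> a v d" and "poly d z0 \<noteq> 0" for a v d z0
  proof -
    have av: "a \<in> slice E c" "v \<in> slice E 0" using line by (auto simp: line_in_slice_def)
    have nz: "\<Delta> (a + z0 *s v) \<noteq> 0" using that line_in_sliceD(3)[OF line] by simp
    obtain r \<beta> where r: "r > 0" and br: "\<And>x. G x = a + z0 *s v \<Longrightarrow> \<beta> x z0 = x"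
      "\<And>z. z \<in> ball z0 r \<Longrightarrow> \<Delta> (a + z *s v) \<noteq> 0"
      "\<And>z. z \<in> ball z0 r \<Longrightarrow> bij_betw (\<lambda>x. \<beta> x z) {x. G x = a + z0 *s v} {x. G x = a + z *s v}"
      "\<And>x. G x = a + z0 *s v \<Longrightarrow> continuous_on (ball z0 r) (\<lambda>z. lift_velocity G v (\<beta> x z))"
      "\<And>x z. G x = a + z0 *s v \<Longrightarrow> z \<in> ball z0 r \<Longrightarrow> (\<beta> x has_derivative (\<lambda>h. h *s lift_velocity G v (\<beta> x z))) (at z)"
      by (rule line_branches[OF G D nz]; rule that; assumption)
    have "(\<lambda>z. \<theta> (\<beta> x z)) holomorphic_on ball z0 r \<and> (\<lambda>z. R (\<beta> x z)) holomorphic_on ball z0 r"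
      if x: "G x = a + z0 *s v" for x
    proof -
      have img: "G (\<beta> x z) = a + z *s v" if "z \<in> ball z0 r" for z
        using br(3)[OF that] x by (auto simp: bij_betw_def)
      show ?thesis
        using polyfun_curve_derivative[OF \<theta> br(5)[OF x]]
          primitive_branch_derivative[OF R \<omega> av br(5)[OF x] br(4)[OF x] img]
        by (simp only: holomorphic_on_open[OF open_ball]) blast
    qed
    then show ?thesis using br(3) r
      by (intro exI[of _ r] conjI exI[of _ "F (a + z0 *s v)"] exI[of _ \<beta>]) (auto simp: F_def)
  qed
  have disc: "\<exists>B P. polyfun P \<and> (\<forall>s\<in>slice E c. \<Delta> s \<noteq> 0 \<longrightarrow> \<Delta> s ^ B * fibre_disc \<theta> (F s) = P s)"
  proof (rule tempered_slice_function_rational[OF \<Delta> s1])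
    fix a v d z0 assume line: "line_in_slice E c \<Delta> a v d" and z0: "poly d z0 \<noteq> 0"
    obtain r and S :: "(complex ^ 'n) set" and \<beta> where r: "r > 0" "\<And>z. z \<in> ball z0 r \<Longrightarrow> bij_betw (\<lambda>x. \<beta> x z) S (F (a + z *s v))"
      "\<And>x. x \<in> S \<Longrightarrow> (\<lambda>z. \<theta> (\<beta> x z)) holomorphic_on ball z0 r"
      using local[OF line z0] by blast
    show "\<exists>r>0. \<exists>H. H holomorphic_on ball z0 r \<and> (\<forall>z\<in>ball z0 r. fibre_disc \<theta> (F (a + z *s v)) = H z)"
      using fibre_disc_reindex[OF r(2)]
      by (intro exI[of _ r] conjI r(1) exI[of _ "\<lambda>z. fibre_disc (\<lambda>x. \<theta> (\<beta> x z)) S"] fibre_disc_holomorphic r(3)) auto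
  next
    fix a v d assume line: "line_in_slice E c \<Delta> a v d"
    from bounds[OF line, of 0] obtain A where A: "A \<ge> 1" "\<And>z. poly d z \<noteq> 0 \<Longrightarrow> 1 \<le> A * weight d z ^ k"
      "\<And>z x y. poly d z \<noteq> 0 \<Longrightarrow> x \<in> F (a + z *s v) \<Longrightarrow> y \<in> F (a + z *s v) \<Longrightarrow> norm (\<theta> x - \<theta> y) \<le> A * weight d z ^ k"
      by blast
    have "norm (fibre_disc \<theta> (F (a + z *s v))) \<le> (A ^ N) ^ N * weight d z ^ (k * N * N)" if z: "poly d z \<noteq> 0" for z
    proof -
      have nz: "\<Delta> (a + z *s v) \<noteq> 0" using z line_in_sliceD(3)[OF line] by simp
      have "norm (fibre_disc \<theta> (F (a + z *s v))) \<le> ((A * weight d z ^ k) ^ N) ^ N"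
        by (rule fibre_disc_bound[OF A(3)[OF z] A(2)[OF z] F(2)[OF nz]])
      then show ?thesis by (simp add: power_mult_distrib power_mult)
    qed
    then show "\<exists>C. \<forall>z. poly d z \<noteq> 0 \<longrightarrow> norm (fibre_disc \<theta> (F (a + z *s v))) \<le> C * weight d z ^ (k * N * N)" by blast
  qed
  have lagr: "\<exists>B P. polyfun P \<and> (\<forall>s\<in>slice E c. \<Delta> s \<noteq> 0 \<longrightarrow> \<Delta> s ^ B * fibre_lagrange R \<theta> (F s) t = P s)" for t
  proof (rule tempered_slice_function_rational[OF \<Delta> s1])
    fix a v d z0 assume line: "line_in_slice E c \<Delta> a v d" and z0: "poly d z0 \<noteq> 0"
    obtain r and S :: "(complex ^ 'n) set" and \<beta> where r: "r > 0" "\<And>z. z \<in> ball z0 r \<Longrightarrow> bij_betw (\<lambda>x. \<beta> x z) S (F (a + z *s v))"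
      "\<And>x. x \<in> S \<Longrightarrow> (\<lambda>z. \<theta> (\<beta> x z)) holomorphic_on ball z0 r" "\<And>x. x \<in> S \<Longrightarrow> (\<lambda>z. R (\<beta> x z)) holomorphic_on ball z0 r"
      using local[OF line z0] by blast
    show "\<exists>r>0. \<exists>H. H holomorphic_on ball z0 r \<and> (\<forall>z\<in>ball z0 r. fibre_lagrange R \<theta> (F (a + z *s v)) t = H z)"
      using fibre_lagrange_reindex[OF r(2)]
      by (intro exI[of _ r] conjI r(1) exI[of _ "\<lambda>z. fibre_lagrange (\<lambda>x. R (\<beta> x z)) (\<lambda>x. \<theta> (\<beta> x z)) S t"]
          fibre_lagrange_holomorphic r(3,4)) auto
  next
    fix a v d assume line: "line_in_slice E c \<Delta> a v d"
    from bounds[OF line, of t] obtain A where A: "A \<ge> 1" "\<And>z. poly d z \<noteq> 0 \<Longrightarrow> 1 \<le> A * weight d z ^ k"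
      "\<And>z x y. poly d z \<noteq> 0 \<Longrightarrow> x \<in> F (a + z *s v) \<Longrightarrow> y \<in> F (a + z *s v) \<Longrightarrow> norm (\<theta> x - \<theta> y) \<le> A * weight d z ^ k"
      "\<And>z x. poly d z \<noteq> 0 \<Longrightarrow> x \<in> F (a + z *s v) \<Longrightarrow> norm (t - \<theta> x) \<le> A * weight d z ^ k"
      "\<And>z x. poly d z \<noteq> 0 \<Longrightarrow> x \<in> F (a + z *s v) \<Longrightarrow> norm (R x) \<le> A * weight d z ^ k"
      by blast
    have "norm (fibre_lagrange R \<theta> (F (a + z *s v)) t) \<le> (N * (A * A ^ N * (A ^ N) ^ N)) * weight d z ^ (k + k * N + k * N * N)"
      if z: "poly d z \<noteq> 0" for z
    proof -
      have nz: "\<Delta> (a + z *s v) \<noteq> 0" using z line_in_sliceD(3)[OF line] by simp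
      define W where "W = weight d z"
      have "norm (fibre_lagrange R \<theta> (F (a + z *s v)) t) \<le>
         N * ((A * weight d z ^ k) * (A * weight d z ^ k) ^ N * ((A * weight d z ^ k) ^ N) ^ N)"
        by (rule fibre_lagrange_bound[OF A(3)[OF z] A(4)[OF z] A(5)[OF z] A(2)[OF z] F(2)[OF nz]])
      also have "\<dots> = (N * (A * A ^ N * (A ^ N) ^ N)) * weight d z ^ (k + k * N + k * N * N)"
        unfolding W_def[symmetric] by (simp add: power_mult_distrib power_add mult_ac flip: power_mult)
      finally show ?thesis .
    qed
    then show "\<exists>C. \<forall>z. poly d z \<noteq> 0 \<longrightarrow> norm (fibre_lagrange R \<theta> (F (a + z *s v)) t) \<le> C * weight d z ^ (k + k * N + k * N * N)" by blast
  qed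
  obtain B PD where PD: "polyfun PD" "\<And>s. s \<in> slice E c \<Longrightarrow> \<Delta> s \<noteq> 0 \<Longrightarrow> \<Delta> s ^ B * fibre_disc \<theta> (F s) = PD s"
    using disc by blast
  obtain Bt PL where PL: "\<And>t. polyfun (PL t)"
    "\<And>t s. s \<in> slice E c \<Longrightarrow> \<Delta> s \<noteq> 0 \<Longrightarrow> \<Delta> s ^ Bt t * fibre_lagrange R \<theta> (F s) t = PL t s"
    using lagr by metis
  define T where "T j = (of_nat j :: complex)" for j
  have injT: "inj_on T {..N}" by (auto simp: inj_on_def T_def)
  define M where "M = B + (\<Sum>j\<le>N. Bt (T j))"
  \<comment> \<open>At least one factor \<open>\<Delta>\<close> is kept, so that both sides of the identity vanish on the discriminant.\<close>
  define Q where "Q s = \<Delta> s ^ Suc (M - B) * PD s" for s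
  define P where "P x = (\<Sum>j\<le>N. \<Delta> (G x) ^ Suc (M - Bt (T j)) * PL (T j) (G x) *
     (\<Prod>i\<in>{..N} - {j}. (\<theta> x - T i) / (T j - T i)))" for x
  have "polyfun Q" unfolding Q_def[abs_def] by (intro polyfun_intros \<Delta> PD(1))
  moreover have "polyfun P" unfolding P_def[abs_def] divide_inverse
    by (intro polyfun_intros polyfun_compose[OF \<Delta> G] polyfun_compose[OF PL(1) G] \<theta>)
  moreover have "Q s1 \<noteq> 0"
  proof -
    have "fibre_disc \<theta> (F s1) \<noteq> 0"
      unfolding fibre_disc_def using F(1)[OF s1(2)] l by (auto simp: inj_on_def \<theta>_def)
    then have "PD s1 \<noteq> 0" using PD(2)[OF s1] s1(2) by (metis mult_eq_0_iff power_not_zero)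
    then show ?thesis using s1(2) by (simp add: Q_def)
  qed
  moreover have "Q (G x) * R x = P x" if x: "G x \<in> slice E c" for x
  proof (cases "\<Delta> (G x) = 0")
    case True
    then show ?thesis by (simp add: Q_def P_def)
  next
    case False
    define s where "s = G x"
    have s: "s \<in> slice E c" "\<Delta> s \<noteq> 0" "x \<in> F s" using x False by (auto simp: s_def F_def)
    obtain q where q: "degree q \<le> card (F s)" "\<And>t. fibre_lagrange R \<theta> (F s) t = poly q t"
      using fibre_lagrange_poly[OF F(1)[OF s(2)]] by blast
    have "degree q \<le> N" using q(1) F(2)[OF s(2)] by simp
    have "R x * fibre_disc \<theta> (F s) = poly q (\<theta> x)"
      using fibre_lagrange_eval[OF F(1)[OF s(2)] s(3), of R \<theta>] q(2) by simp
    also have "\<dots> = (\<Sum>j\<le>N. poly q (T j) * (\<Prod>i\<in>{..N} - {j}. (\<theta> x - T i) / (T j - T i)))"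
      by (rule lagrange_interpolation[OF \<open>degree q \<le> N\<close> injT])
    finally have eq: "\<Delta> s ^ Suc M * (R x * fibre_disc \<theta> (F s)) =
       (\<Sum>j\<le>N. \<Delta> s ^ Suc M * poly q (T j) * (\<Prod>i\<in>{..N} - {j}. (\<theta> x - T i) / (T j - T i)))"
      by (simp add: sum_distrib_left mult.assoc)
    have "Q s * R x = \<Delta> s ^ Suc (M - B) * (\<Delta> s ^ B * fibre_disc \<theta> (F s)) * R x"
      by (simp add: Q_def PD(2)[OF s(1,2)])
    also have "\<dots> = \<Delta> s ^ (Suc (M - B) + B) * (R x * fibre_disc \<theta> (F s))" by (simp only: power_add mult_ac)
    also have "Suc (M - B) + B = Suc M" by (simp add: M_def)
    also note eq
    also have "(\<Sum>j\<le>N. \<Delta> s ^ Suc M * poly q (T j) * (\<Prod>i\<in>{..N} - {j}. (\<theta> x - T i) / (T j - T i))) = P x"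
      unfolding P_def s_def[symmetric]
    proof (intro sum.cong refl)
      fix j assume "j \<in> {..N}"
      then have "Bt (T j) \<le> (\<Sum>j\<le>N. Bt (T j))" by (intro member_le_sum) auto
      then have "Bt (T j) \<le> M" by (simp add: M_def)
      then have "\<Delta> s ^ Suc M = \<Delta> s ^ Suc (M - Bt (T j)) * \<Delta> s ^ Bt (T j)" by (simp flip: power_add)
      then show "\<Delta> s ^ Suc M * poly q (T j) * (\<Prod>i\<in>{..N} - {j}. (\<theta> x - T i) / (T j - T i)) =
         \<Delta> s ^ Suc (M - Bt (T j)) * PL (T j) s * (\<Prod>i\<in>{..N} - {j}. (\<theta> x - T i) / (T j - T i))"
        using PL(2)[OF s(1,2), of "T j"] q(2) by (simp only: mult.assoc)
    qed
    finally show ?thesis by (simp add: s_def)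
  qed
  ultimately show ?thesis using s1(1) by blast
qed

section \<open>Taylor approximation of primitives\<close>

lemma vanishes_to_order_0:
  assumes "isCont g p"
  shows "vanishes_to_order 0 p X g"
proof -
  have "((\<lambda>x. norm (g x)) \<longlongrightarrow> norm (g p)) (nhds p)" by (rule tendsto_norm[OF isCont_tendsto_nhds[OF assms]])
  from order_tendstoD(2)[OF this, of "norm (g p) + 1"] show ?thesis
    unfolding vanishes_to_order_def by (intro exI[of _ "norm (g p) + 1"]) (auto elim: eventually_mono)
qed

lemma polyfun_isCont: "polyfun f \<Longrightarrow> isCont f p"
  using polyfun_has_derivative has_derivative_continuous by blast

text \<open>A partial sum of the geometric series.\<close>

lemma reciprocal_approx:
  assumes M: "polyfun M" "M p \<noteq> 0"
  shows "\<exists>N. polyfun N \<and> vanishes_to_order k p UNIV (\<lambda>x. inverse (M x) - N x)"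
proof -
  define t where "t x = 1 - inverse (M p) * M x" for x
  have t: "polyfun t" unfolding t_def[abs_def] by (intro polyfun_intros M)
  define N where "N x = inverse (M p) * (\<Sum>i<k. t x ^ i)" for x
  have "polyfun N" unfolding N_def[abs_def] by (intro polyfun_intros t)
  have van: "vanishes_to_order (k * 1 + 0) p UNIV (\<lambda>x. t x ^ k * inverse (M x))"
    by (intro vanishes_to_order_mult vanishes_to_order_power vanishes_to_order_1 t vanishes_to_order_0
        continuous_intros polyfun_isCont M) (simp add: t_def M)
  have "open {x. M x \<noteq> 0}"
    using open_Collect_neq[OF polyfun_continuous_on[OF M(1)] continuous_on_const[of _ 0]] by simp
  then have "\<forall>\<^sub>F x in nhds p. M x \<noteq> 0" using M(2) eventually_nhds_in_open[of "{x. M x \<noteq> 0}" p] by simp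
  then have "\<forall>\<^sub>F x in nhds p. inverse (M x) - N x = t x ^ k * inverse (M x)"
  proof eventually_elim
    case (elim x)
    have "(1 - t x) * (\<Sum>i<k. t x ^ i) = 1 - t x ^ k" by (simp add: one_diff_power_eq)
    moreover have "1 - t x = inverse (M p) * M x" by (simp add: t_def)
    ultimately have "M x * N x = 1 - t x ^ k" unfolding N_def by (simp add: mult_ac)
    then show ?case using elim by (simp add: field_simps)
  qed
  then have "vanishes_to_order k p UNIV (\<lambda>x. inverse (M x) - N x)"
    using van unfolding vanishes_to_order_def
    by (elim exE, rule_tac x = C in exI) (auto elim: eventually_elim2)
  with \<open>polyfun N\<close> show ?thesis by blast
qed

text \<open>In the coordinates \<open>s = G x\<close>, the derivative of \<open>R\<close> in the direction \<open>u\<close> of the slice is \<open>\<Sum> u\<^sub>j W\<^sub>j\<close>, where each \<open>W\<^sub>j\<close> is approximated to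
order \<open>k\<close> by a polynomial \<open>b\<^sub>j\<close> in \<open>s\<close>. Integrating the \<open>b\<^sub>j\<close> along the rays from \<open>G p\<close> gives a polynomial, and \<open>R\<close> is compared with it on each ray.\<close>

theorem primitive_taylor:
  fixes G :: "complex ^ 'n \<Rightarrow> complex ^ 'n"
  assumes G: "polymap G" and p: "det (jac_matrix G p) \<noteq> 0" and \<omega>: "polymap \<omega>"
    and R: "primitive_on (G -` slice E (G p)) \<omega> R"
  shows "\<exists>T. polyfun T \<and> vanishes_to_order k p (G -` slice E (G p)) (\<lambda>x. R x - T x)"
proof -
  define M where "M x = det (jac_matrix G x)" for x
  have M: "polyfun M" unfolding M_def[abs_def] by (rule polyfun_det_jac[OF G])
  have Mp: "M p \<noteq> 0" using p by (simp add: M_def)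
  define f where "f j x = (\<Sum>i\<in>UNIV. \<omega> x $ i * adj_vec (jac_matrix G x) (axis j 1) $ i)" for j x
  have f: "polyfun (f j)" for j unfolding f_def[abs_def]
    using \<omega> by (intro polyfun_intros polyfun_adj_vec polyfun_jac G) (auto simp: polymap_def intro: polyfun_intros)
  define W where "W j x = inverse (M x) * f j x" for j x
  have W: "(\<Sum>i\<in>UNIV. \<omega> x $ i * lift_velocity G u x $ i) = (\<Sum>j\<in>UNIV. u $ j * W j x)" if "M x \<noteq> 0" for x u
  proof -
    have "(\<Sum>i\<in>UNIV. \<omega> x $ i * lift_velocity G u x $ i) = (\<Sum>i\<in>UNIV. \<Sum>j\<in>UNIV. u $ j * (\<omega> x $ i * lift_velocity G (axis j 1) x $ i))"
      using that by (subst lift_velocity_linear) (simp_all add: M_def sum_distrib_left mult_ac)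
    also have "\<dots> = (\<Sum>j\<in>UNIV. u $ j * W j x)"
      by (subst sum.swap) (simp add: W_def M_def f_def lift_velocity_def sum_distrib_left mult_ac)
    finally show ?thesis .
  qed
  have "\<exists>b. polyfun b \<and> vanishes_to_order k p UNIV (\<lambda>x. W j x - b (G x))" for j
  proof -
    obtain N where N: "polyfun N" "vanishes_to_order k p UNIV (\<lambda>x. inverse (M x) - N x)"
      using reciprocal_approx[OF M Mp] by blast
    have "polyfun (\<lambda>x. N x * f j x)" by (intro polyfun_intros N f)
    then obtain b where b: "polyfun b" "vanishes_to_order k p UNIV (\<lambda>x. N x * f j x - b (G x))"
      using polyfun_approx_through_chart[OF G p] by blast
    have "vanishes_to_order (k + 0) p UNIV (\<lambda>x. (inverse (M x) - N x) * f j x)"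
      by (intro vanishes_to_order_mult N vanishes_to_order_0 polyfun_isCont f)
    from vanishes_to_order_add[OF this[simplified] b(2)]
    have "vanishes_to_order k p UNIV (\<lambda>x. W j x - b (G x))" by (simp add: W_def algebra_simps)
    with b(1) show ?thesis by blast
  qed
  then have "\<exists>b. \<forall>j. polyfun (b j) \<and> vanishes_to_order k p UNIV (\<lambda>x. W j x - b j (G x))" by (intro choice allI)
  then obtain b where b: "\<And>j. polyfun (b j)" "\<And>j. vanishes_to_order k p UNIV (\<lambda>x. W j x - b j (G x))" by blast
  define b' where "b' j u = b j (G p + u)" for j u
  have "polyfun (b' j)" for j unfolding b'_def[abs_def]
    by (rule polyfun_compose[OF b(1)]) (auto simp: polymap_def intro!: polyfun_intros)
  then have "\<forall>j. \<exists>B. polyfun B \<and> (\<forall>u z. ((\<lambda>z. z * B (z *s u)) has_field_derivative b' j (z *s u)) (at z))"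
    using polyfun_radial_primitive by blast
  then have "\<exists>B. \<forall>j. polyfun (B j) \<and> (\<forall>u z. ((\<lambda>z. z * B j (z *s u)) has_field_derivative b' j (z *s u)) (at z))"
    by (rule choice)
  then obtain B where B: "\<And>j. polyfun (B j)"
    "\<And>j u z. ((\<lambda>z. z * B j (z *s u)) has_field_derivative b' j (z *s u)) (at z)" by blast
  define T where "T x = R p + (\<Sum>j\<in>UNIV. (G x - G p) $ j * B j (G x - G p))" for x
  have GG: "polymap (\<lambda>x. G x - G p)" by (intro polymap_diff G polymap_const)
  then have "polyfun T" unfolding T_def[abs_def]
    by (intro polyfun_intros polyfun_compose[OF B(1) GG]) (simp only: polymap_def)
  obtain U V g where g: "open U" "p \<in> U" "open V" "G p \<in> V" "homeomorphism U V G g"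
      "\<And>x. x \<in> U \<Longrightarrow> det (jac_matrix G x) \<noteq> 0"
      "\<And>y. y \<in> V \<Longrightarrow> (g has_derivative
        (\<lambda>h. inverse (det (jac_matrix G (g y))) *s adj_vec (jac_matrix G (g y)) h)) (at y)"
    by (rule polymap_local_inverse[OF G p]; rule that; assumption)
  have gp: "g (G p) = p" and gU: "\<And>s. s \<in> V \<Longrightarrow> g s \<in> U" and Gg: "\<And>s. s \<in> V \<Longrightarrow> G (g s) = s"
    and gG: "\<And>x. x \<in> U \<Longrightarrow> g (G x) = x"
    using g by (auto simp: homeomorphism_def)
  have "\<forall>j. \<exists>C. \<forall>\<^sub>F x in nhds p. norm (W j x - b j (G x)) \<le> C * norm (x - p) ^ k"
    using b(2) unfolding vanishes_to_order_def by simp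
  then have "\<exists>C. \<forall>j. \<forall>\<^sub>F x in nhds p. norm (W j x - b j (G x)) \<le> C j * norm (x - p) ^ k" by (rule choice)
  then obtain C where C: "\<And>j. \<forall>\<^sub>F x in nhds p. norm (W j x - b j (G x)) \<le> C j * norm (x - p) ^ k" by blast
  have C': "\<forall>\<^sub>F x in nhds p. \<forall>j. norm (W j x - b j (G x)) \<le> C j * norm (x - p) ^ k"
    using C by (simp add: eventually_all_finite)
  have tg: "(g \<longlongrightarrow> p) (nhds (G p))"
    using isCont_tendsto_nhds[OF has_derivative_continuous[OF g(7)[OF g(4)]]] by (simp add: gp)
  have C'': "\<forall>\<^sub>F s in nhds (G p). \<forall>j. norm (W j (g s) - b j (G (g s))) \<le> C j * norm (g s - p) ^ k"
    using C' tg unfolding filterlim_iff by blast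
  obtain K where K: "K \<ge> 0" "\<forall>\<^sub>F s in nhds (G p). norm (g s - g (G p)) \<le> K * norm (s - G p)"
    using has_derivative_local_lipschitz[OF g(7)[OF g(4)]] by blast
  have "\<forall>\<^sub>F s in nhds (G p). s \<in> V \<and> (\<forall>j. norm (W j (g s) - b j s) \<le> (max (C j) 0 * K ^ k) * norm (s - G p) ^ k)"
    using C'' K(2) eventually_nhds_in_open[OF g(3,4)]
  proof eventually_elim
    case (elim s)
    have "norm (W j (g s) - b j s) \<le> (max (C j) 0 * K ^ k) * norm (s - G p) ^ k" for j
    proof -
      have "norm (W j (g s) - b j s) \<le> C j * norm (g s - p) ^ k" using elim Gg by simp
      also have "\<dots> \<le> max (C j) 0 * norm (g s - p) ^ k" by (intro mult_right_mono) auto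
      also have "\<dots> \<le> max (C j) 0 * (K * norm (s - G p)) ^ k"
        using elim by (intro mult_left_mono power_mono) (auto simp: gp)
      finally show ?thesis by (simp add: power_mult_distrib)
    qed
    then show ?case using elim by blast
  qed
  then obtain e where e: "e > 0" "\<And>s. dist s (G p) < e \<Longrightarrow> s \<in> V"
    "\<And>s j. dist s (G p) < e \<Longrightarrow> norm (W j (g s) - b j s) \<le> (max (C j) 0 * K ^ k) * norm (s - G p) ^ k"
    unfolding eventually_nhds_metric by blast
  define Q where "Q = (\<Sum>j\<in>UNIV. max (C j) 0 * K ^ k)"
  have "Q \<ge> 0" unfolding Q_def using K(1) by (intro sum_nonneg) auto
  \<comment> \<open>Integration of the error in the derivative along the ray from \<open>G p\<close> to \<open>G p + u\<close>.\<close>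
  have main: "norm (R (g (G p + u)) - R p - (\<Sum>j\<in>UNIV. u $ j * B j u)) \<le> Q * norm u ^ Suc k"
    if u: "u \<in> slice E 0" "norm u < e" for u
  proof -
    define \<psi> where "\<psi> z = R (g (G p + z *s u)) - (\<Sum>j\<in>UNIV. u $ j * (z * B j (z *s u)))" for z
    define S where "S = {z. G p + z *s u \<in> V}"
    have S: "open S" unfolding S_def by (rule line_preimage_open[OF g(3)])
    have inS: "z \<in> S" "dist (G p + z *s u) (G p) < e" if "norm z \<le> 1" for z
    proof -
      have "norm (z *s u) \<le> 1 * norm u" unfolding norm_vector_smult using that by (intro mult_right_mono) auto
      then show d: "dist (G p + z *s u) (G p) < e" using u(2) by (simp add: dist_norm)
      show "z \<in> S" unfolding S_def using e(2)[OF d] by simp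
    qed
    have der: "(\<psi> has_field_derivative (\<Sum>j\<in>UNIV. u $ j * (W j (g (G p + z *s u)) - b j (G p + z *s u)))) (at z)"
      if z: "z \<in> S" for z
    proof -
      have "((\<lambda>z. R (g (G p + z *s u))) has_field_derivative
          (\<Sum>i\<in>UNIV. \<omega> (g (G p + z *s u)) $ i * lift_velocity G u (g (G p + z *s u)) $ i)) (at z)"
      proof (rule primitive_on_curve[OF R \<omega> S _ _ _ z])
        show "((\<lambda>z. g (G p + z *s u)) has_derivative (\<lambda>h. h *s lift_velocity G u (g (G p + z *s u)))) (at z)" if "z \<in> S" for z
          using local_inverse_line(1)[OF G g(3,5,6,7)] that by (simp add: S_def)
        show "continuous_on S (\<lambda>z. lift_velocity G u (g (G p + z *s u)))"
          unfolding S_def using local_inverse_line(2)[OF G g(3,5,6,7)] z by (simp add: S_def)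
        show "(\<lambda>z. g (G p + z *s u)) ` S \<subseteq> G -` slice E (G p)"
          using Gg u(1) by (auto simp: S_def slice_def)
      qed
      moreover have "M (g (G p + z *s u)) \<noteq> 0" using g(6)[OF gU] z by (simp add: S_def M_def)
      ultimately have d1: "((\<lambda>z. R (g (G p + z *s u))) has_field_derivative (\<Sum>j\<in>UNIV. u $ j * W j (g (G p + z *s u)))) (at z)"
        by (simp add: W)
      have d2: "((\<lambda>z. \<Sum>j\<in>UNIV. u $ j * (z * B j (z *s u))) has_field_derivative (\<Sum>j\<in>UNIV. u $ j * b' j (z *s u))) (at z)"
        by (intro DERIV_sum DERIV_cmult B)
      show ?thesis unfolding \<psi>_def
        using DERIV_diff[OF d1 d2] by (simp add: b'_def right_diff_distrib sum_subtractf)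
    qed
    have "norm (\<psi> 1 - \<psi> 0) \<le> (Q * norm u ^ Suc k) * norm (1 - 0 :: complex)"
    proof (rule field_differentiable_bound[of "cball 0 1" \<psi>])
      fix z :: complex assume "z \<in> cball 0 1"
      then have z: "norm z \<le> 1" by simp
      show "(\<psi> has_field_derivative (\<Sum>j\<in>UNIV. u $ j * (W j (g (G p + z *s u)) - b j (G p + z *s u)))) (at z within cball 0 1)"
        using der[OF inS(1)[OF z]] by (rule has_field_derivative_at_within)
      have "norm (\<Sum>j\<in>UNIV. u $ j * (W j (g (G p + z *s u)) - b j (G p + z *s u))) \<le>
          (\<Sum>j\<in>UNIV. norm u * ((max (C j) 0 * K ^ k) * norm u ^ k))"
      proof (intro order_trans[OF norm_sum] sum_mono)
        fix j
        have "norm (W j (g (G p + z *s u)) - b j (G p + z *s u)) \<le> (max (C j) 0 * K ^ k) * norm (z *s u) ^ k"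
          using e(3)[OF inS(2)[OF z], of j] by simp
        also have "\<dots> \<le> (max (C j) 0 * K ^ k) * norm u ^ k"
          using z K(1) by (intro mult_left_mono power_mono) (auto simp: norm_vector_smult mult_left_le_one_le)
        finally show "norm (u $ j * (W j (g (G p + z *s u)) - b j (G p + z *s u))) \<le> norm u * ((max (C j) 0 * K ^ k) * norm u ^ k)"
          unfolding norm_mult by (intro mult_mono Finite_Cartesian_Product.norm_nth_le) auto
      qed
      also have "\<dots> = Q * norm u ^ Suc k" by (simp add: Q_def sum_distrib_left sum_distrib_right mult_ac)
      finally show "norm (\<Sum>j\<in>UNIV. u $ j * (W j (g (G p + z *s u)) - b j (G p + z *s u))) \<le> Q * norm u ^ Suc k" .
    qed auto
    then show ?thesis by (simp add: \<psi>_def gp algebra_simps)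
  qed
  obtain L where L: "L \<ge> 0" "\<forall>\<^sub>F x in nhds p. norm (G x - G p) \<le> L * norm (x - p)"
    using has_derivative_local_lipschitz[OF polymap_has_derivative[OF G]] by blast
  have "\<forall>\<^sub>F x in nhds p. G x \<in> ball (G p) e"
    using e(1) by (intro topological_tendstoD[OF polymap_tendsto[OF G]]) auto
  with L(2) eventually_nhds_in_open[OF g(1,2)] eventually_nhds_in_open[OF open_ball centre_in_ball[THEN iffD2, OF zero_less_one], of p]
  have "\<forall>\<^sub>F x in nhds p. x \<in> G -` slice E (G p) \<longrightarrow> norm (R x - T x) \<le> (Q * L ^ Suc k) * norm (x - p) ^ k"
  proof eventually_elim
    case (elim x)
    show ?case
    proof
      assume "x \<in> G -` slice E (G p)"
      then have sl: "G x - G p \<in> slice E 0" by (simp add: slice_def)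
      have "norm (G x - G p) < e" using elim by (simp add: dist_norm norm_minus_commute)
      from main[OF sl this] gG[OF elim(2)]
      have "norm (R x - T x) \<le> Q * norm (G x - G p) ^ Suc k" by (simp add: T_def algebra_simps)
      also have "\<dots> \<le> Q * (L * norm (x - p)) ^ Suc k"
        using elim \<open>Q \<ge> 0\<close> by (intro mult_left_mono power_mono) auto
      also have "\<dots> = (Q * L ^ Suc k) * norm (x - p) ^ Suc k" by (simp add: power_mult_distrib)
      also have "\<dots> \<le> (Q * L ^ Suc k) * norm (x - p) ^ k"
        using elim(3) \<open>Q \<ge> 0\<close> L(1) by (intro mult_left_mono power_decreasing) (auto simp: dist_norm norm_minus_commute)
      finally show "norm (R x - T x) \<le> (Q * L ^ Suc k) * norm (x - p) ^ k" .
    qed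
  qed
  then show ?thesis using \<open>polyfun T\<close> unfolding vanishes_to_order_def by blast
qed

section \<open>Noncritical fibres and their ideals\<close>

text \<open>The map \<open>e\<close> tells which coordinate function each component of \<open>F\<close> replaces; the fibres of \<open>F\<close> become preimages of coordinate slices.\<close>

definition completion :: "('q \<Rightarrow> 'n) \<Rightarrow> (complex ^ 'n \<Rightarrow> complex ^ 'q) \<Rightarrow> complex ^ 'n \<Rightarrow> complex ^ 'n" where
  "completion e F x = (\<chi> i. if i \<in> range e then F x $ (inv_into UNIV e i) else x $ i)"

lemma completion_nth: "inj e \<Longrightarrow> completion e F x $ e j = F x $ j" "i \<notin> range e \<Longrightarrow> completion e F x $ i = x $ i"
  by (auto simp: completion_def)

lemma polymap_completion:
  assumes "polymap F"
  shows "polymap (completion e F)"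
  unfolding polymap_def
proof
  fix i
  show "polyfun (\<lambda>x. completion e F x $ i)"
    using assms by (cases "i \<in> range e") (auto simp: completion_def polymap_def intro: polyfun_intros)
qed

lemma completion_fibre:
  assumes "inj e"
  shows "completion e F -` slice (range e) c = {x. \<forall>j. F x $ j = c $ e j}"
  using assms by (auto simp: slice_def completion_nth)

lemma jac_completion:
  assumes "inj e"
  shows "jac_matrix (completion e F) x $ e j = jac_matrix F x $ j"
    "i \<notin> range e \<Longrightarrow> jac_matrix (completion e F) x $ i = axis i 1"
proof -
  show "jac_matrix (completion e F) x $ e j = jac_matrix F x $ j"
    by (simp add: jac_matrix_def completion_nth(1)[OF assms])
  assume "i \<notin> range e"
  then show "jac_matrix (completion e F) x $ i = axis i 1"
    by (simp add: jac_matrix_def completion_nth ext_d_def partial_coord vec_eq_iff axis_def)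
qed

text \<open>By the exchange lemma the independent rows of the derivative of \<open>F\<close> are completed to a basis by unit vectors; \<open>e\<close> enumerates the
remaining coordinates.\<close>

lemma noncritical_chart:
  fixes F :: "complex ^ 'n \<Rightarrow> complex ^ 'q"
  assumes rk: "rank (jac_matrix F p) = CARD('q)"
  shows "\<exists>e :: 'q \<Rightarrow> 'n. inj e \<and> det (jac_matrix (completion e F) p) \<noteq> 0"
proof -
  define A where "A = jac_matrix F p"
  define rw where "rw j = A $ j" for j
  have rows: "rows A = range rw" by (auto simp: rows_def row_def rw_def)
  have fin: "finite (rows A)" by (simp add: rows)
  have "vec.dim (rows A) = CARD('q)" using rk by (simp add: A_def row_rank_def_gen)
  have le: "card (rows A) \<le> CARD('q)" unfolding rows by (rule card_image_le) simp
  then have ind: "vec.independent (rows A)"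
    using vec.card_le_dim_spanning[of "rows A" "rows A"] fin \<open>vec.dim (rows A) = _\<close> vec.span_superset by auto
  have card: "card (rows A) = CARD('q)"
    using vec.dim_eq_card_independent[OF ind] \<open>vec.dim (rows A) = _\<close> by simp
  have inj_rw: "inj rw" using card unfolding rows by (intro eq_card_imp_inj_on) auto
  obtain Bs where Bs: "rows A \<subseteq> Bs" "Bs \<subseteq> rows A \<union> cart_basis" "vec.independent Bs" "rows A \<union> cart_basis \<subseteq> vec.span Bs"
    using vec.maximal_independent_subset_extend[of "rows A" "rows A \<union> cart_basis"] ind by auto
  have span: "vec.span Bs = UNIV"
  proof -
    have "vec.span cart_basis \<subseteq> vec.span Bs" using Bs(4) by (intro vec.span_minimal) auto
    then show ?thesis by (auto simp: span_cart_basis)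
  qed
  have "card Bs = CARD('n)"
    using vec.dim_eq_card[OF _ Bs(3), of UNIV] span by (simp add: card_cart_basis)
  have "finite Bs" using Bs(2) fin finite_cart_basis finite_subset by blast
  define K where "K = {i. axis i (1::complex) \<in> Bs - rows A}"
  have K: "Bs - rows A = (\<lambda>i. axis i 1) ` K" using Bs(2) by (auto simp: K_def cart_basis_def)
  have "card K = card (Bs - rows A)" unfolding K by (rule card_image[symmetric]) (auto simp: inj_on_def axis_eq_axis)
  also have "\<dots> = CARD('n) - CARD('q)"
    using card_Diff_subset[OF fin Bs(1)] card \<open>card Bs = _\<close> by simp
  finally have "card K = CARD('n) - CARD('q)" .
  moreover have "CARD('q) \<le> CARD('n)" using card_mono[OF \<open>finite Bs\<close> Bs(1)] card \<open>card Bs = _\<close> by simp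
  ultimately have "card (-K) = card (UNIV :: 'q set)" by (simp add: Compl_eq_Diff_UNIV card_Diff_subset)
  then obtain e :: "'q \<Rightarrow> 'n" where e: "bij_betw e UNIV (-K)"
    using finite_same_card_bij[of "UNIV :: 'q set" "-K"] by auto
  then have "inj e" "range e = -K" by (auto simp: bij_betw_def)
  define J where "J = jac_matrix (completion e F) p"
  have "Bs \<subseteq> rows J"
  proof
    fix b assume "b \<in> Bs"
    then consider j where "b = rw j" | i where "i \<in> K" "b = axis i 1" using K rows by blast
    then show "b \<in> rows J"
    proof cases
      case (1 j)
      then have "b = row (e j) J"
        using jac_completion(1)[OF \<open>inj e\<close>] by (simp add: row_def J_def rw_def A_def)
      then show ?thesis by (auto simp: rows_def)
    next
      case (2 i)
      then have "b = row i J"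
        using jac_completion(2)[OF \<open>inj e\<close>, of i] \<open>range e = -K\<close> by (simp add: row_def J_def)
      then show ?thesis by (auto simp: rows_def)
    qed
  qed
  then have "vec.span (rows J) = UNIV" using span vec.span_mono by blast
  then have "\<exists>B. B ** J = mat 1" using matrix_left_invertible_span_rows_gen by blast
  then have "det J \<noteq> 0" by (simp add: invertible_det_nz[symmetric] invertible_left_inverse)
  with \<open>inj e\<close> show ?thesis unfolding J_def by blast
qed

definition fibre_ideal :: "(complex ^ 'n \<Rightarrow> complex ^ 'q) \<Rightarrow> complex ^ 'q \<Rightarrow> (complex ^ 'n \<Rightarrow> complex) set" where
  "fibre_ideal F y = {\<lambda>x. \<Sum>j\<in>UNIV. (F x $ j - y $ j) * a j x | a. \<forall>j. polyfun (a j)}"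

lemma fibre_idealI: "(\<And>j. polyfun (a j)) \<Longrightarrow> (\<lambda>x. \<Sum>j\<in>UNIV. (F x $ j - y $ j) * a j x) \<in> fibre_ideal F y"
  unfolding fibre_ideal_def by blast

lemma polyfun_ideal_fibre_ideal:
  fixes F :: "complex ^ 'n \<Rightarrow> complex ^ 'q"
  assumes F: "polymap F"
  shows "polyfun_ideal (fibre_ideal F y)"
  unfolding fun_ideal_def
proof (intro conjI ballI)
  show "fibre_ideal F y \<subseteq> Collect polyfun"
    using F by (auto simp: fibre_ideal_def polymap_def intro!: polyfun_intros)
  show "(\<lambda>x. 0) \<in> fibre_ideal F y"
    using fibre_idealI[of "\<lambda>j x. 0" F y] polyfun.const by auto
next
  fix p r assume "p \<in> fibre_ideal F y" "r \<in> fibre_ideal F y"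
  then obtain a b where ab: "\<And>j. polyfun (a j)" "\<And>j. polyfun (b j)"
    "p = (\<lambda>x. \<Sum>j\<in>UNIV. (F x $ j - y $ j) * a j x)" "r = (\<lambda>x. \<Sum>j\<in>UNIV. (F x $ j - y $ j) * b j x)"
    by (auto simp: fibre_ideal_def)
  have "(\<lambda>x. \<Sum>j\<in>UNIV. (F x $ j - y $ j) * (a j x + b j x)) \<in> fibre_ideal F y"
    by (intro fibre_idealI polyfun_intros ab)
  then show "(\<lambda>x. p x + r x) \<in> fibre_ideal F y" by (simp add: ab distrib_left sum.distrib)
next
  fix c p :: "complex ^ 'n \<Rightarrow> complex" assume "c \<in> Collect polyfun" "p \<in> fibre_ideal F y"
  then obtain a where a: "polyfun c" "\<And>j. polyfun (a j)" "p = (\<lambda>x. \<Sum>j\<in>UNIV. (F x $ j - y $ j) * a j x)"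
    by (auto simp: fibre_ideal_def)
  have "(\<lambda>x. \<Sum>j\<in>UNIV. (F x $ j - y $ j) * (c x * a j x)) \<in> fibre_ideal F y"
    by (intro fibre_idealI polyfun_intros a)
  then show "(\<lambda>x. c x * p x) \<in> fibre_ideal F y" by (simp add: a sum_distrib_left mult_ac)
qed

lemma fibre_ideal_generator: "(\<lambda>x. F x $ j - y $ j) \<in> fibre_ideal F y"
proof -
  have "(\<lambda>x. \<Sum>i\<in>UNIV. (F x $ i - y $ i) * (if i = j then 1 else 0)) \<in> fibre_ideal F y"
    using fibre_idealI[of "\<lambda>i x. if i = j then 1 else 0" F y] polyfun.const by blast
  then show ?thesis by (simp add: if_distrib[of "\<lambda>c. _ * c"] cong: if_cong)
qed

lemma fibre_ideal_zero: "p \<in> fibre_ideal F y \<Longrightarrow> F x = y \<Longrightarrow> p x = 0"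
  by (auto simp: fibre_ideal_def)

lemma off_fibre_generator:
  fixes F :: "complex ^ 'n \<Rightarrow> complex ^ 'q"
  assumes "F x \<noteq> y"
  shows "\<exists>j. F x $ j - y $ j \<noteq> 0"
proof -
  obtain j where "F x $ j \<noteq> y $ j" using assms by (auto simp: vec_eq_iff)
  then show ?thesis by (intro exI[of _ j]) simp
qed

lemma noncritical_fibre_chart:
  fixes F :: "complex ^ 'n \<Rightarrow> complex ^ 'q"
  assumes "noncritical_fibre F y" "F p = y"
  obtains e :: "'q \<Rightarrow> 'n" where "inj e" "det (jac_matrix (completion e F) p) \<noteq> 0"
proof -
  have "rank (jac_matrix F p) = CARD('q)" using assms by (auto simp: noncritical_fibre_def)
  then show ?thesis using noncritical_chart that by blast
qed

lemma completion_fibre_at: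
  assumes "inj e" "F p = y"
  shows "completion e F -` slice (range e) (completion e F p) = F -` {y}"
  using assms by (auto simp: completion_fibre completion_nth vec_eq_iff)

text \<open>This is \<open>local_ideal_membership\<close> for the ideal generated by \<open>D\<close> and the \<open>f\<^sub>j - y\<^sub>j\<close>. At a point off the fibre this ideal
contains an element that does not vanish there; at a point of the fibre, a function that vanishes to order \<open>k\<close> along the fibre is a combination of the \<open>f\<^sub>j - y\<^sub>j\<close> to
order \<open>k\<close> by \<open>vanishing_on_slice_preimage\<close>.\<close>

theorem fibre_ideal_membership:
  fixes F :: "complex ^ 'n \<Rightarrow> complex ^ 'q"
  assumes F: "polymap F" and nc: "noncritical_fibre F y" and D: "polyfun D" and h: "polyfun h"
    and local: "\<And>p k. F p = y \<Longrightarrow> \<exists>r. polyfun r \<and> vanishes_to_order k p (F -` {y}) (\<lambda>x. h x - D x * r x)"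
  shows "\<exists>r. polyfun r \<and> (\<lambda>x. h x - D x * r x) \<in> fibre_ideal F y"
proof -
  define I where "I = fibre_ideal F y"
  define J where "J = {\<lambda>x. j x + a x * D x | j a. j \<in> I \<and> polyfun a}"
  have I: "polyfun_ideal I" unfolding I_def by (rule polyfun_ideal_fibre_ideal[OF F])
  have J: "polyfun_ideal J" "I \<subseteq> J"
    unfolding J_def by (rule polyfun_ideal_add_principal[OF I D])+
  have JI: "(\<lambda>x. j x + a x * D x) \<in> J" if "j \<in> I" "polyfun a" for j a using that unfolding J_def by blast
  have "h \<in> J"
  proof (rule local_ideal_membership[OF J(1) h])
    fix p k
    show "\<exists>j\<in>J. vanishes_to_order k p UNIV (\<lambda>x. h x - j x)"
    proof (cases "F p = y")
      case False
      then obtain j where "F p $ j - y $ j \<noteq> 0" using off_fibre_generator by blast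
      moreover have "(\<lambda>x. F x $ j - y $ j) \<in> J" using fibre_ideal_generator J(2) I_def by blast
      ultimately obtain i where i: "i \<in> J" "vanishes_to_order k p UNIV (\<lambda>x. 1 - i x)"
        using vanishes_to_order_unit[OF J(1)] by blast
      have "vanishes_to_order (0 + k) p UNIV (\<lambda>x. h x * (1 - i x))"
        by (intro vanishes_to_order_mult vanishes_to_order_0 polyfun_isCont h i)
      then have "vanishes_to_order k p UNIV (\<lambda>x. h x - h x * i x)" by (simp add: algebra_simps)
      moreover have "(\<lambda>x. h x * i x) \<in> J" using fun_idealD(3)[OF J(1) _ i(1)] h by blast
      ultimately show ?thesis by (rule bexI)
    next
      case True
      obtain e :: "'q \<Rightarrow> 'n" where e: "inj e" "det (jac_matrix (completion e F) p) \<noteq> 0"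
        by (rule noncritical_fibre_chart[OF nc True])
      define G where "G = completion e F"
      have G: "polymap G" unfolding G_def by (rule polymap_completion[OF F])
      have X: "{x. \<forall>i\<in>range e. G x $ i = G p $ i} = F -` {y}"
        using completion_fibre_at[of e F p y, OF e(1) True] unfolding G_def by (auto simp: slice_def)
      obtain r where r: "polyfun r" "vanishes_to_order k p (F -` {y}) (\<lambda>x. h x - D x * r x)"
        using local[OF True] by blast
      have "polyfun (\<lambda>x. h x - D x * r x)" by (intro polyfun_intros h D r)
      then obtain d where d: "\<And>i. polyfun (d i)" "vanishes_to_order k p UNIV (\<lambda>x. (h x - D x * r x) - (\<Sum>i\<in>range e. (G x $ i - G p $ i) * d i x))"
        using vanishing_on_slice_preimage[OF G _ _ r(2)[folded X]] e(2) unfolding G_def by blast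
      have "(\<Sum>i\<in>range e. (G x $ i - G p $ i) * d i x) = (\<Sum>j\<in>UNIV. (F x $ j - y $ j) * d (e j) x)" for x
        using True by (subst sum.reindex[OF e(1)]) (simp add: G_def completion_nth(1)[OF e(1)])
      then have "vanishes_to_order k p UNIV (\<lambda>x. h x - ((\<Sum>j\<in>UNIV. (F x $ j - y $ j) * d (e j) x) + r x * D x))"
        using d(2) by (simp add: algebra_simps)
      moreover have "(\<lambda>x. (\<Sum>j\<in>UNIV. (F x $ j - y $ j) * d (e j) x) + r x * D x) \<in> J"
        unfolding I_def by (rule JI) (auto simp: I_def intro!: fibre_idealI d r)
      ultimately show ?thesis by (rule bexI)
    qed
  qed
  then obtain j a where "j \<in> I" "polyfun a" "h = (\<lambda>x. j x + a x * D x)" unfolding J_def by blast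
  then have "(\<lambda>x. h x - D x * a x) = j" by (simp add: mult.commute)
  with \<open>j \<in> I\<close> \<open>polyfun a\<close> show ?thesis unfolding I_def by blast
qed

text \<open>The case \<open>D = 0\<close>: the ideal of a noncritical fibre is generated by the \<open>f\<^sub>j - y\<^sub>j\<close>.\<close>

corollary vanishing_on_fibre:
  fixes F :: "complex ^ 'n \<Rightarrow> complex ^ 'q"
  assumes F: "polymap F" and nc: "noncritical_fibre F y" and h: "polyfun h" and z: "\<And>x. F x = y \<Longrightarrow> h x = 0"
  shows "h \<in> fibre_ideal F y"
proof -
  have "\<exists>r. polyfun r \<and> (\<lambda>x. h x - 0 * r x) \<in> fibre_ideal F y"
  proof (rule fibre_ideal_membership[OF F nc polyfun.const h])
    fix p k
    show "\<exists>r. polyfun r \<and> vanishes_to_order k p (F -` {y}) (\<lambda>x. h x - 0 * r x)"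
      using z by (intro exI[of _ "\<lambda>x. 0"]) (auto simp: vanishes_to_order_def intro: polyfun.const intro!: exI[of _ 0])
  qed
  then show ?thesis by auto
qed

section \<open>Relative exactness on a generic fibre\<close>

text \<open>The slice over \<open>y\<close> is not contained in the discriminant, for every completion of \<open>F\<close> that is etale somewhere.\<close>

definition generic_value :: "(complex ^ 'n \<Rightarrow> complex ^ 'q) \<Rightarrow> complex ^ 'q \<Rightarrow> bool" where
  "generic_value F y \<longleftrightarrow> (\<forall>e. inj e \<longrightarrow> (\<exists>x. det (jac_matrix (completion e F) x) \<noteq> 0) \<longrightarrow>
     (\<exists>\<Delta> N C m s. etale_discriminant (completion e F) \<Delta> N C m \<and> (\<forall>j. s $ e j = y $ j) \<and> \<Delta> s \<noteq> 0))"

text \<open>On the fibre \<open>Q(G) R = P\<close> by \<open>primitive_rational\<close>. The Taylor polynomials of \<open>R\<close> satisfy the hypothesis of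
\<open>fibre_ideal_membership\<close>, so \<open>P = Q(G) T\<close> on the fibre for some polynomial \<open>T\<close>. Where \<open>G\<close> is a local
coordinate system, \<open>Q(G)\<close> does not vanish identically on any open part of the fibre, and continuity gives \<open>R = T\<close>.\<close>

lemma chart_primitive_polynomial:
  fixes F :: "complex ^ 'n \<Rightarrow> complex ^ 'q"
  assumes F: "polymap F" and nc: "noncritical_fibre F y" and gen: "generic_value F y" and \<omega>: "polymap \<omega>"
    and R: "primitive_on (F -` {y}) \<omega> R" and e: "inj e" and p: "F p = y" "det (jac_matrix (completion e F) p) \<noteq> 0"
  shows "\<exists>T. polyfun T \<and> (\<forall>x. F x = y \<longrightarrow> det (jac_matrix (completion e F) x) \<noteq> 0 \<longrightarrow> R x = T x)"
proof -
  define G where "G = completion e F"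
  define E where "E = range e"
  have G: "polymap G" unfolding G_def by (rule polymap_completion[OF F])
  have X: "G -` slice E (G q) = F -` {y}" if "F q = y" for q
    using completion_fibre_at[of e F q y] e that by (simp add: G_def E_def)
  obtain \<Delta> N C m s1 where \<Delta>: "etale_discriminant G \<Delta> N C m" "\<And>j. s1 $ e j = y $ j" "\<Delta> s1 \<noteq> 0"
    using gen e p(2) unfolding generic_value_def G_def by blast
  have s1: "s1 \<in> slice E (G p)" using \<Delta>(2) p(1) by (auto simp: slice_def E_def G_def completion_nth(1)[OF e])
  obtain Q P where Q: "polyfun Q" "polyfun P" "\<exists>s\<in>slice E (G p). Q s \<noteq> 0"
    "\<And>x. G x \<in> slice E (G p) \<Longrightarrow> Q (G x) * R x = P x"
    using primitive_rational[OF G \<Delta>(1) \<omega> _ s1 \<Delta>(3), of R] R X[OF p(1)] by auto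
  have QP: "Q (G x) * R x = P x" if "F x = y" for x
  proof -
    have "x \<in> G -` slice E (G p)" unfolding X[OF p(1)] using that by simp
    then show ?thesis using Q(4) by simp
  qed
  define D where "D x = Q (G x)" for x
  have D: "polyfun D" unfolding D_def[abs_def] by (rule polyfun_compose[OF Q(1) G])
  have taylor: "\<exists>T. polyfun T \<and> vanishes_to_order k q (F -` {y}) (\<lambda>x. R x - T x)" if q: "F q = y" for q k
  proof -
    obtain e' :: "'q \<Rightarrow> 'n" where e': "inj e'" "det (jac_matrix (completion e' F) q) \<noteq> 0"
      by (rule noncritical_fibre_chart[OF nc q])
    show ?thesis
      using primitive_taylor[OF polymap_completion[OF F] e'(2) \<omega>, of "range e'" R k] R
      unfolding completion_fibre_at[of e' F q y, OF e'(1) q] by blast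
  qed
  have "\<exists>r. polyfun r \<and> (\<lambda>x. P x - D x * r x) \<in> fibre_ideal F y"
  proof (rule fibre_ideal_membership[OF F nc D Q(2)])
    fix q k assume q: "F q = y"
    obtain T where T: "polyfun T" "vanishes_to_order k q (F -` {y}) (\<lambda>x. R x - T x)" using taylor[OF q] by blast
    have "vanishes_to_order (0 + k) q (F -` {y}) (\<lambda>x. D x * (R x - T x))"
      by (intro vanishes_to_order_mult T vanishes_to_order_0 polyfun_isCont D)
    then obtain c where "\<forall>\<^sub>F x in nhds q. x \<in> F -` {y} \<longrightarrow> norm (D x * (R x - T x)) \<le> c * norm (x - q) ^ k"
      by (auto simp: vanishes_to_order_def)
    then have "\<forall>\<^sub>F x in nhds q. x \<in> F -` {y} \<longrightarrow> norm (P x - D x * T x) \<le> c * norm (x - q) ^ k"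
      by eventually_elim (use QP in \<open>auto simp: D_def right_diff_distrib\<close>)
    with T(1) show "\<exists>r. polyfun r \<and> vanishes_to_order k q (F -` {y}) (\<lambda>x. P x - D x * r x)"
      unfolding vanishes_to_order_def by blast
  qed
  then obtain T where T: "polyfun T" "(\<lambda>x. P x - D x * T x) \<in> fibre_ideal F y" by blast
  have DT: "Q (G x) * (R x - T x) = 0" if "F x = y" for x
    using fibre_ideal_zero[OF T(2) that] QP[OF that] by (simp add: D_def right_diff_distrib)
  have "R x = T x" if x: "F x = y" "det (jac_matrix G x) \<noteq> 0" for x
  proof (rule ccontr)
    assume ne: "R x \<noteq> T x"
    obtain T1 where T1: "polyfun T1" "vanishes_to_order 1 x (F -` {y}) (\<lambda>z. R z - T1 z)" using taylor[OF x(1)] by blast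
    then obtain c where c: "\<forall>\<^sub>F z in nhds x. z \<in> F -` {y} \<longrightarrow> norm (R z - T1 z) \<le> c * norm (z - x)"
      by (auto simp: vanishes_to_order_def)
    have "R x = T1 x" using eventually_nhds_x_imp_x[OF c] x(1) by simp
    \<comment> \<open>The first Taylor polynomial \<open>T1\<close> provides the continuity of \<open>R\<close> at \<open>x\<close> along the fibre.\<close>
    have "((\<lambda>z. norm (T1 z - T z) - c * norm (z - x)) \<longlongrightarrow> norm (T1 x - T x) - c * norm (x - x)) (nhds x)"
      by (intro tendsto_intros isCont_tendsto_nhds polyfun_isCont T1 T filterlim_ident)
    moreover have "0 < norm (T1 x - T x) - c * norm (x - x)" using ne \<open>R x = T1 x\<close> by simp
    ultimately have "\<forall>\<^sub>F z in nhds x. 0 < norm (T1 z - T z) - c * norm (z - x)" by (rule order_tendstoD(1))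
    then have nz: "\<forall>\<^sub>F z in nhds x. z \<in> F -` {y} \<longrightarrow> Q (G z) = 0"
      using c
    proof eventually_elim
      case (elim z)
      show ?case
      proof
        assume z: "z \<in> F -` {y}"
        then have "R z \<noteq> T z" using elim by (auto simp: norm_minus_commute)
        then show "Q (G z) = 0" using DT[of z] z by simp
      qed
    qed
    obtain U V g where g: "open U" "x \<in> U" "open V" "G x \<in> V" "homeomorphism U V G g"
      "\<And>x. x \<in> U \<Longrightarrow> det (jac_matrix G x) \<noteq> 0"
      "\<And>y. y \<in> V \<Longrightarrow> (g has_derivative
        (\<lambda>h. inverse (det (jac_matrix G (g y))) *s adj_vec (jac_matrix G (g y)) h)) (at y)"
      by (rule polymap_local_inverse[OF G x(2)]; rule that; assumption)
    have gx: "g (G x) = x" and Gg: "\<And>s. s \<in> V \<Longrightarrow> G (g s) = s" using g by (auto simp: homeomorphism_def)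
    have tg: "(g \<longlongrightarrow> x) (nhds (G x))"
      using isCont_tendsto_nhds[OF has_derivative_continuous[OF g(7)[OF g(4)]]] by (simp add: gx)
    have ev: "\<forall>\<^sub>F s in nhds (G x). s \<in> V \<and> (g s \<in> F -` {y} \<longrightarrow> Q (G (g s)) = 0)"
      using nz tg eventually_nhds_in_open[OF g(3,4)] unfolding filterlim_iff by (auto intro: eventually_conj)
    have pi: "slice_proj E (G x) (G x) = G x" by (simp add: slice_proj_def vec_eq_iff)
    have "(slice_proj E (G x) \<longlongrightarrow> G x) (nhds (G x))"
      using polymap_tendsto[OF polymap_slice_proj, of E "G x" "G x"] by (simp add: pi)
    with ev have "\<forall>\<^sub>F s in nhds (G x). slice_proj E (G x) s \<in> V \<and>
        (g (slice_proj E (G x) s) \<in> F -` {y} \<longrightarrow> Q (G (g (slice_proj E (G x) s))) = 0)"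
      unfolding filterlim_iff by blast
    then have "\<forall>\<^sub>F s in nhds (G x). Q (slice_proj E (G x) s) = 0"
    proof eventually_elim
      case (elim s)
      have "g (slice_proj E (G x) s) \<in> G -` slice E (G x)"
        using Gg elim slice_proj_slice(1) by simp
      then show ?case using elim Gg X[OF x(1)] by auto
    qed
    then obtain O' where O': "open O'" "G x \<in> O'" "\<And>s. s \<in> O' \<Longrightarrow> Q (slice_proj E (G x) s) = 0"
      unfolding eventually_nhds by blast
    \<comment> \<open>So \<open>Q\<close> vanishes on an open subset of the slice, and by analytic continuation on all of it.\<close>
    have zero: "Q (slice_proj E (G x) s) = 0" for s
      by (rule polyfun_eq_0_open[OF polyfun_compose[OF Q(1) polymap_slice_proj] O'])
    obtain s where s: "s \<in> slice E (G p)" "Q s \<noteq> 0" using Q(3) by blast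
    have "slice E (G p) = slice E (G x)"
      using p(1) x(1) by (auto simp: slice_def E_def G_def completion_nth(1)[OF e])
    then have "slice_proj E (G x) s = s" using s(1) slice_proj_slice(2) by blast
    then show False using zero[of s] s(2) by simp
  qed
  then show ?thesis using T(1) unfolding G_def by blast
qed

text \<open>The polynomials \<open>u\<close> for which \<open>u R\<close> is a polynomial on the fibre form an ideal. It contains the \<open>f\<^sub>j - y\<^sub>j\<close> and the
Jacobian determinants of all charts, which have no common zero, so it contains \<open>1\<close>.\<close>

theorem primitive_polynomial:
  fixes F :: "complex ^ 'n \<Rightarrow> complex ^ 'q"
  assumes F: "polymap F" and nc: "noncritical_fibre F y" and gen: "generic_value F y" and \<omega>: "polymap \<omega>"
    and R: "primitive_on (F -` {y}) \<omega> R"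
  shows "\<exists>T. polyfun T \<and> (\<forall>x. F x = y \<longrightarrow> R x = T x)"
proof -
  define J where "J = {u. polyfun u \<and> (\<exists>r. polyfun r \<and> (\<forall>x. F x = y \<longrightarrow> u x * R x = r x))}"
  have J: "polyfun_ideal J" unfolding fun_ideal_def
  proof (intro conjI ballI)
    show "(\<lambda>x. 0) \<in> J" unfolding J_def by (auto intro: polyfun.const intro!: exI[of _ "\<lambda>x. 0"])
  next
    fix u u' assume "u \<in> J" "u' \<in> J"
    then obtain r r' where "polyfun u" "polyfun u'" "polyfun r" "polyfun r'"
      "\<And>x. F x = y \<Longrightarrow> u x * R x = r x" "\<And>x. F x = y \<Longrightarrow> u' x * R x = r' x" by (auto simp: J_def)
    then show "(\<lambda>x. u x + u' x) \<in> J" unfolding J_def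
      by (intro CollectI conjI exI[of _ "\<lambda>x. r x + r' x"]) (auto simp: distrib_right intro: polyfun_intros)
  next
    fix c u :: "complex ^ 'n \<Rightarrow> complex" assume "c \<in> Collect polyfun" "u \<in> J"
    then obtain r where "polyfun c" "polyfun u" "polyfun r" "\<And>x. F x = y \<Longrightarrow> u x * R x = r x" by (auto simp: J_def)
    then show "(\<lambda>x. c x * u x) \<in> J" unfolding J_def
      by (intro CollectI conjI exI[of _ "\<lambda>x. c x * r x"]) (auto simp: mult.assoc intro: polyfun_intros)
  qed (auto simp: J_def)
  have "(\<lambda>x. 1) \<in> J"
  proof (rule weak_nullstellensatz[OF J])
    fix p
    show "\<exists>u\<in>J. u p \<noteq> 0"
    proof (cases "F p = y")
      case False
      then obtain j where j: "F p $ j - y $ j \<noteq> 0" using off_fibre_generator by blast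
      have "polyfun (\<lambda>x. F x $ j - y $ j)" using F by (auto simp: polymap_def intro!: polyfun_intros)
      then have "(\<lambda>x. F x $ j - y $ j) \<in> J" unfolding J_def
        by (auto intro: polyfun.const intro!: exI[of _ "\<lambda>x. 0"])
      with j show ?thesis by (intro bexI[of _ "\<lambda>x. F x $ j - y $ j"])
    next
      case True
      obtain e :: "'q \<Rightarrow> 'n" where e: "inj e" "det (jac_matrix (completion e F) p) \<noteq> 0"
        by (rule noncritical_fibre_chart[OF nc True])
      define M where "M x = det (jac_matrix (completion e F) x)" for x
      have M: "polyfun M" unfolding M_def[abs_def] by (rule polyfun_det_jac[OF polymap_completion[OF F]])
      obtain T where T: "polyfun T" "\<And>x. F x = y \<Longrightarrow> M x \<noteq> 0 \<Longrightarrow> R x = T x"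
        using chart_primitive_polynomial[OF F nc gen \<omega> R e(1) True e(2)] unfolding M_def by blast
      have "M x * R x = M x * T x" if "F x = y" for x using T(2)[OF that] by (cases "M x = 0") auto
      moreover have "polyfun (\<lambda>x. M x * T x)" by (intro polyfun_intros M T)
      ultimately have "M \<in> J" using M unfolding J_def by blast
      then show ?thesis using e(2) by (intro bexI[of _ M]) (simp_all add: M_def)
    qed
  qed
  then show ?thesis by (auto simp: J_def)
qed

text \<open>Again the polynomials \<open>u\<close> for which \<open>u \<eta>\<close> has the required form are an ideal. In a chart with Jacobian determinant \<open>M\<close>, Cramer's rule expresses \<open>M \<eta>\<close>
by the \<open>df\<^sub>j\<close> at the points of the fibre where \<open>M \<noteq> 0\<close>; the other coefficients vanish because \<open>\<eta>\<close> annihilates the tangent vectors. A further factor \<open>M\<close> makes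
the identity valid on the whole fibre, and \<open>vanishing_on_fibre\<close> applies to the difference.\<close>

lemma form_vanishing_on_fibre_tangents:
  fixes F :: "complex ^ 'n \<Rightarrow> complex ^ 'q"
  assumes F: "polymap F" and nc: "noncritical_fibre F y" and \<eta>: "polymap \<eta>"
    and tang: "\<And>p w. F p = y \<Longrightarrow> jac_matrix F p *v w = 0 \<Longrightarrow> (\<Sum>i\<in>UNIV. \<eta> p $ i * w $ i) = 0"
  shows "\<exists>a b. (\<forall>j. polyfun (a j)) \<and> (\<forall>j k. polyfun (b j k)) \<and>
    (\<forall>x k. \<eta> x $ k = (\<Sum>j\<in>UNIV. a j x * partial k (\<lambda>x. F x $ j) x) + (\<Sum>j\<in>UNIV. (F x $ j - y $ j) * b j k x))"
proof -
  have Fj: "polyfun (\<lambda>x. F x $ j)" for j using F by (simp add: polymap_def)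
  define rel where "rel u a b \<longleftrightarrow> polyfun u \<and> (\<forall>j. polyfun (a j)) \<and> (\<forall>j k. polyfun (b j k)) \<and>
    (\<forall>x k. u x * \<eta> x $ k = (\<Sum>j\<in>UNIV. a j x * partial k (\<lambda>x. F x $ j) x) + (\<Sum>j\<in>UNIV. (F x $ j - y $ j) * b j k x))"
    for u and a :: "'q \<Rightarrow> complex ^ 'n \<Rightarrow> complex" and b :: "'q \<Rightarrow> 'n \<Rightarrow> complex ^ 'n \<Rightarrow> complex"
  define J where "J = {u. \<exists>a b. rel u a b}"
  have J: "polyfun_ideal J" unfolding fun_ideal_def
  proof (intro conjI ballI)
    show "J \<subseteq> Collect polyfun" by (auto simp: J_def rel_def)
    have "rel (\<lambda>x. 0) (\<lambda>j x. 0) (\<lambda>j k x. 0)" by (simp add: rel_def polyfun.const)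
    then show "(\<lambda>x. 0) \<in> J" unfolding J_def by blast
  next
    fix u u' assume "u \<in> J" "u' \<in> J"
    then obtain a b a' b' where "rel u a b" "rel u' a' b'" by (auto simp: J_def)
    then have "rel (\<lambda>x. u x + u' x) (\<lambda>j x. a j x + a' j x) (\<lambda>j k x. b j k x + b' j k x)"
      by (auto simp: rel_def distrib_right distrib_left sum.distrib intro: polyfun_intros)
    then show "(\<lambda>x. u x + u' x) \<in> J" unfolding J_def by blast
  next
    fix c u :: "complex ^ 'n \<Rightarrow> complex" assume "c \<in> Collect polyfun" "u \<in> J"
    then obtain a b where ab: "polyfun c" "rel u a b" by (auto simp: J_def)
    have "rel (\<lambda>x. c x * u x) (\<lambda>j x. c x * a j x) (\<lambda>j k x. c x * b j k x)"
      unfolding rel_def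
    proof (intro conjI allI)
      fix x k
      have "c x * (u x * \<eta> x $ k) = c x * ((\<Sum>j\<in>UNIV. a j x * partial k (\<lambda>x. F x $ j) x) + (\<Sum>j\<in>UNIV. (F x $ j - y $ j) * b j k x))"
        using ab(2) by (simp add: rel_def)
      then show "c x * u x * \<eta> x $ k = (\<Sum>j\<in>UNIV. c x * a j x * partial k (\<lambda>x. F x $ j) x) + (\<Sum>j\<in>UNIV. (F x $ j - y $ j) * (c x * b j k x))"
        by (simp add: distrib_left sum_distrib_left mult_ac)
    qed (use ab in \<open>auto simp: rel_def intro: polyfun_intros\<close>)
    then show "(\<lambda>x. c x * u x) \<in> J" unfolding J_def by blast
  qed
  have "(\<lambda>x. 1) \<in> J"
  proof (rule weak_nullstellensatz[OF J])
    fix p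
    show "\<exists>u\<in>J. u p \<noteq> 0"
    proof (cases "F p = y")
      case False
      then obtain j where j: "F p $ j - y $ j \<noteq> 0" using off_fibre_generator by blast
      have "rel (\<lambda>x. F x $ j - y $ j) (\<lambda>j x. 0) (\<lambda>i k x. if i = j then \<eta> x $ k else 0)"
        unfolding rel_def
      proof (intro conjI allI)
        show "polyfun (\<lambda>x. F x $ j - y $ j)" by (intro polyfun_intros Fj)
        show "polyfun (\<lambda>x. if i = j then \<eta> x $ k else 0)" for i k
          using \<eta> by (cases "i = j") (auto simp: polymap_def intro: polyfun_intros)
      qed (auto simp: polyfun.const if_distrib[of "\<lambda>c. _ * c"] cong: if_cong)
      then have "(\<lambda>x. F x $ j - y $ j) \<in> J" unfolding J_def by blast
      with j show ?thesis by (intro bexI[of _ "\<lambda>x. F x $ j - y $ j"])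
    next
      case True
      obtain e :: "'q \<Rightarrow> 'n" where e: "inj e" "det (jac_matrix (completion e F) p) \<noteq> 0"
        by (rule noncritical_fibre_chart[OF nc True])
      define A where "A x = jac_matrix (completion e F) x" for x
      define M where "M x = det (A x)" for x
      have A: "polyfun (\<lambda>x. A x $ i $ j)" for i j unfolding A_def by (rule polyfun_jac[OF polymap_completion[OF F]])
      have M: "polyfun M" unfolding M_def[abs_def] by (rule polyfun_det[OF A])
      define \<beta> where "\<beta> x = adj_vec (transpose (A x)) (\<eta> x)" for x
      have \<beta>: "polyfun (\<lambda>x. \<beta> x $ i)" for i unfolding \<beta>_def
        by (rule polyfun_adj_vec) (use A \<eta> in \<open>auto simp: transpose_def polymap_def\<close>)
      have cramer: "M x * \<eta> x $ k = (\<Sum>j\<in>UNIV. \<beta> x $ e j * partial k (\<lambda>x. F x $ j) x)"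
        if x: "F x = y" "M x \<noteq> 0" for x k
      proof -
        define c where "c = inverse (M x) *s \<beta> x"
        have c: "transpose (A x) *v c = \<eta> x"
          using solve_adj_vec[of "transpose (A x)" c "\<eta> x"] x(2) by (simp add: c_def \<beta>_def M_def det_transpose)
        have "c $ i = 0" if i: "i \<notin> range e" for i
        proof -
          define w where "w = lift_velocity (completion e F) (axis i 1) x"
          have Aw: "A x *v w = axis i 1" unfolding w_def A_def
            by (rule lift_velocity_eq(1)) (use x(2) in \<open>simp add: M_def A_def\<close>)
          have "jac_matrix F x *v w = 0"
          proof -
            have "(jac_matrix F x *v w) $ j = (A x *v w) $ e j" for j
              by (simp add: matrix_vector_mult_def A_def jac_completion(1)[OF e(1)])
            then show ?thesis using i by (auto simp: Aw vec_eq_iff axis_def)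
          qed
          from tang[OF x(1) this] have "0 = (\<Sum>k\<in>UNIV. (transpose (A x) *v c) $ k * w $ k)" unfolding c by (rule sym)
          also have "\<dots> = (\<Sum>k\<in>UNIV. \<Sum>l\<in>UNIV. c $ l * (A x $ l $ k * w $ k))"
            by (simp add: matrix_vector_mult_def transpose_def sum_distrib_left mult_ac)
          also have "\<dots> = (\<Sum>l\<in>UNIV. c $ l * (A x *v w) $ l)"
            by (subst sum.swap) (simp add: matrix_vector_mult_def sum_distrib_left)
          also have "\<dots> = c $ i" by (simp add: Aw axis_def if_distrib[of "\<lambda>c. _ * c"] cong: if_cong)
          finally show ?thesis by simp
        qed
        then have "\<eta> x $ k = (\<Sum>l\<in>range e. A x $ l $ k * c $ l)"
          unfolding c[symmetric] by (simp add: matrix_vector_mult_def transpose_def)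
            (intro sum.mono_neutral_right, auto)
        also have "\<dots> = (\<Sum>j\<in>UNIV. A x $ e j $ k * c $ e j)" by (subst sum.reindex[OF e(1)]) simp
        also have "\<dots> = (\<Sum>j\<in>UNIV. inverse (M x) * (\<beta> x $ e j * partial k (\<lambda>x. F x $ j) x))"
          by (simp add: c_def A_def jac_completion(1)[OF e(1)]) (simp add: jac_matrix_def ext_d_def mult_ac)
        finally show ?thesis using x(2) by (simp add: sum_distrib_left[symmetric])
      qed
      define h where "h k x = M x * (M x * \<eta> x $ k - (\<Sum>j\<in>UNIV. \<beta> x $ e j * partial k (\<lambda>x. F x $ j) x))" for k x
      have "h k \<in> fibre_ideal F y" for k
      proof (rule vanishing_on_fibre[OF F nc])
        show "polyfun (h k)" unfolding h_def[abs_def]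
          using \<eta> by (intro polyfun_intros M \<beta> polyfun_partial Fj) (simp add: polymap_def)
        show "h k x = 0" if "F x = y" for x
          using cramer[OF that] by (cases "M x = 0") (auto simp: h_def)
      qed
      then have "\<forall>k. \<exists>a. (\<forall>j. polyfun (a j)) \<and> h k = (\<lambda>x. \<Sum>j\<in>UNIV. (F x $ j - y $ j) * a j x)"
        by (auto simp: fibre_ideal_def)
      then have "\<exists>a. \<forall>k. (\<forall>j. polyfun (a k j)) \<and> h k = (\<lambda>x. \<Sum>j\<in>UNIV. (F x $ j - y $ j) * a k j x)" by (rule choice)
      then obtain a where a: "\<And>k j. polyfun (a k j)" "\<And>k. h k = (\<lambda>x. \<Sum>j\<in>UNIV. (F x $ j - y $ j) * a k j x)" by blast
      have "rel (\<lambda>x. M x * M x) (\<lambda>j x. M x * \<beta> x $ e j) (\<lambda>j k. a k j)"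
        unfolding rel_def
      proof (intro conjI allI)
        fix x k
        have "M x * M x * \<eta> x $ k = M x * (\<Sum>j\<in>UNIV. \<beta> x $ e j * partial k (\<lambda>x. F x $ j) x) + h k x"
          by (simp add: h_def algebra_simps)
        then show "M x * M x * \<eta> x $ k = (\<Sum>j\<in>UNIV. M x * \<beta> x $ e j * partial k (\<lambda>x. F x $ j) x) + (\<Sum>j\<in>UNIV. (F x $ j - y $ j) * a k j x)"
          by (simp add: a(2) sum_distrib_left mult.assoc)
      qed (auto intro!: polyfun_intros M \<beta> a)
      then have "(\<lambda>x. M x * M x) \<in> J" unfolding J_def by blast
      moreover have "M p * M p \<noteq> 0" using e(2) by (simp add: M_def A_def)
      ultimately show ?thesis by (intro bexI[of _ "\<lambda>x. M x * M x"])
    qed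
  qed
  then obtain a b where "rel (\<lambda>x. 1) a b" by (auto simp: J_def)
  then show ?thesis unfolding rel_def by (intro exI[of _ a] exI[of _ b]) simp
qed

text \<open>On the fibre the primitive is a polynomial \<open>T\<close>. A tangent vector of the fibre is the velocity of a holomorphic curve in it, and
differentiating \<open>R = T\<close> along that curve shows that \<open>\<omega> - dT\<close> annihilates the vector.\<close>

theorem fibre_relative_exactness:
  fixes F :: "complex ^ 'n \<Rightarrow> complex ^ 'q"
  assumes F: "polymap F" and nc: "noncritical_fibre F y" and gen: "generic_value F y" and \<omega>: "polymap \<omega>"
    and loops: "\<And>\<gamma>. valid_path \<gamma> \<Longrightarrow> pathfinish \<gamma> = pathstart \<gamma> \<Longrightarrow> path_image \<gamma> \<subseteq> F -` {y} \<Longrightarrow> has_form_integral \<omega> 0 \<gamma>"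
  shows "\<exists>T a b. polyfun T \<and> (\<forall>j. polyfun (a j)) \<and> (\<forall>j k. polyfun (b j k)) \<and>
    (\<forall>x k. \<omega> x $ k = partial k T x + (\<Sum>j\<in>UNIV. a j x * partial k (\<lambda>x. F x $ j) x) + (\<Sum>j\<in>UNIV. (F x $ j - y $ j) * b j k x))"
proof -
  obtain R where R: "primitive_on (F -` {y}) \<omega> R" using primitive_on_exists[OF loops] by blast
  obtain T where T: "polyfun T" "\<And>x. F x = y \<Longrightarrow> R x = T x" using primitive_polynomial[OF F nc gen \<omega> R] by blast
  define \<eta> where "\<eta> x = (\<chi> k. \<omega> x $ k - partial k T x)" for x
  have \<eta>: "polymap \<eta>" using \<omega> T(1) unfolding polymap_def \<eta>_def by (auto intro!: polyfun_intros polyfun_partial)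
  have "\<exists>a b. (\<forall>j. polyfun (a j)) \<and> (\<forall>j k. polyfun (b j k)) \<and>
    (\<forall>x k. \<eta> x $ k = (\<Sum>j\<in>UNIV. a j x * partial k (\<lambda>x. F x $ j) x) + (\<Sum>j\<in>UNIV. (F x $ j - y $ j) * b j k x))"
  proof (rule form_vanishing_on_fibre_tangents[OF F nc \<eta>])
    fix p w assume p: "F p = y" and w: "jac_matrix F p *v w = 0"
    obtain e :: "'q \<Rightarrow> 'n" where e: "inj e" "det (jac_matrix (completion e F) p) \<noteq> 0"
      by (rule noncritical_fibre_chart[OF nc p])
    define G where "G = completion e F"
    have G: "polymap G" unfolding G_def by (rule polymap_completion[OF F])
    define v where "v = jac_matrix G p *v w"
    have lift: "lift_velocity G v p = w" unfolding v_def by (rule lift_velocity_eq(2)) (use e(2) in \<open>simp_all add: G_def\<close>)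
    have v0: "v \<in> slice (range e) 0"
    proof -
      have "v $ e j = (jac_matrix F p *v w) $ j" for j
        by (simp add: v_def G_def matrix_vector_mult_def jac_completion(1)[OF e(1)])
      then show ?thesis using w by (simp add: slice_def)
    qed
    obtain U V g where g: "open U" "p \<in> U" "open V" "G p \<in> V" "homeomorphism U V G g"
      "\<And>x. x \<in> U \<Longrightarrow> det (jac_matrix G x) \<noteq> 0"
      "\<And>y. y \<in> V \<Longrightarrow> (g has_derivative
        (\<lambda>h. inverse (det (jac_matrix G (g y))) *s adj_vec (jac_matrix G (g y)) h)) (at y)"
      by (rule polymap_local_inverse[OF G e(2)[folded G_def]]; rule that; assumption)
    have gp: "g (G p) = p" and Gg: "\<And>s. s \<in> V \<Longrightarrow> G (g s) = s" using g by (auto simp: homeomorphism_def)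
    define S where "S = {z. G p + z *s v \<in> V}"
    have S: "open S" "0 \<in> S" unfolding S_def using g by (auto intro: line_preimage_open)
    define c where "c z = g (G p + z *s v)" for z
    have c0: "c 0 = p" by (simp add: c_def gp)
    have der: "(c has_derivative (\<lambda>h. h *s lift_velocity G v (c z))) (at z)" if "z \<in> S" for z
      using local_inverse_line(1)[OF G g(3,5,6,7)] that unfolding c_def[abs_def] S_def by simp
    have cont: "continuous_on S (\<lambda>z. lift_velocity G v (c z))"
      using local_inverse_line(2)[OF G g(3,5,6,7), of "G p" 0 v] g(4) by (simp add: c_def[abs_def] S_def)
    have img: "c ` S \<subseteq> F -` {y}"
    proof -
      have "c z \<in> G -` slice (range e) (G p)" if "z \<in> S" for z
        using that Gg v0 by (auto simp: c_def S_def slice_def)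
      then show ?thesis using completion_fibre_at[of e F p y, OF e(1) p] by (auto simp: G_def)
    qed
    have "((\<lambda>z. R (c z)) has_field_derivative (\<Sum>i\<in>UNIV. \<omega> (c 0) $ i * lift_velocity G v (c 0) $ i)) (at 0)"
      by (rule primitive_on_curve[OF R \<omega> S(1) der cont img S(2)])
    moreover have "((\<lambda>z. T (c z)) has_field_derivative (\<Sum>i\<in>UNIV. partial i T (c 0) * lift_velocity G v (c 0) $ i)) (at 0)"
      by (rule polyfun_curve_derivative[OF T(1) der[OF S(2)]])
    then have "((\<lambda>z. R (c z)) has_field_derivative (\<Sum>i\<in>UNIV. partial i T (c 0) * lift_velocity G v (c 0) $ i)) (at 0)"
      by (rule has_field_derivative_transform_within_open[OF _ S]) (use T(2) img in force)
    ultimately have "(\<Sum>i\<in>UNIV. \<omega> p $ i * w $ i) = (\<Sum>i\<in>UNIV. partial i T p * w $ i)"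
      using DERIV_unique unfolding c0 lift by blast
    then show "(\<Sum>i\<in>UNIV. \<eta> p $ i * w $ i) = 0" by (simp add: \<eta>_def left_diff_distrib sum_subtractf)
  qed
  then obtain a b where ab: "\<And>j. polyfun (a j)" "\<And>j k. polyfun (b j k)"
    "\<And>x k. \<eta> x $ k = (\<Sum>j\<in>UNIV. a j x * partial k (\<lambda>x. F x $ j) x) + (\<Sum>j\<in>UNIV. (F x $ j - y $ j) * b j k x)" by blast
  have "\<omega> x $ k = partial k T x + (\<Sum>j\<in>UNIV. a j x * partial k (\<lambda>x. F x $ j) x) + (\<Sum>j\<in>UNIV. (F x $ j - y $ j) * b j k x)" for x k
    using ab(3)[of x k] by (simp add: \<eta>_def algebra_simps)
  then show ?thesis using T(1) ab(1,2) by blast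
qed

section \<open>Linear systems with polynomial coefficients\<close>

text \<open>Zariski density, tested on one polynomial at a time.\<close>

definition poly_dense :: "(complex ^ 'q) set \<Rightarrow> bool" where
  "poly_dense S \<longleftrightarrow> (\<forall>P. polyfun P \<longrightarrow> (\<forall>y\<in>S. P y = 0) \<longrightarrow> (\<forall>y. P y = 0))"

lemma poly_dense_nonvanishing:
  assumes "poly_dense S" "polyfun g" "g a \<noteq> 0"
  shows "poly_dense {y \<in> S. g y \<noteq> 0}"
  unfolding poly_dense_def
proof (intro allI impI)
  fix P y assume P: "polyfun P" "\<forall>y\<in>{y \<in> S. g y \<noteq> 0}. P y = 0"
  have "polyfun (\<lambda>y. g y * P y)" by (intro polyfun_intros assms P)
  moreover have "\<forall>y\<in>S. g y * P y = 0" using P(2) by auto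
  ultimately have "\<forall>y. g y * P y = 0" using assms(1) unfolding poly_dense_def by blast
  then show "P y = 0" using polyfun_mult_eq_0[OF assms(2) P(1) _ assms(3)] by blast
qed

text \<open>Gaussian elimination over the ring of polynomials in the parameter \<open>y\<close>: a nonzero coefficient \<open>e k0 i0\<close> eliminates the unknown
\<open>k0\<close>, and the set where it does not vanish is still dense. The unknowns are finite in number but the equations \<open>i\<close> need not be; they
will be indexed by the points of \<open>\<complex>\<^sup>n\<close> and the components of a form.\<close>

theorem parametric_linear_system:
  fixes e :: "'k \<Rightarrow> 'i \<Rightarrow> complex ^ 'q \<Rightarrow> complex"
  assumes "finite A" "poly_dense S" "\<And>k i. polyfun (e k i)" "\<And>i. polyfun (b i)"
    "\<And>y. y \<in> S \<Longrightarrow> \<exists>c. \<forall>i. b i y = (\<Sum>k\<in>A. c k * e k i y)"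
  shows "\<exists>P c. polyfun P \<and> (\<exists>y. P y \<noteq> 0) \<and> (\<forall>k. polyfun (c k)) \<and> (\<forall>i y. P y * b i y = (\<Sum>k\<in>A. c k y * e k i y))"
  using assms
proof (induction A arbitrary: S e b)
  case empty
  then have "b i y = 0" for i y unfolding poly_dense_def by auto
  then show ?case by (intro exI[of _ "\<lambda>y. 1"] exI[of _ "\<lambda>k y. 0"]) (auto intro: polyfun.const)
next
  case (insert k0 A)
  show ?case
  proof (cases "\<forall>i y. e k0 i y = 0")
    case True
    have "\<exists>c. \<forall>i. b i y = (\<Sum>k\<in>A. c k * e k i y)" if "y \<in> S" for y
      using insert.prems(4)[OF that] insert.hyps True by auto
    from insert.IH[OF insert.prems(1-3) this] show ?thesis using insert.hyps True by auto
  next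
    case False
    then obtain i0 y0 where e0: "e k0 i0 y0 \<noteq> 0" by blast
    define S' where "S' = {y \<in> S. e k0 i0 y \<noteq> 0}"
    define e' where "e' k i y = e k0 i0 y * e k i y - e k i0 y * e k0 i y" for k i y
    define b' where "b' i y = e k0 i0 y * b i y - b i0 y * e k0 i y" for i y
    have S': "poly_dense S'" unfolding S'_def using insert.prems(1,2) e0 by (intro poly_dense_nonvanishing)
    have e': "polyfun (e' k i)" for k i unfolding e'_def[abs_def] by (intro polyfun_intros insert.prems)
    have b': "polyfun (b' i)" for i unfolding b'_def[abs_def] by (intro polyfun_intros insert.prems)
    have sol: "\<exists>c. \<forall>i. b' i y = (\<Sum>k\<in>A. c k * e' k i y)" if "y \<in> S'" for y
    proof -
      have "y \<in> S" using that by (simp add: S'_def)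
      from insert.prems(4)[OF this] obtain c where c: "\<forall>i. b i y = (\<Sum>k\<in>insert k0 A. c k * e k i y)" ..
      have "b' i y = (\<Sum>k\<in>A. c k * e' k i y)" for i
        unfolding b'_def e'_def using insert.hyps
        by (simp add: c[rule_format] algebra_simps sum_distrib_left sum_subtractf)
      then show ?thesis by blast
    qed
    obtain P c where P: "polyfun P" "\<exists>y. P y \<noteq> 0" "\<And>k. polyfun (c k)" "\<And>i y. P y * b' i y = (\<Sum>k\<in>A. c k y * e' k i y)"
      using insert.IH[OF S' e' b' sol] by blast
    define P' where "P' y = P y * e k0 i0 y" for y
    define d where "d k y = (if k = k0 then P y * b i0 y - (\<Sum>k\<in>A. c k y * e k i0 y) else c k y * e k0 i0 y)" for k y
    have "polyfun P'" unfolding P'_def[abs_def] by (intro polyfun_intros P insert.prems)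
    moreover have "\<exists>y. P' y \<noteq> 0"
    proof (rule ccontr)
      assume "\<not> ?thesis"
      then have "P y * e k0 i0 y = 0" for y by (simp add: P'_def)
      then show False using polyfun_mult_eq_0[OF P(1) insert.prems(2)[of k0 i0]] P(2) e0 by blast
    qed
    moreover have "polyfun (d k)" for k
      by (cases "k = k0") (auto simp: d_def[abs_def] intro!: polyfun_intros P insert.prems)
    moreover have "P' y * b i y = (\<Sum>k\<in>insert k0 A. d k y * e k i y)" for i y
    proof -
      have "(\<Sum>k\<in>A. d k y * e k i y) = (\<Sum>k\<in>A. c k y * e k0 i0 y * e k i y)"
        using insert.hyps by (intro sum.cong) (auto simp: d_def)
      then have "(\<Sum>k\<in>insert k0 A. d k y * e k i y) =
          (P y * b i0 y - (\<Sum>k\<in>A. c k y * e k i0 y)) * e k0 i y + (\<Sum>k\<in>A. c k y * e k0 i0 y * e k i y)"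
        using insert.hyps by (simp add: d_def)
      also have "\<dots> = P y * b i0 y * e k0 i y + (\<Sum>k\<in>A. c k y * e' k i y)"
        by (simp add: e'_def algebra_simps sum_distrib_left sum_distrib_right sum_subtractf)
      also have "\<dots> = P' y * b i y" by (simp add: P(4)[symmetric] b'_def P'_def algebra_simps)
      finally show ?thesis by simp
    qed
    ultimately show ?thesis by blast
  qed
qed

text \<open>Baire's theorem: the complement of a hypersurface is open and dense.\<close>

lemma countable_nonvanishing:
  fixes P :: "nat \<Rightarrow> complex ^ 'q \<Rightarrow> complex"
  assumes P: "\<And>n. polyfun (P n)" "\<And>n. \<exists>y. P n y \<noteq> 0"
  shows "\<exists>y. \<forall>n. P n y \<noteq> 0"
proof -
  define Z where "Z n = {y. P n y \<noteq> 0}" for n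
  have "UNIV \<subseteq> closure (\<Inter>(range Z))"
  proof (rule Baire)
    fix T assume "T \<in> range Z"
    then obtain n where T: "T = Z n" by blast
    have "open (Z n)"
      unfolding Z_def using open_Collect_neq[OF polyfun_continuous_on[OF P(1)] continuous_on_const[of _ 0]] by simp
    moreover have "y \<in> closure (Z n)" for y
    proof (rule ccontr)
      assume y: "y \<notin> closure (Z n)"
      have "P n z = 0" if "z \<in> - closure (Z n)" for z
        using that closure_subset[of "Z n"] by (auto simp: Z_def)
      then have "P n z = 0" for z
        using polyfun_eq_0_open[OF P(1)[of n], of "- closure (Z n)" y z] y
        by (simp add: open_Compl)
      then show False using P(2) by blast
    qed
    ultimately show "openin (top_of_set UNIV) T \<and> UNIV \<subseteq> closure T" unfolding T by auto
  qed auto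
  then have "\<Inter>(range Z) \<noteq> {}" by auto
  then show ?thesis by (auto simp: Z_def)
qed

section \<open>Torsion\<close>

text \<open>For each \<open>e\<close> fix a point \<open>s0\<close> off the discriminant of the completion. Replacing its coordinates in the range of \<open>e\<close> by \<open>y\<close> gives a point \<open>sp y\<close> of the
slice over \<open>y\<close>, and \<open>\<Delta> (sp y)\<close> is a nonzero polynomial in \<open>y\<close>. There are finitely many \<open>e\<close>.\<close>

lemma generic_values:
  fixes F :: "complex ^ 'n \<Rightarrow> complex ^ 'q"
  assumes F: "polymap F" and U: "zariski_open U" "U \<noteq> {}"
  shows "\<exists>P. polyfun P \<and> (\<exists>y. P y \<noteq> 0) \<and> (\<forall>y. P y \<noteq> 0 \<longrightarrow> y \<in> U \<and> generic_value F y)"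
proof -
  obtain I where I: "\<And>p. p \<in> I \<Longrightarrow> polyfun p" "- U = {x. \<forall>p\<in>I. p x = 0}"
    using U(1) unfolding zariski_open_def zariski_closed_def by blast
  obtain u where "u \<in> U" using U(2) by blast
  then have "u \<notin> {x. \<forall>p\<in>I. p x = 0}" using I(2) by blast
  then obtain PU where PU: "PU \<in> I" "PU u \<noteq> 0" by blast
  have PU_U: "y \<in> U" if "PU y \<noteq> 0" for y using that I(2) PU(1) by blast
  define Es where "Es = {e :: 'q \<Rightarrow> 'n. inj e \<and> (\<exists>x. det (jac_matrix (completion e F) x) \<noteq> 0)}"
  have "\<exists>P. polyfun P \<and> (\<exists>y. P y \<noteq> 0) \<and> (\<forall>y. P y \<noteq> 0 \<longrightarrow>
     (\<exists>\<Delta> N C m s. etale_discriminant (completion e F) \<Delta> N C m \<and> (\<forall>j. s $ e j = y $ j) \<and> \<Delta> s \<noteq> 0))" if "e \<in> Es" for e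
  proof -
    have e: "inj e" and "\<exists>x. det (jac_matrix (completion e F) x) \<noteq> 0" using that by (auto simp: Es_def)
    then obtain \<Delta> N C m s0 where \<Delta>: "\<Delta> s0 \<noteq> 0" "etale_discriminant (completion e F) \<Delta> N C m"
      using etale_discriminant_exists[OF polymap_completion[OF F]] by blast
    define sp where "sp y = (\<chi> i. if i \<in> range e then y $ (inv_into UNIV e i) else s0 $ i)" for y :: "complex ^ 'q"
    have "polyfun (\<lambda>y. sp y $ i)" for i
      by (cases "i \<in> range e") (auto simp: sp_def intro: polyfun_intros)
    then have sp: "polymap sp" by (simp add: polymap_def)
    have "sp (\<chi> j. s0 $ e j) = s0" using e by (auto simp: sp_def vec_eq_iff f_inv_into_f)
    then have "\<Delta> (sp (\<chi> j. s0 $ e j)) \<noteq> 0" using \<Delta>(1) by simp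
    moreover have "polyfun (\<lambda>y. \<Delta> (sp y))" by (rule polyfun_compose[OF etale_discriminantD(1)[OF \<Delta>(2)] sp])
    moreover have "\<forall>j. sp y $ e j = y $ j" for y using e by (simp add: sp_def)
    ultimately show ?thesis using \<Delta>(2) by (intro exI[of _ "\<lambda>y. \<Delta> (sp y)"]) blast
  qed
  then obtain Pe where Pe: "\<And>e. e \<in> Es \<Longrightarrow> polyfun (Pe e)" "\<And>e. e \<in> Es \<Longrightarrow> \<exists>y. Pe e y \<noteq> 0"
    "\<And>e y. e \<in> Es \<Longrightarrow> Pe e y \<noteq> 0 \<Longrightarrow>
     \<exists>\<Delta> N C m s. etale_discriminant (completion e F) \<Delta> N C m \<and> (\<forall>j. s $ e j = y $ j) \<and> \<Delta> s \<noteq> 0"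
    by (metis (no_types, lifting))
  have fin: "finite Es" by simp
  define P where "P y = PU y * (\<Prod>e\<in>Es. Pe e y)" for y
  have pp: "polyfun (\<lambda>y. \<Prod>e\<in>Es. Pe e y)" by (intro polyfun_prod Pe)
  have "polyfun P" unfolding P_def[abs_def] by (intro polyfun.mult I(1)[OF PU(1)] pp)
  moreover have "\<exists>y. P y \<noteq> 0"
  proof (rule ccontr)
    assume "\<not> ?thesis"
    then have "(\<Prod>e\<in>Es. Pe e y) = 0" for y
      using polyfun_mult_eq_0[OF I(1)[OF PU(1)] pp _ PU(2)] by (simp add: P_def)
    then show False using polyfun_prod_nonzero[OF fin, of Pe] Pe(1,2) by blast
  qed
  moreover have "y \<in> U \<and> generic_value F y" if "P y \<noteq> 0" for y
  proof -
    have "PU y \<noteq> 0" "\<And>e. e \<in> Es \<Longrightarrow> Pe e y \<noteq> 0" using that fin by (auto simp: P_def)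
    then show ?thesis using PU_U Pe(3) unfolding generic_value_def Es_def by blast
  qed
  ultimately show ?thesis by blast
qed

text \<open>The conclusion of \<open>fibre_relative_exactness\<close> with degree at most \<open>N\<close> in each variable: finitely many unknown coefficients.\<close>

definition fibre_solution where
  "fibre_solution F \<omega> y N T a b \<longleftrightarrow> box_degree N T \<and> (\<forall>j. box_degree N (a j)) \<and> (\<forall>j k. box_degree N (b j k)) \<and>
    (\<forall>x k. \<omega> x $ k = partial k T x + (\<Sum>j\<in>UNIV. a j x * partial k (\<lambda>x. F x $ j) x) + (\<Sum>j\<in>UNIV. (F x $ j - y $ j) * b j k x))"

lemma common_box_degree:
  fixes p :: "'i::finite \<Rightarrow> complex ^ 'n \<Rightarrow> complex"
  assumes "\<And>i. polyfun (p i)"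
  shows "\<exists>N. \<forall>i. box_degree N (p i)"
proof -
  obtain d where d: "\<And>i. box_degree (d i) (p i)" using polyfun_box_degree[OF assms] by metis
  have "box_degree (Max (range d)) (p i)" for i by (rule box_degree_mono[OF d]) auto
  then show ?thesis by blast
qed

text \<open>If for every \<open>N\<close> the values \<open>y\<close> with a solution of degree \<open>N\<close> satisfied a polynomial equation, then some generic \<open>y\<close> would satisfy none of these
countably many equations, although its fibre admits a solution of some degree.\<close>

lemma uniform_degree:
  fixes F :: "complex ^ 'n \<Rightarrow> complex ^ 'q"
  assumes F: "polymap F" and TR: "TR_exact F \<omega>"
  shows "\<exists>N. poly_dense {y. \<exists>T a b. fibre_solution F \<omega> y N T a b}"
proof -
  have \<omega>: "polymap \<omega>" using TR by (simp add: TR_exact_def)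
  obtain U where U: "zariski_open U" "U \<noteq> {}" "\<And>y. y \<in> U \<Longrightarrow> noncritical_fibre F y"
    "\<And>y \<gamma>. y \<in> U \<Longrightarrow> valid_path \<gamma> \<Longrightarrow> pathfinish \<gamma> = pathstart \<gamma> \<Longrightarrow> path_image \<gamma> \<subseteq> F -` {y} \<Longrightarrow> has_form_integral \<omega> 0 \<gamma>"
    using TR unfolding TR_exact_def by blast
  obtain P where P: "polyfun P" "\<exists>y. P y \<noteq> 0" "\<And>y. P y \<noteq> 0 \<Longrightarrow> y \<in> U \<and> generic_value F y"
    using generic_values[OF F U(1,2)] by blast
  have sol: "\<exists>N T a b. fibre_solution F \<omega> y N T a b" if y: "P y \<noteq> 0" for y
  proof -
    have "y \<in> U" "generic_value F y" using P(3)[OF y] by auto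
    then obtain T a b where Tab: "polyfun T" "\<And>j. polyfun (a j)" "\<And>j k. polyfun (b j k)"
      "\<And>x k. \<omega> x $ k = partial k T x + (\<Sum>j\<in>UNIV. a j x * partial k (\<lambda>x. F x $ j) x) + (\<Sum>j\<in>UNIV. (F x $ j - y $ j) * b j k x)"
      using fibre_relative_exactness[OF F U(3)[OF \<open>y \<in> U\<close>] \<open>generic_value F y\<close> \<omega> U(4)[OF \<open>y \<in> U\<close>]]
      by blast
    obtain N1 where N1: "box_degree N1 T" using polyfun_box_degree[OF Tab(1)] by blast
    obtain N2 where N2: "\<And>j. box_degree N2 (a j)" using common_box_degree[of a] Tab(2) by blast
    obtain N3 where N3: "\<And>jk. box_degree N3 (b (fst jk) (snd jk))"
      using common_box_degree[of "\<lambda>jk. b (fst jk) (snd jk)"] Tab(3) by blast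
    define N where "N = max N1 (max N2 N3)"
    have "box_degree N T" using N1 by (rule box_degree_mono) (simp add: N_def)
    moreover have "box_degree N (a j)" for j using N2 by (rule box_degree_mono) (simp add: N_def)
    moreover have "box_degree N (b j k)" for j k using N3[of "(j, k)"] by (auto intro: box_degree_mono simp: N_def)
    ultimately have "fibre_solution F \<omega> y N T a b" using Tab(4) by (simp add: fibre_solution_def)
    then show ?thesis by blast
  qed
  show ?thesis
  proof (rule ccontr)
    assume "\<not> ?thesis"
    then have "\<forall>N. \<exists>Q. polyfun Q \<and> (\<exists>y. Q y \<noteq> 0) \<and> (\<forall>y. (\<exists>T a b. fibre_solution F \<omega> y N T a b) \<longrightarrow> Q y = 0)"
      unfolding poly_dense_def by blast
    then have "\<exists>Q. \<forall>N. polyfun (Q N) \<and> (\<exists>y. Q N y \<noteq> 0) \<and> (\<forall>y. (\<exists>T a b. fibre_solution F \<omega> y N T a b) \<longrightarrow> Q N y = 0)"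
      by (rule choice)
    then obtain Q where Q: "\<And>N. polyfun (Q N)" "\<And>N. \<exists>y. Q N y \<noteq> 0"
      "\<And>N y T a b. fibre_solution F \<omega> y N T a b \<Longrightarrow> Q N y = 0" by blast
    define P' where "P' n = (case n of 0 \<Rightarrow> P | Suc N \<Rightarrow> Q N)" for n
    have "\<exists>y. \<forall>n. P' n y \<noteq> 0"
      by (rule countable_nonvanishing) (auto simp: P'_def P Q split: nat.split)
    then obtain y where y: "\<And>n. P' n y \<noteq> 0" by blast
    have "P y \<noteq> 0" using y[of 0] by (simp add: P'_def)
    then obtain N T a b where "fibre_solution F \<omega> y N T a b" using sol by blast
    then show False using Q(3) y[of "Suc N"] by (auto simp: P'_def)
  qed
qed

text \<open>The unknowns are the coefficients of \<open>T\<close>, \<open>a\<^sub>j\<close> and \<open>b\<^sub>j\<^sub>k\<close>, and there is one equation for each point \<open>x\<close> and component \<open>k\<close>; its coefficients are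
polynomials in \<open>y\<close>. In the polynomial solution, \<open>y = F x\<close> removes the last group of terms. The coefficients of \<open>T\<close> become functions of \<open>F x\<close>, whose derivatives are
combinations of the \<open>df\<^sub>j\<close> and are moved to the \<open>a\<^sub>j\<close>.\<close>

theorem TR_exact_torsion:
  fixes F :: "complex ^ 'n \<Rightarrow> complex ^ 'q"
  assumes F: "polymap F" and TR: "TR_exact F \<omega>"
  shows "\<exists>P R a. polyfun P \<and> (\<exists>t. P t \<noteq> 0) \<and> polyfun R \<and> (\<forall>j. polyfun (a j)) \<and>
    (\<forall>x k. P (F x) * \<omega> x $ k = partial k R x + (\<Sum>j\<in>UNIV. a j x * partial k (\<lambda>x. F x $ j) x))"
proof -
  have Fj: "polyfun (\<lambda>x. F x $ j)" for j using F by (simp add: polymap_def)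
  obtain N where dense: "poly_dense {y. \<exists>T a b. fibre_solution F \<omega> y N T a b}" using uniform_degree[OF F TR] by blast
  define Bx where "Bx = (expo_box N :: ('n \<Rightarrow> nat) set)"
  \<comment> \<open>The three summands index the coefficients of \<open>T\<close>, of the \<open>a\<^sub>j\<close> and of the \<open>b\<^sub>j\<^sub>k\<close>.\<close>
  define A where "A = Bx <+> (UNIV :: 'q set) \<times> Bx <+> (UNIV :: ('q \<times> 'n) set) \<times> Bx"
  define e where "e c i y = (case c of Inl \<alpha> \<Rightarrow> partial (snd i) (monomial \<alpha>) (fst i)
      | Inr (Inl (j, \<alpha>)) \<Rightarrow> monomial \<alpha> (fst i) * partial (snd i) (\<lambda>x. F x $ j) (fst i)
      | Inr (Inr ((j, k), \<alpha>)) \<Rightarrow> if k = snd i then (F (fst i) $ j - y $ j) * monomial \<alpha> (fst i) else 0)"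
    for c :: "('n \<Rightarrow> nat) + ('q \<times> ('n \<Rightarrow> nat)) + (('q \<times> 'n) \<times> ('n \<Rightarrow> nat))" and i :: "(complex ^ 'n) \<times> 'n" and y :: "complex ^ 'q"
  have fin: "finite Bx" "finite A" by (simp_all add: Bx_def A_def)
  have sumA: "(\<Sum>c\<in>A. f c) = (\<Sum>\<alpha>\<in>Bx. f (Inl \<alpha>)) + ((\<Sum>j\<in>UNIV. \<Sum>\<alpha>\<in>Bx. f (Inr (Inl (j, \<alpha>)))) +
      (\<Sum>j\<in>UNIV. \<Sum>k\<in>UNIV. \<Sum>\<alpha>\<in>Bx. f (Inr (Inr ((j, k), \<alpha>)))))" for f :: "_ \<Rightarrow> complex"
  proof -
    have "(\<Sum>x\<in>(UNIV :: ('q \<times> 'n) set) \<times> Bx. f (Inr (Inr x))) = (\<Sum>jk\<in>UNIV. \<Sum>\<alpha>\<in>Bx. f (Inr (Inr (jk, \<alpha>))))"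
      by (simp add: sum.cartesian_product case_prod_unfold)
    also have "\<dots> = (\<Sum>j\<in>UNIV. \<Sum>k\<in>UNIV. \<Sum>\<alpha>\<in>Bx. f (Inr (Inr ((j, k), \<alpha>))))"
      by (simp add: sum.cartesian_product' case_prod_unfold flip: UNIV_Times_UNIV)
    finally show ?thesis
      unfolding A_def using fin(1) by (simp add: sum.Plus sum.cartesian_product case_prod_unfold)
  qed
  have pe: "polyfun (e c i)" for c i
  proof -
    consider (1) \<alpha> where "c = Inl \<alpha>" | (2) j \<alpha> where "c = Inr (Inl (j, \<alpha>))" | (3) j k \<alpha> where "c = Inr (Inr ((j, k), \<alpha>))"
      by (metis sum.exhaust surj_pair)
    then show ?thesis
    proof cases
      case (3 j k \<alpha>)
      then show ?thesis
        by (cases "k = snd i") (auto simp: e_def[abs_def] polyfun.const intro!: polyfun_intros)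
    qed (auto simp: e_def[abs_def] polyfun.const intro!: polyfun_intros)
  qed
  define v where "v i y = \<omega> (fst i) $ snd i" for i :: "(complex ^ 'n) \<times> 'n" and y :: "complex ^ 'q"
  have "\<exists>P c. polyfun P \<and> (\<exists>y. P y \<noteq> 0) \<and> (\<forall>k. polyfun (c k)) \<and>
     (\<forall>i y. P y * v i y = (\<Sum>k\<in>A. c k y * e k i y))"
  proof (rule parametric_linear_system[OF fin(2) dense pe])
    show "polyfun (v i)" for i unfolding v_def[abs_def] by (rule polyfun.const)
    fix y assume "y \<in> {y. \<exists>T a b. fibre_solution F \<omega> y N T a b}"
    then obtain T a b where sol: "fibre_solution F \<omega> y N T a b" by blast
    obtain ct where ct: "\<And>x. T x = (\<Sum>\<alpha>\<in>Bx. ct \<alpha> * monomial \<alpha> x)"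
      using sol unfolding fibre_solution_def box_degree_def Bx_def by blast
    have "\<forall>j. \<exists>c. \<forall>x. a j x = (\<Sum>\<alpha>\<in>Bx. c \<alpha> * monomial \<alpha> x)"
      using sol unfolding fibre_solution_def box_degree_def Bx_def by blast
    from choice[OF this] obtain ca where ca: "\<And>j x. a j x = (\<Sum>\<alpha>\<in>Bx. ca j \<alpha> * monomial \<alpha> x)" by blast
    have "\<forall>jk. \<exists>c. \<forall>x. b (fst jk) (snd jk) x = (\<Sum>\<alpha>\<in>Bx. c \<alpha> * monomial \<alpha> x)"
      using sol unfolding fibre_solution_def box_degree_def Bx_def by blast
    from choice[OF this] obtain cb' where cb': "\<And>jk x. b (fst jk) (snd jk) x = (\<Sum>\<alpha>\<in>Bx. cb' jk \<alpha> * monomial \<alpha> x)" by blast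
    define cb where "cb j k = cb' (j, k)" for j k
    have cb: "b j k x = (\<Sum>\<alpha>\<in>Bx. cb j k \<alpha> * monomial \<alpha> x)" for j k x using cb'[of "(j, k)" x] by (simp add: cb_def)
    have dT: "partial k T x = (\<Sum>\<alpha>\<in>Bx. ct \<alpha> * partial k (monomial \<alpha>) x)" for k x
    proof -
      have "T = (\<lambda>x. \<Sum>\<alpha>\<in>Bx. ct \<alpha> * monomial \<alpha> x)" using ct by blast
      then show ?thesis
        by (simp add: partial_sum polyfun.mult polyfun.const polyfun_monomial partial_mult partial_const)
    qed
    define c where "c k = (case k of Inl \<alpha> \<Rightarrow> ct \<alpha> | Inr (Inl (j, \<alpha>)) \<Rightarrow> ca j \<alpha> | Inr (Inr ((j, k), \<alpha>)) \<Rightarrow> cb j k \<alpha>)" for k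
    have "v i y = (\<Sum>k\<in>A. c k * e k i y)" for i
    proof -
      obtain x k where i: "i = (x, k)" by (cases i)
      have "(\<Sum>k'\<in>UNIV. \<Sum>\<alpha>\<in>Bx. cb j k' \<alpha> * (if k' = k then (F x $ j - y $ j) * monomial \<alpha> x else 0)) = (F x $ j - y $ j) * b j k x" for j
      proof -
        have "(\<Sum>k'\<in>UNIV. \<Sum>\<alpha>\<in>Bx. cb j k' \<alpha> * (if k' = k then (F x $ j - y $ j) * monomial \<alpha> x else 0)) =
            (\<Sum>k'\<in>{k}. \<Sum>\<alpha>\<in>Bx. cb j k' \<alpha> * (if k' = k then (F x $ j - y $ j) * monomial \<alpha> x else 0))"
          by (rule sum.mono_neutral_right) auto
        then show ?thesis by (simp add: cb sum_distrib_left mult_ac)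
      qed
      then show ?thesis
        using sol unfolding sumA fibre_solution_def i
        by (simp add: v_def c_def e_def dT ca sum_distrib_right mult.assoc cong: if_cong)
    qed
    then show "\<exists>c. \<forall>i. v i y = (\<Sum>k\<in>A. c k * e k i y)" by blast
  qed
  then obtain P c where P: "polyfun P" "\<exists>y. P y \<noteq> 0" "\<And>k. polyfun (c k)"
    "\<And>i y. P y * v i y = (\<Sum>k\<in>A. c k y * e k i y)" by blast
  define R where "R x = (\<Sum>\<alpha>\<in>Bx. c (Inl \<alpha>) (F x) * monomial \<alpha> x)" for x
  define a where "a j x = (\<Sum>\<alpha>\<in>Bx. c (Inr (Inl (j, \<alpha>))) (F x) * monomial \<alpha> x)
    - (\<Sum>\<alpha>\<in>Bx. monomial \<alpha> x * partial j (c (Inl \<alpha>)) (F x))" for j x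
  have cF: "polyfun (\<lambda>x. c k (F x))" for k by (rule polyfun_compose[OF P(3) F])
  have "polyfun R" unfolding R_def[abs_def] by (intro polyfun_intros cF polyfun_monomial)
  moreover have "polyfun (a j)" for j unfolding a_def[abs_def]
    by (intro polyfun_intros cF polyfun_monomial polyfun_compose[OF polyfun_partial[OF P(3)] F])
  moreover have "P (F x) * \<omega> x $ k = partial k R x + (\<Sum>j\<in>UNIV. a j x * partial k (\<lambda>x. F x $ j) x)" for x k
  proof -
    have dR: "partial k R x = (\<Sum>\<alpha>\<in>Bx. c (Inl \<alpha>) (F x) * partial k (monomial \<alpha>) x) +
       (\<Sum>j\<in>UNIV. (\<Sum>\<alpha>\<in>Bx. monomial \<alpha> x * partial j (c (Inl \<alpha>)) (F x)) * partial k (\<lambda>x. F x $ j) x)"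
    proof -
      have "partial k R x = (\<Sum>\<alpha>\<in>Bx. c (Inl \<alpha>) (F x) * partial k (monomial \<alpha>) x + monomial \<alpha> x * partial k (\<lambda>x. c (Inl \<alpha>) (F x)) x)"
        unfolding R_def[abs_def]
        by (simp add: partial_sum polyfun.mult cF polyfun_monomial partial_mult)
      also have "\<dots> = (\<Sum>\<alpha>\<in>Bx. c (Inl \<alpha>) (F x) * partial k (monomial \<alpha>) x) +
         (\<Sum>\<alpha>\<in>Bx. \<Sum>j\<in>UNIV. monomial \<alpha> x * partial j (c (Inl \<alpha>)) (F x) * partial k (\<lambda>x. F x $ j) x)"
        by (simp add: sum.distrib partial_compose[OF P(3) F] sum_distrib_left mult.assoc)
      also have "(\<Sum>\<alpha>\<in>Bx. \<Sum>j\<in>UNIV. monomial \<alpha> x * partial j (c (Inl \<alpha>)) (F x) * partial k (\<lambda>x. F x $ j) x) =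
         (\<Sum>j\<in>UNIV. (\<Sum>\<alpha>\<in>Bx. monomial \<alpha> x * partial j (c (Inl \<alpha>)) (F x)) * partial k (\<lambda>x. F x $ j) x)"
        by (subst sum.swap) (simp add: sum_distrib_right)
      finally show ?thesis .
    qed
    have "P (F x) * \<omega> x $ k = (\<Sum>\<alpha>\<in>Bx. c (Inl \<alpha>) (F x) * partial k (monomial \<alpha>) x) +
       (\<Sum>j\<in>UNIV. \<Sum>\<alpha>\<in>Bx. c (Inr (Inl (j, \<alpha>))) (F x) * (monomial \<alpha> x * partial k (\<lambda>x. F x $ j) x))"
      using P(4)[of "F x" "(x, k)"] unfolding sumA by (simp add: v_def e_def cong: if_cong)
    also have "(\<Sum>j\<in>UNIV. \<Sum>\<alpha>\<in>Bx. c (Inr (Inl (j, \<alpha>))) (F x) * (monomial \<alpha> x * partial k (\<lambda>x. F x $ j) x)) =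
       (\<Sum>j\<in>UNIV. (\<Sum>\<alpha>\<in>Bx. c (Inr (Inl (j, \<alpha>))) (F x) * monomial \<alpha> x) * partial k (\<lambda>x. F x $ j) x)"
      by (simp add: sum_distrib_right mult.assoc)
    finally show ?thesis unfolding dR a_def left_diff_distrib sum_subtractf by simp
  qed
  ultimately show ?thesis using P(1,2) by blast
qed

lemma AR_exact_iff:
  "AR_exact F \<omega> \<longleftrightarrow> (\<exists>R a. polyfun R \<and> (\<forall>j. polyfun (a j)) \<and>
     (\<forall>x k. \<omega> x $ k = partial k R x + (\<Sum>j\<in>UNIV. a j x * partial k (\<lambda>z. F z $ j) x)))"
  by (simp add: AR_exact_def fun_eq_iff vec_eq_iff ext_d_def)

lemma AR_exact_0: "AR_exact F (\<lambda>x. 0)"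
  unfolding AR_exact_iff
  by (intro exI[of _ "\<lambda>x. 0"] exI[of _ "\<lambda>j x. 0"]) (simp add: polyfun.const partial_const)

lemma AR_exact_add:
  assumes "AR_exact F \<omega>" "AR_exact F \<eta>"
  shows "AR_exact F (\<lambda>x. \<omega> x + \<eta> x)"
proof -
  obtain R a S b where *: "polyfun R" "\<And>j. polyfun (a j)" "polyfun S" "\<And>j. polyfun (b j)"
    "\<And>x k. \<omega> x $ k = partial k R x + (\<Sum>j\<in>UNIV. a j x * partial k (\<lambda>z. F z $ j) x)"
    "\<And>x k. \<eta> x $ k = partial k S x + (\<Sum>j\<in>UNIV. b j x * partial k (\<lambda>z. F z $ j) x)"
    using assms unfolding AR_exact_iff by blast
  show ?thesis unfolding AR_exact_iff
    by (intro exI[of _ "\<lambda>x. R x + S x"] exI[of _ "\<lambda>j x. a j x + b j x"])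
      (auto simp: * partial_add distrib_right sum.distrib intro: polyfun_intros)
qed

text \<open>The product rule changes \<open>dR\<close> by \<open>R d(P \<circ> F)\<close>, a combination of the \<open>df\<^sub>j\<close>.\<close>

lemma AR_exact_mult:
  fixes F :: "complex ^ 'n \<Rightarrow> complex ^ 'q"
  assumes F: "polymap F" and P: "polyfun P" and \<omega>: "AR_exact F \<omega>"
  shows "AR_exact F (\<lambda>x. P (F x) *s \<omega> x)"
proof -
  obtain R a where *: "polyfun R" "\<And>j. polyfun (a j)"
    "\<And>x k. \<omega> x $ k = partial k R x + (\<Sum>j\<in>UNIV. a j x * partial k (\<lambda>z. F z $ j) x)"
    using \<omega> unfolding AR_exact_iff by blast
  have PF: "polyfun (\<lambda>x. P (F x))" by (rule polyfun_compose[OF P F])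
  show ?thesis unfolding AR_exact_iff
  proof (intro exI[of _ "\<lambda>x. P (F x) * R x"] exI[of _ "\<lambda>j x. P (F x) * a j x - R x * partial j P (F x)"] conjI allI)
    show "polyfun (\<lambda>x. P (F x) * R x)" by (intro polyfun_intros PF *)
    show "polyfun (\<lambda>x. P (F x) * a j x - R x * partial j P (F x))" for j
      by (intro polyfun_intros PF * polyfun_compose[OF polyfun_partial[OF P] F])
    fix x k
    have "partial k (\<lambda>x. P (F x) * R x) x = P (F x) * partial k R x + R x * (\<Sum>j\<in>UNIV. partial j P (F x) * partial k (\<lambda>z. F z $ j) x)"
      by (simp add: partial_mult[OF PF *(1)] partial_compose[OF P F])
    then show "(P (F x) *s \<omega> x) $ k = partial k (\<lambda>x. P (F x) * R x) x +
        (\<Sum>j\<in>UNIV. (P (F x) * a j x - R x * partial j P (F x)) * partial k (\<lambda>z. F z $ j) x)"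
      by (simp add: *(3) distrib_left left_diff_distrib sum_subtractf sum_distrib_left mult.assoc)
  qed
qed

text \<open>Multiplication by \<open>P \<circ> F\<close> makes one representative of the coset AR-exact, and then all, as AR-exact forms are a \<open>\<complex>[F]\<close>-module. Since
the image of \<open>F\<close> is dense, \<open>P \<circ> F \<noteq> 0\<close>.\<close>

lemma torsion_T1:
  fixes F :: "complex ^ 'n \<Rightarrow> complex ^ 'q"
  assumes F: "polymap F" and dom: "dominating F"
  shows "torsion (alg_gen F) (T1 F)"
  unfolding torsion_def
proof
  define H where "H = {\<omega>. AR_exact F \<omega>}"
  fix X assume "X \<in> carrier (T1 F)"
  then obtain \<omega>0 where \<omega>0: "TR_exact F \<omega>0" and X: "X = (\<Union>h\<in>H. {\<lambda>x. h x + \<omega>0 x})"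
    by (auto simp: T1_def TR_forms_def A_RCOSETS_def' a_r_coset_def' H_def)
  obtain P R a where P: "polyfun P" "\<exists>t. P t \<noteq> 0" and Ra: "polyfun R" "\<forall>j. polyfun (a j)"
    "\<forall>x k. P (F x) * \<omega>0 x $ k = partial k R x + (\<Sum>j\<in>UNIV. a j x * partial k (\<lambda>x. F x $ j) x)"
    using TR_exact_torsion[OF F \<omega>0] by blast
  define s where "s = P \<circ> F"
  have "AR_exact F (\<lambda>x. P (F x) *s \<omega>0 x)" unfolding AR_exact_iff using Ra by auto
  have s_AR: "AR_exact F (\<lambda>x. s x *s \<omega> x)" if w: "\<omega> \<in> X" for \<omega>
  proof -
    obtain h where h: "AR_exact F h" "\<omega> = (\<lambda>x. h x + \<omega>0 x)" using w by (auto simp: X H_def)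
    have "AR_exact F (\<lambda>x. P (F x) *s h x + P (F x) *s \<omega>0 x)"
      by (intro AR_exact_add AR_exact_mult[OF F P(1) h(1)]) fact
    then show ?thesis by (simp add: h(2) s_def vector_add_ldistrib)
  qed
  have coset: "(\<Union>h\<in>H. {\<lambda>x. h x + \<eta> x}) = H" if "AR_exact F \<eta>" for \<eta>
  proof
    show "(\<Union>h\<in>H. {\<lambda>x. h x + \<eta> x}) \<subseteq> H" using that by (auto simp: H_def intro: AR_exact_add)
    show "H \<subseteq> (\<Union>h\<in>H. {\<lambda>x. h x + \<eta> x})"
    proof
      fix h assume "h \<in> H"
      have "AR_exact F (\<lambda>x. h x + (-1) *s \<eta> x)"
        using \<open>h \<in> H\<close> AR_exact_mult[OF F polyfun.const[of "-1"] that]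
        by (intro AR_exact_add) (auto simp: H_def)
      then show "h \<in> (\<Union>h\<in>H. {\<lambda>x. h x + \<eta> x})"
        by (intro UN_I[of "\<lambda>x. h x + (-1) *s \<eta> x"]) (auto simp: H_def)
    qed
  qed
  have "(\<lambda>x. 0 + \<omega>0 x) \<in> X" unfolding X by (intro UN_I[of "\<lambda>x. 0"]) (auto simp: H_def AR_exact_0)
  then have "X \<noteq> {}" by blast
  have "s \<odot>\<^bsub>T1 F\<^esub> X = (\<Union>\<omega>\<in>X. \<Union>h\<in>H. {\<lambda>x. h x + s x *s \<omega> x})"
    by (simp add: T1_def TR_forms_def a_r_coset_def' H_def)
  also have "\<dots> = H" using coset[OF s_AR] \<open>X \<noteq> {}\<close> by auto
  also have "\<dots> = \<zero>\<^bsub>T1 F\<^esub>" by (simp add: T1_def H_def)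
  finally have "s \<odot>\<^bsub>T1 F\<^esub> X = \<zero>\<^bsub>T1 F\<^esub>" .
  moreover have "s \<in> carrier (alg_gen F)" using P(1) by (auto simp: alg_gen_def s_def)
  moreover have "s \<noteq> \<zero>\<^bsub>alg_gen F\<^esub>"
  proof
    assume "s = \<zero>\<^bsub>alg_gen F\<^esub>"
    then have "P (F x) = 0" for x by (auto simp: alg_gen_def s_def fun_eq_iff)
    moreover have "zariski_closed {y. P y = 0}"
      unfolding zariski_closed_def using P(1) by (intro exI[of _ "{P}"]) auto
    ultimately have "{y. P y = 0} = UNIV"
      using dom unfolding dominating_def zariski_dense_def by blast
    then show False using P(2) by blast
  qed
  ultimately show "\<exists>s\<in>carrier (alg_gen F). s \<noteq> \<zero>\<^bsub>alg_gen F\<^esub> \<and> s \<odot>\<^bsub>T1 F\<^esub> X = \<zero>\<^bsub>T1 F\<^esub>" by blast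
qed

theorem proposition1p2:
  fixes F :: "complex ^ 'n \<Rightarrow> complex ^ 'q"
  assumes "CARD('q) < CARD('n)"
    and "polymap F"
    and "dominating F"
  shows "torsion (alg_gen F) (T1 F)
    \<and> (\<forall>\<omega>. TR_exact F \<omega> \<longrightarrow>
         (\<exists>P R a. polyfun P \<and> (\<exists>t. P t \<noteq> 0) \<and> polyfun R \<and> (\<forall>j. polyfun (a j)) \<and>
            (\<forall>x. P (F x) *s \<omega> x
                 = ext_d R x + (\<Sum>j\<in>UNIV. a j x *s ext_d (\<lambda>z. F z $ j) x))))"
proof (intro conjI allI impI)
  show "torsion (alg_gen F) (T1 F)" by (rule torsion_T1[OF assms(2,3)])
  fix \<omega> assume "TR_exact F \<omega>"
  from TR_exact_torsion[OF assms(2) this]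
  show "\<exists>P R a. polyfun P \<and> (\<exists>t. P t \<noteq> 0) \<and> polyfun R \<and> (\<forall>j. polyfun (a j)) \<and>
            (\<forall>x. P (F x) *s \<omega> x = ext_d R x + (\<Sum>j\<in>UNIV. a j x *s ext_d (\<lambda>z. F z $ j) x))"
    by (simp add: vec_eq_iff ext_d_def)
qed

end
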